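(* Let $d>d_c$ and $\theta=\theta(d)>2$. Suppose that for $z>0$ and $k\in[-\pi,\pi]^d$ we have $f_0(k;z)=1$ and $$f_{n+1}(k;z)=\sum_{m=1}^{n+1} g_m(k;z)f_{n+1-m}(k;z)+e_{n+1}(k;z)\qquad\text{for all } n\ge 0,$$ where the functions $g_m$ and $e_m$ are regarded as given. Assume that Assumptions S, D, E$_\theta$ and G$_\theta$ (stated in full in the context, with $\epsilon\in(0,\theta-2)$ the moment parameter of Assumption D) all hold. Then there exist positive $L_0=L_0(d,\epsilon)$, $z_c=z_c(d,L)$, $A=A(d,L)$ and $v=v(d,L)$ such that for $L\ge L_0$ the following statements hold. (a) Fix $\gamma\in(0,1\wedge\epsilon)$ and $\delta\in(0,(1\wedge\epsilon)-\gamma)$. Then $$f_n\Big(\frac{k}{\sqrt{v\sigma^2 n}};z_c\Big)=A\,e^{-\frac{|k|^2}{2d}}\left[1+\mathcal{O}(|k|^2n^{-\delta})+\mathcal{O}(n^{-\theta+2})\right],$$ with the error estimate uniform in $\{k\in\mathbb{R}^d: a(k/\sqrt{v\sigma^2 n})\le \gamma n^{-1}\log n\}$. (b) With $\delta$ as in (a), $$-\frac{\nabla^2 f_n(0;z_c)}{f_n(0;z_c)}=v\sigma^2 n\left[1+\mathcal{O}(\beta n^{-\delta})\right].$$ (c) For all $p\ge 1$, $$\|\hat D^2 f_n(\cdot;z_c)\|_p\le \frac{C}{L^{\frac dp}\,n^{\frac{d}{2p}\wedge\theta}}.$$ (d) The constants $z_c$, $A$ and $v$ obey $$1=\sum_{m=1}^\infty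 g_m(0;z_c),\qquad A=\frac{1+\sum_{m=1}^\infty e_m(0;z_c)}{\sum_{m=1}^\infty m\,g_m(0;z_c)},\qquad v=-\frac{\sum_{m=1}^\infty\nabla^2 g_m(0;z_c)}{\sigma^2\sum_{m=1}^\infty m\,g_m(0;z_c)}.$$
   Context: **Setting.** $d$ is the dimension, $d_c$ is the critical dimension of the model under consideration, and $\theta=\theta(d)>2$ is fixed. $D=D_L$ is a probability mass function on $\mathbb{Z}^d$ involving a non-negative parameter $L$, which will typically be large. The functions $f_n(k;z)$ ($n\ge0$), $g_n(k;z)$ and $e_n(k;z)$ ($n\ge1$) depend on $k\in[-\pi,\pi]^d$ and $z>0$. **Notation.** $\hat D(k)=\sum_{x\in\mathbb{Z}^d}D(x)e^{ik\cdot x}$; $a(k)=1-\hat D(k)$; $\nabla^2=\sum_{j=1}^d\partial^2/\partial k_j^2$ with $k=(k_1,\ldots,k_d)$; $\sigma^2=-\nabla^2\hat D(0)=\sum_x|x|^2D(x)$; $x\wedge y=\min(x,y)$. For functions on $[-\pi,\pi]^d$, $\|h\|_p=\big(\int_{[-\pi,\pi]^d}|h(k)|^p\frac{d^dk}{(2\pi)^d}\big)^{1/p}$. $\|k\|_\infty$ is the max norm and $|k|$ the Euclidean norm; $\|D\|_\infty=\sup_x D(x)$. A number $p^*\ge1$ and a nonempty set $B\subset[1,p^*]$ are given, and $\beta=\beta(p^* )=L^{-d/p^*}$. In (c), $C$ denotes a strictly positive constant that may depend on $d$ and $p$, but not on $n$ or $\beta$. **Bounds ( * )**, which a priori may or may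 not be satisfied: for every $p\in B$, $$\|\hat D^2f_m(\cdot;z)\|_p\le\frac{K}{L^{\frac dp}m^{\frac d{2p}\wedge\theta}},\qquad |f_m(0;z)|\le K,\qquad|\nabla^2f_m(0;z)|\le K\sigma^2m,$$ for some positive constant $K$. **Assumption S.** For every $n\in\mathbb{N}$ and $z>0$, the mapping $k\mapsto f_n(k;z)$ is symmetric under replacement of any component $k_i$ of $k$ by $-k_i$, and under permutations of the components of $k$. The same holds for $e_n(\cdot;z)$ and $g_n(\cdot;z)$. In addition, for each $n$, $|f_n(k;z)|$ is bounded uniformly in $k\in[-\pi,\pi]^d$ and $z$ in a neighbourhood of $1$ (both the bound and the neighbourhood may depend on $n$). **Assumption D.** $f_1(k;z)=z\hat D(k)$ and $e_1(k;z)=0$ (in particular, $g_1(k;z)=z\hat D(k)$). In addition: (i) $D$ is normalised so that $\hat D(0)=1$, and has $2+2\epsilon$ moments for some $0<\epsilon<\theta-2$, i.e., $\sum_{x\in\mathbb{Z}^d}|x|^{2+2\epsilon}D(x)<\infty$. (ii) There is a constant $C$ such that, for all $L\ge1$, $\|D\|_\infty\le CL^{-d}$ and $\sigma^2\le CL^2$. (iii) There exist constants $\eta,c_1,c_2>0$ such that $c_1L^2|k|^2\le a(k)\le c_2L^2|k|^2$ for $\|k\|_\infty\le L^{-1}$; $a(k)>\eta$ for $\|k\|_\infty\ge L^{-1}$; and $a(k)<2-\eta$ for $k\in[-\pi,\pi]^d$. **Assumption E$_\theta$.** There is an $L_0$, an interval $I\subset[1-\alpha,1+\alpha]$ with $\alpha\in(0,1)$,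 and a function $K\mapsto C_e(K)$, such that if ( * ) holds for some $K>1$, $L\ge L_0$, $z\in I$ and for all $1\le m\le n$, then for that $L$ and $z$, and for all $k\in[-\pi,\pi]^d$ and $2\le m\le n+1$, the following bounds hold: $$|e_m(k;z)|\le C_e(K)\beta m^{-\theta},\qquad|e_m(k;z)-e_m(0;z)|\le C_e(K)a(k)\beta m^{-\theta+1}.$$ **Assumption G$_\theta$.** There is an $L_0$, an interval $I\subset[1-\alpha,1+\alpha]$ with $\alpha\in(0,1)$, and a function $K\mapsto C_g(K)$, such that if ( * ) holds for some $K>1$, $L\ge L_0$, $z\in I$ and for all $1\le m\le n$, then for that $L$ and $z$, and for all $k\in[-\pi,\pi]^d$ and $2\le m\le n+1$, the following bounds hold: $$|g_m(k;z)|\le C_g(K)\beta m^{-\theta},\quad|\nabla^2g_m(0;z)|\le C_g(K)\sigma^2\beta m^{-\theta+1},\quad|\partial_zg_m(0;z)|\le C_g(K)\beta m^{-\theta+1},$$ $$|g_m(k;z)-g_m(0;z)-a(k)\sigma^{-2}\nabla^2g_m(0;z)|\le C_g(K)\beta a(k)^{1+\epsilon'}m^{-\theta+1+\epsilon'},$$ with the last bound valid for any $\epsilon'\in[0,\epsilon]$, where $0<\epsilon<\theta-2$ is the parameter in Assumption D(i).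
   Formalization: In Assumptions E and G the interval I is required to contain 1 in its interior; as written, I could miss 1 (or be empty), and then the equation 1 = Σ g_m(0;z_c) may have no solution z_c > 0. *)

theory Defs
  imports "HOL-Probability.Probability"
begin

section \<open>The step distribution\<close>

text \<open>The lattice is \<^typ>\<open>int ^ 'd\<close>, momentum space is \<^typ>\<open>real ^ 'd\<close>, and the dimension is
  \<^term>\<open>CARD('d)\<close>. The cube below is the domain of all functions of \<open>k\<close>.\<close>

definition kcube :: "(real ^ 'd) set" where
  "kcube = cbox (\<chi> i. - pi) (\<chi> i. pi)"

definition lattice_vec :: "int ^ 'd \<Rightarrow> real ^ 'd" where
  "lattice_vec x = (\<chi> i. real_of_int (x $ i))"

definition Dhat :: "(int ^ 'd) pmf \<Rightarrow> real ^ 'd \<Rightarrow> complex" where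
  "Dhat P k = (\<Sum>\<^sub>\<infinity>x. complex_of_real (pmf P x) * exp (\<i> * complex_of_real (k \<bullet> lattice_vec x)))"

text \<open>Assumption D makes \<^const>\<open>Dhat\<close> real-valued on the cube (it equals \<open>f\<^sub>1(k;z)/z\<close>), so taking the
  real part there only changes the type.\<close>

definition afun :: "(int ^ 'd) pmf \<Rightarrow> real ^ 'd \<Rightarrow> real" where
  "afun P k = Re (1 - Dhat P k)"

definition sigma2 :: "(int ^ 'd) pmf \<Rightarrow> real" where
  "sigma2 P = (\<Sum>\<^sub>\<infinity>x. (norm (lattice_vec x))\<^sup>2 * pmf P x)"

definition beta :: "'d::finite itself \<Rightarrow> real \<Rightarrow> real \<Rightarrow> real" where
  "beta _ pstar L = L powr (- (real CARD('d) / pstar))"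

section \<open>Norms and derivatives\<close>

text \<open>Extended-valued, so that \<open>lp_norm p h \<le> ennreal c\<close> includes finiteness of the norm.\<close>

definition lp_norm :: "real \<Rightarrow> (real ^ 'd \<Rightarrow> complex) \<Rightarrow> ennreal" where
  "lp_norm p h =
    (let I = (\<integral>\<^sup>+ k \<in> kcube. ennreal (norm (h k) powr p / (2 * pi) ^ CARD('d)) \<partial>lebesgue)
     in if I = \<top> then \<top> else ennreal (enn2real I powr (1 / p)))"

definition laplacian :: "(real ^ 'd \<Rightarrow> real) \<Rightarrow> real ^ 'd \<Rightarrow> real" where
  "laplacian h k = (\<Sum>j\<in>UNIV. (deriv ^^ 2) (\<lambda>t. h (k + t *\<^sub>R axis j 1)) 0)"

text \<open>Existence of the derivatives that occur in \<^const>\<open>laplacian\<close>; \<^const>\<open>deriv\<close> is total and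
  arbitrary where the derivative does not exist.\<close>

definition has_laplacian :: "(real ^ 'd \<Rightarrow> real) \<Rightarrow> real ^ 'd \<Rightarrow> bool" where
  "has_laplacian h k \<longleftrightarrow>
    (\<forall>j. (\<forall>\<^sub>F t in nhds 0. (\<lambda>s. h (k + s *\<^sub>R axis j 1)) differentiable (at t)) \<and>
         deriv (\<lambda>s. h (k + s *\<^sub>R axis j 1)) differentiable (at 0))"

section \<open>The model and its assumptions\<close>

text \<open>A family \<open>h L n k z\<close> stands for \<open>h\<^sub>n(k;z)\<close> at the value \<open>L\<close> of the spread-out parameter. Only
  \<open>L \<ge> 1\<close>, \<open>z > 0\<close> and \<open>k \<in> kcube\<close> matter (and \<open>n \<ge> 1\<close> for \<open>g\<close> and \<open>e\<close>). The step distribution is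
  likewise a family \<open>D L\<close>. No constant in the assumptions depends on \<open>L\<close> unless it is
  quantified after \<open>L\<close>.\<close>

type_synonym 'd family = "real \<Rightarrow> nat \<Rightarrow> real ^ 'd \<Rightarrow> real \<Rightarrow> real"

definition recursion :: "'d::finite family \<Rightarrow> 'd family \<Rightarrow> 'd family \<Rightarrow> bool" where
  "recursion f g e \<longleftrightarrow>
    (\<forall>L\<ge>1. \<forall>z>0. \<forall>k\<in>kcube.
       f L 0 k z = 1 \<and>
       (\<forall>n. f L (n + 1) k z = (\<Sum>m=1..n+1. g L m k z * f L (n + 1 - m) k z) + e L (n + 1) k z))"

text \<open>The norms and Laplacians of \<open>f\<^sub>n\<close> in the bounds (*) below are presumed to make sense.\<close>

definition well_posed :: "'d::finite family \<Rightarrow> bool" where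
  "well_posed f \<longleftrightarrow>
    (\<forall>L\<ge>1. \<forall>n. \<forall>z>0.
       (\<lambda>k. f L n k z) \<in> borel_measurable (lebesgue_on kcube) \<and>
       has_laplacian (\<lambda>k. f L n k z) 0)"

definition star_bounds ::
  "real set \<Rightarrow> real \<Rightarrow> (real \<Rightarrow> (int ^ 'd) pmf) \<Rightarrow> 'd::finite family \<Rightarrow> real \<Rightarrow> real \<Rightarrow> real \<Rightarrow> nat \<Rightarrow> bool" where
  "star_bounds B \<theta> D f K L z m \<longleftrightarrow>
    (\<forall>p\<in>B. lp_norm p (\<lambda>k. (Dhat (D L) k)\<^sup>2 * complex_of_real (f L m k z))
       \<le> ennreal (K / (L powr (real CARD('d) / p) * real m powr min (real CARD('d) / (2 * p)) \<theta>))) \<and>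
    \<bar>f L m 0 z\<bar> \<le> K \<and>
    \<bar>laplacian (\<lambda>k. f L m k z) 0\<bar> \<le> K * sigma2 (D L) * real m"

definition cube_symmetric :: "(real ^ 'd \<Rightarrow> real) \<Rightarrow> bool" where
  "cube_symmetric h \<longleftrightarrow>
    (\<forall>k\<in>kcube. (\<forall>i. h (\<chi> j. if j = i then - (k $ j) else k $ j) = h k) \<and>
                (\<forall>\<pi>. bij \<pi> \<longrightarrow> h (\<chi> j. k $ (\<pi> j)) = h k))"

definition assumption_S :: "'d::finite family \<Rightarrow> 'd family \<Rightarrow> 'd family \<Rightarrow> bool" where
  "assumption_S f g e \<longleftrightarrow>
    (\<forall>L\<ge>1. \<forall>n\<ge>1. \<forall>z>0.
       cube_symmetric (\<lambda>k. f L n k z) \<and> cube_symmetric (\<lambda>k. e L n k z) \<and>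
       cube_symmetric (\<lambda>k. g L n k z)) \<and>
    (\<forall>L\<ge>1. \<forall>n. \<exists>M. \<forall>\<^sub>F z in nhds 1. \<forall>k\<in>kcube. \<bar>f L n k z\<bar> \<le> M)"

definition assumption_D ::
  "real \<Rightarrow> real \<Rightarrow> (real \<Rightarrow> (int ^ 'd) pmf) \<Rightarrow> 'd::finite family \<Rightarrow> 'd family \<Rightarrow> 'd family \<Rightarrow> bool" where
  "assumption_D \<theta> \<epsilon> D f g e \<longleftrightarrow>
    (\<forall>L\<ge>1. \<forall>z>0. \<forall>k\<in>kcube.
       complex_of_real (f L 1 k z) = complex_of_real z * Dhat (D L) k \<and> e L 1 k z = 0 \<and>
       complex_of_real (g L 1 k z) = complex_of_real z * Dhat (D L) k) \<and>
    0 < \<epsilon> \<and> \<epsilon> < \<theta> - 2 \<and>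
    (\<forall>L\<ge>1. Dhat (D L) 0 = 1 \<and>
       (\<lambda>x. norm (lattice_vec x) powr (2 + 2 * \<epsilon>) * pmf (D L) x) summable_on UNIV) \<and>
    (\<exists>C. \<forall>L\<ge>1. (SUP x. pmf (D L) x) \<le> C * L powr (- real CARD('d)) \<and> sigma2 (D L) \<le> C * L\<^sup>2) \<and>
    (\<exists>\<eta>>0. \<exists>c1>0. \<exists>c2>0. \<forall>L\<ge>1. \<forall>k\<in>kcube.
       (infnorm k \<le> 1 / L \<longrightarrow>
          c1 * L\<^sup>2 * (norm k)\<^sup>2 \<le> afun (D L) k \<and> afun (D L) k \<le> c2 * L\<^sup>2 * (norm k)\<^sup>2) \<and>
       (1 / L \<le> infnorm k \<longrightarrow> \<eta> < afun (D L) k) \<and>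
       afun (D L) k < 2 - \<eta>)"

text \<open>In the next two assumptions, the interval \<open>I\<close> must be a neighbourhood of 1. Otherwise, e.g. for
  empty \<open>I\<close>, they would say nothing about the model near its critical point, which is close
  to 1. Requiring \<open>L0 \<ge> 1\<close> is no restriction, since \<open>L0\<close> may always be increased.\<close>

definition admissible_interval :: "real set \<Rightarrow> bool" where
  "admissible_interval I \<longleftrightarrow>
    is_interval I \<and> 1 \<in> interior I \<and> (\<exists>\<alpha>. 0 < \<alpha> \<and> \<alpha> < 1 \<and> I \<subseteq> {1 - \<alpha> .. 1 + \<alpha>})"

definition assumption_E ::
  "real set \<Rightarrow> real \<Rightarrow> real \<Rightarrow> (real \<Rightarrow> (int ^ 'd) pmf) \<Rightarrow> 'd::finite family \<Rightarrow> 'd family \<Rightarrow> bool" where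
  "assumption_E B pstar \<theta> D f e \<longleftrightarrow>
    (\<exists>L0\<ge>1. \<exists>I Ce. admissible_interval I \<and>
      (\<forall>K>1. \<forall>L\<ge>L0. \<forall>z\<in>I. \<forall>n.
        (\<forall>m. 1 \<le> m \<and> m \<le> n \<longrightarrow> star_bounds B \<theta> D f K L z m) \<longrightarrow>
        (\<forall>k\<in>kcube. \<forall>m. 2 \<le> m \<and> m \<le> n + 1 \<longrightarrow>
           \<bar>e L m k z\<bar> \<le> Ce K * beta TYPE('d) pstar L * real m powr (- \<theta>) \<and>
           \<bar>e L m k z - e L m 0 z\<bar>
             \<le> Ce K * afun (D L) k * beta TYPE('d) pstar L * real m powr (- \<theta> + 1))))"

definition assumption_G ::
  "real set \<Rightarrow> real \<Rightarrow> real \<Rightarrow> real \<Rightarrow> (real \<Rightarrow> (int ^ 'd) pmf) \<Rightarrow> 'd::finite family \<Rightarrow> 'd family \<Rightarrow> bool" where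
  "assumption_G B pstar \<theta> \<epsilon> D f g \<longleftrightarrow>
    (\<exists>L0\<ge>1. \<exists>I Cg. admissible_interval I \<and>
      (\<forall>K>1. \<forall>L\<ge>L0. \<forall>z\<in>I. \<forall>n.
        (\<forall>m. 1 \<le> m \<and> m \<le> n \<longrightarrow> star_bounds B \<theta> D f K L z m) \<longrightarrow>
        (\<forall>k\<in>kcube. \<forall>m. 2 \<le> m \<and> m \<le> n + 1 \<longrightarrow>
           \<bar>g L m k z\<bar> \<le> Cg K * beta TYPE('d) pstar L * real m powr (- \<theta>) \<and>
           has_laplacian (\<lambda>k. g L m k z) 0 \<and>
           \<bar>laplacian (\<lambda>k. g L m k z) 0\<bar>
             \<le> Cg K * sigma2 (D L) * beta TYPE('d) pstar L * real m powr (- \<theta> + 1) \<and>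
           (\<lambda>w. g L m 0 w) differentiable (at z) \<and>
           \<bar>deriv (\<lambda>w. g L m 0 w) z\<bar>
             \<le> Cg K * beta TYPE('d) pstar L * real m powr (- \<theta> + 1) \<and>
           (\<forall>\<epsilon>'\<in>{0..\<epsilon>}.
             \<bar>g L m k z - g L m 0 z - afun (D L) k / sigma2 (D L) * laplacian (\<lambda>k. g L m k z) 0\<bar>
               \<le> Cg K * beta TYPE('d) pstar L * afun (D L) k powr (1 + \<epsilon>')
                  * real m powr (- \<theta> + 1 + \<epsilon>')))))"

end

theory Submission
  imports Defs "HOL-Real_Asymp.Real_Asymp"
begin

text \<open>At zero momentum the recursion reads \<open>F (1 - G) = 1 + E\<close> for generating functions in \<open>n\<close>. If
  \<open>1 - (\<Sum>i\<le>m. g\<^sub>i)\<close> is of order \<open>\<beta> m\<close>\<open>\<^sup>1\<^sup>-\<^sup>\<theta>\<close>, then \<open>1 - G = (1 - X) H\<close> where \<open>H - 1\<close> is small in the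
  convolution algebra with weight \<open>(1 + m)\<close>\<open>\<^sup>1\<^sup>-\<^sup>\<theta>\<close>. Hence \<open>H\<close> is invertible there, \<open>f\<^sub>n(0)\<close> converges, and
  the same inversion applied to the Laplacian of the recursion gives (b). At momentum \<open>k\<close>, \<open>1 - G\<close> is
  compared with the random walk factor \<open>1 - (1 - a(k)) X\<close>; the resulting pointwise bounds on \<open>f\<^sub>n(k)\<close>
  integrate to (c), hence to (*) with a constant \<open>K\<close> that does not depend on \<open>\<beta>\<close>, and Assumptions E and G
  advance by one order. The critical point is the common point of nested intervals of \<open>z\<close> on which the
  partial sums of \<open>g\<^sub>m(0;z)\<close> are within order \<open>\<beta> n\<close>\<open>\<^sup>1\<^sup>-\<^sup>\<theta>\<close> of 1. For (a), multiplying \<open>f\<^sub>n(k)\<close> by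
  \<open>exp (v a(k) n)\<close> turns the recursion into one whose kernel agrees with that at zero momentum up to
  an error superlinear in \<open>a(k)\<close>, because \<open>v\<close> makes the linear term sum to zero.\<close>

section \<open>Convolution bounds for power weights\<close>

text \<open>Two obstacles shape the proof. First, the constant K of the inductive bounds must not
  deteriorate. It is extracted from Assumption D; the constants of Assumptions E and G are functions
  of K and always come multiplied by \<beta>, so a large L makes the product s as small as required.
  Estimates therefore carry an explicit factor s, and those used inside the induction refer only to
  orders up to n, since nothing is known beyond. Second, the bounds behind (c) must be uniform in
  a(k) and L. The exponential decay (1 - a)^m does not survive convolution with power tails, so it
  is replaced by powers of 1 / (1 + a m), which are of order 1 up to m = 1 / a and change by bounded
  factors when m doubles. What the perturbation leaves is a term n^(2 - \<theta>) / (1 + a n)^2, of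
  order n^(-\<theta>) / a^2 for large a n; this is the origin of the cap \<theta> in the exponent of
  (c). In (a), the factor exp(v a n) costs a power n^(v \<gamma>) where a is at most \<gamma> log n
  / n; since v tends to 1 for large L, the exponents still fit below \<theta> - 2.\<close>

notation fps_nth (infixl "$$" 75)

text \<open>The range up to \<open>2 * j + 1\<close> is what convolution estimates need: with n in
  place of m, one of the indices i and n - i always satisfies it; so does \<open>m div 2\<close>,
  and so does m - 1 for m \<ge> 1, so that a shift by one costs only the factor C.\<close>

definition doubling :: "real \<Rightarrow> (nat \<Rightarrow> real) \<Rightarrow> bool" where
  "doubling C u \<longleftrightarrow> (\<forall>j m. j \<le> m \<and> m \<le> 2 * j + 1 \<longrightarrow> u j \<le> C * u m)"

lemma doublingD: "doubling C u \<Longrightarrow> j \<le> m \<Longrightarrow> m \<le> 2 * j + 1 \<Longrightarrow> u j \<le> C * u m"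
  by (auto simp: doubling_def)

lemma doubling_mono:
  assumes "doubling C u" "C \<le> C'" "\<And>m. u m \<ge> 0"
  shows "doubling C' u"
  unfolding doubling_def
proof safe
  fix j m :: nat assume "j \<le> m" "m \<le> 2 * j + 1"
  then have "u j \<le> C * u m" by (rule doublingD[OF assms(1)])
  also have "\<dots> \<le> C' * u m" by (intro mult_right_mono assms)
  finally show "u j \<le> C' * u m" .
qed

lemma doubling_mult:
  assumes "doubling C u" "doubling D v" "\<And>m. u m \<ge> 0" "\<And>m. v m \<ge> 0" "C \<ge> 0"
  shows "doubling (C * D) (\<lambda>m. u m * v m)"
  unfolding doubling_def
proof safe
  fix j m :: nat assume *: "j \<le> m" "m \<le> 2 * j + 1"
  have "u j * v j \<le> (C * u m) * (D * v m)"
    by (intro mult_mono doublingD[OF assms(1)] doublingD[OF assms(2)] * assms mult_nonneg_nonneg)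
  then show "u j * v j \<le> C * D * (u m * v m)" by (simp add: mult_ac)
qed

lemma doubling_power:
  assumes "doubling C u" "\<And>m. u m \<ge> 0"
  shows "doubling (C ^ N) (\<lambda>m. u m ^ N)"
  unfolding doubling_def
proof safe
  fix j m :: nat assume *: "j \<le> m" "m \<le> 2 * j + 1"
  have "u j ^ N \<le> (C * u m) ^ N"
    by (intro power_mono doublingD[OF assms(1)] * assms)
  then show "u j ^ N \<le> C ^ N * u m ^ N" by (simp add: power_mult_distrib)
qed

lemma doubling_add:
  assumes "doubling C u" "doubling C v"
  shows "doubling C (\<lambda>m. u m + v m)"
  using assms by (auto simp: doubling_def distrib_left intro!: add_mono)

lemma doubling_cmult:
  assumes "doubling C u" "c \<ge> 0"
  shows "doubling C (\<lambda>m. c * u m)"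
  using assms by (auto simp: doubling_def mult.left_commute[of C] intro!: mult_left_mono)

text \<open>One of the two indices is at least about n / 2, so its weight can be moved to n at the
  cost of C, and the other weight is summed. Partial sums stay in the bound because weights whose
  partial sums grow with n are convolved as well.\<close>

lemma convolution_doubling:
  assumes u: "doubling C u" and v: "doubling C v"
    and nn: "\<And>m. u m \<ge> 0" "\<And>m. v m \<ge> 0" "C \<ge> 0"
  shows "(\<Sum>i\<le>n. u i * v (n - i)) \<le> C * u n * (\<Sum>i\<le>n. v i) + C * v n * (\<Sum>i\<le>n. u i)"
proof -
  have "(\<Sum>i\<le>n. u i * v (n - i)) \<le> (\<Sum>i\<le>n. C * u n * v (n - i) + C * v n * u i)"
  proof (rule sum_mono)
    fix i assume "i \<in> {..n}"
    then have i: "i \<le> n" by simp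
    have p: "0 \<le> C * u n * v (n - i)" "0 \<le> C * v n * u i" using nn by auto
    show "u i * v (n - i) \<le> C * u n * v (n - i) + C * v n * u i"
    proof (cases "n \<le> 2 * i + 1")
      case True
      then have "u i \<le> C * u n" using doublingD[OF u i] by simp
      then have "u i * v (n - i) \<le> C * u n * v (n - i)" by (intro mult_right_mono nn)
      with p show ?thesis by linarith
    next
      case False
      then have "v (n - i) \<le> C * v n" using i by (intro doublingD[OF v]) auto
      then have "v (n - i) * u i \<le> C * v n * u i" by (intro mult_right_mono nn)
      with p show ?thesis by (simp add: mult.commute)
    qed
  qed
  also have "\<dots> = C * u n * (\<Sum>i\<le>n. v (n - i)) + C * v n * (\<Sum>i\<le>n. u i)"
    by (simp add: sum.distrib sum_distrib_left)
  also have "(\<Sum>i\<le>n. v (n - i)) = (\<Sum>i\<le>n. v i)"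
    by (rule sum.reindex_bij_witness[of _ "\<lambda>i. n - i" "\<lambda>i. n - i"]) auto
  finally show ?thesis .
qed

lemma fps_mult_bound:
  fixes x y :: "real fps"
  assumes "\<And>i. i \<le> n \<Longrightarrow> \<bar>x $$ i\<bar> \<le> u i" "\<And>i. i \<le> n \<Longrightarrow> \<bar>y $$ i\<bar> \<le> v i"
  shows "\<bar>(x * y) $$ n\<bar> \<le> (\<Sum>i\<le>n. u i * v (n - i))"
proof -
  have "\<bar>(x * y) $$ n\<bar> \<le> (\<Sum>i\<le>n. \<bar>x $$ i * y $$ (n - i)\<bar>)"
    by (simp add: fps_mult_nth atLeast0AtMost)
  also have "\<dots> \<le> (\<Sum>i\<le>n. u i * v (n - i))"
    unfolding abs_mult
  proof (intro sum_mono mult_mono)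
    fix i assume i: "i \<in> {..n}"
    show "\<bar>x $$ i\<bar> \<le> u i" using assms(1) i by simp
    then show "0 \<le> u i" by linarith
    show "\<bar>y $$ (n - i)\<bar> \<le> v (n - i)" using assms(2) i by simp
  qed auto
  finally show ?thesis .
qed

lemma fps_mult_bound_doubling:
  fixes x y :: "real fps"
  assumes "\<And>i. i \<le> n \<Longrightarrow> \<bar>x $$ i\<bar> \<le> s * u i" "\<And>i. i \<le> n \<Longrightarrow> \<bar>y $$ i\<bar> \<le> t * v i"
    and "doubling C u" "doubling C v" "\<And>m. u m \<ge> 0" "\<And>m. v m \<ge> 0" "C \<ge> 0" "s \<ge> 0" "t \<ge> 0"
    and "(\<Sum>i\<le>n. u i) \<le> U" "(\<Sum>i\<le>n. v i) \<le> V"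
  shows "\<bar>(x * y) $$ n\<bar> \<le> s * t * C * (u n * V + v n * U)"
proof -
  have "\<bar>(x * y) $$ n\<bar> \<le> (\<Sum>i\<le>n. (s * u i) * (t * v (n - i)))"
    by (rule fps_mult_bound[OF assms(1,2)])
  also have "\<dots> = s * t * (\<Sum>i\<le>n. u i * v (n - i))"
    by (simp add: sum_distrib_left mult_ac)
  also have "\<dots> \<le> s * t * (C * u n * (\<Sum>i\<le>n. v i) + C * v n * (\<Sum>i\<le>n. u i))"
    by (intro mult_left_mono convolution_doubling assms mult_nonneg_nonneg)
  also have "\<dots> \<le> s * t * (C * u n * V + C * v n * U)"
    by (intro mult_left_mono add_mono assms mult_nonneg_nonneg)
  finally show ?thesis by (simp add: algebra_simps)
qed

text \<open>Instead of a Neumann series, strong induction on the fixed point equation y = x + x y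
  for y = 1 / (1 - x) - 1. As x has no constant term, x y at order m sees y only below m, and the
  factor 2 reproduces itself because 2 s c \<le> 1. Only orders up to n enter.\<close>

lemma inverse_one_minus_bound:
  fixes x :: "real fps"
  assumes x0: "x $$ 0 = 0" and x: "\<And>m. m \<le> n \<Longrightarrow> \<bar>x $$ m\<bar> \<le> s * w m"
    and c: "\<And>m. m \<le> n \<Longrightarrow> (\<Sum>i\<le>m. w i * w (m - i)) \<le> c * w m"
    and nn: "s \<ge> 0" "\<And>m. w m \<ge> 0" and sc: "2 * s * c \<le> 1"
    and m: "m \<le> n"
  shows "\<bar>(inverse (1 - x) - 1) $$ m\<bar> \<le> 2 * s * w m"
  using m
proof (induction m rule: less_induct)
  case (less m)
  define y where "y = inverse (1 - x) - 1"
  have "(1 - x) * inverse (1 - x) = 1"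
    using inverse_mult_eq_1'[of "1 - x"] x0 by simp
  then have y: "y = x + x * y"
    unfolding y_def by (simp add: algebra_simps)
  have "\<bar>(x * y) $$ m\<bar> \<le> (\<Sum>i\<le>m. \<bar>x $$ i * y $$ (m - i)\<bar>)"
    by (simp add: fps_mult_nth atLeast0AtMost)
  also have "\<dots> \<le> (\<Sum>i\<le>m. (s * w i) * (2 * s * w (m - i)))"
  proof (rule sum_mono)
    fix i assume i: "i \<in> {..m}"
    show "\<bar>x $$ i * y $$ (m - i)\<bar> \<le> (s * w i) * (2 * s * w (m - i))"
    proof (cases "i = 0")
      case True
      then show ?thesis using x0 nn by simp
    next
      case False
      have "\<bar>x $$ i\<bar> \<le> s * w i" using x i less.prems by auto
      moreover have "\<bar>y $$ (m - i)\<bar> \<le> 2 * s * w (m - i)"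
        unfolding y_def using False i less.prems by (intro less.IH) auto
      ultimately show ?thesis
        unfolding abs_mult by (intro mult_mono) (use nn in auto)
    qed
  qed
  also have "\<dots> = 2 * s * s * (\<Sum>i\<le>m. w i * w (m - i))"
    by (simp add: sum_distrib_left mult_ac)
  also have "\<dots> \<le> 2 * s * s * (c * w m)"
    using nn by (intro mult_left_mono c less.prems) auto
  also have "\<dots> = (2 * s * c) * (s * w m)" by simp
  also have "\<dots> \<le> 1 * (s * w m)"
    using nn sc by (intro mult_right_mono) auto
  finally have "\<bar>(x * y) $$ m\<bar> \<le> s * w m" by simp
  moreover have "\<bar>x $$ m\<bar> \<le> s * w m" using x less.prems by simp
  moreover have "y $$ m = x $$ m + (x * y) $$ m" by (subst y) simp
  ultimately show ?case unfolding y_def[symmetric] by linarith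
qed

section \<open>The weights \<open>rho\<close> and \<open>bump\<close>\<close>

definition rho :: "real \<Rightarrow> nat \<Rightarrow> real" where
  "rho q m = (1 + real m) powr (- q)"

text \<open>A polynomial substitute for the random walk decay (1 - a)^m: of order 1 up to m = 1 / a
  and decreasing beyond. Unlike the exponential it has the doubling property uniformly in a, and its
  powers recover as much decay as is needed.\<close>

definition bump :: "real \<Rightarrow> nat \<Rightarrow> real" where
  "bump a m = 1 / (1 + a * real m)"

lemma rho_pos [simp]: "rho q m > 0" and rho_nonneg [simp]: "rho q m \<ge> 0"
  by (auto simp: rho_def)

lemma rho_0 [simp]: "rho q 0 = 1"
  by (simp add: rho_def)

lemma rho_zero [simp]: "rho 0 m = 1"
  by (simp add: rho_def)

lemma rho_antimono: "q \<le> q' \<Longrightarrow> rho q' m \<le> rho q m"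
  by (auto simp: rho_def intro!: powr_mono)

lemma rho_le_1: "0 \<le> q \<Longrightarrow> rho q m \<le> 1"
  using rho_antimono[of 0 q m] by simp

lemma rho_mult: "rho p m * rho q m = rho (p + q) m"
  by (simp add: rho_def powr_add[symmetric])

lemma rho_Suc_mult: "rho q m * (real m + 1) = rho (q - 1) m"
  using rho_mult[of q m "-1"] by (simp add: rho_def add.commute)

lemma doubling_rho:
  assumes "q \<ge> 0" shows "doubling (2 powr q) (rho q)"
  unfolding doubling_def
proof safe
  fix j m :: nat assume "j \<le> m" "m \<le> 2 * j + 1"
  then have "real m \<le> real (2 * j + 1)" by (subst of_nat_le_iff)
  then have "1 + real m \<le> 2 * (1 + real j)" by simp
  then have "(1 + real m) powr q \<le> (2 * (1 + real j)) powr q"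
    using assms by (intro powr_mono2) auto
  also have "\<dots> = 2 powr q * (1 + real j) powr q" by (rule powr_mult)
  finally show "rho q j \<le> 2 powr q * rho q m"
    by (simp add: rho_def powr_minus divide_simps mult_ac)
qed

lemma powr_le_rho:
  assumes "q \<ge> 0" "m \<ge> 1" shows "real m powr (- q) \<le> 2 powr q * rho q m"
proof -
  have "(1 + real m) powr q \<le> (2 * real m) powr q"
    by (rule powr_mono2) (use assms in auto)
  also have "\<dots> = 2 powr q * real m powr q" by (rule powr_mult)
  finally show ?thesis using assms by (simp add: rho_def powr_minus divide_simps mult_ac)
qed

lemma rho_le_powr:
  assumes "q \<ge> 0" "m \<ge> 1" shows "rho q m \<le> real m powr (- q)"
  unfolding rho_def by (rule powr_mono2') (use assms in auto)

lemma summable_rho: "q > 1 \<Longrightarrow> summable (rho q)"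
proof -
  assume "q > 1"
  then have "summable (\<lambda>n. real n powr (-q))" by (subst summable_real_powr_iff) auto
  then have "summable (\<lambda>n. real (Suc n) powr (-q))" by (subst summable_Suc_iff)
  then show ?thesis unfolding rho_def[abs_def] by simp
qed

lemma sum_rho_le: "q > 1 \<Longrightarrow> (\<Sum>m\<le>n. rho q m) \<le> suminf (rho q)"
  by (rule sum_le_suminf[OF summable_rho]) auto

lemma suminf_rho_ge_1: "q > 1 \<Longrightarrow> suminf (rho q) \<ge> 1"
  using sum_rho_le[of q 0] by simp

context
  fixes a :: real
  assumes a: "0 \<le> a" "a \<le> 2"
begin

lemma bump_pos: "bump a m > 0"
  using a by (auto simp: bump_def add_pos_nonneg)

lemma bump_nonneg: "bump a m \<ge> 0"
  using bump_pos[of m] by simp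

lemma bump_le_1: "bump a m \<le> 1"
  using a by (auto simp: bump_def divide_simps)

lemma bump_power_le: "1 \<le> N \<Longrightarrow> bump a m ^ N \<le> bump a m"
  using power_decreasing[of 1 N "bump a m"] bump_nonneg bump_le_1 by simp

lemma doubling_bump: "doubling 3 (bump a)"
  unfolding doubling_def
proof safe
  fix j m :: nat assume "j \<le> m" "m \<le> 2 * j + 1"
  then have "a * real m \<le> a * (2 * real j + 1)" using a by (intro mult_left_mono) auto
  also have "\<dots> = 2 * (a * real j) + a" by (simp add: algebra_simps)
  also have "\<dots> \<le> 3 * (a * real j) + 2" using a mult_nonneg_nonneg[of a "real j"] by linarith
  finally have *: "1 + a * real m \<le> 3 * (1 + a * real j)" by simp
  have "0 \<le> a * real j" "0 \<le> a * real m" using a by auto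
  then have "1 + a * real j > 0" "1 + a * real m > 0" by linarith+
  with * show "bump a j \<le> 3 * bump a m" unfolding bump_def by (simp add: divide_simps)
qed

text \<open>The quantity \<open>(real m + 1) * bump a m\<close> is comparable to the smaller of m +
  1 and 1 / a, the time up to m that a walk with decay rate a survives. This bound and the next
  allow it to be inserted as a factor, or to be cancelled against a.\<close>

lemma Suc_bump_ge: "1 \<le> 2 * ((real m + 1) * bump a m)"
proof -
  have "a * real m \<le> 2 * real m" using a by (intro mult_right_mono) auto
  moreover have "0 \<le> a * real m" using a by auto
  ultimately show ?thesis by (simp add: bump_def divide_simps)
qed

lemma Suc_bump_le: "a * ((real m + 1) * bump a m) \<le> 2"
proof -
  have "0 \<le> a * real m" using a by auto
  then have "1 + a * real m > 0" "a \<le> 2 + a * real m" using a by linarith+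
  then show ?thesis using a by (simp add: bump_def divide_simps algebra_simps)
qed

text \<open>Telescoping: n / (1 + a n) has the increments 1 / (x (x + a)) with x = 1 + a n, and
  these dominate the squares.\<close>

lemma sum_bump_sq: "(\<Sum>m\<le>n. (bump a m)\<^sup>2) \<le> 1 + real n * bump a n"
proof (induction n)
  case 0
  then show ?case by (simp add: bump_def)
next
  case (Suc n)
  define x where "x = 1 + a * real n"
  have x: "x \<ge> 1" using a by (simp add: x_def)
  have b: "bump a n = 1 / x" "bump a (Suc n) = 1 / (x + a)"
    by (simp_all add: bump_def x_def algebra_simps)
  have "(1 / (x + a))\<^sup>2 \<le> 1 / (x * (x + a))"
    using x a by (simp add: power2_eq_square divide_simps)
  also have "\<dots> = (real n + 1) / (x + a) - real n / x"
  proof -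
    have e: "(real n + 1) * x - real n * (x + a) = 1" by (simp add: x_def algebra_simps)
    have "(real n + 1) / (x + a) - real n / x = ((real n + 1) * x - real n * (x + a)) / (x * (x + a))"
      using x a by (simp add: field_simps)
    then show ?thesis using e by simp
  qed
  finally have "(bump a (Suc n))\<^sup>2 \<le> real (Suc n) * bump a (Suc n) - real n * bump a n"
    by (simp add: b add.commute)
  with Suc show ?case by simp
qed

lemma sum_bump_power:
  assumes N: "N \<ge> 2"
  shows "(\<Sum>m\<le>n. bump a m ^ N) \<le> 3 * ((real n + 1) * bump a n)"
    and "(\<Sum>m\<le>n. a * bump a m ^ N) \<le> 6"
proof -
  have "(\<Sum>m\<le>n. bump a m ^ N) \<le> (\<Sum>m\<le>n. (bump a m)\<^sup>2)"
    by (intro sum_mono power_decreasing N bump_nonneg bump_le_1)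
  also have "\<dots> \<le> 1 + real n * bump a n" by (rule sum_bump_sq)
  also have "\<dots> \<le> 3 * ((real n + 1) * bump a n)"
    using Suc_bump_ge[of n] bump_pos[of n] by (simp add: algebra_simps)
  finally show *: "(\<Sum>m\<le>n. bump a m ^ N) \<le> 3 * ((real n + 1) * bump a n)" .
  have "(\<Sum>m\<le>n. a * bump a m ^ N) = a * (\<Sum>m\<le>n. bump a m ^ N)" by (simp add: sum_distrib_left)
  also have "\<dots> \<le> a * (3 * ((real n + 1) * bump a n))" using * a by (intro mult_left_mono)
  also have "\<dots> = 3 * (a * ((real n + 1) * bump a n))" by simp
  also have "\<dots> \<le> 6" using Suc_bump_le[of n] by linarith
  finally show "(\<Sum>m\<le>n. a * bump a m ^ N) \<le> 6" .
qed

end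

section \<open>Perturbations of the random walk\<close>

text \<open>One half of a convolution bound: for j above m / 2 the weight of x is comparable to its
  value at m, while c enters only through the sum of its majorant.\<close>

lemma sum_bound_by_doubling_tail:
  fixes x :: "nat \<Rightarrow> real"
  assumes "\<And>j. h < j \<Longrightarrow> j \<le> m \<Longrightarrow> \<bar>x j\<bar> \<le> s * u j"
    and "doubling C u" "\<And>m. u m \<ge> 0" "s \<ge> 0" "h = m div 2" "\<And>i. \<bar>c i\<bar> \<le> v i"
    and "(\<Sum>i\<le>m. v i) \<le> V" "C \<ge> 0"
  shows "\<bar>\<Sum>j\<in>{h<..m}. x j * c (m - j)\<bar> \<le> s * C * u m * V"
proof -
  have vnn: "v i \<ge> 0" for i using assms(6)[of i] by linarith
  have "\<bar>\<Sum>j\<in>{h<..m}. x j * c (m - j)\<bar> \<le> (\<Sum>j\<in>{h<..m}. \<bar>x j * c (m - j)\<bar>)"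
    by (rule sum_abs)
  also have "\<dots> \<le> (\<Sum>j\<in>{h<..m}. s * C * u m * v (m - j))"
  proof (rule sum_mono)
    fix j assume j: "j \<in> {h<..m}"
    have "\<bar>x j\<bar> \<le> s * u j" using assms(1) j by auto
    also have "\<dots> \<le> s * (C * u m)"
      by (intro mult_left_mono doublingD[OF assms(2)] assms) (use j \<open>h = m div 2\<close> in auto)
    finally have "\<bar>x j\<bar> \<le> s * C * u m" by simp
    then show "\<bar>x j * c (m - j)\<bar> \<le> s * C * u m * v (m - j)"
      unfolding abs_mult using assms vnn by (intro mult_mono) auto
  qed
  also have "\<dots> \<le> (\<Sum>j\<le>m. s * C * u m * v (m - j))"
    by (intro sum_mono2 mult_nonneg_nonneg assms vnn) auto
  also have "\<dots> = s * C * u m * (\<Sum>j\<le>m. v (m - j))" by (simp add: sum_distrib_left)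
  also have "(\<Sum>j\<le>m. v (m - j)) = (\<Sum>j\<le>m. v j)"
    by (rule sum.reindex_bij_witness[of _ "\<lambda>i. m - i" "\<lambda>i. m - i"]) auto
  also have "s * C * u m * (\<Sum>j\<le>m. v j) \<le> s * C * u m * V"
    using assms by (intro mult_left_mono) auto
  finally show ?thesis .
qed

lemma geometric_fps:
  fixes c :: real
  shows "Abs_fps (\<lambda>i. c ^ i) * (1 - fps_const c * fps_X) = 1"
proof (rule fps_ext)
  fix n
  have "(Abs_fps (\<lambda>i. c ^ i) * (1 - fps_const c * fps_X)) $$ n
      = c ^ n - c * (Abs_fps (\<lambda>i. c ^ i) * fps_X) $$ n"
    by (simp add: right_diff_distrib mult.left_commute[of _ "fps_const c"])
  also have "\<dots> = 1 $$ n" by (cases n) auto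
  finally show "(Abs_fps (\<lambda>i. c ^ i) * (1 - fps_const c * fps_X)) $$ n = 1 $$ n" .
qed

lemma partial_sums_fps:
  fixes X :: "real fps"
  shows "(1 - fps_X) * Abs_fps (\<lambda>m. \<Sum>i\<le>m. X $$ i) = X"
proof (rule fps_ext)
  fix n show "((1 - fps_X) * Abs_fps (\<lambda>m. \<Sum>i\<le>m. X $$ i)) $$ n = X $$ n"
    by (cases n) (auto simp: left_diff_distrib)
qed

text \<open>The weight \<open>rho (\<theta> - 1) * bump a + a * bump a ^ N\<close> is, up to constants, closed under convolution
  uniformly in \<open>a\<close>; it controls the deviation of \<open>1 - G\<close> from the random walk \<open>1 - (1 - a) w\<close>.\<close>

lemma random_walk_perturbation:
  fixes \<theta> CN :: real and N :: nat
  assumes \<theta>: "\<theta> > 2" and N: "N \<ge> 2" and CN: "CN \<ge> 1"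
  shows "\<exists>K>0. \<forall>a n s X X0. 0 \<le> a \<longrightarrow> a \<le> 2 \<longrightarrow> 0 \<le> s \<longrightarrow>
    (\<forall>i. \<bar>1 - a\<bar> ^ i \<le> CN * bump a i ^ N) \<longrightarrow>
    (\<forall>m\<le>n. \<bar>X0 $$ m\<bar> \<le> s * rho \<theta> m \<and> \<bar>X $$ m\<bar> \<le> s * rho \<theta> m \<and>
        \<bar>X $$ m - X0 $$ m\<bar> \<le> s * a * rho (\<theta> - 1) m \<and>
        \<bar>\<Sum>i\<le>m. X0 $$ i\<bar> \<le> s * rho (\<theta> - 1) m) \<longrightarrow>
    (\<forall>m\<le>n. \<bar>(Abs_fps (\<lambda>i. (1 - a) ^ i) * X) $$ m\<bar>
        \<le> K * s * (rho (\<theta> - 1) m * bump a m + a * bump a m ^ N))"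
proof -
  define Z where "Z = suminf (rho (\<theta> - 1))"
  have Z: "Z \<ge> 1" "(\<Sum>m\<le>n. rho (\<theta> - 1) m) \<le> Z" for n
    unfolding Z_def using \<theta> by (auto intro: suminf_rho_ge_1 sum_rho_le)
  \<comment> \<open>A common doubling constant for all weights below: \<open>3 ^ N\<close> for the
    power of \<open>bump\<close>, \<open>2 powr \<theta>\<close> for \<open>rho\<close>, and
    \<open>3 * 2 powr (\<theta> - 1)\<close> for their mixed product.\<close>
  define Dd :: real where "Dd = 3 ^ N * (3 * 2 powr \<theta>)"
  have p1: "1 \<le> (2::real) powr \<theta>" using \<theta> ge_one_powr_ge_zero[of 2 \<theta>] by simp
  have Dd3: "3 ^ N \<le> Dd" "3 * 2 powr \<theta> \<le> Dd" "1 \<le> Dd"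
  proof -
    have "(1::real) \<le> 3 ^ N" by simp
    moreover have "1 * (3 * 2 powr \<theta>) \<le> 3 ^ N * (3 * 2 powr \<theta>)"
      by (intro mult_right_mono) auto
    moreover have "3 ^ N * 1 \<le> 3 ^ N * (3 * 2 powr \<theta>)" using p1 by (intro mult_left_mono) auto
    ultimately show "3 ^ N \<le> Dd" "3 * 2 powr \<theta> \<le> Dd" "1 \<le> Dd" using p1 unfolding Dd_def by linarith+
  qed
  define K1 where "K1 = 3 * CN * Dd * (Z + 6)"
  define K2 where "K2 = Dd * (1 + CN * Dd * (Z + 6))"
  define K3 where "K3 = CN * Dd * (K2 + 3)"
  have pos: "0 < CN" "0 < Dd" "0 < Z" using CN Dd3 Z by linarith+
  show ?thesis
  proof (rule exI[of _ "K1 + K3"], intro conjI allI impI)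
    show "0 < K1 + K3" unfolding K1_def K2_def K3_def using pos
      by (intro add_pos_pos mult_pos_pos) (auto intro: mult_nonneg_nonneg)
    fix a s :: real and n m :: nat and X X0 :: "real fps"
    assume a: "0 \<le> a" "a \<le> 2" and s: "0 \<le> s" and geo: "\<forall>i. \<bar>1 - a\<bar> ^ i \<le> CN * bump a i ^ N"
      and bds: "\<forall>m\<le>n. \<bar>X0 $$ m\<bar> \<le> s * rho \<theta> m \<and> \<bar>X $$ m\<bar> \<le> s * rho \<theta> m \<and>
        \<bar>X $$ m - X0 $$ m\<bar> \<le> s * a * rho (\<theta> - 1) m \<and>
        \<bar>\<Sum>i\<le>m. X0 $$ i\<bar> \<le> s * rho (\<theta> - 1) m"
      and m: "m \<le> n"
    define P where "P m = bump a m ^ N" for m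
    define psi where "psi m = rho (\<theta> - 1) m * bump a m" for m
    define U where "U = Abs_fps (\<lambda>i. (1 - a) ^ i)"
    have bnn: "bump a i \<ge> 0" "bump a i \<le> 1" for i using bump_nonneg[OF a] bump_le_1[OF a] by auto
    have nn: "P i \<ge> 0" "psi i \<ge> 0" for i
      unfolding P_def psi_def using bnn by auto
    have P1: "P i \<le> bump a i" for i unfolding P_def using N by (intro bump_power_le a) auto
    have P2: "P i \<le> 1" for i using P1[of i] bnn(2)[of i] by linarith
    have psi1: "psi i \<le> rho (\<theta> - 1) i" for i
      unfolding psi_def using mult_left_mono[OF bnn(2), of "rho (\<theta> - 1) i" i] by simp
    have dP: "doubling Dd P"
      unfolding P_def using Dd3 bnn
      by (intro doubling_mono[OF doubling_power[OF doubling_bump[OF a]]]) auto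
    have dr1: "doubling Dd (rho (\<theta> - 1))"
    proof (rule doubling_mono[OF doubling_rho])
      have "2 powr (\<theta> - 1) \<le> 2 powr \<theta>" by simp
      then show "2 powr (\<theta> - 1) \<le> Dd" using Dd3 p1 by linarith
    qed (use \<theta> in auto)
    have dr: "doubling Dd (rho \<theta>)"
      by (rule doubling_mono[OF doubling_rho]) (use \<theta> Dd3 p1 in auto)
    have dpsi: "doubling Dd psi"
    proof -
      have "doubling (2 powr (\<theta> - 1) * 3) psi"
        unfolding psi_def using \<theta> bnn by (intro doubling_mult doubling_rho doubling_bump[OF a]) auto
      moreover have "2 powr (\<theta> - 1) * 3 \<le> Dd"
      proof -
        have "2 powr (\<theta> - 1) \<le> 2 powr \<theta>" by simp
        then show ?thesis using Dd3 by linarith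
      qed
      ultimately show ?thesis by (rule doubling_mono) (rule nn)
    qed
    have SaP: "(\<Sum>i\<le>m. a * P i) \<le> 6" for m
      unfolding P_def by (rule sum_bump_power(2)[OF a N])
    have SP: "(\<Sum>i\<le>m. P i) \<le> 3 * ((real m + 1) * bump a m)" for m
      unfolding P_def by (rule sum_bump_power(1)[OF a N])
    have Spsi: "(\<Sum>i\<le>m. psi i) \<le> Z" for m
      by (rule order_trans[OF sum_mono[OF psi1] Z(2)])
    have U: "\<bar>U $$ i\<bar> \<le> CN * P i" for i
      unfolding U_def P_def using geo by (simp add: power_abs)
    have Ua: "\<bar>(fps_const a * U) $$ i\<bar> \<le> CN * (a * P i)" for i
      using mult_left_mono[OF U a(1), of i] a by (simp add: abs_mult mult_ac)
    have rpsi: "rho \<theta> j * ((real j + 1) * bump a j) = psi j" for j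
      using rho_Suc_mult[of \<theta> j] by (simp add: psi_def mult.assoc[symmetric])

    \<comment> \<open>Interpolation between two bounds on the difference: the one with the factor a
      is used as it stands, the one without it is multiplied by a j. Together they bound (1 + a j)
      times the difference, which produces the factor \<open>bump\<close>.\<close>
    have dX: "\<bar>(X - X0) $$ j\<bar> \<le> (3 * s) * (a * psi j)" if j: "j \<le> m" for j
    proof -
      let ?x = "\<bar>X $$ j - X0 $$ j\<bar>"
      have b: "?x \<le> s * a * rho (\<theta> - 1) j" "?x \<le> 2 * s * rho \<theta> j"
        using bds[rule_format, of j] j m by (auto simp: abs_le_iff)
      have "rho \<theta> j * real j \<le> rho (\<theta> - 1) j"
        using rho_Suc_mult[of \<theta> j] rho_pos[of \<theta> j] unfolding distrib_left by linarith
      then have "a * (2 * s) * (rho \<theta> j * real j) \<le> a * (2 * s) * rho (\<theta> - 1) j"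
        using a s by (intro mult_left_mono) auto
      moreover have "?x * (a * real j) \<le> 2 * s * rho \<theta> j * (a * real j)"
        by (intro mult_right_mono b) (use a in auto)
      ultimately have "?x * (1 + a * real j) \<le> 3 * s * a * rho (\<theta> - 1) j"
        using b(1) by (simp add: algebra_simps)
      moreover have "1 + a * real j > 0" using a by (simp add: add_pos_nonneg)
      ultimately show ?thesis by (simp add: psi_def bump_def field_simps)
    qed
    have convdX: "\<bar>(U * (X - X0)) $$ m\<bar> \<le> K1 * s * (psi m + a * P m)"
    proof -
      have "\<bar>(U * (X - X0)) $$ m\<bar> \<le> (\<Sum>i\<le>m. (CN * P i) * (3 * s * (a * psi (m - i))))"
        by (rule fps_mult_bound) (use U dX in auto)
      also have "\<dots> = CN * (3 * s) * (\<Sum>i\<le>m. (a * P i) * psi (m - i))"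
        by (simp add: sum_distrib_left mult_ac)
      also have "\<dots> \<le> CN * (3 * s) * (Dd * (a * P m) * (\<Sum>i\<le>m. psi i) + Dd * psi m * (\<Sum>i\<le>m. a * P i))"
        by (intro mult_left_mono convolution_doubling doubling_cmult dP dpsi)
           (use a nn pos s in auto)
      also have "\<dots> \<le> CN * (3 * s) * (Dd * (a * P m) * Z + Dd * psi m * 6)"
        by (intro mult_left_mono add_mono Spsi SaP) (use a nn pos s in auto)
      also have "\<dots> \<le> CN * (3 * s) * (Dd * (a * P m) * (Z + 6) + Dd * psi m * (Z + 6))"
        by (intro mult_left_mono add_mono) (use a nn pos s in auto)
      finally show ?thesis by (simp add: K1_def algebra_simps)
    qed

    define S where "S = Abs_fps (\<lambda>m. \<Sum>i\<le>m. X0 $$ i)"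
    have Sbd: "\<bar>S $$ j\<bar> \<le> s * rho (\<theta> - 1) j" if "j \<le> n" for j
      using bds that by (simp add: S_def)
    \<comment> \<open>Summation by parts: X0 is (1 - fps_X) S, where S has small coefficients, and U
      inverts 1 - (1 - a) fps_X. So U X0 is S minus a correction carrying a factor a, which
      compensates the growing sum of U.\<close>
    have UX0: "U * X0 = S - fps_X * (fps_const a * U * S)"
    proof -
      have "U * (1 - fps_const (1 - a) * fps_X) = 1" unfolding U_def by (rule geometric_fps)
      moreover have "fps_const (1 - a) = 1 - fps_const a" by (simp add: fps_const_sub[symmetric] del: fps_const_sub)
      ultimately have "U * (1 - fps_X) = 1 - fps_X * (fps_const a * U)"
        by (simp add: algebra_simps)
      moreover have "X0 = (1 - fps_X) * S" unfolding S_def by (rule partial_sums_fps[symmetric])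
      ultimately show ?thesis by (metis (no_types, lifting) left_diff_distrib mult.assoc mult_1)
    qed
    have aUS: "\<bar>(fps_const a * U * S) $$ j\<bar> \<le> s * CN * Dd * (Z + 6) * (rho (\<theta> - 1) j + a * P j)" if j: "j \<le> n" for j
    proof -
      have "\<bar>(fps_const a * U * S) $$ j\<bar> \<le> CN * s * Dd * ((a * P j) * Z + rho (\<theta> - 1) j * 6)"
      proof (rule fps_mult_bound_doubling)
        show "\<bar>(fps_const a * U) $$ i\<bar> \<le> CN * (a * P i)" for i by (rule Ua)
        show "\<bar>S $$ i\<bar> \<le> s * rho (\<theta> - 1) i" if "i \<le> j" for i using Sbd that j by simp
        show "doubling Dd (\<lambda>j. a * P j)" by (intro doubling_cmult dP a)
      qed (use pos nn a s dr1 SaP Z in auto)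
      also have "\<dots> \<le> CN * s * Dd * ((a * P j) * (Z + 6) + rho (\<theta> - 1) j * (Z + 6))"
        by (intro mult_left_mono add_mono) (use a nn pos s in auto)
      finally show ?thesis by (simp add: algebra_simps)
    qed
    \<comment> \<open>A preliminary bound that still lacks the factor \<open>bump\<close> next to
      \<open>rho\<close>; cutting at half the order will supply it.\<close>
    have UX0b: "\<bar>(U * X0) $$ j\<bar> \<le> K2 * s * (rho (\<theta> - 1) j + a * P j)" if j: "j \<le> n" for j
    proof -
      have 1: "\<bar>S $$ j\<bar> \<le> s * Dd * (rho (\<theta> - 1) j + a * P j)"
      proof -
        have "s * rho (\<theta> - 1) j * 1 \<le> s * rho (\<theta> - 1) j * Dd"
          using s Dd3 by (intro mult_left_mono) auto
        moreover have "0 \<le> s * Dd * (a * P j)" using s pos a nn by auto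
        ultimately show ?thesis using Sbd[OF j] by (simp add: algebra_simps)
      qed
      have 2: "\<bar>(fps_X * (fps_const a * U * S)) $$ j\<bar> \<le> s * CN * Dd * (Z + 6) * (Dd * (rho (\<theta> - 1) j + a * P j))"
      proof (cases j)
        case 0
        then show ?thesis using s pos a nn by auto
      next
        case (Suc i)
        have d: "doubling Dd (\<lambda>j. rho (\<theta> - 1) j + a * P j)"
          by (intro doubling_add dr1 doubling_cmult dP a)
        have "\<bar>(fps_X * (fps_const a * U * S)) $$ j\<bar> = \<bar>(fps_const a * U * S) $$ i\<bar>"
          by (simp add: Suc mult.assoc)
        also have "\<dots> \<le> s * CN * Dd * (Z + 6) * (rho (\<theta> - 1) i + a * P i)"
          using j Suc by (intro aUS) auto
        also have "\<dots> \<le> s * CN * Dd * (Z + 6) * (Dd * (rho (\<theta> - 1) j + a * P j))"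
          by (intro mult_left_mono doublingD[OF d]) (use s pos Suc in auto)
        finally show ?thesis .
      qed
      have "\<bar>(U * X0) $$ j\<bar> \<le> \<bar>S $$ j\<bar> + \<bar>(fps_X * (fps_const a * U * S)) $$ j\<bar>"
        unfolding UX0 fps_sub_nth by linarith
      also have "\<dots> \<le> s * Dd * (rho (\<theta> - 1) j + a * P j) +
            s * CN * Dd * (Z + 6) * (Dd * (rho (\<theta> - 1) j + a * P j))"
        using 1 2 by linarith
      also have "\<dots> = K2 * s * (rho (\<theta> - 1) j + a * P j)"
        by (simp add: K2_def algebra_simps)
      finally show ?thesis .
    qed

    \<comment> \<open>Second pass. For j \<le> h the factor (1 - a)^(m - h) splits off and supplies
      the missing \<open>bump\<close>; what is left is the preliminary bound at h. For j > h the
      pointwise bound \<open>rho \<theta>\<close> is combined with the sum of the geometric weights,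
      of order (m + 1) \<open>bump\<close>, and this product is psi.\<close>
    define h where "h = m div 2"
    have split: "(U * X0) $$ m = (1 - a) ^ (m - h) * (U * X0) $$ h
        + (\<Sum>j\<in>{h<..m}. X0 $$ j * (1 - a) ^ (m - j))"
    proof -
      have e: "(U * X0) $$ l = (\<Sum>j\<le>l. X0 $$ j * (1 - a) ^ (l - j))" for l
        by (subst mult.commute) (simp add: fps_mult_nth U_def atLeast0AtMost)
      have "{..m} = {..h} \<union> {h<..m}" by (auto simp: h_def)
      then have "(U * X0) $$ m = (\<Sum>j\<le>h. X0 $$ j * (1 - a) ^ (m - j))
          + (\<Sum>j\<in>{h<..m}. X0 $$ j * (1 - a) ^ (m - j))"
        unfolding e by (simp add: sum.union_disjoint ivl_disj_int)
      also have "(\<Sum>j\<le>h. X0 $$ j * (1 - a) ^ (m - j)) = (1 - a) ^ (m - h) * (U * X0) $$ h"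
        unfolding e sum_distrib_left
      proof (rule sum.cong)
        fix j assume "j \<in> {..h}"
        then have "m - j = (m - h) + (h - j)" by (auto simp: h_def)
        then show "X0 $$ j * (1 - a) ^ (m - j) = (1 - a) ^ (m - h) * (X0 $$ j * (1 - a) ^ (h - j))"
          by (simp add: power_add)
      qed auto
      finally show ?thesis .
    qed
    have t1: "\<bar>(1 - a) ^ (m - h) * (U * X0) $$ h\<bar> \<le> CN * Dd * K2 * s * (psi m + a * P m)"
    proof -
      have K2: "K2 \<ge> 0" unfolding K2_def using pos by (intro mult_nonneg_nonneg add_nonneg_nonneg) auto
      have g: "\<bar>(1 - a) ^ (m - h)\<bar> \<le> CN * P (m - h)" using geo by (simp add: power_abs P_def)
      have Pm: "P (m - h) \<le> Dd * P m" by (rule doublingD[OF dP]) (auto simp: h_def)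
      have rm: "rho (\<theta> - 1) h \<le> Dd * rho (\<theta> - 1) m" by (rule doublingD[OF dr1]) (auto simp: h_def)
      have "\<bar>(1 - a) ^ (m - h) * (U * X0) $$ h\<bar> \<le> (CN * P (m - h)) * (K2 * s * (rho (\<theta> - 1) h + a * P h))"
        unfolding abs_mult by (intro mult_mono g UX0b) (use m pos nn in \<open>auto simp: h_def\<close>)
      also have "\<dots> = CN * K2 * s * (P (m - h) * rho (\<theta> - 1) h + a * (P (m - h) * P h))"
        by (simp add: algebra_simps)
      also have "\<dots> \<le> CN * K2 * s * (Dd * psi m + a * (Dd * P m))"
      proof (intro mult_left_mono add_mono)
        have "P (m - h) * rho (\<theta> - 1) h \<le> bump a (m - h) * rho (\<theta> - 1) h"
          by (intro mult_right_mono P1) auto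
        also have "\<dots> \<le> (3 * bump a m) * (2 powr (\<theta> - 1) * rho (\<theta> - 1) m)"
        proof (intro mult_mono)
          show "bump a (m - h) \<le> 3 * bump a m"
            by (rule doublingD[OF doubling_bump[OF a]]) (auto simp: h_def)
          show "rho (\<theta> - 1) h \<le> 2 powr (\<theta> - 1) * rho (\<theta> - 1) m"
            by (rule doublingD[OF doubling_rho]) (use \<theta> in \<open>auto simp: h_def\<close>)
        qed (use bnn in auto)
        also have "\<dots> = 3 * 2 powr (\<theta> - 1) * psi m" by (simp add: psi_def)
        also have "\<dots> \<le> Dd * psi m"
        proof (intro mult_right_mono nn)
          have "2 powr (\<theta> - 1) \<le> 2 powr \<theta>" by simp
          then show "3 * 2 powr (\<theta> - 1) \<le> Dd" using Dd3 by linarith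
        qed
        finally show "P (m - h) * rho (\<theta> - 1) h \<le> Dd * psi m" .
        have "P (m - h) * P h \<le> P (m - h) * 1" by (intro mult_left_mono P2 nn)
        then show "P (m - h) * P h \<le> Dd * P m" using Pm by linarith
      qed (use pos s a K2 in auto)
      finally show ?thesis by (simp add: algebra_simps)
    qed
    have *: "\<bar>\<Sum>j\<in>{h<..m}. X0 $$ j * (1 - a) ^ (m - j)\<bar> \<le> s * Dd * rho \<theta> m * (CN * (3 * ((real m + 1) * bump a m)))"
    proof (rule sum_bound_by_doubling_tail[where v = "\<lambda>i. CN * P i"])
      show "\<bar>X0 $$ j\<bar> \<le> s * rho \<theta> j" if "h < j" "j \<le> m" for j using bds that m by auto
      show "\<bar>(1 - a) ^ i\<bar> \<le> CN * P i" for i using geo by (simp add: power_abs P_def)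
      show "(\<Sum>i\<le>m. CN * P i) \<le> CN * (3 * ((real m + 1) * bump a m))"
        unfolding sum_distrib_left[symmetric] by (intro mult_left_mono SP) (use pos in auto)
    qed (use s pos dr in \<open>auto simp: h_def\<close>)
    have **: "s * Dd * rho \<theta> m * (CN * (3 * ((real m + 1) * bump a m))) = 3 * s * Dd * CN * psi m" unfolding rpsi[symmetric] by (simp add: algebra_simps)
    have t2': "\<bar>\<Sum>j\<in>{h<..m}. X0 $$ j * (1 - a) ^ (m - j)\<bar> \<le> CN * Dd * 3 * s * (psi m + a * P m)"
    proof -
      have "0 \<le> CN * Dd * 3 * s * (a * P m)" using s pos a nn(1)[of m] by simp
      with *[unfolded **] show ?thesis by (simp add: algebra_simps)
    qed
    have "\<bar>(U * X) $$ m\<bar> \<le> \<bar>(U * (X - X0)) $$ m\<bar> + \<bar>(U * X0) $$ m\<bar>"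
      by (simp add: right_diff_distrib)
    also have "\<dots> \<le> K1 * s * (psi m + a * P m) + (CN * Dd * K2 * s * (psi m + a * P m) + CN * Dd * 3 * s * (psi m + a * P m))"
      using convdX t1 t2' split by linarith
    also have "\<dots> = (K1 + K3) * s * (psi m + a * P m)" by (simp add: K3_def algebra_simps)
    finally show "\<bar>(Abs_fps (\<lambda>i. (1 - a) ^ i) * X) $$ m\<bar> \<le> (K1 + K3) * s * (rho (\<theta> - 1) m * bump a m + a * bump a m ^ N)"
      by (simp add: U_def psi_def P_def)
  qed
qed

text \<open>The random walk part 1 - (1 - a) fps_X is divided out first: with U its inverse and Y =
  U X, one has F = U (1 + E) / (1 - Y). By \<open>random_walk_perturbation\<close>, Y is bounded by
  a weight phi that is summable uniformly in a, so for small s the inverse of 1 - Y obeys a bound of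
  the same type. The second term of the result arises as psi times (m + 1) \<open>bump\<close>, when
  the correction from this inverse meets the growing partial sums of U.\<close>

lemma pointwise_bound:
  fixes \<theta> CN :: real and N :: nat
  assumes \<theta>: "\<theta> > 2" and N: "N \<ge> 2" and CN: "CN \<ge> 1"
  shows "\<exists>s0>0. \<exists>C>0. \<forall>a n s F X X0 E. 0 \<le> a \<longrightarrow> a \<le> 2 \<longrightarrow> 0 \<le> s \<longrightarrow> s \<le> s0 \<longrightarrow>
    (\<forall>i. \<bar>1 - a\<bar> ^ i \<le> CN * bump a i ^ N) \<longrightarrow>
    F * (1 - fps_const (1 - a) * fps_X - X) = 1 + E \<longrightarrow> X $$ 0 = 0 \<longrightarrow>
    (\<forall>m\<le>n. \<bar>E $$ m\<bar> \<le> rho \<theta> m \<and> \<bar>X0 $$ m\<bar> \<le> s * rho \<theta> m \<and> \<bar>X $$ m\<bar> \<le> s * rho \<theta> m \<and>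
        \<bar>X $$ m - X0 $$ m\<bar> \<le> s * a * rho (\<theta> - 1) m \<and>
        \<bar>\<Sum>i\<le>m. X0 $$ i\<bar> \<le> s * rho (\<theta> - 1) m) \<longrightarrow>
    (\<forall>m\<le>n. \<bar>F $$ m\<bar> \<le> C * (bump a m ^ N + rho (\<theta> - 2) m * (bump a m)\<^sup>2))"
proof -
  obtain K where K: "K > 0" and Kbd: "\<And>a n s X X0. 0 \<le> a \<Longrightarrow> a \<le> 2 \<Longrightarrow> 0 \<le> s \<Longrightarrow>
    (\<forall>i. \<bar>1 - a\<bar> ^ i \<le> CN * bump a i ^ N) \<Longrightarrow>
    (\<forall>m\<le>n. \<bar>X0 $$ m\<bar> \<le> s * rho \<theta> m \<and> \<bar>X $$ m\<bar> \<le> s * rho \<theta> m \<and>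
        \<bar>X $$ m - X0 $$ m\<bar> \<le> s * a * rho (\<theta> - 1) m \<and>
        \<bar>\<Sum>i\<le>m. X0 $$ i\<bar> \<le> s * rho (\<theta> - 1) m) \<Longrightarrow>
    (\<forall>m\<le>n. \<bar>(Abs_fps (\<lambda>i. (1 - a) ^ i) * X) $$ m\<bar>
        \<le> K * s * (rho (\<theta> - 1) m * bump a m + a * bump a m ^ N))"
    using random_walk_perturbation[OF assms] by metis
  define Z where "Z = suminf (rho (\<theta> - 1))"
  have Z: "Z \<ge> 1" "(\<Sum>m\<le>n. rho (\<theta> - 1) m) \<le> Z" for n
    unfolding Z_def using \<theta> by (auto intro: suminf_rho_ge_1 sum_rho_le)
  define Dd :: real where "Dd = 3 ^ N * (3 * 2 powr \<theta>)"
  have p1: "1 \<le> (2::real) powr \<theta>" using \<theta> ge_one_powr_ge_zero[of 2 \<theta>] by simp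
  have Dd3: "3 ^ N \<le> Dd" "3 * 2 powr \<theta> \<le> Dd" "1 \<le> Dd"
  proof -
    have "(1::real) \<le> 3 ^ N" by simp
    moreover have "1 * (3 * 2 powr \<theta>) \<le> 3 ^ N * (3 * 2 powr \<theta>)"
      by (intro mult_right_mono) auto
    moreover have "3 ^ N * 1 \<le> 3 ^ N * (3 * 2 powr \<theta>)" using p1 by (intro mult_left_mono) auto
    ultimately show "3 ^ N \<le> Dd" "3 * 2 powr \<theta> \<le> Dd" "1 \<le> Dd" using p1 unfolding Dd_def by linarith+
  qed
  have pos: "0 < CN" "0 < Dd" "0 < Z" using CN Dd3 Z by linarith+
  \<comment> \<open>The convolution constant of phi: twice the doubling constant times the bound Z +
    6 on the sum of phi. Then s0 is the threshold at which \<open>inverse_one_minus_bound\<close>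
    applies to a series of size K s.\<close>
  define c where "c = 2 * Dd * (Z + 6)"
  have c: "c > 0" unfolding c_def using pos by (intro mult_pos_pos add_pos_pos) auto
  define s0 where "s0 = 1 / (2 * K * c)"
  define K1 where "K1 = CN * (1 + Dd * (Z + 3))"
  define K2 where "K2 = K1 * (1 + Dd / c * (3 + 2 * Z + (Z + 6)))"
  have s0: "s0 > 0" unfolding s0_def using K c by simp
  have K1: "K1 > 0" unfolding K1_def using pos by (intro mult_pos_pos add_pos_pos) auto
  have K2: "K2 > 0" unfolding K2_def using K1 pos c by (intro mult_pos_pos add_pos_pos divide_pos_pos) auto
  show ?thesis
  proof (rule exI[of _ s0], intro conjI exI[of _ "3 * K2"] allI impI)
    show "0 < s0" by (rule s0)
    show "0 < 3 * K2" using K2 by simp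
    fix a s :: real and n m :: nat and F X X0 E :: "real fps"
    assume a: "0 \<le> a" "a \<le> 2" and s: "0 \<le> s" "s \<le> s0" and geo: "\<forall>i. \<bar>1 - a\<bar> ^ i \<le> CN * bump a i ^ N"
      and F: "F * (1 - fps_const (1 - a) * fps_X - X) = 1 + E" and X0: "X $$ 0 = 0"
      and bds: "\<forall>m\<le>n. \<bar>E $$ m\<bar> \<le> rho \<theta> m \<and> \<bar>X0 $$ m\<bar> \<le> s * rho \<theta> m \<and> \<bar>X $$ m\<bar> \<le> s * rho \<theta> m \<and>
        \<bar>X $$ m - X0 $$ m\<bar> \<le> s * a * rho (\<theta> - 1) m \<and>
        \<bar>\<Sum>i\<le>m. X0 $$ i\<bar> \<le> s * rho (\<theta> - 1) m"
      and m: "m \<le> n"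
    define P where "P m = bump a m ^ N" for m
    define psi where "psi m = rho (\<theta> - 1) m * bump a m" for m
    define phi where "phi m = psi m + a * P m" for m
    define U where "U = Abs_fps (\<lambda>i. (1 - a) ^ i)"
    define Y where "Y = U * X"
    have bnn: "bump a i \<ge> 0" "bump a i \<le> 1" for i using bump_nonneg[OF a] bump_le_1[OF a] by auto
    have nn: "P i \<ge> 0" "psi i \<ge> 0" for i
      unfolding P_def psi_def using bnn by auto
    have phinn: "phi i \<ge> 0" for i unfolding phi_def using nn a by auto
    have psi1: "psi i \<le> rho (\<theta> - 1) i" for i
      unfolding psi_def using mult_left_mono[OF bnn(2), of "rho (\<theta> - 1) i" i] by simp
    have dP: "doubling Dd P"
      unfolding P_def using Dd3 bnn
      by (intro doubling_mono[OF doubling_power[OF doubling_bump[OF a]]]) auto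
    have dr: "doubling Dd (rho \<theta>)"
      by (rule doubling_mono[OF doubling_rho]) (use \<theta> Dd3 p1 in auto)
    have dpsi: "doubling Dd psi"
    proof -
      have "doubling (2 powr (\<theta> - 1) * 3) psi"
        unfolding psi_def using \<theta> bnn by (intro doubling_mult doubling_rho doubling_bump[OF a]) auto
      moreover have "2 powr (\<theta> - 1) * 3 \<le> Dd"
      proof -
        have "2 powr (\<theta> - 1) \<le> 2 powr \<theta>" by simp
        then show ?thesis using Dd3 by linarith
      qed
      ultimately show ?thesis by (rule doubling_mono) (rule nn)
    qed
    have dphi: "doubling Dd phi"
      unfolding phi_def by (intro doubling_add doubling_cmult dpsi dP a)
    have SaP: "(\<Sum>i\<le>m. a * P i) \<le> 6" for m
      unfolding P_def by (rule sum_bump_power(2)[OF a N])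
    have SP: "(\<Sum>i\<le>m. P i) \<le> 3 * ((real m + 1) * bump a m)" for m
      unfolding P_def by (rule sum_bump_power(1)[OF a N])
    have Spsi: "(\<Sum>i\<le>m. psi i) \<le> Z" for m
      by (rule order_trans[OF sum_mono[OF psi1] Z(2)])
    have Sphi: "(\<Sum>i\<le>m. phi i) \<le> Z + 6" for m
      unfolding phi_def sum.distrib using Spsi SaP by (intro add_mono)
    have rpsi: "rho \<theta> j * ((real j + 1) * bump a j) = psi j" for j
      using rho_Suc_mult[of \<theta> j] by (simp add: psi_def mult.assoc[symmetric])
    have U: "\<bar>U $$ i\<bar> \<le> CN * P i" for i
      unfolding U_def P_def using geo by (simp add: power_abs)

    have "\<forall>m\<le>n. \<bar>Y $$ m\<bar> \<le> K * s * phi m"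
      unfolding Y_def U_def phi_def psi_def P_def
      using Kbd[of a s n X0 X] a s geo bds by blast
    then have Y: "\<bar>Y $$ j\<bar> \<le> (K * s) * phi j" if "j \<le> n" for j using that by simp
    have conv: "(\<Sum>i\<le>m. phi i * phi (m - i)) \<le> c * phi m" for m
    proof -
      have "(\<Sum>i\<le>m. phi i * phi (m - i)) \<le> Dd * phi m * (\<Sum>i\<le>m. phi i) + Dd * phi m * (\<Sum>i\<le>m. phi i)"
        by (intro convolution_doubling dphi phinn) (use pos in auto)
      also have "\<dots> \<le> Dd * phi m * (Z + 6) + Dd * phi m * (Z + 6)"
        by (intro add_mono mult_left_mono Sphi mult_nonneg_nonneg phinn) (use pos in auto)
      finally show ?thesis by (simp add: c_def algebra_simps)
    qed
    have sc: "2 * (K * s) * c \<le> 1"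
    proof -
      have "s * (2 * K * c) \<le> s0 * (2 * K * c)" using s K c by (intro mult_right_mono) auto
      also have "\<dots> = 1" unfolding s0_def using K c by simp
      finally show ?thesis by (simp add: mult_ac)
    qed
    define y where "y = inverse (1 - Y) - 1"
    have Y0: "Y $$ 0 = 0" by (simp add: Y_def X0)
    have y: "\<bar>y $$ j\<bar> \<le> (1 / c) * phi j" if j: "j \<le> n" for j
    proof -
      have "\<bar>y $$ j\<bar> \<le> 2 * (K * s) * phi j"
        unfolding y_def
        by (rule inverse_one_minus_bound[OF Y0 Y conv _ phinn sc j]) (use K s in simp_all)
      also have "\<dots> \<le> (1 / c) * phi j"
        using sc c by (intro mult_right_mono phinn) (simp add: field_simps)
      finally show ?thesis .
    qed
    define Q where "Q = U * (1 + E)"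
    have Qb: "\<bar>Q $$ j\<bar> \<le> K1 * (P j + psi j)" if j: "j \<le> n" for j
    proof -
      have "\<bar>(U * E) $$ j\<bar> \<le> CN * 1 * Dd * (P j * Z + rho \<theta> j * (3 * ((real j + 1) * bump a j)))"
      proof (rule fps_mult_bound_doubling)
        show "\<bar>E $$ i\<bar> \<le> 1 * rho \<theta> i" if "i \<le> j" for i using bds j that by auto
        have "(\<Sum>i\<le>j. rho \<theta> i) \<le> (\<Sum>i\<le>j. rho (\<theta> - 1) i)" by (intro sum_mono rho_antimono) auto
        then show "(\<Sum>i\<le>j. rho \<theta> i) \<le> Z" using Z(2)[of j] by linarith
      qed (use U dP dr nn pos SP in auto)
      also have "\<dots> = CN * Dd * (P j * Z + psi j * 3)"
        unfolding rpsi[symmetric] by (simp add: algebra_simps)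
      also have "\<dots> \<le> CN * Dd * (P j * (Z + 3) + psi j * (Z + 3))"
        by (intro mult_left_mono add_mono) (use nn pos in auto)
      finally have "\<bar>(U * E) $$ j\<bar> \<le> CN * Dd * (Z + 3) * (P j + psi j)" by (simp add: algebra_simps)
      moreover have "\<bar>Q $$ j\<bar> \<le> \<bar>U $$ j\<bar> + \<bar>(U * E) $$ j\<bar>" by (simp add: Q_def distrib_left)
      moreover have "0 \<le> CN * psi j" using pos nn by simp
      ultimately show ?thesis using U[of j] by (simp add: K1_def algebra_simps)
    qed
    have Feq: "F = Q + y * Q"
    proof -
      define V where "V = 1 - fps_const (1 - a) * fps_X"
      define I where "I = inverse (1 - Y)"
      have UV: "U * V = 1" unfolding U_def V_def by (rule geometric_fps)
      have I: "(1 - Y) * I = 1" unfolding I_def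
        using inverse_mult_eq_1'[of "1 - Y"] Y0 by simp
      have "V * Y = (U * V) * X" unfolding Y_def by (simp only: mult_ac)
      then have VY: "V * (1 - Y) = V - X" by (simp add: UV right_diff_distrib)
      have "F = F * (U * V) * ((1 - Y) * I)" by (simp only: UV I mult_1_right)
      also have "\<dots> = (F * (V * (1 - Y))) * U * I" by (simp only: mult_ac)
      also have "F * (V * (1 - Y)) = 1 + E" unfolding VY unfolding V_def by (rule F)
      finally have "F = (1 + E) * U * I" .
      moreover have "I = 1 + y" by (simp add: y_def I_def)
      ultimately show ?thesis unfolding Q_def by (simp add: algebra_simps)
    qed
    \<comment> \<open>Q is not summable uniformly in a: its partial sums grow like (m + 1)
      \<open>bump\<close>, and this is the factor that multiplies phi.\<close>
    have yQ: "\<bar>(y * Q) $$ m\<bar> \<le> (1 / c) * K1 * Dd * (phi m * ((3 + 2 * Z) * ((real m + 1) * bump a m)) + (P m + psi m) * (Z + 6))"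
    proof (rule fps_mult_bound_doubling)
      show "\<bar>y $$ i\<bar> \<le> (1 / c) * phi i" "\<bar>Q $$ i\<bar> \<le> K1 * (P i + psi i)" if "i \<le> m" for i
        using that m y Qb by auto
      show "doubling Dd (\<lambda>i. P i + psi i)" by (intro doubling_add dP dpsi)
      have "Z * 1 \<le> Z * (2 * ((real m + 1) * bump a m))"
        using pos by (intro mult_left_mono Suc_bump_ge[OF a]) auto
      then show "(\<Sum>i\<le>m. P i + psi i) \<le> (3 + 2 * Z) * ((real m + 1) * bump a m)"
        unfolding sum.distrib using SP[of m] Spsi[of m] by (simp add: algebra_simps)
    qed (use dphi phinn nn pos c K1 Sphi in \<open>auto intro: less_imp_le\<close>)
    define W where "W = rho (\<theta> - 2) m * (bump a m)\<^sup>2"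
    have W0: "W \<ge> 0" unfolding W_def by simp
    have psiW: "psi m * ((real m + 1) * bump a m) = W"
      using rho_Suc_mult[of "\<theta> - 1" m] unfolding W_def psi_def by (simp add: power2_eq_square mult_ac)
    have psi2W: "psi m \<le> 2 * W"
      using mult_left_mono[OF Suc_bump_ge[OF a] nn(2), of m m] psiW by simp
    have phiW: "phi m * ((real m + 1) * bump a m) \<le> 2 * P m + W"
      using mult_left_mono[OF Suc_bump_le[OF a] nn(1), of m m] psiW by (simp add: phi_def algebra_simps)
    have e1: "P m + psi m \<le> 3 * (P m + W)" "2 * P m + W \<le> 3 * (P m + W)"
      using psi2W W0 nn(1)[of m] unfolding distrib_left by linarith+
    have "\<bar>F $$ m\<bar> \<le> \<bar>Q $$ m\<bar> + \<bar>(y * Q) $$ m\<bar>" by (simp add: Feq)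
    also have "\<dots> \<le> K1 * (P m + psi m) + (1 / c) * K1 * Dd * (phi m * ((3 + 2 * Z) * ((real m + 1) * bump a m)) + (P m + psi m) * (Z + 6))"
      by (intro add_mono Qb yQ m)
    also have "\<dots> = K1 * (P m + psi m) + (1 / c) * K1 * Dd * ((3 + 2 * Z) * (phi m * ((real m + 1) * bump a m)) + (Z + 6) * (P m + psi m))"
      by (simp add: mult_ac)
    also have "\<dots> \<le> K1 * (3 * (P m + W)) + (1 / c) * K1 * Dd * ((3 + 2 * Z) * (3 * (P m + W)) + (Z + 6) * (3 * (P m + W)))"
      by (intro add_mono mult_left_mono e1 order_trans[OF phiW e1(2)]) (use K1 c pos in auto)
    also have "\<dots> = 3 * K2 * (P m + W)" by (simp add: K2_def algebra_simps add_divide_distrib)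
    finally show "\<bar>F $$ m\<bar> \<le> 3 * K2 * (bump a m ^ N + rho (\<theta> - 2) m * (bump a m)\<^sup>2)"
      by (simp add: P_def W_def)
  qed
qed

section \<open>Bounds in the weighted convolution algebra\<close>

text \<open>Mean value theorem for the power 1 - q. Besides tail sums, the case q = \<theta> serves
  the critical point, where it shows that one further order of g fits between two successive
  tolerances.\<close>

lemma rho_telescope:
  assumes q: "q > 1"
  shows "(q - 1) * rho q (Suc j) \<le> rho (q - 1) j - rho (q - 1) (Suc j)"
proof -
  define f where "f x = x powr (1 - q)" for x :: real
  obtain z where z: "z > 1 + real j" "z < 2 + real j"
    and fz: "f (2 + real j) - f (1 + real j) = (2 + real j - (1 + real j)) * ((1 - q) * z powr (1 - q - 1))"
  proof -
    have "\<exists>z>1 + real j. z < 2 + real j \<and> f (2 + real j) - f (1 + real j)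
        = (2 + real j - (1 + real j)) * ((1 - q) * z powr (1 - q - 1))"
    proof (rule MVT2)
      fix x assume "1 + real j \<le> x"
      then show "(f has_real_derivative (1 - q) * x powr (1 - q - 1)) (at x)"
        unfolding f_def[abs_def] by (intro has_real_derivative_powr) simp
    qed simp
    then show ?thesis using that by blast
  qed
  have "rho (q - 1) j - rho (q - 1) (Suc j) = (q - 1) * z powr (- q)"
    using fz by (simp add: rho_def f_def algebra_simps)
  moreover have "rho q (Suc j) \<le> z powr (- q)"
    unfolding rho_def using z q by (intro powr_mono2') auto
  ultimately show ?thesis using q by simp
qed

lemma sum_rho_tail:
  assumes q: "q > 1"
  shows "(\<Sum>j\<in>{n<..m}. rho q j) \<le> rho (q - 1) n / (q - 1)"
proof -
  have "(q - 1) * (\<Sum>j\<in>{n<..m}. rho q j) \<le> rho (q - 1) n"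
  proof (cases "n \<le> m")
    case True
    have "(q - 1) * (\<Sum>j\<in>{n<..m}. rho q j) \<le> rho (q - 1) n - rho (q - 1) m"
      using True
    proof (induction m rule: dec_induct)
      case (step m)
      have e: "{n<..Suc m} = insert (Suc m) {n<..m}" using step.hyps by auto
      have "(q - 1) * (\<Sum>j\<in>{n<..Suc m}. rho q j)
          = (q - 1) * rho q (Suc m) + (q - 1) * (\<Sum>j\<in>{n<..m}. rho q j)"
        unfolding e by (subst sum.insert) (auto simp: distrib_left)
      then show ?case using step.IH rho_telescope[OF q, of m] by linarith
    qed simp
    then show ?thesis using rho_nonneg[of "q - 1" m] by linarith
  qed simp
  then show ?thesis using q by (simp add: field_simps)
qed

lemma suminf_rho_tail:
  fixes b :: "nat \<Rightarrow> real"
  assumes q: "q > 1" and b: "\<And>j. n < j \<Longrightarrow> \<bar>b j\<bar> \<le> s * rho q j" and s: "s \<ge> 0"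
  shows "summable b" and "\<bar>suminf b - (\<Sum>j\<le>n. b j)\<bar> \<le> s / (q - 1) * rho (q - 1) n"
proof -
  show sm: "summable b"
  proof (rule summable_comparison_test)
    show "\<exists>N. \<forall>j\<ge>N. norm (b j) \<le> s * rho q j" using b by (intro exI[of _ "Suc n"]) auto
    show "summable (\<lambda>j. s * rho q j)" by (intro summable_mult summable_rho q)
  qed
  have "(\<lambda>m. \<bar>(\<Sum>j\<le>m. b j) - (\<Sum>j\<le>n. b j)\<bar>) \<longlonglongrightarrow> \<bar>suminf b - (\<Sum>j\<le>n. b j)\<bar>"
    using summable_LIMSEQ'[OF sm] by (intro tendsto_intros)
  then show "\<bar>suminf b - (\<Sum>j\<le>n. b j)\<bar> \<le> s / (q - 1) * rho (q - 1) n"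
  proof (rule LIMSEQ_le_const2, intro exI[of _ n] allI impI)
    fix m assume m: "n \<le> m"
    have "{..m} = {..n} \<union> {n<..m}" using m by auto
    then have "(\<Sum>j\<le>m. b j) - (\<Sum>j\<le>n. b j) = (\<Sum>j\<in>{n<..m}. b j)"
      by (simp add: sum.union_disjoint ivl_disj_int)
    also have "\<bar>\<dots>\<bar> \<le> (\<Sum>j\<in>{n<..m}. s * rho q j)"
      by (rule order_trans[OF sum_abs sum_mono]) (use b in auto)
    also have "\<dots> = s * (\<Sum>j\<in>{n<..m}. rho q j)" by (simp add: sum_distrib_left)
    also have "\<dots> \<le> s * (rho (q - 1) n / (q - 1))" by (intro mult_left_mono sum_rho_tail q s)
    finally show "\<bar>(\<Sum>j\<le>m. b j) - (\<Sum>j\<le>n. b j)\<bar> \<le> s / (q - 1) * rho (q - 1) n" by simp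
  qed
qed

text \<open>The divergent counterpart of the tail bound: errors of order j^(-\<delta>) at each step
  add up to n^(1 - \<delta>).\<close>

lemma sum_rho_below_one:
  assumes d: "0 \<le> d" "d < 1"
  shows "(\<Sum>j\<le>n. rho d j) \<le> 1 / (1 - d) * rho (d - 1) n"
proof (induction n)
  case 0
  then show ?case using d by (simp add: field_simps)
next
  case (Suc n)
  define f where "f x = x powr (1 - d)" for x :: real
  have "\<exists>z>1 + real n. z < 2 + real n \<and> f (2 + real n) - f (1 + real n)
      = (2 + real n - (1 + real n)) * ((1 - d) * z powr (1 - d - 1))"
  proof (rule MVT2)
    fix x assume "1 + real n \<le> x"
    then show "(f has_real_derivative (1 - d) * x powr (1 - d - 1)) (at x)"
      unfolding f_def[abs_def] by (intro has_real_derivative_powr) simp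
  qed simp
  then obtain z where z: "z > 1 + real n" "z < 2 + real n"
    and fz: "f (2 + real n) - f (1 + real n) = (2 + real n - (1 + real n)) * ((1 - d) * z powr (1 - d - 1))"
    by blast
  have "rho (d - 1) (Suc n) - rho (d - 1) n = (1 - d) * z powr (- d)"
    using fz by (simp add: rho_def f_def algebra_simps)
  moreover have "rho d (Suc n) \<le> z powr (- d)"
    unfolding rho_def using z d by (intro powr_mono2') auto
  ultimately have "(1 - d) * rho d (Suc n) \<le> rho (d - 1) (Suc n) - rho (d - 1) n"
    using d by simp
  then have "rho d (Suc n) \<le> (rho (d - 1) (Suc n) - rho (d - 1) n) / (1 - d)"
    using d by (simp add: pos_le_divide_eq mult.commute)
  then have "rho d (Suc n) \<le> 1 / (1 - d) * rho (d - 1) (Suc n) - 1 / (1 - d) * rho (d - 1) n"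
    by (simp add: diff_divide_distrib)
  with Suc show ?case by simp
qed

definition rho_conv_const :: "real \<Rightarrow> real" where
  "rho_conv_const q = 2 * 2 powr q * suminf (rho q)"

lemma rho_conv:
  assumes q: "q > 1"
  shows "(\<Sum>i\<le>m. rho q i * rho q (m - i)) \<le> rho_conv_const q * rho q m"
proof -
  have "(\<Sum>i\<le>m. rho q i * rho q (m - i)) \<le> 2 powr q * rho q m * (\<Sum>i\<le>m. rho q i) + 2 powr q * rho q m * (\<Sum>i\<le>m. rho q i)"
    by (intro convolution_doubling doubling_rho) (use q in auto)
  also have "\<dots> \<le> 2 powr q * rho q m * suminf (rho q) + 2 powr q * rho q m * suminf (rho q)"
    by (intro add_mono mult_left_mono sum_rho_le q) auto
  finally show ?thesis by (simp add: rho_conv_const_def algebra_simps)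
qed

lemma rho_conv_const_pos: "q > 1 \<Longrightarrow> rho_conv_const q \<ge> 2"
proof -
  assume q: "q > 1"
  have "1 * 1 \<le> 2 powr q * suminf (rho q)"
    using suminf_rho_ge_1[OF q] ge_one_powr_ge_zero[of 2 q] q by (intro mult_mono) auto
  then show ?thesis by (simp add: rho_conv_const_def)
qed

lemma inverse_rho_bound:
  fixes H :: "real fps"
  assumes q: "q > 1" and H0: "H $$ 0 = 1" and H: "\<And>m. m \<le> n \<Longrightarrow> \<bar>(H - 1) $$ m\<bar> \<le> s * rho q m"
    and s: "0 \<le> s" "2 * s * rho_conv_const q \<le> 1" and m: "m \<le> n"
  shows "\<bar>(inverse H - 1) $$ m\<bar> \<le> 2 * s * rho q m"
proof -
  have "\<bar>(inverse (1 - (1 - H)) - 1) $$ m\<bar> \<le> 2 * s * rho q m"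
  proof (rule inverse_one_minus_bound[OF _ _ rho_conv[OF q] s(1) _ s(2) m])
    show "\<bar>(1 - H) $$ i\<bar> \<le> s * rho q i" if "i \<le> n" for i
      using H[OF that] by (simp add: abs_minus_commute)
  qed (use H0 in auto)
  then show ?thesis by simp
qed

text \<open>Coefficients of a product up to order n involve only coefficients up to n, so this
  truncation is still submultiplicative. It serves part (a), where the modulated series are
  controlled only up to order n.\<close>

definition l1_upto :: "nat \<Rightarrow> real fps \<Rightarrow> real" where
  "l1_upto n x = (\<Sum>i\<le>n. \<bar>x $$ i\<bar>)"

lemma l1_upto_nonneg: "l1_upto n x \<ge> 0"
  by (simp add: l1_upto_def sum_nonneg)

lemma l1_upto_add: "l1_upto n (x + y) \<le> l1_upto n x + l1_upto n y"
  unfolding l1_upto_def sum.distrib[symmetric] by (intro sum_mono) auto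

lemma l1_upto_mult: "l1_upto n (x * y) \<le> l1_upto n x * l1_upto n y"
proof -
  have "l1_upto n (x * y) \<le> (\<Sum>k\<le>n. \<Sum>i\<le>k. \<bar>x $$ i\<bar> * \<bar>y $$ (k - i)\<bar>)"
    unfolding l1_upto_def fps_mult_nth atLeast0AtMost
    by (intro sum_mono order_trans[OF sum_abs]) (auto simp: abs_mult)
  also have "\<dots> = (\<Sum>(i, j) \<in> {(i, j). i + j \<le> n}. \<bar>x $$ i\<bar> * \<bar>y $$ j\<bar>)"
    by (rule sum.triangle_reindex_eq[symmetric])
  also have "\<dots> \<le> (\<Sum>(i, j) \<in> {..n} \<times> {..n}. \<bar>x $$ i\<bar> * \<bar>y $$ j\<bar>)"
    by (intro sum_mono2) auto
  also have "\<dots> = l1_upto n x * l1_upto n y"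
    by (simp add: l1_upto_def sum_product sum.cartesian_product)
  finally show ?thesis .
qed

text \<open>From 1/H = 1 - (H - 1)/H the norm of 1/H is at most 1 plus half of itself; it is finite
  by truncation, so this half can be absorbed.\<close>

lemma l1_upto_inverse:
  assumes H0: "H $$ 0 = 1" and H: "l1_upto n (H - 1) \<le> 1 / 2"
  shows "l1_upto n (inverse H) \<le> 2"
proof -
  have "H * inverse H = 1" using inverse_mult_eq_1'[of H] H0 by simp
  then have "inverse H = 1 + (- (H - 1)) * inverse H" by (simp add: algebra_simps)
  then have "l1_upto n (inverse H) \<le> l1_upto n 1 + l1_upto n ((- (H - 1)) * inverse H)"
    by (metis l1_upto_add)
  also have "l1_upto n 1 = 1" by (simp add: l1_upto_def if_distrib[of abs] sum.delta cong: if_cong)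
  also have "l1_upto n ((- (H - 1)) * inverse H) \<le> l1_upto n (- (H - 1)) * l1_upto n (inverse H)"
    by (rule l1_upto_mult)
  also have "l1_upto n (- (H - 1)) = l1_upto n (H - 1)"
    unfolding l1_upto_def by (intro sum.cong) (auto simp: abs_minus_commute)
  also have "l1_upto n (H - 1) * l1_upto n (inverse H) \<le> 1 / 2 * l1_upto n (inverse H)"
    by (intro mult_right_mono H l1_upto_nonneg)
  finally show ?thesis by simp
qed

lemma partial_sums_eq:
  fixes T V :: "real fps"
  assumes "T * (1 - fps_X) = V"
  shows "T $$ m = (\<Sum>j\<le>m. V $$ j)"
proof -
  have "(1 - fps_X) * T = (1 - fps_X) * Abs_fps (\<lambda>m. \<Sum>i\<le>m. V $$ i)"
    using assms partial_sums_fps[of V] by (simp add: mult.commute)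
  moreover have "(1 - fps_X :: real fps) \<noteq> 0"
    by (auto simp: fps_eq_iff intro!: exI[of _ 0])
  ultimately have "T = Abs_fps (\<lambda>m. \<Sum>i\<le>m. V $$ i)" by simp
  then show ?thesis by simp
qed

text \<open>The factor H in 1 - G = (1 - fps_X) H. If G sums to 1, its coefficients are the tails of
  G and its sum is the first moment of G.\<close>

definition tail_fps :: "real fps \<Rightarrow> real fps" where
  "tail_fps G = Abs_fps (\<lambda>m. 1 - (\<Sum>i\<le>m. G $$ i))"

lemma tail_fps: "(1 - fps_X) * tail_fps G = 1 - G"
proof (rule fps_ext)
  fix n show "((1 - fps_X) * tail_fps G) $$ n = (1 - G) $$ n"
    by (cases n) (auto simp: left_diff_distrib tail_fps_def)
qed

text \<open>Cancelling 1 - fps_X shows that the increments of T are (Gam F + E2) / H, which is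
  bounded; hence linear growth. This crude version is the one used inside the induction, where only
  orders up to n are known and no limit is available. The alternative m = 0 is there because the
  tail of order 0 is 1 and not small.\<close>

lemma laplacian_growth_bound:
  fixes G F T Gam E2 :: "real fps"
  assumes \<theta>: "\<theta> > 2" and s: "0 \<le> s" "2 * s * rho_conv_const (\<theta> - 1) \<le> 1"
    and G0: "G $$ 0 = 0" and G: "\<And>m. m \<le> n \<Longrightarrow> \<bar>1 - (\<Sum>i\<le>m. G $$ i)\<bar> \<le> s * rho (\<theta> - 1) m \<or> m = 0"
    and T: "T * (1 - G) = Gam * F + E2"
    and Gam: "\<And>m. m \<le> n \<Longrightarrow> \<bar>Gam $$ m\<bar> \<le> cg * rho (\<theta> - 1) m"
    and F: "\<And>m. m \<le> n \<Longrightarrow> \<bar>F $$ m\<bar> \<le> cf"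
    and E2: "\<And>m. m \<le> n \<Longrightarrow> \<bar>E2 $$ m\<bar> \<le> ce" and m: "m \<le> n" and c: "cg \<ge> 0" "cf \<ge> 0" "ce \<ge> 0"
  shows "\<bar>T $$ m\<bar> \<le> (real m + 1) * (2 * suminf (rho (\<theta> - 1)) * (cg * cf * suminf (rho (\<theta> - 1)) + ce))"
proof -
  define Z where "Z = suminf (rho (\<theta> - 1))"
  have Z: "Z \<ge> 1" "(\<Sum>m\<le>n. rho (\<theta> - 1) m) \<le> Z" for n
    unfolding Z_def using \<theta> by (auto intro: suminf_rho_ge_1 sum_rho_le)
  define H where "H = tail_fps G"
  define I where "I = inverse H"
  define V where "V = I * (Gam * F + E2)"
  define M where "M = cg * cf * Z + ce"
  have M0: "M \<ge> 0" using c Z by (simp add: M_def)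
  have H0: "H $$ 0 = 1" by (simp add: H_def tail_fps_def G0)
  have HI: "H * I = 1" unfolding I_def using inverse_mult_eq_1'[of H] H0 by simp
  have "T * (1 - fps_X) = T * (1 - fps_X) * (H * I)" by (simp only: HI mult_1_right)
  also have "\<dots> = T * ((1 - fps_X) * H) * I" by (simp only: mult_ac)
  also have "\<dots> = V" unfolding H_def tail_fps T V_def by (simp only: mult_ac)
  finally have TV: "T $$ m = (\<Sum>j\<le>m. V $$ j)" for m by (rule partial_sums_eq)
  have I: "\<bar>(I - 1) $$ j\<bar> \<le> 2 * s * rho (\<theta> - 1) j" if "j \<le> n" for j
    unfolding I_def
  proof (rule inverse_rho_bound[OF _ H0 _ s that])
    show "\<bar>(H - 1) $$ i\<bar> \<le> s * rho (\<theta> - 1) i" if "i \<le> n" for i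
      using G[OF that] s(1) G0 by (cases i) (auto simp: H_def tail_fps_def)
  qed (use \<theta> in auto)
  have s1: "4 * s \<le> 1" using s mult_left_mono[OF rho_conv_const_pos[of "\<theta> - 1"], of s] \<theta> by simp
  have I': "\<bar>I $$ j\<bar> \<le> 2 * rho (\<theta> - 1) j" if "j \<le> n" for j
  proof (cases j)
    case 0
    then show ?thesis by (simp add: I_def H0)
  next
    case (Suc i)
    have "\<bar>I $$ j\<bar> \<le> 2 * s * rho (\<theta> - 1) j" using I[OF that] Suc by simp
    also have "\<dots> \<le> 2 * rho (\<theta> - 1) j" using s1 s by (intro mult_right_mono) auto
    finally show ?thesis .
  qed
  have W: "\<bar>(Gam * F + E2) $$ j\<bar> \<le> M" if j: "j \<le> n" for j
  proof -
    have "\<bar>(Gam * F) $$ j\<bar> \<le> (\<Sum>i\<le>j. cg * rho (\<theta> - 1) i * cf)"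
      by (rule fps_mult_bound) (use Gam F j in auto)
    also have "\<dots> = cg * cf * (\<Sum>i\<le>j. rho (\<theta> - 1) i)" by (simp add: sum_distrib_left mult_ac)
    also have "\<dots> \<le> cg * cf * Z" by (intro mult_left_mono Z) (use c in auto)
    finally show ?thesis using E2[OF j] by (simp add: M_def abs_le_iff)
  qed
  have V: "\<bar>V $$ j\<bar> \<le> 2 * Z * M" if j: "j \<le> n" for j
  proof -
    have "\<bar>V $$ j\<bar> \<le> (\<Sum>i\<le>j. (2 * rho (\<theta> - 1) i) * M)"
      unfolding V_def by (rule fps_mult_bound) (use I' W j in auto)
    also have "\<dots> = 2 * M * (\<Sum>i\<le>j. rho (\<theta> - 1) i)" by (simp add: sum_distrib_left mult_ac)
    also have "\<dots> \<le> 2 * M * Z" by (intro mult_left_mono Z) (use M0 in auto)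
    finally show ?thesis by (simp add: mult_ac)
  qed
  have "\<bar>T $$ m\<bar> \<le> (\<Sum>j\<le>m. 2 * Z * M)"
    unfolding TV by (rule order_trans[OF sum_abs sum_mono]) (use V m in auto)
  also have "\<dots> = (real m + 1) * (2 * Z * M)" by (simp add: add.commute)
  finally show ?thesis by (simp add: Z_def M_def)
qed

section \<open>The recursion at zero momentum\<close>

text \<open>\<open>T\<close>, \<open>Gam\<close>, \<open>E2\<close> stand for the Laplacians of
  \<open>f\<close>, \<open>g\<close>, \<open>e\<close>, and \<open>t\<close> for \<open>\<sigma>\<^sup>2\<close>.\<close>

locale zero_mode =
  fixes \<theta> s t :: real and G E F T Gam E2 :: "real fps"
  assumes \<theta>: "\<theta> > 2" and s: "0 \<le> s" "2 * s * rho_conv_const (\<theta> - 1) \<le> 1" and t: "t > 0"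
    and G0: "G $$ 0 = 0" and G_tail: "\<And>m. m \<ge> 1 \<Longrightarrow> \<bar>1 - (\<Sum>i\<le>m. G $$ i)\<bar> \<le> s * rho (\<theta> - 1) m"
    and E0: "E $$ 0 = 0" and E: "\<And>m. \<bar>E $$ m\<bar> \<le> s * rho (\<theta> - 1) m"
    and F: "F * (1 - G) = 1 + E"
    and Gam0: "Gam $$ 0 = 0" and Gam1: "\<bar>Gam $$ 1 + t\<bar> \<le> s * t"
    and Gam: "\<And>m. m \<ge> 2 \<Longrightarrow> \<bar>Gam $$ m\<bar> \<le> s * t * rho (\<theta> - 1) m"
    and E20: "E2 $$ 0 = 0" and E2: "\<And>m. \<bar>E2 $$ m\<bar> \<le> s * t * rho (\<theta> - 1) m"
    and T: "T * (1 - G) = Gam * F + E2"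
begin

definition "q = \<theta> - 1"
definition "Z = suminf (rho q)"
definition "H = tail_fps G"
definition "I = inverse H"
text \<open>The increments of F, that is F (1 - fps_X), so that F converges to the sum of B.\<close>

definition "B = (1 + E) * I"
text \<open>The sum of the tails of G, absolutely convergent by the tail bound. Summation by parts
  identifies it with the first moment of G in \<open>mean_sums\<close>.\<close>

definition "mean = suminf (fps_nth H)"
definition "A = (1 + suminf (fps_nth E)) / mean"
definition "v = - suminf (fps_nth Gam) / (t * mean)"
definition "P = 2 powr q"

lemma q: "q > 1" using \<theta> by (simp add: q_def)

lemma Z: "Z \<ge> 1" "(\<Sum>m\<le>n. rho q m) \<le> Z"
  unfolding Z_def using q by (auto intro: suminf_rho_ge_1 sum_rho_le)

lemma P: "P \<ge> 2"
  unfolding P_def using q powr_mono[of 1 q 2] by simp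

lemma s4: "4 * (s * (P * Z)) \<le> 1"
  using s by (simp add: rho_conv_const_def q_def Z_def P_def mult_ac)

lemma s8: "8 * (s * Z) \<le> 1"
proof -
  have "s * (2 * Z) \<le> s * (P * Z)" using P Z s by (intro mult_left_mono mult_right_mono) auto
  then show ?thesis using s4 by simp
qed

lemma s1: "8 * s \<le> 1"
  using s8 mult_left_mono[OF Z(1) s(1)] by simp

lemma suminf_bound:
  fixes x :: "nat \<Rightarrow> real"
  assumes "\<And>m. \<bar>x m\<bar> \<le> c * rho q m" "c \<ge> 0"
  shows "summable x" "summable (\<lambda>m. \<bar>x m\<bar>)" "\<bar>suminf x\<bar> \<le> c * Z" "(\<Sum>m\<le>n. \<bar>x m\<bar>) \<le> c * Z"
proof -
  have sr: "summable (\<lambda>m. c * rho q m)" by (intro summable_mult summable_rho q)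
  show sa: "summable (\<lambda>m. \<bar>x m\<bar>)"
    by (rule summable_comparison_test'[OF sr]) (use assms in auto)
  then show "summable x" by (rule summable_rabs_cancel)
  have "\<bar>suminf x\<bar> \<le> (\<Sum>m. \<bar>x m\<bar>)" by (rule summable_rabs[OF sa])
  also have "\<dots> \<le> (\<Sum>m. c * rho q m)" by (intro suminf_le assms sa sr)
  also have "\<dots> = c * Z" unfolding Z_def by (intro suminf_mult summable_rho q)
  finally show "\<bar>suminf x\<bar> \<le> c * Z" .
  have "(\<Sum>m\<le>n. \<bar>x m\<bar>) \<le> (\<Sum>m\<le>n. c * rho q m)" by (intro sum_mono assms)
  also have "\<dots> = c * (\<Sum>m\<le>n. rho q m)" by (simp add: sum_distrib_left)
  also have "\<dots> \<le> c * Z" by (intro mult_left_mono Z assms)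
  finally show "(\<Sum>m\<le>n. \<bar>x m\<bar>) \<le> c * Z" .
qed

lemma H0: "H $$ 0 = 1" by (simp add: H_def tail_fps_def G0)

lemma Hm: "\<bar>(H - 1) $$ m\<bar> \<le> s * rho q m"
  using G_tail[of m] s(1) by (cases m) (auto simp: H_def tail_fps_def q_def G0)

lemma Im: "\<bar>(I - 1) $$ m\<bar> \<le> 2 * s * rho q m"
  unfolding I_def by (rule inverse_rho_bound[OF q H0 Hm s(1) _ order_refl]) (use s in \<open>simp add: q_def\<close>)

lemma HI: "H * I = 1"
  unfolding I_def using inverse_mult_eq_1'[of H] H0 by simp

lemma plus_one_bound:
  assumes "\<And>m. \<bar>x $$ m\<bar> \<le> c * rho q m" "c \<ge> 0"
  shows "\<bar>(1 + x) $$ m\<bar> \<le> (1 + c) * rho q m"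
proof -
  have "\<bar>(1 :: real fps) $$ m\<bar> \<le> rho q m" by (cases m) auto
  moreover have "\<bar>(1 + x) $$ m\<bar> \<le> \<bar>(1 :: real fps) $$ m\<bar> + \<bar>x $$ m\<bar>"
    unfolding fps_add_nth by (rule abs_triangle_ineq)
  ultimately show ?thesis using assms(1)[of m] unfolding distrib_right by linarith
qed

lemma summable_plus_one:
  assumes "\<And>m. \<bar>x $$ m\<bar> \<le> c * rho q m" "c \<ge> 0"
  shows "summable (\<lambda>m. \<bar>(1 + x) $$ m\<bar>)" "suminf (fps_nth (1 + x)) = 1 + suminf (fps_nth x)"
proof -
  show "summable (\<lambda>m. \<bar>(1 + x) $$ m\<bar>)"
    by (rule suminf_bound(2)[OF plus_one_bound[OF assms]]) (use assms in auto)
  have "(\<lambda>m. (1 :: real fps) $$ m) sums 1"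
    using sums_single[of 0 "\<lambda>_. 1 :: real"] by simp
  moreover have "summable (fps_nth x)" by (rule suminf_bound(1)[OF assms])
  ultimately have "(\<lambda>m. (1 :: real fps) $$ m + x $$ m) sums (1 + suminf (fps_nth x))"
    by (intro sums_add summable_sums)
  moreover have "fps_nth (1 + x) = (\<lambda>m. (1 :: real fps) $$ m + x $$ m)"
    by (rule ext) (rule fps_add_nth)
  ultimately have "fps_nth (1 + x) sums (1 + suminf (fps_nth x))" by (simp only:)
  then show "suminf (fps_nth (1 + x)) = 1 + suminf (fps_nth x)" by (rule sums_unique[symmetric])
qed

lemma suminf_fps_mult:
  fixes x y :: "real fps"
  assumes "summable (\<lambda>m. \<bar>x $$ m\<bar>)" "summable (\<lambda>m. \<bar>y $$ m\<bar>)"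
  shows "suminf (fps_nth (x * y)) = suminf (fps_nth x) * suminf (fps_nth y)"
proof -
  have e: "fps_nth (x * y) = (\<lambda>k. \<Sum>i\<le>k. x $$ i * y $$ (k - i))"
    by (rule ext) (simp add: fps_mult_nth atLeast0AtMost)
  show ?thesis
    unfolding e by (rule Cauchy_product[symmetric]) (use assms in simp_all)
qed

lemma H_sums: "summable (\<lambda>m. \<bar>H $$ m\<bar>)" "\<bar>mean - 1\<bar> \<le> s * Z"
proof -
  have e: "1 + (H - 1) = H" by simp
  show "summable (\<lambda>m. \<bar>H $$ m\<bar>)" using summable_plus_one(1)[OF Hm s(1)] unfolding e .
  have "mean = 1 + suminf (fps_nth (H - 1))"
    using summable_plus_one(2)[OF Hm s(1)] unfolding e mean_def .
  then show "\<bar>mean - 1\<bar> \<le> s * Z"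
    using suminf_bound(3)[of "fps_nth (H - 1)", OF Hm s(1)] by linarith
qed

lemma mean: "7 / 8 \<le> mean" "mean \<le> 9 / 8"
  using H_sums(2) s8 by linarith+

lemma I_sums: "summable (\<lambda>m. \<bar>I $$ m\<bar>)" "suminf (fps_nth I) = 1 / mean"
proof -
  show *: "summable (\<lambda>m. \<bar>I $$ m\<bar>)" using summable_plus_one(1)[OF Im] s by simp
  have "suminf (fps_nth (H * I)) = mean * suminf (fps_nth I)"
    unfolding mean_def by (rule suminf_fps_mult[OF H_sums(1) *])
  moreover have "suminf (fps_nth (1 :: real fps)) = 1"
  proof -
    have e: "fps_nth (1 :: real fps) = (\<lambda>m. if m = 0 then 1 else 0)"
      by (rule ext) simp
    show ?thesis
      using sums_single[of 0 "\<lambda>_. 1 :: real"] unfolding e by (rule sums_unique[symmetric])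
  qed
  ultimately have "mean * suminf (fps_nth I) = 1" unfolding HI by linarith
  moreover have "mean \<noteq> 0" using mean by linarith
  ultimately show "suminf (fps_nth I) = 1 / mean" by (metis nonzero_mult_div_cancel_left)
qed

lemma E_sums: "summable (fps_nth E)" "\<bar>suminf (fps_nth E)\<bar> \<le> s * Z"
  using suminf_bound(1,3)[of "fps_nth E" s] E s by (auto simp: q_def)

lemma B_sums: "suminf (fps_nth B) = A"
proof -
  have "suminf (fps_nth B) = suminf (fps_nth (1 + E)) * suminf (fps_nth I)"
    unfolding B_def by (rule suminf_fps_mult[OF summable_plus_one(1)[of _ s] I_sums(1)]) (use E s in \<open>auto simp: q_def\<close>)
  also have "suminf (fps_nth (1 + E)) = 1 + suminf (fps_nth E)"
    by (rule summable_plus_one(2)[of _ s]) (use E s in \<open>auto simp: q_def\<close>)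
  finally show ?thesis by (simp add: A_def I_sums)
qed

lemma Bm: "\<bar>(B - 1) $$ m\<bar> \<le> 4 * s * rho q m"
proof -
  have "\<bar>(E * (I - 1)) $$ m\<bar> \<le> (\<Sum>i\<le>m. s * rho q i * (2 * s * rho q (m - i)))"
    by (rule fps_mult_bound) (use E Im in \<open>auto simp: q_def\<close>)
  also have "\<dots> = s * (2 * s) * (\<Sum>i\<le>m. rho q i * rho q (m - i))"
    by (simp add: sum_distrib_left mult_ac)
  also have "\<dots> \<le> s * (2 * s) * (rho_conv_const q * rho q m)"
    by (intro mult_left_mono rho_conv q) (use s in auto)
  also have "\<dots> = (2 * s * rho_conv_const (\<theta> - 1)) * (s * rho q m)" by (simp add: q_def)
  also have "\<dots> \<le> 1 * (s * rho q m)" by (intro mult_right_mono s) (use s in auto)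
  finally have "\<bar>(E * (I - 1)) $$ m\<bar> \<le> s * rho q m" by simp
  moreover have "(B - 1) $$ m = (E * (I - 1)) $$ m + (I - 1) $$ m + E $$ m"
    by (simp add: B_def algebra_simps)
  ultimately show ?thesis using Im[of m] E[of m] unfolding q_def by linarith
qed

lemma cancel_tail:
  assumes "X * (1 - G) = Y" shows "X * (1 - fps_X) = Y * I"
proof -
  have "X * (1 - fps_X) = X * (1 - fps_X) * (H * I)" by (simp only: HI mult_1_right)
  also have "\<dots> = X * ((1 - fps_X) * H) * I" by (simp only: mult_ac)
  finally show ?thesis by (simp only: H_def tail_fps assms)
qed

lemma F_nth: "F $$ n = (\<Sum>j\<le>n. B $$ j)"
  using cancel_tail[OF F] unfolding B_def[symmetric] by (rule partial_sums_eq)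

lemma F_near_1: "\<bar>F $$ n - 1\<bar> \<le> 1 / 2"
proof -
  have "F $$ n = (\<Sum>j\<le>n. (1 :: real fps) $$ j) + (\<Sum>j\<le>n. (B - 1) $$ j)"
    unfolding F_nth sum.distrib[symmetric] by simp
  also have "(\<Sum>j\<le>n. (1 :: real fps) $$ j) = 1" by (simp add: sum.delta)
  finally have "F $$ n - 1 = (\<Sum>j\<le>n. (B - 1) $$ j)" by linarith
  then have "\<bar>F $$ n - 1\<bar> \<le> (\<Sum>j\<le>n. \<bar>(B - 1) $$ j\<bar>)" by (simp only: sum_abs)
  also have "\<dots> \<le> 4 * s * Z" by (rule suminf_bound(4)[OF Bm]) (use s in auto)
  finally show ?thesis using s8 by simp
qed

lemma A_bounds: "7 / 9 \<le> A" "A \<le> 2"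
proof -
  have 1: "7 / 8 \<le> 1 + suminf (fps_nth E)" "1 + suminf (fps_nth E) \<le> 9 / 8" using E_sums(2) s8 by linarith+
  have m: "0 < mean" "0 \<le> mean" using mean by linarith+
  show "7 / 9 \<le> A" unfolding A_def pos_le_divide_eq[OF m(1)] using 1 mean by linarith
  show "A \<le> 2" unfolding A_def pos_divide_le_eq[OF m(1)] using 1 mean by linarith
qed

text \<open>F at n is a partial sum of B, so its distance from the limit is a tail of B; the
  exponent drops from \<theta> - 1 to \<theta> - 2 in passing to the tail.\<close>

lemma F_limit: "\<bar>F $$ n - A\<bar> \<le> 4 / (\<theta> - 2) * s * rho (\<theta> - 2) n"
proof -
  have "\<bar>suminf (fps_nth B) - (\<Sum>j\<le>n. B $$ j)\<bar> \<le> (4 * s) / (q - 1) * rho (q - 1) n"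
  proof (rule suminf_rho_tail(2)[OF q])
    fix j assume "n < j"
    then show "\<bar>B $$ j\<bar> \<le> 4 * s * rho q j" using Bm[of j] by simp
  qed (use s in auto)
  then show ?thesis by (simp add: B_sums F_nth q_def abs_minus_commute)
qed

section \<open>The sum and first moment of G, and the Laplacian series\<close>

lemma G_sums: "fps_nth G sums 1"
proof -
  have 0: "(\<lambda>m. s * rho q m) \<longlonglongrightarrow> 0"
    by (rule tendsto_mult_right_zero) (rule summable_LIMSEQ_zero[OF summable_rho[OF q]])
  have "(\<lambda>m. (\<Sum>i\<le>m. G $$ i) - 1) \<longlonglongrightarrow> 0"
  proof (rule Lim_null_comparison[OF _ 0])
    show "\<forall>\<^sub>F m in sequentially. norm ((\<Sum>i\<le>m. G $$ i) - 1) \<le> s * rho q m"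
      using G_tail by (intro eventually_sequentiallyI[of 1]) (simp add: q_def abs_minus_commute)
  qed
  then show ?thesis unfolding sums_def_le by (rule LIM_zero_cancel)
qed

text \<open>Summation by parts; the boundary term (n + 1) H at n is at most s (1 + n)^(2 - \<theta>)
  for n \<ge> 1 and vanishes in the limit because \<theta> > 2.\<close>

lemma mean_sums: "(\<lambda>m. real m * G $$ m) sums mean"
proof -
  have e: "(\<Sum>m\<le>n. real m * G $$ m) = (\<Sum>m\<le>n. H $$ m) - (real n + 1) * H $$ n" for n
    by (induction n) (auto simp: H_def tail_fps_def algebra_simps G0)
  have "(\<lambda>n. (real n + 1) * H $$ n) \<longlonglongrightarrow> 0"
  proof (rule Lim_null_comparison)
    show "\<forall>\<^sub>F n in sequentially. norm ((real n + 1) * H $$ n) \<le> s * rho (q - 1) n"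
    proof (intro eventually_sequentiallyI[of 1])
      fix n :: nat assume "1 \<le> n"
      then have "\<bar>H $$ n\<bar> \<le> s * rho q n" using Hm[of n] by simp
      then have "(real n + 1) * \<bar>H $$ n\<bar> \<le> (real n + 1) * (s * rho q n)" by (intro mult_left_mono) auto
      also have "\<dots> = s * (rho q n * (real n + 1))" by simp
      finally show "norm ((real n + 1) * H $$ n) \<le> s * rho (q - 1) n"
        unfolding rho_Suc_mult by (simp add: abs_mult)
    qed
    have "filterlim (\<lambda>n. 1 + real n) at_top sequentially"
      by (rule filterlim_at_top_mono[OF filterlim_real_sequentially]) (rule always_eventually, simp)
    then have "(\<lambda>n. rho (q - 1) n) \<longlonglongrightarrow> 0"
      unfolding rho_def using q by (intro tendsto_neg_powr) simp_all
    then show "(\<lambda>n. s * rho (q - 1) n) \<longlonglongrightarrow> 0" by (rule tendsto_mult_right_zero)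
  qed
  moreover have "(\<lambda>n. \<Sum>m\<le>n. H $$ m) \<longlonglongrightarrow> mean"
    unfolding mean_def by (rule summable_LIMSEQ'[OF summable_rabs_cancel[OF H_sums(1)]])
  ultimately have "(\<lambda>n. (\<Sum>m\<le>n. H $$ m) - (real n + 1) * H $$ n) \<longlonglongrightarrow> mean - 0"
    by (rule tendsto_diff[rotated])
  then show ?thesis unfolding sums_def_le e by simp
qed

text \<open>Gam is not small at order 1, where it is close to - t, the value for the random walk;
  adding \<open>fps_const t * fps_X\<close> removes this term. The factor P makes up for
  \<open>rho q 1\<close>, which is 1 / P.\<close>

lemma Gam': "\<bar>(Gam + fps_const t * fps_X) $$ m\<bar> \<le> s * t * P * rho q m"
proof -
  consider "m = 0" | "m = 1" | "m \<ge> 2" by linarith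
  then show ?thesis
  proof cases
    case 1
    then show ?thesis using Gam0 s t P by simp
  next
    case 2
    have "P * rho q 1 = 1" by (simp add: P_def rho_def powr_minus)
    then show ?thesis using Gam1 2 by (simp add: mult.assoc)
  next
    case 3
    have "\<bar>Gam $$ m\<bar> \<le> (s * t) * rho q m" using Gam[OF 3] by (simp add: q_def)
    also have "\<dots> \<le> (s * t * P) * rho q m"
      using P s t mult_left_mono[of 1 P "s * t"] by (intro mult_right_mono) auto
    finally show ?thesis using 3 by (simp add: fps_X_nth)
  qed
qed

lemma Gam_sums: "summable (fps_nth Gam)" "\<bar>suminf (fps_nth Gam) + t\<bar> \<le> s * t * P * Z"
proof -
  have nn: "s * t * P \<ge> 0" using s t P by simp
  have sm: "summable (fps_nth (Gam + fps_const t * fps_X))" by (rule suminf_bound(1)[OF Gam' nn])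
  have "(\<lambda>m. if m = 1 then t else 0) sums t" using sums_single[of 1 "\<lambda>_. t"] by simp
  moreover have "(fps_const t * fps_X) $$ m = (if m = 1 then t else 0)" for m
    by (cases m) auto
  ultimately have tx: "(\<lambda>m. (fps_const t * fps_X) $$ m) sums t" by simp
  have "(\<lambda>m. (Gam + fps_const t * fps_X) $$ m - (fps_const t * fps_X) $$ m) sums
      (suminf (fps_nth (Gam + fps_const t * fps_X)) - t)"
    by (intro sums_diff tx summable_sums sm)
  then have g: "fps_nth Gam sums (suminf (fps_nth (Gam + fps_const t * fps_X)) - t)" by simp
  then show "summable (fps_nth Gam)" by (rule sums_summable)
  show "\<bar>suminf (fps_nth Gam) + t\<bar> \<le> s * t * P * Z"
  proof -
    have "\<bar>suminf (fps_nth (Gam + fps_const t * fps_X))\<bar> \<le> s * t * P * Z"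
      by (rule suminf_bound(3)[OF Gam' nn])
    then show ?thesis using sums_unique[OF g] by linarith
  qed
qed

text \<open>The numerator and the denominator of v are within order s of their random walk values t
  and 1, up to a common factor t. The second bound is what keeps v \<gamma> + \<delta> below
  \<theta> - 2 for large L.\<close>

lemma v_bounds: "2 / 3 \<le> v" "\<bar>v - 1\<bar> \<le> 4 * (P * Z) * s"
proof -
  define x where "x = suminf (fps_nth Gam) / t + 1"
  have x: "\<bar>x\<bar> \<le> s * (P * Z)"
  proof -
    have "\<bar>x\<bar> = \<bar>suminf (fps_nth Gam) + t\<bar> / t" using t by (simp add: x_def field_simps abs_divide)
    also have "\<dots> \<le> s * t * P * Z / t" using t Gam_sums(2) by (intro divide_right_mono) auto
    finally show ?thesis using t by (simp add: mult_ac)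
  qed
  have vx: "v = (1 - x) / mean" unfolding v_def x_def using t mean by (simp add: field_simps)
  have x4: "\<bar>x\<bar> \<le> 1 / 4" using x s4 by linarith
  show "2 / 3 \<le> v" unfolding vx using x4 mean by (simp add: field_simps abs_le_iff)
  have "s * Z \<le> s * (P * Z)" using P Z s mult_right_mono[of 1 P Z] by (intro mult_left_mono) auto
  then have "\<bar>1 - x - mean\<bar> \<le> 2 * (s * (P * Z))" using x H_sums(2) by linarith
  moreover have "\<bar>v - 1\<bar> = \<bar>1 - x - mean\<bar> / mean" unfolding vx using mean by (simp add: field_simps abs_divide)
  moreover have "\<bar>1 - x - mean\<bar> / mean \<le> \<bar>1 - x - mean\<bar> / (1 / 2)"
    using mean by (intro divide_left_mono) auto
  ultimately show "\<bar>v - 1\<bar> \<le> 4 * (P * Z) * s" by (simp add: mult_ac)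
qed

lemma Gam_abs: "\<bar>Gam $$ m\<bar> \<le> t * (2 * P) * rho q m"
proof -
  have "\<bar>(fps_const t * fps_X) $$ m\<bar> \<le> t * P * rho q m"
  proof (cases "m = 1")
    case True
    have "P * rho q 1 = 1" by (simp add: P_def rho_def powr_minus)
    then show ?thesis using True t by (simp add: mult.assoc)
  qed (use t P in \<open>auto simp: fps_X_nth\<close>)
  moreover have "s * (t * P * rho q m) \<le> 1 * (t * P * rho q m)"
    using s1 t P s by (intro mult_right_mono) auto
  moreover have "\<bar>Gam $$ m\<bar> \<le> \<bar>(Gam + fps_const t * fps_X) $$ m\<bar> + \<bar>(fps_const t * fps_X) $$ m\<bar>" by simp
  ultimately show ?thesis using Gam'[of m] by (simp add: mult_ac)
qed

text \<open>Collects three errors: the tail of Gam, the distance of F from A, and E2. This constant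
  and \<open>Kv\<close> depend on \<theta> alone, while s and t stay outside; so the constant in (b)
  is uniform in L, with an explicit factor \<beta>.\<close>

definition "Kw = 2 / (q - 1) + 2 * P * (4 / (q - 1)) * P * (1 + Z) + 1"

definition "W = Gam * F + E2"

definition "limit = A * suminf (fps_nth Gam)"

text \<open>The weight \<open>rho (q - 1)\<close> need not be summable, since q - 1 = \<theta> - 2
  is only known to be positive. Its partial sums are at most n + 1, and this factor turns
  \<open>rho q\<close> into \<open>rho (q - 1)\<close>.\<close>

lemma rho_conv':
  fixes x y :: "real fps"
  assumes "\<And>i. \<bar>x $$ i\<bar> \<le> a * rho q i" "\<And>i. \<bar>y $$ i\<bar> \<le> b * rho (q - 1) i" "a \<ge> 0" "b \<ge> 0"
  shows "\<bar>(x * y) $$ n\<bar> \<le> a * b * P * (1 + Z) * rho (q - 1) n"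
proof -
  have "\<bar>(x * y) $$ n\<bar> \<le> a * b * P * (rho q n * (real n + 1) + rho (q - 1) n * Z)"
  proof (rule fps_mult_bound_doubling)
    show "doubling P (rho q)" unfolding P_def using q by (intro doubling_rho) auto
    have "doubling (2 powr (q - 1)) (rho (q - 1))" using q by (intro doubling_rho) auto
    then show "doubling P (rho (q - 1))" by (rule doubling_mono) (auto simp: P_def)
    have "(\<Sum>i\<le>n. rho (q - 1) i) \<le> (\<Sum>i\<le>n. 1)" using q by (intro sum_mono rho_le_1) auto
    then show "(\<Sum>i\<le>n. rho (q - 1) i) \<le> real n + 1" by simp
  qed (use assms P Z in auto)
  then show ?thesis unfolding rho_Suc_mult by (simp add: algebra_simps)
qed

lemma W_limit:
  assumes n: "n \<ge> 1"
  shows "\<bar>W $$ n - limit\<bar> \<le> Kw * (s * t) * rho (q - 1) n"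
proof -
  \<comment> \<open>Replacing F by the constant series A turns Gam F into A times the partial sums
    of Gam, and the rest R decays. These partial sums must contain order 1, the only order at which
    Gam is not small; hence n \<ge> 1.\<close>
  define R where "R = F - Abs_fps (\<lambda>_. A)"
  have "(Gam * Abs_fps (\<lambda>_. A)) $$ n = A * (\<Sum>i\<le>n. Gam $$ i)"
    by (simp add: fps_mult_nth atLeast0AtMost sum_distrib_left mult.commute)
  moreover have "Gam * F = Gam * Abs_fps (\<lambda>_. A) + Gam * R" by (simp add: R_def algebra_simps)
  ultimately have e: "W $$ n - limit = - (A * (suminf (fps_nth Gam) - (\<Sum>i\<le>n. Gam $$ i))) + (Gam * R) $$ n + E2 $$ n"
    by (simp add: W_def limit_def algebra_simps)
  have st: "s * t \<ge> 0" using s t by simp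
  have "\<bar>A * (suminf (fps_nth Gam) - (\<Sum>i\<le>n. Gam $$ i))\<bar> \<le> 2 * ((s * t) / (q - 1) * rho (q - 1) n)"
    unfolding abs_mult
  proof (intro mult_mono suminf_rho_tail(2)[OF q])
    fix j assume "n < j"
    then show "\<bar>Gam $$ j\<bar> \<le> s * t * rho q j" using Gam[of j] n by (simp add: q_def)
  qed (use A_bounds st in auto)
  moreover have "\<bar>(Gam * R) $$ n\<bar> \<le> (t * (2 * P)) * (4 / (q - 1) * s) * P * (1 + Z) * rho (q - 1) n"
  proof (rule rho_conv'[OF Gam_abs])
    show "\<bar>R $$ i\<bar> \<le> 4 / (q - 1) * s * rho (q - 1) i" for i
      using F_limit[of i] by (simp add: R_def q_def)
  qed (use t P s q in auto)
  moreover have "\<bar>E2 $$ n\<bar> \<le> s * t * rho (q - 1) n"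
    using E2[of n] mult_left_mono[OF rho_antimono[of "q - 1" q n] st] by (simp add: q_def)
  ultimately have "\<bar>W $$ n - limit\<bar> \<le> 2 * ((s * t) / (q - 1) * rho (q - 1) n)
     + (t * (2 * P)) * (4 / (q - 1) * s) * P * (1 + Z) * rho (q - 1) n + s * t * rho (q - 1) n"
    unfolding e by linarith
  also have "\<dots> = Kw * (s * t) * rho (q - 1) n"
    by (simp add: Kw_def distrib_right distrib_left add_divide_distrib mult_ac)
  finally show ?thesis .
qed

lemma W0: "W $$ 0 = 0" by (simp add: W_def Gam0 E20)

lemma Kw_pos: "Kw \<ge> 0"
  unfolding Kw_def using q P Z by (intro add_nonneg_nonneg mult_nonneg_nonneg divide_nonneg_nonneg) auto

lemma limit_abs: "\<bar>limit\<bar> \<le> 4 * t"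
proof -
  have "s * t * P * Z = s * (P * Z) * t" by simp
  also have "\<dots> \<le> 1 * t" using s4 t by (intro mult_right_mono) auto
  finally have "\<bar>suminf (fps_nth Gam)\<bar> \<le> 2 * t" using Gam_sums(2) t by linarith
  then have "\<bar>A\<bar> * \<bar>suminf (fps_nth Gam)\<bar> \<le> 2 * (2 * t)"
    using A_bounds by (intro mult_mono) auto
  then show ?thesis by (simp add: limit_def abs_mult)
qed

definition "Kv = 8 * P / (q - 1) + 2 * Kw * P * (1 + Z)"

lemma V_limit:
  assumes n: "n \<ge> 1"
  shows "\<bar>(W * I) $$ n - limit / mean\<bar> \<le> Kv * (s * t) * rho (q - 1) n"
proof -
  \<comment> \<open>W vanishes at order 0, so its limit is subtracted only from order 1 on.
    Convolving J with I gives partial sums of I, which converge to 1 / mean.\<close>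
  define J where "J = Abs_fps (\<lambda>n. if n = 0 then 0 else 1 :: real)"
  define R where "R = W - fps_const limit * J"
  have R: "\<bar>R $$ i\<bar> \<le> Kw * (s * t) * rho (q - 1) i" for i
    using W_limit[of i] W0 Kw_pos s t by (cases "i = 0") (auto simp: R_def J_def)
  have IJ: "(I * J) $$ n = (\<Sum>i\<le>n - 1. I $$ i)"
  proof -
    have "(I * J) $$ n = (\<Sum>i\<le>n. I $$ i * J $$ (n - i))" by (simp add: fps_mult_nth atLeast0AtMost)
    also have "\<dots> = (\<Sum>i\<le>n - 1. I $$ i)"
      by (rule sum.mono_neutral_cong_right) (use n in \<open>auto simp: J_def\<close>)
    finally show ?thesis .
  qed
  have "W * I = fps_const limit * (I * J) + I * R" by (simp add: R_def algebra_simps)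
  then have WI: "(W * I) $$ n = limit * (I * J) $$ n + (I * R) $$ n"
    by (simp only: fps_add_nth fps_mult_left_const_nth)
  have e: "(W * I) $$ n - limit / mean = - (limit * (suminf (fps_nth I) - (\<Sum>i\<le>n - 1. I $$ i))) + (I * R) $$ n"
    unfolding WI IJ I_sums(2) by (simp add: right_diff_distrib)
  have "\<bar>limit * (suminf (fps_nth I) - (\<Sum>i\<le>n - 1. I $$ i))\<bar> \<le> 4 * t * ((2 * s) / (q - 1) * rho (q - 1) (n - 1))"
    unfolding abs_mult
  proof (intro mult_mono suminf_rho_tail(2)[OF q] limit_abs)
    fix j assume "n - 1 < j"
    then show "\<bar>I $$ j\<bar> \<le> 2 * s * rho q j" using Im[of j] by simp
  qed (use s t in auto)
  also have "\<dots> \<le> 4 * t * ((2 * s) / (q - 1) * (P * rho (q - 1) n))"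
  proof (intro mult_left_mono)
    have "rho (q - 1) (n - 1) \<le> 2 powr (q - 1) * rho (q - 1) n"
      using q n by (intro doublingD[OF doubling_rho]) auto
    also have "\<dots> \<le> P * rho (q - 1) n" by (intro mult_right_mono) (auto simp: P_def)
    finally show "rho (q - 1) (n - 1) \<le> P * rho (q - 1) n" .
  qed (use s t q in auto)
  finally have "\<bar>limit * (suminf (fps_nth I) - (\<Sum>i\<le>n - 1. I $$ i))\<bar> \<le> 4 * t * ((2 * s) / (q - 1) * (P * rho (q - 1) n))" .
  moreover have "\<bar>(I * R) $$ n\<bar> \<le> 2 * (Kw * (s * t)) * P * (1 + Z) * rho (q - 1) n"
  proof (rule rho_conv'[OF _ R])
    show "\<bar>I $$ i\<bar> \<le> 2 * rho q i" for i
    proof -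
      have "\<bar>I $$ i\<bar> \<le> (1 + 2 * s) * rho q i" using plus_one_bound[OF Im] s by simp
      also have "\<dots> \<le> 2 * rho q i" using s1 by (intro mult_right_mono) auto
      finally show ?thesis .
    qed
  qed (use Kw_pos s t in auto)
  ultimately have "\<bar>(W * I) $$ n - limit / mean\<bar> \<le> 4 * t * ((2 * s) / (q - 1) * (P * rho (q - 1) n))
     + 2 * (Kw * (s * t)) * P * (1 + Z) * rho (q - 1) n"
    unfolding e by linarith
  also have "\<dots> = Kv * (s * t) * rho (q - 1) n"
    by (simp add: Kv_def distrib_right distrib_left add_divide_distrib mult_ac)
  finally show ?thesis .
qed

lemma Kv_pos: "Kv \<ge> 0"
  unfolding Kv_def using q P Z Kw_pos by (intro add_nonneg_nonneg mult_nonneg_nonneg divide_nonneg_nonneg) auto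

text \<open>The increments of T are the coefficients of W / H, which tend to limit / mean = - A v t;
  the errors of the single steps are added up.\<close>

lemma T_asymptotics: "\<bar>T $$ n + real n * A * v * t\<bar> \<le> Kv * (s * t) * (\<Sum>j\<le>n. rho (\<theta> - 2) j)"
proof -
  have Tn: "T $$ n = (\<Sum>j\<le>n. (W * I) $$ j)"
    using cancel_tail[OF T] unfolding W_def[symmetric] by (rule partial_sums_eq)
  have "limit / mean = - (A * v * t)" using t by (simp add: limit_def v_def)
  moreover have "(\<Sum>j\<le>n. if j = 0 then 0 else limit / mean) = real n * (limit / mean)"
    by (induction n) (auto simp: algebra_simps add_divide_distrib)
  ultimately have "T $$ n + real n * A * v * t = (\<Sum>j\<le>n. (W * I) $$ j - (if j = 0 then 0 else limit / mean))"
    by (simp add: Tn sum_subtractf)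
  also have "\<bar>\<dots>\<bar> \<le> (\<Sum>j\<le>n. Kv * (s * t) * rho (\<theta> - 2) j)"
  proof (rule order_trans[OF sum_abs sum_mono])
    fix j show "\<bar>(W * I) $$ j - (if j = 0 then 0 else limit / mean)\<bar> \<le> Kv * (s * t) * rho (\<theta> - 2) j"
      using V_limit[of j] W0 Kv_pos s t by (cases "j = 0") (auto simp: q_def)
  qed
  finally show ?thesis by (simp add: sum_distrib_left)
qed

lemma T_over_F:
  assumes d: "0 \<le> \<delta>" "\<delta> < 1" "\<delta> \<le> \<theta> - 2" and n: "n \<ge> 1"
  shows "\<bar>- (T $$ n) / F $$ n / (v * t * real n) - 1\<bar> \<le> (8 / (\<theta> - 2) + 6 * Kv / (1 - \<delta>)) * s * real n powr (- \<delta>)"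
proof -
  have Fn: "F $$ n \<ge> 1 / 2" using F_near_1[of n] by linarith
  have v: "v \<ge> 2 / 3" by (rule v_bounds)
  define e where "e = T $$ n + real n * A * v * t"
  define r where "r = real n powr (- \<delta>)"
  have rr: "rho \<delta> n \<le> r" unfolding r_def by (rule rho_le_powr) (use d n in auto)
  have r0: "r \<ge> 0" by (simp add: r_def)
  \<comment> \<open>Weakening \<theta> - 2 to \<delta> < 1 gives an accumulated error of order n^(1
    - \<delta>) in all cases, also where the sum of \<open>rho (\<theta> - 2)\<close>
    converges.\<close>
  have "\<bar>e\<bar> \<le> Kv * (s * t) * (\<Sum>j\<le>n. rho (\<theta> - 2) j)" unfolding e_def by (rule T_asymptotics)
  also have "\<dots> \<le> Kv * (s * t) * (\<Sum>j\<le>n. rho \<delta> j)"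
    by (intro mult_left_mono sum_mono rho_antimono) (use d Kv_pos s t in auto)
  also have "\<dots> \<le> Kv * (s * t) * (1 / (1 - \<delta>) * rho (\<delta> - 1) n)"
    by (intro mult_left_mono sum_rho_below_one) (use d Kv_pos s t in auto)
  also have "rho (\<delta> - 1) n = rho \<delta> n * (real n + 1)" by (simp add: rho_Suc_mult)
  also have "Kv * (s * t) * (1 / (1 - \<delta>) * (rho \<delta> n * (real n + 1))) \<le> Kv * (s * t) * (1 / (1 - \<delta>) * (r * (2 * real n)))"
    by (intro mult_left_mono mult_mono rr) (use d Kv_pos s t n r0 in auto)
  finally have e: "\<bar>e\<bar> \<le> Kv * (s * t) * (1 / (1 - \<delta>) * (r * (2 * real n)))" .
  have FA: "\<bar>A - F $$ n\<bar> \<le> 4 / (\<theta> - 2) * s * r"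
  proof -
    have "\<bar>A - F $$ n\<bar> \<le> 4 / (\<theta> - 2) * s * rho (\<theta> - 2) n" using F_limit[of n] by (simp add: abs_minus_commute)
    also have "\<dots> \<le> 4 / (\<theta> - 2) * s * rho \<delta> n"
      by (intro mult_left_mono rho_antimono) (use \<theta> s d in auto)
    also have "\<dots> \<le> 4 / (\<theta> - 2) * s * r" by (intro mult_left_mono rr) (use \<theta> s in auto)
    finally show ?thesis .
  qed
  have n0: "real n > 0" using n by simp
  have "- (T $$ n) / F $$ n / (v * t * real n) - 1 = (A - F $$ n) / F $$ n - e / (F $$ n * (v * t * real n))"
    using Fn v t n0 by (simp add: e_def field_simps)
  also have "\<bar>\<dots>\<bar> \<le> \<bar>A - F $$ n\<bar> / F $$ n + \<bar>e\<bar> / (F $$ n * (v * t * real n))"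
    using Fn v t n0 abs_triangle_ineq4[of "(A - F $$ n) / F $$ n" "e / (F $$ n * (v * t * real n))"]
    by (simp add: abs_mult abs_divide)
  also have "\<dots> \<le> (4 / (\<theta> - 2) * s * r) / (1 / 2) +
      (Kv * (s * t) * (1 / (1 - \<delta>) * (r * (2 * real n)))) / (1 / 2 * (2 / 3 * t * real n))"
  proof (rule add_mono)
    show "\<bar>A - F $$ n\<bar> / F $$ n \<le> (4 / (\<theta> - 2) * s * r) / (1 / 2)"
      by (rule frac_le[OF _ FA _ Fn]) (use \<theta> s r0 in auto)
    have "1 / 2 * (2 / 3 * t * real n) \<le> F $$ n * (v * t * real n)"
      using Fn v t n0 by (intro mult_mono) auto
    then show "\<bar>e\<bar> / (F $$ n * (v * t * real n)) \<le>
        (Kv * (s * t) * (1 / (1 - \<delta>) * (r * (2 * real n)))) / (1 / 2 * (2 / 3 * t * real n))"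
      by (intro frac_le[OF _ e]) (use Kv_pos s t n0 r0 d in auto)
  qed
  also have "\<dots> = (8 / (\<theta> - 2) + 6 * Kv / (1 - \<delta>)) * s * r"
  proof -
    have "(Kv * (s * t) * (1 / D * (r * (2 * real n)))) / (1 / 2 * (2 / 3 * t * real n)) = 6 * Kv / D * s * r"
      if "D \<noteq> 0" for D
      using t n0 that by (simp add: field_simps)
    from this[of "1 - \<delta>"] d show ?thesis by (simp add: distrib_right)
  qed
  finally show ?thesis unfolding r_def .
qed

end

section \<open>Gaussian modulation\<close>

text \<open>The fractional power trades smallness for summability: with x = v a m, every power of a
  gained costs the same power of m, and the weights can afford only little more than the power
  \<delta>.\<close>

lemma exp_minus_1_le:
  fixes x p :: real
  assumes "x \<ge> 0" "0 < p" "p \<le> 1"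
  shows "exp x - 1 \<le> x powr p * exp x"
proof (cases "x \<le> 1")
  case True
  have "(1 - x) * exp x \<le> exp (- x) * exp x"
    using exp_ge_add_one_self[of "- x"] by (intro mult_right_mono) auto
  also have "\<dots> = 1" by (simp flip: exp_add)
  finally have "exp x - 1 \<le> x * exp x" by (simp add: algebra_simps)
  moreover have "x \<le> x powr p"
  proof (cases "x = 0")
    case False
    then show ?thesis using powr_mono'[of p 1 x] assms True by simp
  qed simp
  then have "x * exp x \<le> x powr p * exp x" by (intro mult_right_mono) auto
  ultimately show ?thesis by linarith
next
  case False
  then have "1 * exp x \<le> x powr p * exp x" using assms by (intro mult_right_mono ge_one_powr_ge_zero) auto
  then show ?thesis using exp_gt_zero[of x] by linarith
qed

lemma exp_minus_1_minus_le:
  fixes x p :: real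
  assumes x: "x \<ge> 0" and p: "0 < p" "p \<le> 1"
  shows "exp x - 1 - x \<le> x powr (1 + p) * exp x"
proof -
  have "exp x - 1 \<le> x * exp x" using exp_minus_1_le[of x 1] x by simp
  then have "exp x - 1 - x \<le> x * (exp x - 1)" by (simp add: algebra_simps)
  also have "\<dots> \<le> x * (x powr p * exp x)" by (intro mult_left_mono exp_minus_1_le x p)
  also have "\<dots> = x powr (1 + p) * exp x"
    using x by (cases "x = 0") (auto simp: powr_add)
  finally show ?thesis .
qed

text \<open>The rate is bounded in terms of n, but the bound is needed at every m \<le> n. It
  follows from m log n / n \<le> log m + 1, which comes from log y \<le> y with y = n / m.
  Modulation thus costs the power v \<gamma> in the weights.\<close>

lemma exp_rate_le_rho:
  assumes m: "m \<le> n" and a: "0 \<le> a" "a \<le> \<gamma> * ln (real n) / real n" and v: "v \<ge> 0" and g: "\<gamma> \<ge> 0"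
  shows "exp (v * a * real m) \<le> exp (v * \<gamma>) * rho (- (v * \<gamma>)) m"
proof (cases "m = 0")
  case True
  then show ?thesis using v g by simp
next
  case False
  then have m1: "real m \<ge> 1" "real n \<ge> 1" using m by auto
  define y where "y = real n / real m"
  have y: "y \<ge> 1" using m m1 by (simp add: y_def field_simps)
  have "ln y \<le> y" using ln_le_minus_one[of y] y by simp
  then have ly: "ln y / y \<le> 1" using y by simp
  have "real m * ln (real n) / real n = (ln (real m) + ln y) / y"
    using m1 by (simp add: y_def ln_div)
  also have "\<dots> = ln (real m) / y + ln y / y" by (simp add: add_divide_distrib)
  also have "\<dots> \<le> ln (real m) + 1"
  proof (intro add_mono ly)
    have "ln (real m) / y \<le> ln (real m) / 1" using y m1 by (intro divide_left_mono) auto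
    then show "ln (real m) / y \<le> ln (real m)" by simp
  qed
  also have "\<dots> \<le> ln (1 + real m) + 1" using m1 by simp
  finally have l: "real m * ln (real n) / real n \<le> ln (1 + real m) + 1" .
  have "v * a * real m \<le> v * (\<gamma> * ln (real n) / real n) * real m"
    using a v by (intro mult_right_mono mult_left_mono) auto
  also have "\<dots> = v * \<gamma> * (real m * ln (real n) / real n)" by simp
  also have "\<dots> \<le> v * \<gamma> * (ln (1 + real m) + 1)" using v g by (intro mult_left_mono l) auto
  finally have "exp (v * a * real m) \<le> exp (v * \<gamma> * (ln (1 + real m) + 1))" by simp
  also have "\<dots> = exp (v * \<gamma>) * rho (- (v * \<gamma>)) m"
    by (simp add: rho_def powr_def distrib_left exp_add mult_ac)
  finally show ?thesis .
qed

text \<open>The logarithm is absorbed by log n \<le> n^k / k with k = 1 - \<delta> / p, chosen so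
  that (k - 1) p = - \<delta>.\<close>

lemma log_rate_powr:
  assumes n: "n \<ge> 1" and a: "0 \<le> a" "a \<le> \<gamma> * ln (real n) / real n" and g: "\<gamma> > 0"
    and d: "0 < \<delta>" "\<delta> < p"
  shows "a powr p \<le> (\<gamma> / (1 - \<delta> / p)) powr p * real n powr (- \<delta>)"
proof -
  define k where "k = 1 - \<delta> / p"
  have k: "k > 0" using d by (simp add: k_def field_simps)
  have n1: "real n \<ge> 1" using n by simp
  have "a \<le> \<gamma> * (real n powr k / k) / real n"
    using a(2) g n1 ln_powr_bound[OF n1 k] by (smt (verit) divide_right_mono mult_left_mono)
  also have "\<dots> = \<gamma> / k * real n powr (k - 1)"
    using n1 by (simp add: powr_diff)
  finally have "a powr p \<le> (\<gamma> / k * real n powr (k - 1)) powr p"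
    using a d by (intro powr_mono2) auto
  also have "\<dots> = (\<gamma> / k) powr p * real n powr ((k - 1) * p)"
    by (simp only: powr_mult powr_powr)
  also have "(k - 1) * p = - \<delta>" using d by (simp add: k_def)
  finally show ?thesis by (simp add: k_def)
qed

lemma l1_upto_rho:
  assumes "\<And>m. m \<le> n \<Longrightarrow> \<bar>x $$ m\<bar> \<le> c * rho q m" "q > 1" "c \<ge> 0"
  shows "l1_upto n x \<le> c * suminf (rho q)"
proof -
  have "l1_upto n x \<le> (\<Sum>m\<le>n. c * rho q m)" unfolding l1_upto_def by (intro sum_mono assms) auto
  also have "\<dots> = c * (\<Sum>m\<le>n. rho q m)" by (simp add: sum_distrib_left)
  also have "\<dots> \<le> c * suminf (rho q)" by (intro mult_left_mono sum_rho_le assms)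
  finally show ?thesis .
qed

lemma cancel_tail_fps:
  fixes X Y G :: "real fps"
  assumes "X * (1 - G) = Y" "G $$ 0 = 0"
  shows "X $$ n = (\<Sum>j\<le>n. (Y * inverse (tail_fps G)) $$ j)"
proof -
  define H where "H = tail_fps G"
  define I where "I = inverse H"
  have "H * I = 1" unfolding I_def using inverse_mult_eq_1'[of H] assms(2) by (simp add: H_def tail_fps_def)
  then have "X * (1 - fps_X) = X * (1 - fps_X) * (H * I)" by (simp only: mult_1_right)
  also have "\<dots> = X * ((1 - fps_X) * H) * I" by (simp only: mult_ac)
  also have "\<dots> = Y * I" unfolding H_def tail_fps assms(1) ..
  finally show ?thesis unfolding I_def H_def by (rule partial_sums_eq)
qed

text \<open>G, E, F are the series at momentum k; G0, E0, F0 those at zero momentum; Gam holds the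
  Laplacians of g divided by \<sigma>^2. Since a may depend on n and closeness is assumed only up to
  order n, everything is measured in \<open>l1_upto n\<close>, against the size D = a n^(1 -
  \<delta>). The threshold n0 makes D small enough for the modulated tail series to be
  inverted.\<close>

lemma gaussian_modulation:
  fixes \<theta> s v \<gamma> \<delta> \<epsilon>1 M :: real and G0 E0 Gam F0 :: "real fps"
  assumes \<theta>: "\<theta> > 2" and s: "0 \<le> s" "2 * s * rho_conv_const (\<theta> - 1) \<le> 1"
    and g: "\<gamma> > 0" and d: "\<delta> > 0" "\<delta> < \<epsilon>1" "\<epsilon>1 \<le> 1" and v: "v > 0" and vg: "v * \<gamma> + \<delta> < \<theta> - 2"
    and M: "M \<ge> 0"
    and G00: "G0 $$ 0 = 0" and G_tail: "\<And>m. m \<ge> 1 \<Longrightarrow> \<bar>1 - (\<Sum>i\<le>m. G0 $$ i)\<bar> \<le> s * rho (\<theta> - 1) m"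
    and E0: "\<And>m. \<bar>E0 $$ m\<bar> \<le> M * rho \<theta> m" and G0: "\<And>m. \<bar>G0 $$ m\<bar> \<le> M * rho \<theta> m"
    and Gam: "\<And>m. \<bar>Gam $$ m\<bar> \<le> M * rho (\<theta> - 1) m"
    and sum0: "(\<lambda>m. Gam $$ m + v * (real m * G0 $$ m)) sums 0"
    and F0: "F0 * (1 - G0) = 1 + E0"
  shows "\<exists>C\<ge>0. \<exists>n0\<ge>1. \<forall>n\<ge>n0. \<forall>a G E F. 0 \<le> a \<longrightarrow> a \<le> \<gamma> * ln (real n) / real n \<longrightarrow>
    G $$ 0 = 0 \<longrightarrow> F * (1 - G) = 1 + E \<longrightarrow>
    (\<forall>m\<le>n. (\<forall>e\<in>{0..\<epsilon>1}. \<bar>G $$ m - G0 $$ m - a * Gam $$ m\<bar> \<le> M * a powr (1 + e) * rho (\<theta> - 1 - e) m) \<and>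
       \<bar>E $$ m - E0 $$ m\<bar> \<le> M * a * rho (\<theta> - 1) m) \<longrightarrow>
    \<bar>F $$ n * exp (v * a * real n) - F0 $$ n\<bar> \<le> C * (a * real n powr (1 - \<delta>))"
proof -
  define \<nu> where "\<nu> = v * \<gamma>"
  have \<nu>: "\<nu> > 0" unfolding \<nu>_def using v g by simp
  \<comment> \<open>The exponent by which the error is superlinear in a. It exceeds \<delta>, so
    that a^e is at most of order n^(-\<delta>) in spite of the logarithm, and it is small enough for
    the weight left after expansion and modulation to be summable, q > 1.\<close>
  obtain e where e: "\<delta> < e" "e < \<epsilon>1" "e < \<theta> - 2 - \<nu>"
  proof -
    have "\<delta> < min \<epsilon>1 (\<theta> - 2 - \<nu>)" using d vg by (simp add: \<nu>_def)
    then obtain e where "\<delta> < e" "e < min \<epsilon>1 (\<theta> - 2 - \<nu>)" using dense by blast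
    then show ?thesis using that by auto
  qed
  define q where "q = \<theta> - 1 - e - \<nu>"
  have q: "q > 1" using e by (simp add: q_def)
  define Ev where "Ev = exp \<nu>"
  define C1 where "C1 = M * Ev * (1 + v powr e + v powr (1 + e))"
  define C2 where "C2 = M * (1 + v) / (\<theta> - 2)"
  define C3 where "C3 = (\<gamma> / (1 - \<delta> / e)) powr e"
  define C4 where "C4 = C2 * (2 / (1 - \<delta>)) + 2 * C1 * suminf (rho q) * C3"
  define C5 where "C5 = M * (1 + v) * Ev * suminf (rho (\<theta> - 1 - \<nu>))"
  define C6 where "C6 = 1 + M * suminf (rho (\<theta> - 1))"
  define C where "C = 2 * C5 + C6 * (4 * C4)"
  have Zq: "suminf (rho q) \<ge> 1" by (rule suminf_rho_ge_1[OF q])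
  have Z\<nu>: "suminf (rho (\<theta> - 1 - \<nu>)) \<ge> 1" by (rule suminf_rho_ge_1) (use e d in simp)
  have Z1: "suminf (rho (\<theta> - 1)) \<ge> 1" by (rule suminf_rho_ge_1) (use \<theta> in simp)
  have Cs: "Ev > 0" "C1 \<ge> 0" "C2 \<ge> 0" "C3 \<ge> 0" "C5 \<ge> 0" "C6 \<ge> 0"
    unfolding Ev_def C1_def C2_def C3_def C5_def C6_def using M v \<theta> Z\<nu> Z1 by auto
  then have C4: "C4 \<ge> 0" unfolding C4_def using d Zq by (intro add_nonneg_nonneg mult_nonneg_nonneg) auto
  then have C0: "C \<ge> 0" unfolding C_def using Cs by (intro add_nonneg_nonneg mult_nonneg_nonneg) auto
  obtain n0 where n0: "n0 \<ge> 1" "\<And>n. n \<ge> n0 \<Longrightarrow> C4 * (\<gamma> / (\<delta> / 2) * real n powr (- (\<delta> / 2))) \<le> 1 / 4"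
  proof -
    have "(\<lambda>n. real n powr (- (\<delta> / 2))) \<longlonglongrightarrow> 0"
      using d by (intro tendsto_neg_powr filterlim_real_sequentially) simp
    then have "(\<lambda>n. (C4 * (\<gamma> / (\<delta> / 2))) * real n powr (- (\<delta> / 2))) \<longlonglongrightarrow> 0"
      by (rule tendsto_mult_right_zero)
    then have "\<forall>\<^sub>F n in sequentially. (C4 * (\<gamma> / (\<delta> / 2))) * real n powr (- (\<delta> / 2)) < 1 / 4"
      by (rule order_tendstoD) simp
    then obtain N where "\<And>n. n \<ge> N \<Longrightarrow> (C4 * (\<gamma> / (\<delta> / 2))) * real n powr (- (\<delta> / 2)) < 1 / 4"
      by (auto simp: eventually_sequentially)
    then show ?thesis using that[of "max N 1"] by (auto simp: mult.assoc intro: less_imp_le)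
  qed
  show ?thesis
  proof (rule exI[of _ C], intro conjI C0 exI[of _ n0] n0(1) allI impI)
    fix n :: nat and a :: real and G E F :: "real fps"
    assume nn0: "n \<ge> n0" and a: "0 \<le> a" "a \<le> \<gamma> * ln (real n) / real n" and G00': "G $$ 0 = 0"
      and F: "F * (1 - G) = 1 + E"
      and bds: "\<forall>m\<le>n. (\<forall>e\<in>{0..\<epsilon>1}. \<bar>G $$ m - G0 $$ m - a * Gam $$ m\<bar> \<le> M * a powr (1 + e) * rho (\<theta> - 1 - e) m) \<and>
       \<bar>E $$ m - E0 $$ m\<bar> \<le> M * a * rho (\<theta> - 1) m"
    have n: "n \<ge> 1" using nn0 n0 by simp
    define D where "D = a * real n powr (1 - \<delta>)"
    have D0: "D \<ge> 0" using a by (simp add: D_def)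
    define Ex where "Ex m = exp (v * a * real m)" for m
    define sc where "sc X = Abs_fps (\<lambda>m. X $$ m * Ex m)" for X :: "real fps"
    have Ex0: "Ex 0 = 1" by (simp add: Ex_def)
    have Exadd: "Ex (i + j) = Ex i * Ex j" for i j by (simp add: Ex_def algebra_simps exp_add)
    have scn: "sc X $$ m = X $$ m * Ex m" for X m by (simp add: sc_def)
    \<comment> \<open>Scaling coefficients by an exponential in the order respects products, so the
      modulated series satisfy the same recursion.\<close>
    have sc_mult: "sc (X * Y) = sc X * sc Y" for X Y
    proof (rule fps_ext)
      fix m
      have "sc (X * Y) $$ m = (\<Sum>i=0..m. X $$ i * Y $$ (m - i) * Ex m)"
        by (simp add: scn fps_mult_nth sum_distrib_right)
      also have "\<dots> = (\<Sum>i=0..m. (X $$ i * Ex i) * (Y $$ (m - i) * Ex (m - i)))"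
      proof (rule sum.cong)
        fix i assume "i \<in> {0..m}"
        then have "Ex m = Ex i * Ex (m - i)" using Exadd[of i "m - i"] by simp
        then show "X $$ i * Y $$ (m - i) * Ex m = (X $$ i * Ex i) * (Y $$ (m - i) * Ex (m - i))" by simp
      qed simp
      also have "\<dots> = (sc X * sc Y) $$ m" by (simp add: fps_mult_nth scn)
      finally show "sc (X * Y) $$ m = (sc X * sc Y) $$ m" .
    qed
    have sc1: "sc (1 - X) = 1 - sc X" "sc (1 + X) = 1 + sc X" for X
      by (auto simp: fps_eq_iff scn Ex0 algebra_simps)
    have Fsc: "sc F * (1 - sc G) = 1 + sc E"
      using arg_cong[OF F, of sc] by (simp only: sc_mult sc1)
    have Exb: "Ex m \<le> Ev * rho (- \<nu>) m" if "m \<le> n" for m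
      unfolding Ex_def Ev_def \<nu>_def by (rule exp_rate_le_rho[OF that a]) (use v g in auto)
    have Ex1: "Ex m \<ge> 1" for m using a v by (simp add: Ex_def)
    define x where "x m = v * a * real m" for m
    have x0: "x m \<ge> 0" for m using a v by (simp add: x_def)
    have mpow: "real m powr p \<le> rho (- p) m" if "p \<ge> 0" for p m
      using that by (auto simp: rho_def intro!: powr_mono2)
    have a_e: "a powr (1 + e) = a * a powr e" using a e d by (cases "a = 0") (auto simp: powr_add)

    \<comment> \<open>The subtracted part is linear in a and has two sources: Gam from the kernel,
      and v m G0 from expanding the exponential in front of G0.\<close>
    define r where "r m = (sc G $$ m - G0 $$ m) - a * (Gam $$ m + v * (real m * G0 $$ m))" for m
    have r: "\<bar>r m\<bar> \<le> C1 * a powr (1 + e) * rho q m" if m: "m \<le> n" for m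
    proof -
      have reg: "r m = (G $$ m - G0 $$ m - a * Gam $$ m) * Ex m + a * Gam $$ m * (Ex m - 1) + G0 $$ m * (Ex m - 1 - x m)"
        by (simp add: r_def scn x_def algebra_simps)
      have ep: "0 < e" "e \<le> 1" using e d by auto
      have rr: "rho (\<theta> - 1 - e) m * rho (- \<nu>) m = rho q m"
        by (simp add: rho_mult q_def)
      have 1: "\<bar>(G $$ m - G0 $$ m - a * Gam $$ m) * Ex m\<bar> \<le> (M * a powr (1 + e) * rho (\<theta> - 1 - e) m) * (Ev * rho (- \<nu>) m)"
      proof -
        have "e \<in> {0..\<epsilon>1}" using e d by auto
        then have "\<bar>G $$ m - G0 $$ m - a * Gam $$ m\<bar> \<le> M * a powr (1 + e) * rho (\<theta> - 1 - e) m"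
          using bds m by blast
        moreover have "\<bar>Ex m\<bar> \<le> Ev * rho (- \<nu>) m" using Exb[OF m] Ex1[of m] by linarith
        ultimately show ?thesis
          unfolding abs_mult by (intro mult_mono) (use M in simp_all)
      qed
      also have "\<dots> = M * Ev * a powr (1 + e) * rho q m" unfolding rr[symmetric] by simp
      finally have 1: "\<bar>(G $$ m - G0 $$ m - a * Gam $$ m) * Ex m\<bar> \<le> M * Ev * a powr (1 + e) * rho q m" .
      have "\<bar>Ex m - 1\<bar> \<le> x m powr e * Ex m"
        using exp_minus_1_le[OF x0 ep, of m] Ex1[of m] by (simp add: Ex_def x_def)
      also have "x m powr e = v powr e * a powr e * real m powr e"
        using v a by (simp add: x_def powr_mult)
      also have "v powr e * a powr e * real m powr e * Ex m \<le> v powr e * a powr e * rho (- e) m * (Ev * rho (- \<nu>) m)"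
        using Exb[OF m] mpow[of e m] ep Ex1[of m] by (intro mult_mono mult_left_mono) auto
      finally have E1: "\<bar>Ex m - 1\<bar> \<le> v powr e * a powr e * rho (- e) m * (Ev * rho (- \<nu>) m)" .
      have "\<bar>a * Gam $$ m * (Ex m - 1)\<bar> \<le> a * (M * rho (\<theta> - 1) m) * (v powr e * a powr e * rho (- e) m * (Ev * rho (- \<nu>) m))"
        unfolding abs_mult using E1 Gam[of m] a M by (intro mult_mono) auto
      also have "\<dots> = M * Ev * v powr e * a powr (1 + e) * (rho (\<theta> - 1) m * rho (- e) m * rho (- \<nu>) m)"
        by (simp add: a_e mult_ac)
      also have "rho (\<theta> - 1) m * rho (- e) m * rho (- \<nu>) m = rho q m"
        unfolding rho_mult q_def by (simp add: algebra_simps)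
      finally have 2: "\<bar>a * Gam $$ m * (Ex m - 1)\<bar> \<le> M * Ev * v powr e * a powr (1 + e) * rho q m" .
      have "\<bar>Ex m - 1 - x m\<bar> \<le> x m powr (1 + e) * Ex m"
      proof -
        have "Ex m = exp (x m)" by (simp add: Ex_def x_def)
        moreover have "0 \<le> exp (x m) - 1 - x m" using exp_ge_add_one_self[of "x m"] by linarith
        ultimately show ?thesis using exp_minus_1_minus_le[OF x0 ep, of m] by (simp only: abs_of_nonneg)
      qed
      also have "x m powr (1 + e) = v powr (1 + e) * a powr (1 + e) * real m powr (1 + e)"
        using v a by (simp add: x_def powr_mult)
      also have "v powr (1 + e) * a powr (1 + e) * real m powr (1 + e) * Ex m
          \<le> v powr (1 + e) * a powr (1 + e) * rho (- (1 + e)) m * (Ev * rho (- \<nu>) m)"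
        using Exb[OF m] mpow[of "1 + e" m] ep Ex1[of m] by (intro mult_mono mult_left_mono) auto
      finally have E2: "\<bar>Ex m - 1 - x m\<bar> \<le> v powr (1 + e) * a powr (1 + e) * rho (- (1 + e)) m * (Ev * rho (- \<nu>) m)" .
      have "\<bar>G0 $$ m * (Ex m - 1 - x m)\<bar> \<le> (M * rho \<theta> m) * (v powr (1 + e) * a powr (1 + e) * rho (- (1 + e)) m * (Ev * rho (- \<nu>) m))"
        unfolding abs_mult using E2 G0[of m] M by (intro mult_mono) auto
      also have "\<dots> = M * Ev * v powr (1 + e) * a powr (1 + e) * (rho \<theta> m * rho (- (1 + e)) m * rho (- \<nu>) m)"
        by (simp add: mult_ac)
      also have "rho \<theta> m * rho (- (1 + e)) m * rho (- \<nu>) m = rho q m"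
        unfolding rho_mult q_def by (simp add: algebra_simps)
      finally have 3: "\<bar>G0 $$ m * (Ex m - 1 - x m)\<bar> \<le> M * Ev * v powr (1 + e) * a powr (1 + e) * rho q m" .
      have "\<bar>r m\<bar> \<le> M * Ev * a powr (1 + e) * rho q m + M * Ev * v powr e * a powr (1 + e) * rho q m
          + M * Ev * v powr (1 + e) * a powr (1 + e) * rho q m"
        unfolding reg using 1 2 3 by linarith
      then show ?thesis by (simp add: C1_def algebra_simps)
    qed

    define H where "H = tail_fps G0"
    define H' where "H' = tail_fps (sc G)"
    define L where "L m = Gam $$ m + v * (real m * G0 $$ m)" for m
    have Lb: "\<bar>L m\<bar> \<le> (M * (1 + v)) * rho (\<theta> - 1) m" for m
    proof -
      have "real m * \<bar>G0 $$ m\<bar> \<le> (real m + 1) * (M * rho \<theta> m)" using G0[of m] by (intro mult_mono) auto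
      also have "\<dots> = M * (rho \<theta> m * (real m + 1))" by simp
      finally have "real m * \<bar>G0 $$ m\<bar> \<le> M * rho (\<theta> - 1) m" unfolding rho_Suc_mult .
      then have "v * (real m * \<bar>G0 $$ m\<bar>) \<le> v * (M * rho (\<theta> - 1) m)" using v by (intro mult_left_mono) auto
      moreover have "\<bar>L m\<bar> \<le> \<bar>Gam $$ m\<bar> + v * (real m * \<bar>G0 $$ m\<bar>)"
        unfolding L_def using v by (intro order_trans[OF abs_triangle_ineq]) (simp add: abs_mult)
      ultimately show ?thesis using Gam[of m] by (simp add: algebra_simps)
    qed
    have Lsum: "\<bar>\<Sum>i\<le>j. L i\<bar> \<le> C2 * rho (\<theta> - 2) j" for j
    proof -
      have "\<bar>suminf L - (\<Sum>i\<le>j. L i)\<bar> \<le> (M * (1 + v)) / (\<theta> - 1 - 1) * rho (\<theta> - 1 - 1) j"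
        by (rule suminf_rho_tail(2)) (use Lb M v \<theta> in auto)
      moreover have "suminf L = 0" unfolding L_def[abs_def] by (rule sums_unique[OF sum0, symmetric])
      ultimately show ?thesis by (simp add: C2_def)
    qed
    \<comment> \<open>Partial sums of the linear part are, up to sign, tails of a series with sum 0
      and therefore decay. The remainder r is simply summed and gives the same bound at every
      order.\<close>
    have HH: "\<bar>(H' - H) $$ j\<bar> \<le> a * C2 * rho \<delta> j + C1 * suminf (rho q) * a powr (1 + e)" if j: "j \<le> n" for j
    proof -
      have "(H' - H) $$ j = - (\<Sum>i\<le>j. a * L i + r i)"
        by (simp add: H_def H'_def tail_fps_def r_def L_def sum_subtractf sum.distrib)
      then have "\<bar>(H' - H) $$ j\<bar> \<le> a * \<bar>\<Sum>i\<le>j. L i\<bar> + \<bar>\<Sum>i\<le>j. r i\<bar>"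
        using a abs_triangle_ineq[of "a * (\<Sum>i\<le>j. L i)" "\<Sum>i\<le>j. r i"]
        by (simp add: sum.distrib sum_distrib_left[symmetric] abs_mult)
      also have "a * \<bar>\<Sum>i\<le>j. L i\<bar> \<le> a * (C2 * rho \<delta> j)"
      proof (intro mult_left_mono a order_trans[OF Lsum] Cs)
        show "rho (\<theta> - 2) j \<le> rho \<delta> j" by (rule rho_antimono) (use vg \<nu> in \<open>simp add: \<nu>_def\<close>)
      qed
      also have "\<bar>\<Sum>i\<le>j. r i\<bar> \<le> (\<Sum>i\<le>j. C1 * a powr (1 + e) * rho q i)"
        by (rule order_trans[OF sum_abs sum_mono]) (use r j in auto)
      also have "\<dots> = C1 * a powr (1 + e) * (\<Sum>i\<le>j. rho q i)" by (simp add: sum_distrib_left)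
      also have "\<dots> \<le> C1 * a powr (1 + e) * suminf (rho q)"
        by (intro mult_left_mono sum_rho_le q) (use Cs in auto)
      finally show ?thesis by (simp add: mult_ac)
    qed
    \<comment> \<open>Summing over j \<le> n, the first term gives a n^(1 - \<delta>) and the second
      n a^(1 + e), which is of the same order where a \<le> \<gamma> log n / n.\<close>
    have l1HH: "l1_upto n (H' - H) \<le> C4 * D"
    proof -
      have "l1_upto n (H' - H) \<le> (\<Sum>j\<le>n. a * C2 * rho \<delta> j + C1 * suminf (rho q) * a powr (1 + e))"
        unfolding l1_upto_def by (intro sum_mono HH) auto
      also have "\<dots> = a * C2 * (\<Sum>j\<le>n. rho \<delta> j) + (real n + 1) * (C1 * suminf (rho q) * a powr (1 + e))"
        by (simp add: sum.distrib sum_distrib_left)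
      finally have l1: "l1_upto n (H' - H) \<le> a * C2 * (\<Sum>j\<le>n. rho \<delta> j) + (real n + 1) * (C1 * suminf (rho q) * a powr (1 + e))" .
      have r2: "rho (\<delta> - 1) n \<le> 2 * real n powr (1 - \<delta>)"
      proof -
        have "rho (\<delta> - 1) n \<le> (2 * real n) powr (1 - \<delta>)"
          unfolding rho_def using n d by (simp, intro powr_mono2) auto
        also have "\<dots> = 2 powr (1 - \<delta>) * real n powr (1 - \<delta>)" by (rule powr_mult)
        also have "\<dots> \<le> 2 * real n powr (1 - \<delta>)"
        proof (rule mult_right_mono)
          have "2 powr (1 - \<delta>) \<le> (2::real) powr 1" using d by (intro powr_mono) auto
          then show "2 powr (1 - \<delta>) \<le> (2::real)" by simp
        qed simp
        finally show ?thesis .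
      qed
      have "(\<Sum>j\<le>n. rho \<delta> j) \<le> 1 / (1 - \<delta>) * rho (\<delta> - 1) n"
        by (rule sum_rho_below_one) (use d in auto)
      also have "\<dots> \<le> 1 / (1 - \<delta>) * (2 * real n powr (1 - \<delta>))"
        by (intro mult_left_mono r2) (use d in auto)
      finally have s1: "a * C2 * (\<Sum>j\<le>n. rho \<delta> j) \<le> a * C2 * (1 / (1 - \<delta>) * (2 * real n powr (1 - \<delta>)))"
        by (rule mult_left_mono) (use a Cs in auto)
      have "(real n + 1) * (C1 * suminf (rho q) * a powr (1 + e))
          \<le> (2 * real n) * (C1 * suminf (rho q) * (a * (C3 * real n powr (- \<delta>))))"
        unfolding a_e C3_def
        by (intro mult_mono mult_left_mono log_rate_powr a g d e) (use n a Cs Zq in auto)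
      also have "\<dots> = 2 * C1 * suminf (rho q) * C3 * D"
        using n by (simp add: D_def powr_diff powr_minus field_simps)
      finally have s2: "(real n + 1) * (C1 * suminf (rho q) * a powr (1 + e)) \<le> 2 * C1 * suminf (rho q) * C3 * D" .
      from l1 s1 s2 have "l1_upto n (H' - H) \<le> a * C2 * (1 / (1 - \<delta>) * (2 * real n powr (1 - \<delta>))) + 2 * C1 * suminf (rho q) * C3 * D"
        by linarith
      also have "\<dots> = C4 * D" by (simp add: C4_def D_def algebra_simps)
      finally show ?thesis .
    qed
    have D14: "C4 * D \<le> 1 / 4"
    proof -
      have "D \<le> (\<gamma> * ln (real n) / real n) * real n powr (1 - \<delta>)"
        unfolding D_def using a by (intro mult_right_mono) auto
      also have "\<dots> = \<gamma> * ln (real n) * real n powr (- \<delta>)" using n by (simp add: powr_diff powr_minus field_simps)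
      also have "\<dots> \<le> \<gamma> * (real n powr (\<delta> / 2) / (\<delta> / 2)) * real n powr (- \<delta>)"
        using g n d by (intro mult_right_mono mult_left_mono ln_powr_bound) auto
      also have "\<dots> = \<gamma> / (\<delta> / 2) * (real n powr (\<delta> / 2) * real n powr (- \<delta>))" by simp
      also have "real n powr (\<delta> / 2) * real n powr (- \<delta>) = real n powr (- (\<delta> / 2))"
        by (simp flip: powr_add)
      finally have "C4 * D \<le> C4 * (\<gamma> / (\<delta> / 2) * real n powr (- (\<delta> / 2)))" by (intro mult_left_mono C4)
      then show ?thesis using n0(2)[OF nn0] by linarith
    qed
    have H0: "H $$ 0 = 1" "H' $$ 0 = 1" by (simp_all add: H_def H'_def tail_fps_def G00 scn G00')
    have l1H: "l1_upto n (H - 1) \<le> 1 / 4"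
    proof -
      have "l1_upto n (H - 1) \<le> s * suminf (rho (\<theta> - 1))"
      proof (rule l1_upto_rho)
        fix m show "\<bar>(H - 1) $$ m\<bar> \<le> s * rho (\<theta> - 1) m"
          using G_tail[of m] s by (cases m) (auto simp: H_def tail_fps_def G00)
      qed (use \<theta> s in auto)
      moreover have "4 * (s * suminf (rho (\<theta> - 1))) \<le> 1"
      proof -
        have "1 * (s * suminf (rho (\<theta> - 1))) \<le> 2 powr (\<theta> - 1) * (s * suminf (rho (\<theta> - 1)))"
          using \<theta> s Z1 by (intro mult_right_mono ge_one_powr_ge_zero) auto
        then show ?thesis using s by (simp add: rho_conv_const_def mult_ac)
      qed
      ultimately show ?thesis by linarith
    qed
    have "l1_upto n (H' - 1) \<le> l1_upto n (H' - H) + l1_upto n (H - 1)"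
      using l1_upto_add[of n "H' - H" "H - 1"] by simp
    then have l1H': "l1_upto n (H' - 1) \<le> 1 / 2" using l1HH D14 l1H by linarith
    define I where "I = inverse H"
    define I' where "I' = inverse H'"
    have HI: "H * I = 1" "H' * I' = 1"
      unfolding I_def I'_def using inverse_mult_eq_1'[of H] inverse_mult_eq_1'[of H'] H0 by simp_all
    have lI: "l1_upto n I \<le> 2" "l1_upto n I' \<le> 2"
      unfolding I_def I'_def using l1H l1H' H0 by (auto intro: l1_upto_inverse)
    have II: "I' - I = I * I' * (H - H')"
    proof -
      have "I' - I = (H * I) * I' - (H' * I') * I" by (simp only: HI mult_1_left)
      then show ?thesis by (simp add: algebra_simps)
    qed
    have lE: "l1_upto n (sc E - E0) \<le> C5 * D"
    proof -
      have "l1_upto n (sc E - E0) \<le> M * (1 + v) * Ev * a * suminf (rho (\<theta> - 1 - \<nu>))"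
      proof (rule l1_upto_rho)
        fix m assume m: "m \<le> n"
        have 1: "\<bar>(E $$ m - E0 $$ m) * Ex m\<bar> \<le> (M * a * rho (\<theta> - 1) m) * (Ev * rho (- \<nu>) m)"
          unfolding abs_mult using bds m Exb[OF m] Ex1[of m] M a by (intro mult_mono) auto
        have "\<bar>Ex m - 1\<bar> \<le> x m * Ex m"
          using exp_minus_1_le[of "x m" 1] x0[of m] Ex1[of m] by (simp add: Ex_def x_def)
        also have "\<dots> \<le> (v * a * (real m + 1)) * (Ev * rho (- \<nu>) m)"
          unfolding x_def using Exb[OF m] Ex1[of m] v a by (intro mult_mono) auto
        finally have "\<bar>E0 $$ m * (Ex m - 1)\<bar> \<le> (M * rho \<theta> m) * ((v * a * (real m + 1)) * (Ev * rho (- \<nu>) m))"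
          unfolding abs_mult using E0[of m] M by (intro mult_mono) auto
        also have "\<dots> = M * v * a * Ev * ((rho \<theta> m * (real m + 1)) * rho (- \<nu>) m)" by (simp add: mult_ac)
        also have "\<dots> = M * v * a * Ev * rho (\<theta> - 1 - \<nu>) m" unfolding rho_Suc_mult rho_mult by simp
        finally have 2: "\<bar>E0 $$ m * (Ex m - 1)\<bar> \<le> M * v * a * Ev * rho (\<theta> - 1 - \<nu>) m" .
        have 3: "(M * a * rho (\<theta> - 1) m) * (Ev * rho (- \<nu>) m) = M * a * Ev * rho (\<theta> - 1 - \<nu>) m"
          using rho_mult[of "\<theta> - 1" m "- \<nu>"] by (simp add: mult_ac)
        have "(sc E - E0) $$ m = (E $$ m - E0 $$ m) * Ex m + E0 $$ m * (Ex m - 1)"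
          by (simp add: scn algebra_simps)
        then have "\<bar>(sc E - E0) $$ m\<bar> \<le> \<bar>(E $$ m - E0 $$ m) * Ex m\<bar> + \<bar>E0 $$ m * (Ex m - 1)\<bar>"
          by (simp only: abs_triangle_ineq)
        then have "\<bar>(sc E - E0) $$ m\<bar> \<le> M * a * Ev * rho (\<theta> - 1 - \<nu>) m + M * v * a * Ev * rho (\<theta> - 1 - \<nu>) m"
          using 1 2 3 by linarith
        then show "\<bar>(sc E - E0) $$ m\<bar> \<le> M * (1 + v) * Ev * a * rho (\<theta> - 1 - \<nu>) m"
          by (simp add: algebra_simps)
      qed (use e d M v Cs a in auto)
      also have "\<dots> = C5 * (a * 1)" by (simp add: C5_def mult_ac)
      also have "\<dots> \<le> C5 * D" unfolding D_def
        using n d Cs a by (intro mult_left_mono ge_one_powr_ge_zero) auto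
      finally show ?thesis .
    qed
    have l1E: "l1_upto n (1 + E0) \<le> C6"
    proof -
      have "l1_upto n E0 \<le> M * suminf (rho (\<theta> - 1))"
      proof (rule l1_upto_rho)
        fix m
        have "M * rho \<theta> m \<le> M * rho (\<theta> - 1) m" by (intro mult_left_mono rho_antimono M) simp
        then show "\<bar>E0 $$ m\<bar> \<le> M * rho (\<theta> - 1) m" using E0[of m] by linarith
      qed (use \<theta> M in auto)
      moreover have "l1_upto n (1 + E0) \<le> l1_upto n 1 + l1_upto n E0" by (rule l1_upto_add)
      moreover have "l1_upto n 1 = 1" by (simp add: l1_upto_def if_distrib[of abs] sum.delta cong: if_cong)
      ultimately show ?thesis by (simp add: C6_def)
    qed
    have "(1 + sc E) * I' - (1 + E0) * I = (sc E - E0) * I' + (1 + E0) * (I * I' * (H - H'))"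
      unfolding II[symmetric] by (simp add: algebra_simps)
    then have "l1_upto n ((1 + sc E) * I' - (1 + E0) * I)
        \<le> l1_upto n ((sc E - E0) * I') + l1_upto n ((1 + E0) * (I * I' * (H - H')))"
      by (simp only: l1_upto_add)
    also have "l1_upto n ((sc E - E0) * I') \<le> l1_upto n (sc E - E0) * l1_upto n I'" by (rule l1_upto_mult)
    also have "\<dots> \<le> (C5 * D) * 2" by (intro mult_mono lE lI l1_upto_nonneg) (use Cs D0 in auto)
    also have "l1_upto n ((1 + E0) * (I * I' * (H - H'))) \<le> l1_upto n (1 + E0) * l1_upto n (I * I' * (H - H'))"
      by (rule l1_upto_mult)
    also have "\<dots> \<le> C6 * (2 * 2 * (C4 * D))"
    proof (intro mult_mono l1E l1_upto_nonneg)
      have "l1_upto n (I * I' * (H - H')) \<le> l1_upto n (I * I') * l1_upto n (H - H')" by (rule l1_upto_mult)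
      also have "\<dots> \<le> (2 * 2) * (C4 * D)"
      proof (intro mult_mono l1_upto_nonneg)
        show "l1_upto n (I * I') \<le> 2 * 2"
          by (rule order_trans[OF l1_upto_mult]) (intro mult_mono lI l1_upto_nonneg, auto)
        show "l1_upto n (H - H') \<le> C4 * D" using l1HH by (simp add: l1_upto_def abs_minus_commute)
      qed auto
      finally show "l1_upto n (I * I' * (H - H')) \<le> 2 * 2 * (C4 * D)" .
    qed (use Cs in auto)
    finally have fin: "l1_upto n ((1 + sc E) * I' - (1 + E0) * I) \<le> C * D"
      by (simp add: C_def algebra_simps)
    have "sc F $$ n - F0 $$ n = (\<Sum>j\<le>n. ((1 + sc E) * I' - (1 + E0) * I) $$ j)"
      using cancel_tail_fps[OF Fsc, of n] cancel_tail_fps[OF F0 G00, of n]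
      by (simp add: scn G00' sum_subtractf I_def I'_def H_def H'_def)
    also have "\<bar>\<dots>\<bar> \<le> l1_upto n ((1 + sc E) * I' - (1 + E0) * I)"
      unfolding l1_upto_def by (rule sum_abs)
    also note fin
    finally show "\<bar>F $$ n * exp (v * a * real n) - F0 $$ n\<bar> \<le> C * (a * real n powr (1 - \<delta>))"
      by (simp add: scn Ex_def D_def)
  qed
qed

section \<open>Step distributions\<close>

definition pmf_summable :: "'a pmf \<Rightarrow> ('a \<Rightarrow> real) \<Rightarrow> bool" where
  "pmf_summable P h \<longleftrightarrow> (\<lambda>x. h x * pmf P x) summable_on UNIV"

definition pmf_sum :: "'a pmf \<Rightarrow> ('a \<Rightarrow> real) \<Rightarrow> real" where
  "pmf_sum P h = (\<Sum>\<^sub>\<infinity>x. h x * pmf P x)"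

lemma pmf_summable_on: "pmf P summable_on UNIV" and infsum_pmf: "infsum (pmf P) UNIV = 1"
proof -
  have "Infinite_Set_Sum.abs_summable_on (pmf P) UNIV" by (rule pmf_abs_summable)
  then show "infsum (pmf P) UNIV = 1"
    using infsetsum_infsum[of "pmf P" UNIV] infsetsum_pmf_eq_1[of P UNIV] by simp
  have "(\<lambda>x. norm (pmf P x)) summable_on UNIV"
    using abs_summable_equivalent[of "pmf P" UNIV] pmf_abs_summable[of P UNIV] by blast
  then show "pmf P summable_on UNIV" by simp
qed

lemma pmf_summable_const: "pmf_summable P (\<lambda>_. c)" and pmf_sum_const: "pmf_sum P (\<lambda>_. c) = c"
  unfolding pmf_summable_def pmf_sum_def
  by (auto intro: summable_on_cmult_right pmf_summable_on simp: infsum_cmult_right' infsum_pmf)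

lemma pmf_summable_comparison:
  assumes "pmf_summable P g" "\<And>x. \<bar>h x\<bar> \<le> g x"
  shows "pmf_summable P h"
proof -
  have gnn: "g x \<ge> 0" for x using assms(2)[of x] by linarith
  have "(\<lambda>x. norm (h x * pmf P x)) summable_on UNIV"
  proof (rule Infinite_Sum.abs_summable_on_comparison_test)
    show "(\<lambda>x. norm (g x * pmf P x)) summable_on UNIV"
      using assms(1) gnn by (simp add: pmf_summable_def)
    show "norm (h x * pmf P x) \<le> norm (g x * pmf P x)" for x
      using assms(2)[of x] gnn[of x] by (simp add: abs_mult mult_right_mono)
  qed
  then show ?thesis unfolding pmf_summable_def by (rule Infinite_Sum.abs_summable_summable)
qed

lemma pmf_summable_add: "pmf_summable P g \<Longrightarrow> pmf_summable P h \<Longrightarrow> pmf_summable P (\<lambda>x. g x + h x)"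
  unfolding pmf_summable_def distrib_right by (rule summable_on_add)

lemma pmf_sum_add: "pmf_summable P g \<Longrightarrow> pmf_summable P h \<Longrightarrow> pmf_sum P (\<lambda>x. g x + h x) = pmf_sum P g + pmf_sum P h"
  unfolding pmf_summable_def pmf_sum_def distrib_right by (rule infsum_add)

lemma pmf_summable_cmult: "pmf_summable P h \<Longrightarrow> pmf_summable P (\<lambda>x. c * h x)"
  unfolding pmf_summable_def mult.assoc by (rule summable_on_cmult_right)

lemma pmf_sum_cmult: "pmf_sum P (\<lambda>x. c * h x) = c * pmf_sum P h"
  unfolding pmf_sum_def mult.assoc by (rule infsum_cmult_right')

lemma pmf_sum_diff: "pmf_summable P g \<Longrightarrow> pmf_summable P h \<Longrightarrow> pmf_sum P (\<lambda>x. g x - h x) = pmf_sum P g - pmf_sum P h"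
  using pmf_sum_add[of P g "\<lambda>x. (-1) * h x"] pmf_summable_cmult[of P h "-1"] pmf_sum_cmult[of P "-1" h] by simp

lemma pmf_sum_mono:
  "pmf_summable P g \<Longrightarrow> pmf_summable P h \<Longrightarrow> (\<And>x. g x \<le> h x) \<Longrightarrow> pmf_sum P g \<le> pmf_sum P h"
  unfolding pmf_summable_def pmf_sum_def by (rule infsum_mono) (auto intro: mult_right_mono)

lemma pmf_sum_nonneg: "(\<And>x. h x \<ge> 0) \<Longrightarrow> pmf_sum P h \<ge> 0"
  unfolding pmf_sum_def by (rule infsum_nonneg) auto

lemma pmf_sum_abs_le:
  assumes "pmf_summable P g" "\<And>x. \<bar>h x\<bar> \<le> g x"
  shows "\<bar>pmf_sum P h\<bar> \<le> pmf_sum P g"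
proof -
  have h: "pmf_summable P h" by (rule pmf_summable_comparison[OF assms])
  have "pmf_sum P h \<le> pmf_sum P g"
    by (rule pmf_sum_mono[OF h assms(1)]) (rule order_trans[OF abs_ge_self assms(2)])
  moreover have "pmf_sum P (\<lambda>x. (-1) * h x) \<le> pmf_sum P g"
    by (rule pmf_sum_mono[OF pmf_summable_cmult[OF h] assms(1)])
       (use assms(2) in \<open>simp add: abs_le_iff\<close>)
  ultimately show ?thesis unfolding pmf_sum_cmult by (simp add: abs_le_iff)
qed

lemma pmf_sum_sum:
  assumes "finite S" "\<And>i. i \<in> S \<Longrightarrow> pmf_summable P (h i)"
  shows "pmf_sum P (\<lambda>x. \<Sum>i\<in>S. h i x) = (\<Sum>i\<in>S. pmf_sum P (h i)) \<and> pmf_summable P (\<lambda>x. \<Sum>i\<in>S. h i x)"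
  using assms
proof (induction S rule: finite_induct)
  case empty
  then show ?case using pmf_sum_const[of P 0] pmf_summable_const[of P 0] by simp
next
  case (insert i S)
  then show ?case using pmf_sum_add[of P "h i"] pmf_summable_add[of P "h i"] by simp
qed

section \<open>The transform of the step distribution and the function a(k)\<close>

lemma Dhat_summable: "(\<lambda>x. norm (complex_of_real (pmf P x) * exp (\<i> * complex_of_real (k \<bullet> lattice_vec x)))) summable_on UNIV"
  using pmf_summable_on[of P] by (simp add: norm_mult)

lemma norm_Dhat_le_1: "norm (Dhat P k) \<le> 1"
proof -
  have "norm (Dhat P k) \<le> (\<Sum>\<^sub>\<infinity>x. norm (complex_of_real (pmf P x) * exp (\<i> * complex_of_real (k \<bullet> lattice_vec x))))"
    unfolding Dhat_def by (rule norm_infsum_bound[OF Dhat_summable])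
  also have "\<dots> = 1" using infsum_pmf[of P] by (simp add: norm_mult)
  finally show ?thesis .
qed

lemma pmf_summable_cos: "pmf_summable P (\<lambda>x. 1 - cos (k \<bullet> lattice_vec x))"
  by (rule pmf_summable_comparison[OF pmf_summable_const[of P 2]]) (simp add: abs_le_iff)

lemma afun_eq: "afun P k = pmf_sum P (\<lambda>x. 1 - cos (k \<bullet> lattice_vec x))"
proof -
  have "Re (Dhat P k) = (\<Sum>\<^sub>\<infinity>x. Re (complex_of_real (pmf P x) * exp (\<i> * complex_of_real (k \<bullet> lattice_vec x))))"
    unfolding Dhat_def by (rule infsum_Re[OF Infinite_Sum.abs_summable_summable[OF Dhat_summable], symmetric])
  also have "\<dots> = pmf_sum P (\<lambda>x. cos (k \<bullet> lattice_vec x))"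
    unfolding pmf_sum_def by (simp add: Re_exp mult.commute)
  finally have "Re (Dhat P k) = pmf_sum P (\<lambda>x. cos (k \<bullet> lattice_vec x))" .
  moreover have "pmf_summable P (\<lambda>x. cos (k \<bullet> lattice_vec x))"
    by (rule pmf_summable_comparison[OF pmf_summable_const[of P 1]]) simp
  ultimately show ?thesis
    by (simp add: afun_def pmf_sum_diff[OF pmf_summable_const] pmf_sum_const)
qed

lemma afun_nonneg: "afun P k \<ge> 0"
  unfolding afun_eq by (rule pmf_sum_nonneg) simp

lemma afun_le_2: "afun P k \<le> 2"
proof -
  have "afun P k \<le> pmf_sum P (\<lambda>_. 2)"
    unfolding afun_eq by (rule pmf_sum_mono[OF pmf_summable_cos pmf_summable_const])
      (metis abs_cos_le_one abs_le_iff diff_le_eq diff_minus_eq_add le_diff_eq one_add_one add.commute add_left_mono)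
  then show ?thesis by (simp add: pmf_sum_const)
qed

section \<open>Taylor bounds for the cosine\<close>

lemma cos_quadratic_bound: "1 - cos y \<le> y\<^sup>2 / 2" for y :: real
proof -
  have "1 - cos y = 2 * (sin (y / 2))\<^sup>2"
    using cos_double_sin[of "y / 2"] by simp
  also have "(sin (y / 2))\<^sup>2 \<le> (y / 2)\<^sup>2"
    using abs_sin_x_le_abs_x[of "y / 2"] by (simp only: abs_le_square_iff)
  finally show ?thesis by (simp add: power2_eq_square)
qed

lemma cos_fourth_order: "y\<^sup>2 / 2 - (1 - cos y) \<le> y ^ 4" for y :: real
proof -
  obtain t where t: "cos y = (\<Sum>m<4. cos_coeff m * y ^ m) + (cos (t + 1/2 * real 4 * pi) / fact 4) * y ^ 4"
    using Maclaurin_cos_expansion[of y 4] by blast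
  have "(\<Sum>m<4. cos_coeff m * y ^ m) = 1 - y\<^sup>2 / 2"
  proof -
    have "{..<4} = {0, 1, 2, 3 :: nat}" by auto
    then show ?thesis by (simp add: cos_coeff_def fact_numeral)
  qed
  then have "y\<^sup>2 / 2 - (1 - cos y) = (cos (t + 1/2 * real 4 * pi) / fact 4) * y ^ 4" using t by simp
  also have "\<dots> \<le> 1 * y ^ 4"
  proof (rule mult_right_mono)
    have "cos (t + 1/2 * real 4 * pi) \<le> 1" by (rule cos_le_one)
    moreover have "(fact 4 :: real) \<ge> 1" by (rule fact_ge_1)
    ultimately have "cos (t + 1/2 * real 4 * pi) \<le> 1 * fact 4" "(0 :: real) < fact 4" by linarith+
    then show "cos (t + 1/2 * real 4 * pi) / fact 4 \<le> 1"
      by (simp only: pos_divide_le_eq)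
  qed auto
  finally show ?thesis by simp
qed

text \<open>Interpolates between the fourth order bound, used for |y| \<le> 1, and the quadratic one
  for |y| > 1. The exponent 2 + 2 p is matched to the moments that exist.\<close>

lemma cos_taylor_powr:
  fixes y p :: real
  assumes "0 \<le> p" "p \<le> 1"
  shows "\<bar>(1 - cos y) - y\<^sup>2 / 2\<bar> \<le> \<bar>y\<bar> powr (2 + 2 * p)"
proof -
  have "(1 - cos y) - y\<^sup>2 / 2 \<le> 0" using cos_quadratic_bound[of y] by simp
  moreover have "y\<^sup>2 / 2 - (1 - cos y) \<le> \<bar>y\<bar> powr (2 + 2 * p)"
  proof (cases "\<bar>y\<bar> \<le> 1")
    case True
    show ?thesis
    proof (cases "y = 0")
      case False
      have "y\<^sup>2 / 2 - (1 - cos y) \<le> \<bar>y\<bar> ^ 4" using cos_fourth_order[of y] by simp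
      also have "\<dots> = \<bar>y\<bar> powr 4" using False by simp
      also have "\<dots> \<le> \<bar>y\<bar> powr (2 + 2 * p)" using True False assms by (intro powr_mono') auto
      finally show ?thesis .
    qed simp
  next
    case False
    have "y\<^sup>2 / 2 - (1 - cos y) \<le> \<bar>y\<bar> ^ 2" using cos_le_one[of y] zero_le_power2[of y] unfolding power2_abs by linarith
    also have "\<dots> = \<bar>y\<bar> powr 2" using False by simp
    also have "\<dots> \<le> \<bar>y\<bar> powr (2 + 2 * p)" using False assms by (intro powr_mono) auto
    finally show ?thesis .
  qed
  ultimately show ?thesis by simp
qed

definition second_moment :: "(int ^ 'd::finite) pmf \<Rightarrow> real ^ 'd \<Rightarrow> real" where
  "second_moment P k = pmf_sum P (\<lambda>x. (k \<bullet> lattice_vec x)\<^sup>2)"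

text \<open>Symmetry is available for a(k) on the cube, inherited from g at order 1, and not
  directly for the mass function. Isotropy of the second moments is therefore recovered from the
  behaviour of a(k) near 0.\<close>

locale step_distribution =
  fixes P :: "(int ^ 'd::finite) pmf" and \<epsilon> :: real
  assumes eps: "\<epsilon> > 0"
    and moments: "(\<lambda>x. norm (lattice_vec x) powr (2 + 2 * \<epsilon>) * pmf P x) summable_on UNIV"
    and symmetric: "cube_symmetric (afun P)"
begin

lemma moment_summable:
  assumes "0 \<le> p" "p \<le> 2 + 2 * \<epsilon>"
  shows "pmf_summable P (\<lambda>x. norm (lattice_vec x) powr p)"
proof (rule pmf_summable_comparison)
  show "pmf_summable P (\<lambda>x. 1 + norm (lattice_vec x) powr (2 + 2 * \<epsilon>))"
    by (intro pmf_summable_add pmf_summable_const) (use moments in \<open>simp add: pmf_summable_def\<close>)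
  fix x :: "int ^ 'd"
  let ?y = "norm (lattice_vec x)"
  show "\<bar>?y powr p\<bar> \<le> 1 + ?y powr (2 + 2 * \<epsilon>)"
  proof (cases "?y \<le> 1")
    case True
    then have "?y powr p \<le> 1" using assms powr_mono2[of p ?y 1] by simp
    moreover have "?y powr (2 + 2 * \<epsilon>) \<ge> 0" by simp
    ultimately show ?thesis by (simp add: add_increasing2)
  next
    case False
    then have "?y powr p \<le> ?y powr (2 + 2 * \<epsilon>)" using assms by (intro powr_mono) auto
    then show ?thesis by simp
  qed
qed

lemma norm_sq_summable: "pmf_summable P (\<lambda>x. (norm (lattice_vec x))\<^sup>2)"
proof -
  have "(\<lambda>x :: int ^ 'd. norm (lattice_vec x) powr 2) = (\<lambda>x. (norm (lattice_vec x))\<^sup>2)"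
    by (rule ext) simp
  with moment_summable[of 2] eps show ?thesis by simp
qed

lemma inner_sq_summable: "pmf_summable P (\<lambda>x. (k \<bullet> lattice_vec x)\<^sup>2)"
proof (rule pmf_summable_comparison[OF pmf_summable_cmult[OF norm_sq_summable, of "(norm k)\<^sup>2"]])
  fix x :: "int ^ 'd"
  have "(k \<bullet> lattice_vec x)\<^sup>2 \<le> (norm k * norm (lattice_vec x))\<^sup>2"
    using Cauchy_Schwarz_ineq2[of k "lattice_vec x"] by (metis abs_ge_zero power2_abs power_mono)
  then show "\<bar>(k \<bullet> lattice_vec x)\<^sup>2\<bar> \<le> (norm k)\<^sup>2 * (norm (lattice_vec x))\<^sup>2" by (simp add: power_mult_distrib)
qed

lemma afun_le_second_moment: "afun P k \<le> second_moment P k / 2"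
proof -
  have "afun P k \<le> pmf_sum P (\<lambda>x. (1/2) * (k \<bullet> lattice_vec x)\<^sup>2)"
    unfolding afun_eq
    by (rule pmf_sum_mono[OF pmf_summable_cos pmf_summable_cmult[OF inner_sq_summable]])
       (use cos_quadratic_bound in simp)
  then show ?thesis by (simp only: pmf_sum_cmult second_moment_def)
qed

lemma afun_expansion:
  assumes p: "0 \<le> p" "p \<le> 1" "p \<le> \<epsilon>"
  shows "\<bar>afun P k - second_moment P k / 2\<bar> \<le> pmf_sum P (\<lambda>x. norm (lattice_vec x) powr (2 + 2 * p)) * norm k powr (2 + 2 * p)"
proof -
  have e: "afun P k - second_moment P k / 2 = pmf_sum P (\<lambda>x. (1 - cos (k \<bullet> lattice_vec x)) - (1/2) * (k \<bullet> lattice_vec x)\<^sup>2)"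
    unfolding pmf_sum_diff[OF pmf_summable_cos pmf_summable_cmult[OF inner_sq_summable]] pmf_sum_cmult
    by (simp add: afun_eq second_moment_def)
  have "\<bar>afun P k - second_moment P k / 2\<bar> \<le> pmf_sum P (\<lambda>x. norm k powr (2 + 2 * p) * norm (lattice_vec x) powr (2 + 2 * p))"
    unfolding e
  proof (rule pmf_sum_abs_le[OF pmf_summable_cmult[OF moment_summable]])
    fix x :: "int ^ 'd"
    have "\<bar>(1 - cos (k \<bullet> lattice_vec x)) - (1/2) * (k \<bullet> lattice_vec x)\<^sup>2\<bar> \<le> \<bar>k \<bullet> lattice_vec x\<bar> powr (2 + 2 * p)"
      using cos_taylor_powr[OF p(1,2), of "k \<bullet> lattice_vec x"] by simp
    also have "\<dots> \<le> (norm k * norm (lattice_vec x)) powr (2 + 2 * p)"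
      using Cauchy_Schwarz_ineq2[of k "lattice_vec x"] p by (intro powr_mono2) auto
    also have "\<dots> = norm k powr (2 + 2 * p) * norm (lattice_vec x) powr (2 + 2 * p)" by (rule powr_mult)
    finally show "\<bar>(1 - cos (k \<bullet> lattice_vec x)) - (1/2) * (k \<bullet> lattice_vec x)\<^sup>2\<bar>
        \<le> norm k powr (2 + 2 * p) * norm (lattice_vec x) powr (2 + 2 * p)" .
  qed (use p eps in auto)
  then show ?thesis unfolding pmf_sum_cmult by (simp only: mult.commute)
qed

lemma second_moment_scale: "second_moment P (t *\<^sub>R k) = t\<^sup>2 * second_moment P k"
  unfolding second_moment_def pmf_sum_cmult[symmetric] by (simp add: power_mult_distrib)

lemma second_moment_parallelogram:
  "second_moment P (j + k) + second_moment P (j - k) = 2 * second_moment P j + 2 * second_moment P k"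
  unfolding second_moment_def pmf_sum_cmult[symmetric] pmf_sum_add[OF inner_sq_summable inner_sq_summable, symmetric]
    pmf_sum_add[OF pmf_summable_cmult pmf_summable_cmult, OF inner_sq_summable inner_sq_summable, symmetric]
  by (rule arg_cong[where f = "pmf_sum P"]) (auto simp: inner_add_left inner_diff_left power2_eq_square algebra_simps)

lemma second_moment_limit: "((\<lambda>t. afun P (t *\<^sub>R k) / t\<^sup>2) \<longlongrightarrow> second_moment P k / 2) (at 0)"
proof -
  define p where "p = min 1 \<epsilon>"
  have p: "0 < p" "p \<le> 1" "p \<le> \<epsilon>" using eps by (auto simp: p_def)
  define M where "M = pmf_sum P (\<lambda>x. norm (lattice_vec x) powr (2 + 2 * p)) * norm k powr (2 + 2 * p)"
  have b: "\<bar>afun P (t *\<^sub>R k) / t\<^sup>2 - second_moment P k / 2\<bar> \<le> M * \<bar>t\<bar> powr (2 * p)" if t: "t \<noteq> 0" for t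
  proof -
    have "\<bar>afun P (t *\<^sub>R k) - t\<^sup>2 * second_moment P k / 2\<bar> \<le> M * \<bar>t\<bar> powr (2 + 2 * p)"
      using afun_expansion[of p "t *\<^sub>R k"] p by (simp add: second_moment_scale M_def powr_mult mult_ac)
    also have "\<bar>t\<bar> powr (2 + 2 * p) = t\<^sup>2 * \<bar>t\<bar> powr (2 * p)" using t by (simp add: powr_add)
    finally have "\<bar>afun P (t *\<^sub>R k) - t\<^sup>2 * second_moment P k / 2\<bar> / t\<^sup>2 \<le> M * \<bar>t\<bar> powr (2 * p)"
      using t by (simp add: field_simps)
    moreover have "\<bar>afun P (t *\<^sub>R k) / t\<^sup>2 - second_moment P k / 2\<bar> = \<bar>afun P (t *\<^sub>R k) - t\<^sup>2 * second_moment P k / 2\<bar> / t\<^sup>2"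
    proof -
      have "afun P (t *\<^sub>R k) / t\<^sup>2 - second_moment P k / 2 = (afun P (t *\<^sub>R k) - t\<^sup>2 * second_moment P k / 2) / t\<^sup>2"
        using t by (simp add: diff_divide_distrib)
      then show ?thesis by (simp only: abs_divide abs_power2)
    qed
    ultimately show ?thesis by simp
  qed
  have "((\<lambda>t::real. \<bar>t\<bar> powr (2 * p)) \<longlongrightarrow> \<bar>0\<bar> powr (2 * p)) (at 0)"
    using p by (intro tendsto_intros) auto
  then have "((\<lambda>t. M * \<bar>t\<bar> powr (2 * p)) \<longlongrightarrow> 0) (at 0)" using p by (intro tendsto_mult_right_zero) simp
  then have "((\<lambda>t. afun P (t *\<^sub>R k) / t\<^sup>2 - second_moment P k / 2) \<longlongrightarrow> 0) (at 0)"
    by (rule Lim_null_comparison[rotated]) (use b in \<open>auto simp: eventually_at intro!: exI[of _ 1]\<close>)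
  then show ?thesis by (rule LIM_zero_cancel)
qed

text \<open>The quadratic form is the limit of 2 a(t k) / t^2 as t tends to 0, and t k lies in the
  cube for small t. So invariance of a on the cube passes to the form on the whole space.\<close>

lemma second_moment_invariant:
  assumes R: "\<And>t k. R (t *\<^sub>R k) = t *\<^sub>R R k"
    and inv: "\<And>k. k \<in> kcube \<Longrightarrow> afun P (R k) = afun P k"
  shows "second_moment P (R k) = second_moment P k"
proof -
  have ev: "\<forall>\<^sub>F t in at 0. t *\<^sub>R k \<in> kcube"
  proof -
    have "open (box (\<chi> i. - pi) (\<chi> i. pi) :: (real ^ 'd) set)" by (rule open_box)
    moreover have "0 *\<^sub>R k \<in> box (\<chi> i. - pi) (\<chi> i. pi)" by (simp add: mem_box_cart)
    moreover have "((\<lambda>t. t *\<^sub>R k) \<longlongrightarrow> 0 *\<^sub>R k) (at 0)" by (intro tendsto_intros)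
    ultimately have "\<forall>\<^sub>F t in at 0. t *\<^sub>R k \<in> box (\<chi> i. - pi) (\<chi> i. pi)"
      by (metis topological_tendstoD)
    then show ?thesis unfolding kcube_def
      by eventually_elim (use box_subset_cbox in blast)
  qed
  have "((\<lambda>t. afun P (t *\<^sub>R R k) / t\<^sup>2) \<longlongrightarrow> second_moment P k / 2) (at 0)"
  proof (rule Lim_transform_eventually[OF second_moment_limit])
    show "\<forall>\<^sub>F t in at 0. afun P (t *\<^sub>R k) / t\<^sup>2 = afun P (t *\<^sub>R R k) / t\<^sup>2"
      using ev by eventually_elim (simp add: R[symmetric] inv)
  qed
  from LIM_unique[OF this second_moment_limit] show ?thesis by simp
qed

lemma second_moment_axis: "second_moment P (axis i 1) = second_moment P (axis j 1)"
proof -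
  define \<pi> where "\<pi> l = (if l = i then j else if l = j then i else l)" for l
  have bij: "bij \<pi>" by (rule o_bij[of \<pi> \<pi>]) (auto simp: \<pi>_def fun_eq_iff)
  define R where "R k = (\<chi> l. k $ \<pi> l)" for k :: "real ^ 'd"
  have "second_moment P (R (axis i 1)) = second_moment P (axis i 1)"
  proof (rule second_moment_invariant)
    show "afun P (R k) = afun P k" if "k \<in> kcube" for k
      using symmetric that bij unfolding cube_symmetric_def R_def by blast
  qed (simp add: R_def vec_eq_iff)
  moreover have "R (axis i 1) = axis j 1"
    by (auto simp: R_def vec_eq_iff axis_def \<pi>_def)
  ultimately show ?thesis by simp
qed

text \<open>Reflecting coordinate i exchanges k + c e_i and k - c e_i. Since both have the same
  value, the parallelogram law determines it, with no mixed term.\<close>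

lemma second_moment_split:
  assumes "k $ i = 0"
  shows "second_moment P (k + c *\<^sub>R axis i 1) = second_moment P k + c\<^sup>2 * second_moment P (axis i 1)"
proof -
  define R where "R k = (\<chi> j. if j = i then - (k $ j) else k $ j)" for k :: "real ^ 'd"
  have "second_moment P (R (k + c *\<^sub>R axis i 1)) = second_moment P (k + c *\<^sub>R axis i 1)"
  proof (rule second_moment_invariant)
    show "afun P (R k) = afun P k" if "k \<in> kcube" for k
      using symmetric that unfolding cube_symmetric_def R_def by blast
  qed (simp add: R_def vec_eq_iff)
  moreover have "R (k + c *\<^sub>R axis i 1) = k - c *\<^sub>R axis i 1"
    using assms by (auto simp: R_def vec_eq_iff axis_def)
  ultimately show ?thesis
    using second_moment_parallelogram[of k "c *\<^sub>R axis i 1"] by (simp add: second_moment_scale)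
qed

lemma second_moment_isotropic: "second_moment P k = (norm k)\<^sup>2 * second_moment P (axis i 1)"
proof -
  have "second_moment P (\<Sum>j\<in>S. (k $ j) *\<^sub>R axis j 1) = (\<Sum>j\<in>S. (k $ j)\<^sup>2) * second_moment P (axis i 1)"
    if "finite S" for S
    using that
  proof (induction S rule: finite_induct)
    case empty
    then show ?case using second_moment_scale[of 0 0] by simp
  next
    case (insert j S)
    have "(\<Sum>j\<in>S. (k $ j) *\<^sub>R axis j (1::real)) $ j = 0"
      using insert.hyps by (auto simp: axis_def intro!: sum.neutral)
    from second_moment_split[OF this, of "k $ j"] show ?case
      using insert second_moment_axis[of j i] by (simp add: add.commute distrib_right)
  qed
  from this[of UNIV] have "second_moment P (\<Sum>j\<in>UNIV. (k $ j) *\<^sub>R axis j 1) = (\<Sum>j\<in>UNIV. (k $ j)\<^sup>2) * second_moment P (axis i 1)" by simp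
  moreover have "(\<Sum>j\<in>UNIV. (k $ j) *\<^sub>R axis j 1) = k"
    using basis_expansion[of k] by (simp add: scalar_mult_eq_scaleR)
  moreover have "(\<Sum>j\<in>UNIV. (k $ j)\<^sup>2) = (norm k)\<^sup>2"
    by (simp add: norm_vec_def L2_set_def sum_nonneg)
  ultimately show ?thesis by simp
qed

lemma sigma2_eq: "sigma2 P = real CARD('d) * second_moment P (axis i 1)"
proof -
  have "sigma2 P = pmf_sum P (\<lambda>x. \<Sum>j\<in>UNIV. (axis j 1 \<bullet> lattice_vec x)\<^sup>2)"
    unfolding sigma2_def pmf_sum_def
    by (simp add: norm_vec_def L2_set_def sum_nonneg inner_axis' lattice_vec_def)
  also have "\<dots> = (\<Sum>j\<in>UNIV. second_moment P (axis j 1))"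
    using pmf_sum_sum[of UNIV P "\<lambda>j x. (axis j 1 \<bullet> lattice_vec x)\<^sup>2"] inner_sq_summable
    by (simp add: second_moment_def)
  also have "\<dots> = (\<Sum>j\<in>(UNIV :: 'd set). second_moment P (axis i 1))"
    by (intro sum.cong refl second_moment_axis)
  finally show ?thesis by simp
qed

lemma second_moment_eq: "second_moment P k = (norm k)\<^sup>2 * sigma2 P / real CARD('d)"
  using second_moment_isotropic[of k undefined] sigma2_eq[of undefined] by simp

end

section \<open>Integrals over momentum space\<close>

lemma integer_frequency_integral:
  fixes m :: int
  defines "h \<equiv> (\<lambda>t. indicator {-pi..pi} t *\<^sub>R exp (\<i> * complex_of_real (t * of_int m)))"
  shows "integrable lborel h" and "integral\<^sup>L lborel h = (if m = 0 then 2 * pi else 0)"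
proof -
  have cont: "continuous_on {-pi..pi} (\<lambda>t. exp (\<i> * complex_of_real (t * of_int m)))"
    by (intro continuous_intros)
  show "integrable lborel h"
    unfolding h_def by (rule borel_integrable_compact[OF compact_Icc cont])
  show "integral\<^sup>L lborel h = (if m = 0 then 2 * pi else 0)"
  proof (cases "m = 0")
    case True
    have "integral\<^sup>L lborel h = complex_of_real (measure lborel {-pi..pi})"
      unfolding h_def using True by (simp add: scaleR_conv_of_real)
    then show ?thesis using True by simp
  next
    case False
    define F where "F t = exp (\<i> * complex_of_real (t * of_int m)) / (\<i> * of_int m)" for t :: real
    have "integral\<^sup>L lborel h = F pi - F (-pi)"
      unfolding h_def
    proof (rule integral_FTC_Icc[OF _ _ cont])
      fix t :: real
      have "((\<lambda>z. exp (\<i> * (z * of_int m)) / (\<i> * of_int m)) has_field_derivative exp (\<i> * (complex_of_real t * of_int m))) (at (complex_of_real t))"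
        using False by (auto intro!: derivative_eq_intros simp: field_simps)
      then have "((\<lambda>t. exp (\<i> * (complex_of_real t * of_int m)) / (\<i> * of_int m)) has_vector_derivative
          exp (\<i> * (complex_of_real t * of_int m))) (at t within {-pi..pi})"
        by (rule has_vector_derivative_real_field)
      then show "(F has_vector_derivative exp (\<i> * complex_of_real (t * of_int m))) (at t within {-pi..pi})"
        by (simp add: F_def[abs_def])
    qed simp
    also have "F pi - F (-pi) = 0"
    proof -
      have "exp (\<i> * complex_of_real (pi * of_int m)) = exp (\<i> * complex_of_real (- pi * of_int m)) * exp (2 * of_int m * pi * \<i>)"
      proof -
        have "\<i> * complex_of_real (pi * of_int m) = \<i> * complex_of_real (- pi * of_int m) + 2 * of_int m * pi * \<i>"
          by (simp add: algebra_simps)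
        then show ?thesis by (simp only: exp_add)
      qed
      also have "exp (2 * of_int m * pi * \<i>) = (1 :: complex)"
        by (rule exp_integer_2pi) simp
      finally have "exp (\<i> * complex_of_real (pi * of_int m)) = exp (\<i> * complex_of_real (- pi * of_int m))"
        by (simp only: mult_1_right)
      then show ?thesis unfolding F_def by (simp only: diff_self)
    qed
    finally show ?thesis using False by simp
  qed
qed

lemma cube_frequency_integral:
  fixes w :: "int ^ 'd::finite"
  defines "g \<equiv> (\<lambda>k :: real ^ 'd. indicator kcube k *\<^sub>R exp (\<i> * complex_of_real (k \<bullet> lattice_vec w)))"
  shows "integrable lborel g" and "integral\<^sup>L lborel g = (if w = 0 then (2 * pi) ^ CARD('d) else 0)"
proof -
  have cont: "continuous_on kcube (\<lambda>k :: real ^ 'd. exp (\<i> * complex_of_real (k \<bullet> lattice_vec w)))"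
    by (intro continuous_intros)
  show "integrable lborel g"
    unfolding g_def by (rule borel_integrable_compact[OF _ cont]) (simp add: kcube_def compact_cbox)
  \<comment> \<open>The product measure is indexed by basis vectors, so m reads off the integer
    coordinate that belongs to a basis vector.\<close>
  define m where "m b = (if \<exists>i. b = axis i 1 then w $ (THE i. b = axis i 1) else 0)" for b :: "real ^ 'd"
  have m: "m (axis i 1) = w $ i" for i
  proof -
    have "(THE j. axis i 1 = (axis j 1 :: real ^ 'd)) = i" by (rule the_equality) (auto simp: axis_eq_axis)
    then show ?thesis by (auto simp: m_def)
  qed
  have B: "(Basis :: (real ^ 'd) set) = range (\<lambda>i. axis i 1)" by (auto simp: Basis_vec_def)
  define h where "h b t = indicator {-pi..pi} t *\<^sub>R exp (\<i> * complex_of_real (t * of_int (m b)))" for b :: "real ^ 'd" and t :: real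
  have gh: "g k = (\<Prod>b\<in>Basis. h b (k \<bullet> b))" for k
  proof -
    have "indicator kcube k = (\<Prod>b\<in>Basis. indicator {-pi..pi} (k \<bullet> b) :: real)"
    proof (cases "k \<in> kcube")
      case True
      then have "k \<bullet> b \<in> {-pi..pi}" if "b \<in> Basis" for b
        using that by (auto simp: kcube_def B mem_box_cart inner_axis)
      then show ?thesis using True by simp
    next
      case False
      then obtain i where "k $ i \<notin> {-pi..pi}" by (auto simp: kcube_def mem_box_cart)
      then have "indicator {-pi..pi} (k \<bullet> axis i 1) = (0::real)" by (simp add: inner_axis)
      moreover have "axis i 1 \<in> (Basis :: (real ^ 'd) set)" by (simp add: B)
      ultimately have "(\<Prod>b\<in>Basis. indicator {-pi..pi} (k \<bullet> b) :: real) = 0" by (intro prod_zero) auto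
      then show ?thesis using False by simp
    qed
    moreover have "k \<bullet> lattice_vec w = (\<Sum>b\<in>Basis. (k \<bullet> b) * of_int (m b))"
    proof -
      have "(\<Sum>b\<in>Basis. (k \<bullet> b) * of_int (m b)) = (\<Sum>i\<in>UNIV. (k \<bullet> axis i 1) * of_int (m (axis i 1)))"
        unfolding B by (subst sum.reindex) (auto simp: inj_on_def axis_eq_axis)
      also have "\<dots> = (\<Sum>i\<in>UNIV. k $ i * of_int (w $ i))" by (simp add: inner_axis m)
      also have "\<dots> = k \<bullet> lattice_vec w" by (simp add: inner_vec_def lattice_vec_def)
      finally show ?thesis by simp
    qed
    then have "exp (\<i> * complex_of_real (k \<bullet> lattice_vec w)) = (\<Prod>b\<in>Basis. exp (\<i> * complex_of_real ((k \<bullet> b) * of_int (m b))))"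
      by (simp add: exp_sum sum_distrib_left)
    ultimately show ?thesis
      unfolding g_def h_def scaleR_conv_of_real prod.distrib by simp
  qed
  interpret product_sigma_finite "\<lambda>_ :: real ^ 'd. lborel :: real measure" by standard
  have "integral\<^sup>L lborel g = integral\<^sup>L (distr (\<Pi>\<^sub>M b\<in>(Basis :: (real ^ 'd) set). lborel) borel (\<lambda>f. \<Sum>b\<in>Basis. f b *\<^sub>R b)) g"
    by (subst lborel_eq) (rule refl)
  also have "\<dots> = (\<integral>f. g (\<Sum>b\<in>Basis. f b *\<^sub>R b) \<partial>(\<Pi>\<^sub>M b\<in>(Basis :: (real ^ 'd) set). lborel))"
  proof (rule integral_distr)
    show "g \<in> borel_measurable borel" using borel_measurable_integrable[OF \<open>integrable lborel g\<close>] by simp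
  qed measurable
  also have "\<dots> = (\<integral>f. (\<Prod>b\<in>Basis. h b (f b)) \<partial>(\<Pi>\<^sub>M b\<in>(Basis :: (real ^ 'd) set). lborel))"
    unfolding gh by (intro Bochner_Integration.integral_cong refl prod.cong) (simp add: inner_sum_left_Basis)
  also have "\<dots> = (\<Prod>b\<in>(Basis :: (real ^ 'd) set). integral\<^sup>L lborel (h b))"
  proof (rule product_integral_prod)
    show "integrable lborel (h b)" for b
      unfolding h_def[abs_def] by (rule integer_frequency_integral(1))
  qed simp
  also have "\<dots> = (\<Prod>b\<in>(Basis :: (real ^ 'd) set). if m b = 0 then 2 * pi else 0)"
    unfolding h_def[abs_def] integer_frequency_integral(2) by (simp only: of_real_prod)
  also have "\<dots> = (if w = 0 then (2 * pi) ^ CARD('d) else 0)"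
  proof (cases "w = 0")
    case True
    then have "m b = 0" if "b \<in> Basis" for b using that m by (auto simp: B)
    then show ?thesis using True by simp
  next
    case False
    then obtain i where "w $ i \<noteq> 0" by (auto simp: vec_eq_iff)
    then have "m (axis i 1) \<noteq> 0" "axis i 1 \<in> (Basis :: (real ^ 'd) set)" using m by (auto simp: B)
    then show ?thesis using False by auto
  qed
  finally show "integral\<^sup>L lborel g = (if w = 0 then (2 * pi) ^ CARD('d) else 0)" .
qed

text \<open>Finite truncations of \<open>Dhat\<close>. Parseval's identity is proved for these,
  where sum and integral commute; the bound for \<open>Dhat\<close> follows by uniform
  approximation.\<close>

definition trig_poly :: "(int ^ 'd::finite) pmf \<Rightarrow> (int ^ 'd) set \<Rightarrow> real ^ 'd \<Rightarrow> complex" where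
  "trig_poly P S k = (\<Sum>x\<in>S. complex_of_real (pmf P x) * exp (\<i> * complex_of_real (k \<bullet> lattice_vec x)))"

lemma trig_poly_measurable [measurable]: "trig_poly P S \<in> borel_measurable borel"
  unfolding trig_poly_def[abs_def]
  by (intro borel_measurable_continuous_onI continuous_intros)

lemma trig_poly_parseval:
  fixes P :: "(int ^ 'd::finite) pmf"
  assumes S: "finite S"
  shows "(\<integral>\<^sup>+k. ennreal (indicator kcube k * (norm (trig_poly P S k))\<^sup>2) \<partial>lborel) = ennreal ((2 * pi) ^ CARD('d) * (\<Sum>x\<in>S. (pmf P x)\<^sup>2))"
proof -
  define e where "e w k = indicator kcube k *\<^sub>R exp (\<i> * complex_of_real (k \<bullet> lattice_vec w))" for w :: "int ^ 'd" and k :: "real ^ 'd"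
  have sub: "lattice_vec (x - y) = lattice_vec x - lattice_vec y" for x y :: "int ^ 'd"
    by (simp add: lattice_vec_def vec_eq_iff)
  have expand: "complex_of_real (indicator kcube k * (norm (trig_poly P S k))\<^sup>2)
      = (\<Sum>x\<in>S. \<Sum>y\<in>S. complex_of_real (pmf P x * pmf P y) * e (x - y) k)" for k
  proof -
    have "complex_of_real ((norm (trig_poly P S k))\<^sup>2) = trig_poly P S k * cnj (trig_poly P S k)"
      by (rule complex_norm_square)
    also have "\<dots> = (\<Sum>x\<in>S. \<Sum>y\<in>S. complex_of_real (pmf P x * pmf P y) * exp (\<i> * complex_of_real (k \<bullet> lattice_vec (x - y))))"
      unfolding trig_poly_def cnj_sum sum_product
    proof (intro sum.cong refl)
      fix x y
      have key: "exp (\<i> * complex_of_real a) * cnj (exp (\<i> * complex_of_real b)) = exp (\<i> * complex_of_real (a - b))" for a b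
      proof -
        have "cnj (exp (\<i> * complex_of_real b)) = exp (- (\<i> * complex_of_real b))" by (simp add: exp_cnj)
        moreover have "\<i> * complex_of_real a + - (\<i> * complex_of_real b) = \<i> * complex_of_real (a - b)"
          by (simp add: algebra_simps)
        ultimately show ?thesis by (simp only: exp_add[symmetric])
      qed
      have gen: "p * X * cnj (q * Y) = p * q * (X * cnj Y)" if "cnj q = q" for p q X Y
        using that by simp
      have "complex_of_real (pmf P x) * exp (\<i> * complex_of_real (k \<bullet> lattice_vec x)) *
           cnj (complex_of_real (pmf P y) * exp (\<i> * complex_of_real (k \<bullet> lattice_vec y)))
         = complex_of_real (pmf P x * pmf P y) *
           (exp (\<i> * complex_of_real (k \<bullet> lattice_vec x)) * cnj (exp (\<i> * complex_of_real (k \<bullet> lattice_vec y))))"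
        unfolding of_real_mult by (rule gen) (rule complex_cnj_complex_of_real)
      also have "exp (\<i> * complex_of_real (k \<bullet> lattice_vec x)) * cnj (exp (\<i> * complex_of_real (k \<bullet> lattice_vec y)))
          = exp (\<i> * complex_of_real (k \<bullet> lattice_vec (x - y)))"
        unfolding sub inner_diff_right by (rule key)
      finally show "complex_of_real (pmf P x) * exp (\<i> * complex_of_real (k \<bullet> lattice_vec x)) *
           cnj (complex_of_real (pmf P y) * exp (\<i> * complex_of_real (k \<bullet> lattice_vec y)))
         = complex_of_real (pmf P x * pmf P y) * exp (\<i> * complex_of_real (k \<bullet> lattice_vec (x - y)))" .
    qed
    finally have "complex_of_real (indicator kcube k) * complex_of_real ((norm (trig_poly P S k))\<^sup>2)
       = complex_of_real (indicator kcube k) * (\<Sum>x\<in>S. \<Sum>y\<in>S. complex_of_real (pmf P x * pmf P y) * exp (\<i> * complex_of_real (k \<bullet> lattice_vec (x - y))))"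
      by simp
    then show ?thesis by (simp add: e_def scaleR_conv_of_real sum_distrib_left mult_ac)
  qed
  have int: "integrable lborel (e w)" "integral\<^sup>L lborel (e w) = (if w = 0 then (2 * pi) ^ CARD('d) else 0)" for w
    unfolding e_def[abs_def] by (rule cube_frequency_integral)+
  have hb: "has_bochner_integral lborel (\<lambda>k. complex_of_real (indicator kcube k * (norm (trig_poly P S k))\<^sup>2))
      (\<Sum>x\<in>S. \<Sum>y\<in>S. complex_of_real (pmf P x * pmf P y) * (if x - y = 0 then (2 * pi) ^ CARD('d) else 0))"
    unfolding expand
    by (intro has_bochner_integral_sum has_bochner_integral_mult_right)
       (use int in \<open>simp add: has_bochner_integral_iff\<close>)
  have "(\<Sum>x\<in>S. \<Sum>y\<in>S. complex_of_real (pmf P x * pmf P y) * (if x - y = 0 then (2 * pi) ^ CARD('d) else 0))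
      = (\<Sum>x\<in>S. complex_of_real ((2 * pi) ^ CARD('d) * (pmf P x)\<^sup>2))"
  proof (rule sum.cong[OF refl])
    fix x assume x: "x \<in> S"
    have "(\<Sum>y\<in>S. complex_of_real (pmf P x * pmf P y) * (if x - y = 0 then (2 * pi) ^ CARD('d) else 0))
        = (\<Sum>y\<in>S. if y = x then complex_of_real (pmf P x * pmf P x) * (2 * pi) ^ CARD('d) else 0)"
      by (intro sum.cong refl) auto
    then show "(\<Sum>y\<in>S. complex_of_real (pmf P x * pmf P y) * (if x - y = 0 then (2 * pi) ^ CARD('d) else 0))
        = complex_of_real ((2 * pi) ^ CARD('d) * (pmf P x)\<^sup>2)"
      using S x by (simp add: power2_eq_square mult_ac)
  qed
  also have "\<dots> = complex_of_real ((2 * pi) ^ CARD('d) * (\<Sum>x\<in>S. (pmf P x)\<^sup>2))"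
    by (simp add: sum_distrib_left)
  finally have hb': "has_bochner_integral lborel (\<lambda>k. complex_of_real (indicator kcube k * (norm (trig_poly P S k))\<^sup>2))
      (complex_of_real ((2 * pi) ^ CARD('d) * (\<Sum>x\<in>S. (pmf P x)\<^sup>2)))"
    using hb by simp
  have "has_bochner_integral lborel (\<lambda>k. indicator kcube k * (norm (trig_poly P S k))\<^sup>2)
      ((2 * pi) ^ CARD('d) * (\<Sum>x\<in>S. (pmf P x)\<^sup>2))"
    using has_bochner_integral_Re[OF hb'] by (simp only: Re_complex_of_real)
  then show ?thesis
    by (intro nn_integral_eq_integral[THEN trans]) (auto simp: has_bochner_integral_iff)
qed

text \<open>The approximation is uniform in k because the remainder is bounded by the mass outside
  S.\<close>

lemma Dhat_approx:
  fixes P :: "(int ^ 'd::finite) pmf"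
  assumes "\<rho> > 0"
  obtains S where "finite S" "\<And>k. norm (Dhat P k - trig_poly P S k) \<le> \<rho>"
proof -
  obtain S where S: "finite S" "dist (sum (pmf P) S) (infsum (pmf P) UNIV) \<le> \<rho>"
    using infsum_finite_approximation[OF pmf_summable_on[of P] assms] by blast
  have sub: "pmf P summable_on A" for A
    by (rule summable_on_subset_banach[OF pmf_summable_on]) simp
  have split: "infsum (pmf P) UNIV = sum (pmf P) S + infsum (pmf P) (- S)"
  proof -
    have "infsum (pmf P) (S \<union> - S) = infsum (pmf P) S + infsum (pmf P) (- S)"
      by (rule infsum_Un_disjoint[OF sub sub]) simp
    then show ?thesis unfolding Compl_partition using S(1) by (simp only: infsum_finite)
  qed
  have r: "infsum (pmf P) (- S) \<le> \<rho>"
    using S(2) split by (simp add: dist_real_def)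
  have "norm (Dhat P k - trig_poly P S k) \<le> \<rho>" for k
  proof -
    define u where "u x = complex_of_real (pmf P x) * exp (\<i> * complex_of_real (k \<bullet> lattice_vec x))" for x
    have un: "norm (u x) = pmf P x" for x by (simp add: u_def norm_mult)
    have us: "(\<lambda>x. norm (u x)) summable_on A" for A
      unfolding un by (rule sub)
    have "Dhat P k = infsum u UNIV" unfolding Dhat_def u_def ..
    also have "\<dots> = infsum u S + infsum u (- S)"
      using infsum_Un_disjoint[of u S "- S"] Infinite_Sum.abs_summable_summable[OF us] by (simp add: Compl_partition)
    also have "infsum u S = trig_poly P S k" using S(1) by (simp add: trig_poly_def u_def)
    finally have "Dhat P k - trig_poly P S k = infsum u (- S)" by simp
    moreover have "norm (infsum u (- S)) \<le> \<rho>"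
      using norm_infsum_bound[OF us, of "- S"] r by (simp add: un)
    ultimately show ?thesis by simp
  qed
  with S(1) show ?thesis using that by blast
qed

lemma Dhat_measurable [measurable]: "Dhat P \<in> borel_measurable borel"
proof -
  have "\<exists>S. \<forall>k. norm (Dhat P k - trig_poly P S k) \<le> 1 / real (Suc n)" for n
    using Dhat_approx[of "1 / real (Suc n)" P] by (metis divide_pos_pos of_nat_0_less_iff zero_less_Suc zero_less_one)
  then obtain S where S: "\<And>n k. norm (Dhat P k - trig_poly P (S n) k) \<le> 1 / real (Suc n)" by metis
  show ?thesis
  proof (rule borel_measurable_LIMSEQ_metric)
    show "trig_poly P (S n) \<in> borel_measurable borel" for n by (rule trig_poly_measurable)
    fix k
    have "(\<lambda>n. trig_poly P (S n) k - Dhat P k) \<longlonglongrightarrow> 0"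
    proof (rule Lim_null_comparison[OF _ LIMSEQ_inverse_real_of_nat])
      show "\<forall>\<^sub>F n in sequentially. norm (trig_poly P (S n) k - Dhat P k) \<le> inverse (real (Suc n))"
        using S by (intro always_eventually) (simp add: norm_minus_commute inverse_eq_divide)
    qed
    then show "(\<lambda>n. trig_poly P (S n) k) \<longlonglongrightarrow> Dhat P k" by (rule LIM_zero_cancel)
  qed
qed

lemma pmf_bdd_above: "bdd_above (range (pmf P))"
  by (rule bdd_aboveI[of _ 1]) (auto simp: pmf_le_1)

text \<open>The factor 4 in place of 1 pays for approximating \<open>Dhat\<close> within sqrt m,
  where m is the supremum of the masses, and for (x + y)^2 \<le> 2 x^2 + 2 y^2. The sum of squared
  masses is at most m, so each of the two parts contributes at most 2 m times the volume. Under
  Assumption D the result is of order L^(-d).\<close>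

lemma Dhat_square_integral:
  fixes P :: "(int ^ 'd::finite) pmf"
  shows "(\<integral>\<^sup>+k. ennreal (indicator kcube k * (norm (Dhat P k))\<^sup>2) \<partial>lborel) \<le> ennreal (4 * (2 * pi) ^ CARD('d) * (SUP x. pmf P x))"
proof -
  define m where "m = (SUP x. pmf P x)"
  have le: "pmf P x \<le> m" for x unfolding m_def by (rule cSUP_upper[OF _ pmf_bdd_above]) simp
  have m: "m > 0"
  proof -
    obtain x where "x \<in> set_pmf P" using set_pmf_not_empty[of P] by blast
    then have "pmf P x > 0" by (rule pmf_positive)
    then show ?thesis using le[of x] by linarith
  qed
  obtain S where S: "finite S" "\<And>k. norm (Dhat P k - trig_poly P S k) \<le> sqrt m"
    using Dhat_approx[of "sqrt m" P] m by auto
  have near: "norm (Dhat P k) \<le> norm (trig_poly P S k) + sqrt m" for k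
    using S(2)[of k] norm_triangle_ineq2[of "Dhat P k" "trig_poly P S k"] by linarith
  have pt: "indicator kcube k * (norm (Dhat P k))\<^sup>2 \<le> 2 * (indicator kcube k * (norm (trig_poly P S k))\<^sup>2) + 2 * m * indicator kcube k" for k
  proof -
    have "(norm (Dhat P k))\<^sup>2 \<le> (norm (trig_poly P S k) + sqrt m)\<^sup>2" by (intro power_mono near) simp
    also have "\<dots> \<le> 2 * (norm (trig_poly P S k))\<^sup>2 + 2 * (sqrt m)\<^sup>2"
      using sum_squares_bound[of "norm (trig_poly P S k)" "sqrt m"] by (simp add: power2_sum)
    finally show ?thesis using m by (simp add: indicator_def)
  qed
  have "(\<integral>\<^sup>+k. ennreal (indicator kcube k * (norm (Dhat P k))\<^sup>2) \<partial>lborel)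
      \<le> (\<integral>\<^sup>+k. 2 * ennreal (indicator kcube k * (norm (trig_poly P S k))\<^sup>2) + ennreal (2 * m) * indicator kcube k \<partial>lborel)"
  proof (rule nn_integral_mono)
    fix k
    have "ennreal (indicator kcube k * (norm (Dhat P k))\<^sup>2) \<le> ennreal (2 * (indicator kcube k * (norm (trig_poly P S k))\<^sup>2) + 2 * m * indicator kcube k)"
      by (intro ennreal_leI pt)
    also have "\<dots> = 2 * ennreal (indicator kcube k * (norm (trig_poly P S k))\<^sup>2) + ennreal (2 * m) * indicator kcube k"
      using m by (simp add: ennreal_plus ennreal_mult indicator_def)
    finally show "ennreal (indicator kcube k * (norm (Dhat P k))\<^sup>2) \<le> 2 * ennreal (indicator kcube k * (norm (trig_poly P S k))\<^sup>2) + ennreal (2 * m) * indicator kcube k" .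
  qed
  also have "\<dots> = 2 * ennreal ((2 * pi) ^ CARD('d) * (\<Sum>x\<in>S. (pmf P x)\<^sup>2)) + ennreal (2 * m) * emeasure lborel (kcube :: (real ^ 'd) set)"
  proof -
    have [measurable]: "(kcube :: (real ^ 'd) set) \<in> sets borel" by (simp add: kcube_def)
    show ?thesis
      by (subst nn_integral_add) (auto simp: nn_integral_cmult trig_poly_parseval[OF S(1)])
  qed
  also have "emeasure lborel (kcube :: (real ^ 'd) set) = ennreal ((2 * pi) ^ CARD('d))"
  proof -
    have "emeasure lborel (kcube :: (real ^ 'd) set) = ennreal (\<Prod>b\<in>Basis. ((\<chi> i. pi) - (\<chi> i. - pi) :: real ^ 'd) \<bullet> b)"
      unfolding kcube_def by (rule emeasure_lborel_cbox) (auto simp: Basis_vec_def inner_axis)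
    also have "(\<Prod>b\<in>Basis. ((\<chi> i. pi) - (\<chi> i. - pi) :: real ^ 'd) \<bullet> b) = (\<Prod>b\<in>(Basis :: (real ^ 'd) set). 2 * pi)"
      by (intro prod.cong) (auto simp: Basis_vec_def inner_axis)
    finally show ?thesis by simp
  qed
  also have "2 * ennreal ((2 * pi) ^ CARD('d) * (\<Sum>x\<in>S. (pmf P x)\<^sup>2)) + ennreal (2 * m) * ennreal ((2 * pi) ^ CARD('d))
      = ennreal (2 * ((2 * pi) ^ CARD('d) * (\<Sum>x\<in>S. (pmf P x)\<^sup>2)) + 2 * m * (2 * pi) ^ CARD('d))"
    using m by (simp add: ennreal_plus ennreal_mult sum_nonneg)
  also have "\<dots> \<le> ennreal (4 * (2 * pi) ^ CARD('d) * m)"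
  proof (rule ennreal_leI)
    have "(\<Sum>x\<in>S. (pmf P x)\<^sup>2) \<le> (\<Sum>x\<in>S. m * pmf P x)"
      unfolding power2_eq_square by (intro sum_mono mult_right_mono le) simp
    also have "\<dots> = m * sum (pmf P) S" by (simp add: sum_distrib_left)
    also have "\<dots> \<le> m * 1"
    proof (rule mult_left_mono)
      have "sum (pmf P) S = measure (measure_pmf P) S" using S(1) by (simp add: measure_measure_pmf_finite)
      then show "sum (pmf P) S \<le> 1" by simp
    qed (use m in simp)
    finally have "(2 * pi) ^ CARD('d) * (\<Sum>x\<in>S. (pmf P x)\<^sup>2) \<le> (2 * pi) ^ CARD('d) * m"
      by (intro mult_left_mono) auto
    then show "2 * ((2 * pi) ^ CARD('d) * (\<Sum>x\<in>S. (pmf P x)\<^sup>2)) + 2 * m * (2 * pi) ^ CARD('d) \<le> 4 * (2 * pi) ^ CARD('d) * m"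
      by (simp add: algebra_simps)
  qed
  finally show ?thesis by (simp add: m_def)
qed

text \<open>A substitute for polar coordinates: a function that at every point lies below one of
  countably many multiples of balls is integrated by adding volumes. In the applications the radii
  are dyadic and the sum is geometric.\<close>

lemma dyadic_integral:
  fixes f :: "'a::euclidean_space \<Rightarrow> real" and c r :: "nat \<Rightarrow> real"
  assumes cover: "\<And>k. \<exists>j. f k \<le> c j * indicator (cball 0 (r j)) k"
    and nn: "\<And>j. c j \<ge> 0" "\<And>j. r j \<ge> 0" and sums: "(\<lambda>j. c j * r j ^ DIM('a)) sums s"
  shows "(\<integral>\<^sup>+k. ennreal (f k) \<partial>lborel) \<le> ennreal (unit_ball_vol (DIM('a)) * s)"
proof -
  have "(\<integral>\<^sup>+k. ennreal (f k) \<partial>lborel) \<le> (\<integral>\<^sup>+(k :: 'a). (\<Sum>j. ennreal (c j) * indicator (cball 0 (r j)) k) \<partial>lborel)"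
  proof (rule nn_integral_mono)
    fix k
    obtain j where j: "f k \<le> c j * indicator (cball 0 (r j)) k" using cover by blast
    then have "ennreal (f k) \<le> ennreal (c j * indicator (cball 0 (r j)) k)" by (rule ennreal_leI)
    also have "\<dots> = ennreal (c j) * indicator (cball 0 (r j)) k" by (simp add: indicator_def)
    also have "\<dots> \<le> (\<Sum>j. ennreal (c j) * indicator (cball 0 (r j)) k)"
    proof -
      define G where "G i = ennreal (c i) * indicator (cball 0 (r i)) k" for i
      have "G j = sum G {j}" by simp
      also have "\<dots> \<le> suminf G" by (rule sum_le_suminf) auto
      finally show ?thesis unfolding G_def .
    qed
    finally show "ennreal (f k) \<le> (\<Sum>j. ennreal (c j) * indicator (cball 0 (r j)) k)" .
  qed
  also have "\<dots> = (\<Sum>j. ennreal (c j) * emeasure lborel (cball (0 :: 'a) (r j)))"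
  proof -
    have [measurable]: "cball (0 :: 'a) (r i) \<in> sets borel" for i by (rule borel_closed) simp
    show ?thesis by (subst nn_integral_suminf) (simp_all add: nn_integral_cmult_indicator)
  qed
  also have "\<dots> = (\<Sum>j. ennreal (unit_ball_vol (DIM('a)) * (c j * r j ^ DIM('a))))"
    by (intro suminf_cong) (use nn in \<open>simp add: emeasure_cball ennreal_mult mult_ac\<close>)
  also have "\<dots> = ennreal (unit_ball_vol (DIM('a)) * s)"
    by (rule suminf_ennreal_eq) (use nn in \<open>auto intro!: sums_mult sums\<close>)
  finally show ?thesis .
qed

section \<open>Radial integrals over dyadic balls\<close>

lemma ex_dyadic_scale:
  fixes y :: real assumes "y > 1"
  shows "\<exists>j. 2 ^ j < y \<and> y \<le> 2 ^ Suc j"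
proof -
  obtain n where n: "y < 2 ^ n" using real_arch_pow[of 2 y] by auto
  define j where "j = (LEAST n. y \<le> 2 ^ n)"
  have j: "y \<le> 2 ^ j" unfolding j_def by (rule LeastI[of _ n]) (use n in simp)
  have "j \<noteq> 0" using j assms by (intro notI) simp
  then obtain i where i: "j = Suc i" by (cases j) auto
  have "\<not> y \<le> 2 ^ i" using not_less_Least[of i "\<lambda>n. y \<le> 2 ^ n"] i by (simp add: j_def)
  then show ?thesis using j i by (intro exI[of _ i]) auto
qed

lemma two_power_square: "((2 :: real) ^ j)\<^sup>2 = 4 ^ j"
  by (simp add: power2_eq_square flip: power_mult_distrib)

lemma four_powr: "(4 :: real) powr a = 2 powr (2 * a)"
  using powr_powr[of 2 2 a] by simp

text \<open>On the j-th ball the integrand is of order 4^(- q j) and the volume of order 2^(d j), so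
  the series converges for q > d / 2. Scaling makes V independent of R.\<close>

lemma decaying_radial_integral:
  fixes q :: real
  assumes q: "q > real DIM('a::euclidean_space) / 2"
  shows "\<exists>V\<ge>0. \<forall>R>0. (\<integral>\<^sup>+k. ennreal ((1 + (norm (k :: 'a) / R)\<^sup>2) powr (- q)) \<partial>lborel) \<le> ennreal (V * R ^ DIM('a))"
proof -
  define x where "x = 2 ^ DIM('a) * 4 powr (- q)"
  have x: "0 \<le> x" "x < 1"
  proof -
    have "(4::real) powr (- q) < 4 powr (- (real DIM('a) / 2))" by (rule powr_less_mono) (use q in auto)
    also have "\<dots> = 2 powr (2 * (- (real DIM('a) / 2)))" by (rule four_powr)
    also have "\<dots> = 1 / 2 ^ DIM('a)" by (simp add: powr_minus powr_realpow divide_simps)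
    finally show "x < 1" by (simp add: x_def field_simps)
  qed (simp add: x_def)
  have q0: "q > 0" using q by (smt (verit) divide_nonneg_pos of_nat_0_le_iff)
  define s where "s = 4 powr q * (1 / (1 - x))"
  have s: "s \<ge> 0" using x by (simp add: s_def)
  show ?thesis
  proof (rule exI[of _ "unit_ball_vol (DIM('a)) * s"], intro conjI allI impI)
    show "0 \<le> unit_ball_vol (DIM('a)) * s" using s by simp
    fix R :: real assume R: "R > 0"
    have "(\<integral>\<^sup>+k. ennreal ((1 + (norm (k :: 'a) / R)\<^sup>2) powr (- q)) \<partial>lborel) \<le> ennreal (unit_ball_vol (DIM('a)) * (s * R ^ DIM('a)))"
    proof (rule dyadic_integral)
      fix k :: 'a
      define y where "y = norm k / R"
      have y0: "y \<ge> 0" using R by (simp add: y_def)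
      have g: "(1 + y\<^sup>2) powr (- q) \<le> 1" using q0 y0 powr_mono2'[of "- q" 1 "1 + y\<^sup>2"] by simp
      show "\<exists>j. (1 + (norm k / R)\<^sup>2) powr (- q) \<le> (4 powr q * (4 powr (- q)) ^ j) * indicator (cball 0 (2 ^ j * R)) k"
      proof (cases "y \<le> 1")
        case True
        then have "k \<in> cball 0 (2 ^ 0 * R)" using R by (simp add: y_def field_simps)
        moreover have "1 \<le> (4::real) powr q" using q0 by (intro ge_one_powr_ge_zero) auto
        ultimately show ?thesis using g by (intro exI[of _ 0]) (simp add: y_def)
      next
        case False
        then obtain j where j: "2 ^ j < y" "y \<le> 2 ^ Suc j" using ex_dyadic_scale[of y] by auto
        have "(1 + y\<^sup>2) powr (- q) \<le> ((2 ^ j)\<^sup>2) powr (- q)"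
        proof (rule powr_mono2')
          have "(2 ^ j)\<^sup>2 \<le> y\<^sup>2" using j by (intro power_mono) auto
          then show "(2 ^ j)\<^sup>2 \<le> 1 + y\<^sup>2" by linarith
        qed (use q0 in auto)
        also have "((2 ^ j)\<^sup>2) powr (- q) = (4 powr (- q)) ^ j"
        proof -
          have "((2 ^ j)\<^sup>2 :: real) = 4 powr real j" by (simp add: two_power_square powr_realpow)
          then show ?thesis by (simp add: powr_powr powr_realpow[symmetric] mult.commute)
        qed
        also have "\<dots> = 4 powr q * (4 powr (- q)) ^ Suc j" by (simp add: powr_minus field_simps)
        finally have "(1 + y\<^sup>2) powr (- q) \<le> 4 powr q * (4 powr (- q)) ^ Suc j" .
        moreover have "k \<in> cball 0 (2 ^ Suc j * R)" using j R by (simp add: y_def field_simps)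
        ultimately show ?thesis by (intro exI[of _ "Suc j"]) (simp add: y_def)
      qed
    next
      have "(\<lambda>j. (4 powr q * R ^ DIM('a)) * x ^ j) sums ((4 powr q * R ^ DIM('a)) * (1 / (1 - x)))"
        by (intro sums_mult geometric_sums) (use x in simp)
      moreover have "(\<lambda>j. (4 powr q * R ^ DIM('a)) * x ^ j) = (\<lambda>j. (4 powr q * (4 powr (- q)) ^ j) * (2 ^ j * R) ^ DIM('a))"
        by (rule ext) (simp add: x_def power_mult_distrib mult_ac flip: power_mult)
      ultimately show "(\<lambda>j. (4 powr q * (4 powr (- q)) ^ j) * (2 ^ j * R) ^ DIM('a)) sums (s * R ^ DIM('a))"
        by (simp add: s_def mult_ac)
    qed (use R in auto)
    then show "(\<integral>\<^sup>+k. ennreal ((1 + (norm (k :: 'a) / R)\<^sup>2) powr (- q)) \<partial>lborel) \<le> ennreal (unit_ball_vol (DIM('a)) * s * R ^ DIM('a))"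
      by (simp add: mult.assoc)
  qed
qed

lemma singular_radial_integral:
  fixes q :: real
  assumes q: "0 \<le> q" "q < real DIM('a::euclidean_space) / 2"
  shows "\<exists>V\<ge>0. \<forall>R>0. (\<integral>\<^sup>+k. ennreal (((norm (k :: 'a) / R)\<^sup>2) powr (- q) * indicator (cball 0 R) k) \<partial>lborel) \<le> ennreal (V * R ^ DIM('a))"
proof -
  define x where "x = 4 powr q / 2 ^ DIM('a)"
  have x: "0 \<le> x" "x < 1"
  proof -
    have "(4::real) powr q < 4 powr (real DIM('a) / 2)" by (rule powr_less_mono) (use q in auto)
    also have "\<dots> = 2 powr (2 * (real DIM('a) / 2))" by (rule four_powr)
    also have "\<dots> = 2 ^ DIM('a)" by (simp add: powr_realpow)
    finally show "x < 1" by (simp add: x_def field_simps)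
  qed (simp add: x_def)
  define s where "s = 4 powr q * (1 / (1 - x))"
  have s: "s \<ge> 0" using x by (simp add: s_def)
  show ?thesis
  proof (rule exI[of _ "unit_ball_vol (DIM('a)) * s"], intro conjI allI impI)
    show "0 \<le> unit_ball_vol (DIM('a)) * s" using s by simp
    fix R :: real assume R: "R > 0"
    have "(\<integral>\<^sup>+k. ennreal (((norm (k :: 'a) / R)\<^sup>2) powr (- q) * indicator (cball 0 R) k) \<partial>lborel) \<le> ennreal (unit_ball_vol (DIM('a)) * (s * R ^ DIM('a)))"
    proof (rule dyadic_integral)
      fix k :: 'a
      define y where "y = norm k / R"
      have y0: "y \<ge> 0" using R by (simp add: y_def)
      consider "k = 0" | "k \<notin> cball 0 R" | "0 < y" "y \<le> 1"
        using R by (cases "k = 0") (auto simp: y_def field_simps)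
      then show "\<exists>j. ((norm k / R)\<^sup>2) powr (- q) * indicator (cball 0 R) k \<le> (4 powr q * (4 powr q) ^ j) * indicator (cball 0 (R / 2 ^ j)) k"
      proof cases
        \<comment> \<open>At the origin \<open>0 powr (- q)\<close> is 0, so the singular point is
          covered by any ball.\<close>
        case 1
        then show ?thesis using R by (intro exI[of _ 0]) simp
      next
        case 2
        then show ?thesis by (intro exI[of _ 0]) simp
      next
        case 3
        have "2 / y > 1" using 3 by (simp add: field_simps)
        then obtain j where j: "2 ^ j < 2 / y" "2 / y \<le> 2 ^ Suc j" using ex_dyadic_scale by blast
        have yj: "y \<le> 2 / 2 ^ j" "1 / 2 ^ j \<le> y" using j 3 by (auto simp: field_simps)
        show ?thesis
        proof (cases j)
          case 0
          then have y1: "y = 1" using yj 3 by simp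
          have "1 \<le> (4::real) powr q" using q by (intro ge_one_powr_ge_zero) auto
          then show ?thesis using y1 by (intro exI[of _ 0]) (auto simp: y_def indicator_def)
        next
          case (Suc i)
          have "(y\<^sup>2) powr (- q) \<le> ((1 / 2 ^ j)\<^sup>2) powr (- q)"
          proof (rule powr_mono2')
            show "(1 / 2 ^ j)\<^sup>2 \<le> y\<^sup>2" using yj by (intro power_mono) auto
          qed (use q in auto)
          also have "((1 / 2 ^ j)\<^sup>2) powr (- q) = (4 powr q) ^ j"
          proof -
            have "((1 / 2 ^ j)\<^sup>2 :: real) = 4 powr (- real j)"
              unfolding power_one_over two_power_square by (simp add: powr_minus_divide powr_realpow)
            moreover have "(4 powr q) ^ j = (4 powr q) powr real j" by (rule powr_realpow[symmetric]) simp
            ultimately show ?thesis by (simp only: powr_powr minus_mult_minus mult.commute)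
          qed
          also have "\<dots> = 4 powr q * (4 powr q) ^ i" by (simp add: Suc)
          finally have "(y\<^sup>2) powr (- q) \<le> 4 powr q * (4 powr q) ^ i" .
          moreover have "k \<in> cball 0 (R / 2 ^ i)" using yj(1) R by (simp add: y_def Suc field_simps)
          ultimately show ?thesis by (intro exI[of _ i]) (auto simp: y_def indicator_def)
        qed
      qed
    next
      have "(\<lambda>j. (4 powr q * R ^ DIM('a)) * x ^ j) sums ((4 powr q * R ^ DIM('a)) * (1 / (1 - x)))"
        by (intro sums_mult geometric_sums) (use x in simp)
      moreover have "(\<lambda>j. (4 powr q * R ^ DIM('a)) * x ^ j) = (\<lambda>j. (4 powr q * (4 powr q) ^ j) * (R / 2 ^ j) ^ DIM('a))"
      proof (rule ext)
        fix j
        have "((2 :: real) ^ j) ^ DIM('a) = (2 ^ DIM('a)) ^ j" by (simp only: power_mult[symmetric] mult.commute)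
        then show "(4 powr q * R ^ DIM('a)) * x ^ j = (4 powr q * (4 powr q) ^ j) * (R / 2 ^ j) ^ DIM('a)"
          unfolding x_def power_divide by (simp only: times_divide_eq_left times_divide_eq_right mult_ac)
      qed
      ultimately show "(\<lambda>j. (4 powr q * (4 powr q) ^ j) * (R / 2 ^ j) ^ DIM('a)) sums (s * R ^ DIM('a))"
        by (simp add: s_def mult_ac)
    qed (use R in auto)
    then show "(\<integral>\<^sup>+k. ennreal (((norm (k :: 'a) / R)\<^sup>2) powr (- q) * indicator (cball 0 R) k) \<partial>lborel) \<le> ennreal (unit_ball_vol (DIM('a)) * s * R ^ DIM('a))"
      by (simp add: mult.assoc)
  qed
qed

section \<open>Norms of products with the square of \<open>Dhat\<close>\<close>

lemma lp_norm_le: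
  assumes "c \<ge> 0" "p \<ge> 1"
    and "(\<integral>\<^sup>+ k \<in> kcube. ennreal (norm (h k) powr p / (2 * pi) ^ CARD('d)) \<partial>lebesgue) \<le> ennreal (c powr p)"
  shows "lp_norm p (h :: real ^ 'd \<Rightarrow> complex) \<le> ennreal c"
proof -
  define I where "I = (\<integral>\<^sup>+ k \<in> kcube. ennreal (norm (h k) powr p / (2 * pi) ^ CARD('d)) \<partial>lebesgue)"
  have I: "I \<le> ennreal (c powr p)" using assms(3) by (simp only: I_def)
  then have It: "I \<noteq> \<top>" by (auto simp: top_unique)
  have "enn2real I \<le> c powr p" using I by (metis enn2real_leI powr_ge_zero)
  then have "enn2real I powr (1 / p) \<le> (c powr p) powr (1 / p)"
    using assms by (intro powr_mono2) auto
  also have "\<dots> = c" using assms by (simp add: powr_powr)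
  finally show ?thesis
    using It unfolding lp_norm_def I_def[symmetric] Let_def by (simp add: ennreal_leI)
qed

lemma add_powr_le: "0 \<le> x \<Longrightarrow> 0 \<le> y \<Longrightarrow> 1 \<le> p \<Longrightarrow> x powr p + y powr p \<le> (x + y) powr p" for x y p :: real
proof -
  assume *: "0 \<le> x" "0 \<le> y" "1 \<le> p"
  have 1: "x powr p = x * x powr (p - 1)" "y powr p = y * y powr (p - 1)" "(x + y) powr p = (x + y) * (x + y) powr (p - 1)"
    using * by (auto simp: powr_mult_base)
  have "x * x powr (p - 1) \<le> x * (x + y) powr (p - 1)" "y * y powr (p - 1) \<le> y * (x + y) powr (p - 1)"
    using * by (auto intro!: mult_left_mono powr_mono2)
  then show ?thesis unfolding 1 by (simp add: distrib_right)
qed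

lemma powr_add_le: "0 \<le> x \<Longrightarrow> 0 \<le> y \<Longrightarrow> 0 \<le> p \<Longrightarrow> (x + y) powr p \<le> 2 powr p * (x powr p + y powr p)" for x y p :: real
proof -
  assume *: "0 \<le> x" "0 \<le> y" "0 \<le> p"
  have "(x + y) powr p \<le> (2 * max x y) powr p" using * by (intro powr_mono2) auto
  also have "\<dots> = 2 powr p * max x y powr p" by (rule powr_mult)
  also have "max x y powr p \<le> x powr p + y powr p" by (simp add: max_def)
  finally show ?thesis by simp
qed

lemma bump_antimono: "0 \<le> a \<Longrightarrow> a \<le> b \<Longrightarrow> bump b n \<le> bump a n"
  unfolding bump_def by (intro divide_left_mono add_left_mono mult_right_mono mult_pos_pos add_pos_nonneg mult_nonneg_nonneg) auto

text \<open>Where the max norm of k is at most 1 / L, a(k) is at least of order L^2 |k|^2, and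
  integration over scales 1 / (L sqrt n) and 1 / L yields the factor L^(-d). Elsewhere a(k) is
  bounded below and the profile is uniformly of order n^(-\<mu>), so that L^(-d) has to come from
  the square integral of \<open>Dhat\<close>. N \<ge> d makes the powers N p of \<open>bump\<close>
  integrable for all p \<ge> 1, and N \<ge> \<theta> provides the decay in n. The constant is chosen
  before p.\<close>

lemma lp_norm_bound:
  fixes \<theta> \<eta> c1 CD :: real and N :: nat
  assumes \<theta>: "\<theta> > 2" and N: "CARD('d::finite) \<le> N" "\<theta> \<le> real N" and pos: "\<eta> > 0" "c1 > 0" "CD > 0"
  shows "\<exists>K>0. \<forall>(P :: (int ^ 'd) pmf) L p n C F. L \<ge> 1 \<longrightarrow> p \<ge> 1 \<longrightarrow> n \<ge> 1 \<longrightarrow> C \<ge> 0 \<longrightarrow>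
     (SUP x. pmf P x) \<le> CD * L powr (- real CARD('d)) \<longrightarrow>
     (\<forall>k\<in>kcube. (infnorm k \<le> 1 / L \<longrightarrow> c1 * L\<^sup>2 * (norm k)\<^sup>2 \<le> afun P k) \<and> (1 / L \<le> infnorm k \<longrightarrow> \<eta> < afun P k)) \<longrightarrow>
     (\<forall>k\<in>kcube. \<bar>F k\<bar> \<le> C * (bump (afun P k) n ^ N + rho (\<theta> - 2) n * (bump (afun P k) n)\<^sup>2)) \<longrightarrow>
     lp_norm p (\<lambda>k. (Dhat P k)\<^sup>2 * complex_of_real (F k)) \<le> ennreal (K * C / (L powr (real CARD('d) / p) * real n powr min (real CARD('d) / (2 * p)) \<theta>))"
proof -
  define d where "d = real CARD('d)"
  have d: "d \<ge> 1" unfolding d_def using zero_less_card_finite[where 'a='d] by (simp add: Suc_leI)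
  have DIM: "DIM(real ^ 'd) = CARD('d)" by simp
  \<comment> \<open>A threshold strictly between 2 and \<theta> for d / (2 p). Above it, 2 p \<le>
    q1 < d / 2, and the square of \<open>bump\<close> is integrated as a singularity on the scale 1
    / L. Below it, \<theta> p \<ge> qB > d / 2, and everything is dominated by the power \<theta> of
    \<open>bump\<close>. As q1 and qB do not depend on p, neither do the constants.\<close>
  define l0 where "l0 = (\<theta> + 2) / 2"
  have l0: "2 < l0" "l0 < \<theta>" using \<theta> by (auto simp: l0_def)
  define q1 where "q1 = d / l0"
  define qB where "qB = \<theta> * d / (2 * l0)"
  have q1: "0 \<le> q1" "q1 < d / 2" using d l0 by (auto simp: q1_def field_simps)
  have qB: "d / 2 < qB" using d l0 by (simp add: qB_def field_simps)
  define c where "c = min c1 1"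
  have c: "0 < c" "c \<le> 1" "c \<le> c1" using pos by (auto simp: c_def)
  have N2: "N \<ge> 2" using N \<theta> by linarith
  \<comment> \<open>R is the diffusive scale; R2 is the radius of a Euclidean ball containing all
    points of max norm at most 1 / L.\<close>
  define R where "R L n = 1 / (L * sqrt (real n))" for L :: real and n :: nat
  define R2 where "R2 L = sqrt d / L" for L :: real
  obtain V1 where V1: "V1 \<ge> 0" "\<And>R. R > 0 \<Longrightarrow> (\<integral>\<^sup>+k. ennreal ((1 + (norm (k :: real ^ 'd) / R)\<^sup>2) powr (- d)) \<partial>lborel) \<le> ennreal (V1 * R ^ CARD('d))"
    using decaying_radial_integral[where 'a="real ^ 'd", of d] d by (auto simp: d_def)
  obtain V3 where V3: "V3 \<ge> 0" "\<And>R. R > 0 \<Longrightarrow> (\<integral>\<^sup>+k. ennreal ((1 + (norm (k :: real ^ 'd) / R)\<^sup>2) powr (- qB)) \<partial>lborel) \<le> ennreal (V3 * R ^ CARD('d))"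
    using decaying_radial_integral[where 'a="real ^ 'd", of qB] qB by (auto simp: d_def)
  obtain V2 where V2: "V2 \<ge> 0" "\<And>R. R > 0 \<Longrightarrow> (\<integral>\<^sup>+k. ennreal (((norm (k :: real ^ 'd) / R)\<^sup>2) powr (- q1) * indicator (cball 0 R) k) \<partial>lborel) \<le> ennreal (V2 * R ^ CARD('d))"
    using singular_radial_integral[where 'a="real ^ 'd", of q1] q1 by (auto simp: d_def)
  define W2 where "W2 = V2 * sqrt d ^ CARD('d)"
  define WA where "WA = 2 * (1 + (V1 + W2))"
  define B0 where "B0 = 1 + d powr (\<theta> - 2)"
  define WB where "WB = B0 * (1 + V3)"
  define C2 where "C2 = (1 / \<eta>) ^ N + (1 / \<eta>)\<^sup>2"
  define X2 where "X2 = 4 * (2 * pi) ^ CARD('d) * CD"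
  define K where "K = (1 / c) ^ N * (WA + WB) + C2 * (1 + X2)"
  have W2: "W2 \<ge> 0" unfolding W2_def using V2(1) d by simp
  have WA: "WA > 0" unfolding WA_def using V1(1) W2 by simp
  have "d powr (\<theta> - 2) \<ge> 0" by simp
  then have B0: "B0 > 0" unfolding B0_def by linarith
  have WB: "WB > 0" unfolding WB_def using B0 V3(1) by (intro mult_pos_pos) linarith+
  have C2: "C2 > 0" unfolding C2_def using pos by (intro add_pos_pos zero_less_power) auto
  have X2: "X2 > 0" unfolding X2_def using pos pi_gt_zero by (intro mult_pos_pos zero_less_power) auto
  note nn = W2 WA B0 WB C2 X2
  have K: "K > 0" unfolding K_def using nn c by (intro add_pos_pos mult_pos_pos) auto
  show ?thesis
  proof (rule exI[of _ K], intro conjI K allI impI)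
    fix P :: "(int ^ 'd) pmf" and L p C :: real and n :: nat and F :: "real ^ 'd \<Rightarrow> real"
    assume L: "L \<ge> 1" and p: "p \<ge> 1" and n: "n \<ge> 1" and C: "C \<ge> 0"
      and sup: "(SUP x. pmf P x) \<le> CD * L powr (- real CARD('d))"
      and reg: "\<forall>k\<in>kcube. (infnorm k \<le> 1 / L \<longrightarrow> c1 * L\<^sup>2 * (norm k)\<^sup>2 \<le> afun P k) \<and> (1 / L \<le> infnorm k \<longrightarrow> \<eta> < afun P k)"
      and F: "\<forall>k\<in>kcube. \<bar>F k\<bar> \<le> C * (bump (afun P k) n ^ N + rho (\<theta> - 2) n * (bump (afun P k) n)\<^sup>2)"
    define \<mu> where "\<mu> = min (d / (2 * p)) \<theta>"
    define nm where "nm = real n powr (- \<mu>)"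
    define Lp where "Lp = L powr (- d / p)"
    define Phi where "Phi a = bump a n ^ N + rho (\<theta> - 2) n * (bump a n)\<^sup>2" for a
    define x where "x k = L\<^sup>2 * (norm k)\<^sup>2" for k :: "real ^ 'd"
    define b where "b k = 1 / (1 + real n * x k)" for k :: "real ^ 'd"
    define r where "r = rho (\<theta> - 2) n"
    have n1: "real n \<ge> 1" using n by simp
    have \<mu>: "\<mu> \<le> d / (2 * p)" "\<mu> \<le> \<theta>" "0 \<le> \<mu>" using d p \<theta> by (auto simp: \<mu>_def)
    have pos': "nm > 0" "Lp > 0" using n1 L by (auto simp: nm_def Lp_def)
    have Lpp: "Lp powr p = L powr (- d)" using p by (simp add: Lp_def powr_powr)
    have nmp: "nm powr p = real n powr (- \<mu> * p)" by (simp add: nm_def powr_powr)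
    have Rpos: "R L n > 0" "R2 L > 0" using L n1 d by (auto simp: R_def R2_def)
    have x0: "x k \<ge> 0" for k by (simp add: x_def)
    have b0: "0 < b k" "b k \<le> 1" for k
      using x0[of k] by (auto simp: b_def field_simps add_pos_nonneg)
    have bR: "1 + (norm k / R L n)\<^sup>2 = 1 / b k" for k
    proof -
      have "(norm k / R L n)\<^sup>2 = (norm k * (L * sqrt (real n)))\<^sup>2" by (simp add: R_def)
      also have "\<dots> = real n * x k" by (simp add: power_mult_distrib x_def)
      finally show ?thesis by (simp add: b_def)
    qed
    have bpow: "b k powr q = (1 + (norm k / R L n)\<^sup>2) powr (- q)" for k q
      unfolding bR using b0[of k] by (simp add: powr_minus powr_divide)
    have r: "0 < r" "r \<le> real n powr (2 - \<theta>)"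
      using rho_le_powr[of "\<theta> - 2" n] \<theta> n by (auto simp: r_def)
    have Ld: "L powr (- d) = 1 / L ^ CARD('d)" using L by (simp add: powr_minus_divide powr_realpow d_def)
    have Rd: "R L n ^ CARD('d) = L powr (- d) * real n powr (- (d / 2))"
    proof -
      have "sqrt (real n) ^ CARD('d) = real n powr (d / 2)"
      proof -
        have "sqrt (real n) ^ CARD('d) = (real n powr (1 / 2)) powr d"
          using n1 by (simp add: powr_half_sqrt powr_realpow d_def)
        then show ?thesis by (simp add: powr_powr)
      qed
      then show ?thesis by (simp add: R_def Ld power_divide power_mult_distrib powr_minus_divide[of "real n"])
    qed
    have R2d: "V2 * R2 L ^ CARD('d) = W2 * L powr (- d)" by (simp add: R2_def W2_def Ld power_divide)

    define T where "T = nm * Lp"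
    have T: "T > 0" using pos' by (simp add: T_def)
    have Tp: "T powr p = real n powr (- \<mu> * p) * L powr (- d)" by (simp add: T_def powr_mult nmp Lpp)
    have near: "x k \<le> d" "k \<in> cball 0 (R2 L)" "bump (afun P k) n \<le> b k / c"
      if "k \<in> kcube" "infnorm k \<le> 1 / L" for k
    proof -
      have "norm k \<le> sqrt d * infnorm k" using norm_le_infnorm[of k] by (simp add: d_def)
      also have "\<dots> \<le> sqrt d * (1 / L)" using that d by (intro mult_left_mono) auto
      finally have nk: "norm k \<le> sqrt d / L" by simp
      then show "k \<in> cball 0 (R2 L)" by (simp add: R2_def)
      have "(norm k)\<^sup>2 \<le> (sqrt d / L)\<^sup>2" using nk by (intro power_mono) auto
      then show "x k \<le> d" using d L by (simp add: x_def power_divide field_simps)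
      have "c * x k \<le> c1 * x k" using c x0 by (intro mult_right_mono) auto
      also have "\<dots> \<le> afun P k" using reg that by (auto simp: x_def mult.assoc)
      finally have "bump (afun P k) n \<le> bump (c * x k) n" using c x0 by (intro bump_antimono) auto
      also have "\<dots> \<le> b k / c"
      proof -
        have "c * (1 + real n * x k) \<le> 1 + c * x k * real n" using c by (simp add: algebra_simps)
        moreover have "0 < c * (1 + real n * x k)" using c x0[of k] by (simp add: add_pos_nonneg)
        ultimately have "1 / (1 + c * x k * real n) \<le> 1 / (c * (1 + real n * x k))" by (intro divide_left_mono) auto
        then show ?thesis by (simp add: bump_def b_def mult.commute)
      qed
      finally show "bump (afun P k) n \<le> b k / c" .
    qed
    have Phi_near: "Phi (afun P k) \<le> (1 / c) ^ N * (b k ^ N + r * (b k)\<^sup>2)"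
      if "k \<in> kcube" "infnorm k \<le> 1 / L" for k
    proof -
      have bn: "0 \<le> bump (afun P k) n" using afun_nonneg[of P k] by (simp add: bump_def)
      have "bump (afun P k) n ^ N \<le> (b k / c) ^ N" by (intro power_mono near(3) that bn)
      moreover have "(bump (afun P k) n)\<^sup>2 \<le> (b k / c)\<^sup>2" by (intro power_mono near(3) that bn)
      then have "r * (bump (afun P k) n)\<^sup>2 \<le> r * (b k / c)\<^sup>2" using r by (intro mult_left_mono) auto
      moreover have "r * (b k / c)\<^sup>2 \<le> (1 / c) ^ N * (r * (b k)\<^sup>2)"
      proof -
        have "(1 / c)\<^sup>2 \<le> (1 / c) ^ N" using c N2 by (intro power_increasing) auto
        then have "(1 / c)\<^sup>2 * (r * (b k)\<^sup>2) \<le> (1 / c) ^ N * (r * (b k)\<^sup>2)" using r by (intro mult_right_mono) auto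
        then show ?thesis by (simp add: power_divide)
      qed
      ultimately show ?thesis unfolding Phi_def r_def[symmetric] by (simp add: power_divide distrib_left)
    qed
    have Phi_far: "Phi (afun P k) \<le> C2 * nm" if "k \<in> kcube" "1 / L \<le> infnorm k" for k
    proof -
      have a: "\<eta> \<le> afun P k" using reg that by (auto intro: less_imp_le)
      have bn: "0 \<le> bump (afun P k) n" using afun_nonneg[of P k] by (simp add: bump_def)
      have "bump (afun P k) n \<le> bump \<eta> n" using a pos by (intro bump_antimono) auto
      also have "\<dots> \<le> 1 / (\<eta> * real n)" using pos n1 unfolding bump_def by (intro divide_left_mono) (auto intro!: mult_pos_pos add_pos_pos)
      finally have bb: "bump (afun P k) n \<le> 1 / \<eta> * real n powr (-1)" using n1 by (simp add: powr_minus_divide)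
      have "bump (afun P k) n ^ N \<le> (1 / \<eta> * real n powr (-1)) ^ N" by (intro power_mono bb bn)
      also have "\<dots> = (1 / \<eta>) ^ N * real n powr (- real N)"
      proof -
        have "(real n powr (-1)) ^ N = (real n powr (-1)) powr real N" using n1 by (intro powr_realpow[symmetric]) simp
        also have "\<dots> = real n powr (-1 * real N)" by (rule powr_powr)
        finally have "(real n powr (-1)) ^ N = real n powr (- real N)" by (simp only: mult_minus_left mult_1_left)
        then show ?thesis unfolding power_mult_distrib by simp
      qed
      also have "\<dots> \<le> (1 / \<eta>) ^ N * nm"
      proof (intro mult_left_mono)
        have "d / (2 * p) \<le> d / 1" using p d by (intro divide_left_mono) auto
        then have "\<mu> \<le> real N" using \<mu> N by (simp add: d_def)
        then show "real n powr (- real N) \<le> nm" unfolding nm_def using n1 by (intro powr_mono) auto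
      qed (use pos in auto)
      finally have 1: "bump (afun P k) n ^ N \<le> (1 / \<eta>) ^ N * nm" .
      have "(bump (afun P k) n)\<^sup>2 \<le> (1 / \<eta> * real n powr (-1))\<^sup>2" by (intro power_mono bb bn)
      also have "\<dots> = (1 / \<eta>)\<^sup>2 * real n powr (- 2)"
        using n1 by (simp add: power_mult_distrib power_divide powr_minus_divide)
      finally have "r * (bump (afun P k) n)\<^sup>2 \<le> real n powr (2 - \<theta>) * ((1 / \<eta>)\<^sup>2 * real n powr (- 2))"
        using r by (intro mult_mono) auto
      also have "\<dots> = (1 / \<eta>)\<^sup>2 * (real n powr (2 - \<theta>) * real n powr (- 2))" by simp
      also have "real n powr (2 - \<theta>) * real n powr (- 2) = real n powr (- \<theta>)" by (simp flip: powr_add)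
      also have "(1 / \<eta>)\<^sup>2 * real n powr (- \<theta>) \<le> (1 / \<eta>)\<^sup>2 * nm"
        unfolding nm_def using n1 \<mu> by (intro mult_left_mono powr_mono) auto
      finally have 2: "r * (bump (afun P k) n)\<^sup>2 \<le> (1 / \<eta>)\<^sup>2 * nm" .
      show ?thesis using 1 2 unfolding Phi_def r_def[symmetric] C2_def by (simp add: distrib_right)
    qed

    \<comment> \<open>The point k = 0 is excluded because the singular part of the first majorant
      takes the default value 0 there; it is a null set.\<close>
    obtain G W where G [measurable]: "G \<in> borel_measurable borel" and G0: "\<And>k. G k \<ge> 0"
      and Gb: "\<And>k. k \<in> kcube \<Longrightarrow> k \<noteq> 0 \<Longrightarrow> infnorm k \<le> 1 / L \<Longrightarrow> (b k ^ N + r * (b k)\<^sup>2) powr p \<le> G k"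
      and W: "(\<integral>\<^sup>+k. ennreal (G k) \<partial>lborel) \<le> ennreal ((W * T) powr p)" "0 \<le> W" "W \<le> WA + WB"
    proof (cases "l0 \<le> d / (2 * p)")
      case True
      have pq: "2 * p \<le> q1" using True p l0 by (simp add: q1_def field_simps)
      define G where "G k = 2 powr p * ((1 + (norm k / R L n)\<^sup>2) powr (- d)
         + real n powr (- \<theta> * p) * (((norm k / R2 L)\<^sup>2) powr (- q1) * indicator (cball 0 (R2 L)) k))" for k :: "real ^ 'd"
      have [measurable]: "cball (0 :: real ^ 'd) (R2 L) \<in> sets borel" by (rule borel_closed) simp
      have m1 [measurable]: "(\<lambda>k :: real ^ 'd. (1 + (norm k / R L n)\<^sup>2) powr (- d)) \<in> borel_measurable borel"
        and m2 [measurable]: "(\<lambda>k :: real ^ 'd. ((norm k / R2 L)\<^sup>2) powr (- q1) * indicator (cball 0 (R2 L)) k) \<in> borel_measurable borel"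
        by measurable
      show thesis
      proof (rule that[of G WA])
        show "G \<in> borel_measurable borel" unfolding G_def by measurable
        show "G k \<ge> 0" for k by (simp add: G_def)
        show "0 \<le> WA" "WA \<le> WA + WB" using nn by auto
        show "(b k ^ N + r * (b k)\<^sup>2) powr p \<le> G k" if k: "k \<in> kcube" "k \<noteq> 0" "infnorm k \<le> 1 / L" for k
        proof -
          have xk: "x k > 0" using k L by (simp add: x_def)
          have "(b k ^ N + r * (b k)\<^sup>2) powr p \<le> 2 powr p * ((b k ^ N) powr p + (r * (b k)\<^sup>2) powr p)"
            using b0[of k] r p by (intro powr_add_le) auto
          also have "\<dots> \<le> G k"
            unfolding G_def
          proof (intro mult_left_mono add_mono)
            have "(b k ^ N) powr p = b k powr (real N * p)"
              using b0[of k] by (simp add: powr_realpow[symmetric] powr_powr)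
            also have "\<dots> \<le> b k powr d"
            proof (rule powr_mono')
              have "d * 1 \<le> real N * p" using N p d by (intro mult_mono) (auto simp: d_def)
              then show "d \<le> real N * p" by simp
            qed (use b0[of k] in auto)
            finally show "(b k ^ N) powr p \<le> (1 + (norm k / R L n)\<^sup>2) powr (- d)" unfolding bpow .
            have xR: "(norm k / R2 L)\<^sup>2 = x k / d" using d L by (simp add: R2_def x_def power_divide field_simps)
            have "b k \<le> 1 / (real n * x k)"
            proof -
              have "0 < real n * x k" using n1 xk by simp
              then show ?thesis unfolding b_def by (intro divide_left_mono mult_pos_pos add_pos_pos) (use n1 xk in auto)
            qed
            also have "\<dots> \<le> 1 / (real n * (x k / d))"
              using n1 xk d by (simp add: field_simps)
            finally have "(b k)\<^sup>2 \<le> (1 / (real n * (x k / d)))\<^sup>2" using b0[of k] by (intro power_mono) auto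
            also have "\<dots> = real n powr (-2) * (x k / d) powr (-2)"
              using n1 xk d by (simp add: power_divide power_mult_distrib powr_minus_divide)
            finally have "r * (b k)\<^sup>2 \<le> real n powr (2 - \<theta>) * (real n powr (-2) * (x k / d) powr (-2))"
              using r by (intro mult_mono) auto
            also have "\<dots> = (real n powr (2 - \<theta>) * real n powr (-2)) * (x k / d) powr (-2)" by simp
            also have "real n powr (2 - \<theta>) * real n powr (-2) = real n powr (- \<theta>)" by (simp flip: powr_add)
            finally have "(r * (b k)\<^sup>2) powr p \<le> (real n powr (- \<theta>) * (x k / d) powr (-2)) powr p"
              using r p by (intro powr_mono2) auto
            also have "\<dots> = real n powr (- \<theta> * p) * (x k / d) powr (- (2 * p))"
              by (simp only: powr_mult powr_powr) simp
            also have "\<dots> \<le> real n powr (- \<theta> * p) * (x k / d) powr (- q1)"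
              using near(1)[OF k(1,3)] xk d pq by (intro mult_left_mono powr_mono') auto
            finally show "(r * (b k)\<^sup>2) powr p \<le> real n powr (- \<theta> * p) * (((norm k / R2 L)\<^sup>2) powr (- q1) * indicator (cball 0 (R2 L)) k)"
              using near(2)[OF k(1,3)] by (simp add: xR)
          qed auto
          finally show ?thesis .
        qed
        have "(\<integral>\<^sup>+k. ennreal (G k) \<partial>lborel) = (\<integral>\<^sup>+k. ennreal (2 powr p) * ennreal ((1 + (norm (k :: real ^ 'd) / R L n)\<^sup>2) powr (- d))
            + ennreal (2 powr p * real n powr (- \<theta> * p)) * ennreal (((norm k / R2 L)\<^sup>2) powr (- q1) * indicator (cball 0 (R2 L)) k) \<partial>lborel)"
          unfolding G_def by (intro nn_integral_cong) (simp add: distrib_left ennreal_plus ennreal_mult mult.assoc)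
        also have "\<dots> = ennreal (2 powr p) * (\<integral>\<^sup>+k. ennreal ((1 + (norm (k :: real ^ 'd) / R L n)\<^sup>2) powr (- d)) \<partial>lborel)
            + ennreal (2 powr p * real n powr (- \<theta> * p)) * (\<integral>\<^sup>+k. ennreal (((norm (k :: real ^ 'd) / R2 L)\<^sup>2) powr (- q1) * indicator (cball 0 (R2 L)) k) \<partial>lborel)"
          by (subst nn_integral_add) (simp_all add: nn_integral_cmult)
        also have "\<dots> \<le> ennreal (2 powr p) * ennreal (V1 * R L n ^ CARD('d)) + ennreal (2 powr p * real n powr (- \<theta> * p)) * ennreal (V2 * R2 L ^ CARD('d))"
          by (intro add_mono mult_left_mono V1(2) V2(2) Rpos) auto
        also have "\<dots> = ennreal (2 powr p * (V1 * (real n powr (- (d / 2)) * L powr (- d)) + real n powr (- \<theta> * p) * (W2 * L powr (- d))))"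
          unfolding R2d Rd using V1(1) nn by (simp add: ennreal_plus ennreal_mult distrib_left mult_ac flip: ennreal_mult)
        also have "\<dots> \<le> ennreal ((WA * T) powr p)"
        proof (rule ennreal_leI)
          have e1: "real n powr (- (d / 2)) \<le> real n powr (- \<mu> * p)"
          proof (rule powr_mono)
            have "\<mu> * p \<le> d / (2 * p) * p" using \<mu> p by (intro mult_right_mono) auto
            then show "- (d / 2) \<le> - \<mu> * p" using p by simp
          qed (use n1 in auto)
          have e2: "real n powr (- \<theta> * p) \<le> real n powr (- \<mu> * p)"
            using n1 \<mu> p by (intro powr_mono) auto
          have "V1 * (real n powr (- (d / 2)) * L powr (- d)) + real n powr (- \<theta> * p) * (W2 * L powr (- d))
              \<le> V1 * (real n powr (- \<mu> * p) * L powr (- d)) + real n powr (- \<mu> * p) * (W2 * L powr (- d))"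
            using e1 e2 V1(1) nn by (intro add_mono mult_left_mono mult_right_mono) auto
          also have "\<dots> = (V1 + W2) * T powr p" by (simp add: Tp algebra_simps)
          also have "\<dots> \<le> (1 + (V1 + W2)) powr p * T powr p"
          proof (rule mult_right_mono)
            have "V1 + W2 \<le> (1 + (V1 + W2)) powr 1" using V1 nn by simp
            also have "\<dots> \<le> (1 + (V1 + W2)) powr p" using V1 nn p by (intro powr_mono) auto
            finally show "V1 + W2 \<le> (1 + (V1 + W2)) powr p" .
          qed simp
          finally have "2 powr p * (V1 * (real n powr (- (d / 2)) * L powr (- d)) + real n powr (- \<theta> * p) * (W2 * L powr (- d)))
             \<le> 2 powr p * ((1 + (V1 + W2)) powr p * T powr p)" by (intro mult_left_mono) auto
          also have "\<dots> = (WA * T) powr p" by (simp only: WA_def powr_mult mult.assoc)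
          finally show "2 powr p * (V1 * (real n powr (- (d / 2)) * L powr (- d)) + real n powr (- \<theta> * p) * (W2 * L powr (- d))) \<le> (WA * T) powr p" .
        qed
        finally show "(\<integral>\<^sup>+k. ennreal (G k) \<partial>lborel) \<le> ennreal ((WA * T) powr p)" .
      qed
    next
      case False
      have pq: "qB \<le> \<theta> * p" using False p l0 \<theta> by (simp add: qB_def field_simps)
      define G where "G k = B0 powr p * (1 + (norm k / R L n)\<^sup>2) powr (- qB)" for k :: "real ^ 'd"
      have m1 [measurable]: "(\<lambda>k :: real ^ 'd. (1 + (norm k / R L n)\<^sup>2) powr (- qB)) \<in> borel_measurable borel"
        by measurable
      show thesis
      proof (rule that[of G WB])
        show "G \<in> borel_measurable borel" unfolding G_def by measurable
        show "G k \<ge> 0" for k by (simp add: G_def)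
        show "0 \<le> WB" "WB \<le> WA + WB" using nn by auto
        show "(b k ^ N + r * (b k)\<^sup>2) powr p \<le> G k" if k: "k \<in> kcube" "k \<noteq> 0" "infnorm k \<le> 1 / L" for k
        proof -
          have "b k ^ N = b k powr real N" using b0[of k] by (simp add: powr_realpow)
          also have "\<dots> \<le> b k powr \<theta>" using b0[of k] N by (intro powr_mono') auto
          finally have 1: "b k ^ N \<le> b k powr \<theta>" .
          \<comment> \<open>For L |k| at most sqrt d, the weight b is at least 1 / (d (1 + n)), so
            (1 + n)^(2 - \<theta>) is at most d^(\<theta> - 2) b^(\<theta> - 2). This is the origin
            of B0.\<close>
          have "1 / b k \<le> d * (1 + real n)"
          proof -
            have "real n * x k \<le> real n * d" using near(1)[OF k(1,3)] by (intro mult_left_mono) auto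
            then show ?thesis using d by (simp add: b_def algebra_simps)
          qed
          then have "(1 / b k) powr (\<theta> - 2) \<le> (d * (1 + real n)) powr (\<theta> - 2)"
            using \<theta> b0[of k] by (intro powr_mono2) auto
          also have "\<dots> = d powr (\<theta> - 2) * (1 + real n) powr (\<theta> - 2)" by (rule powr_mult)
          finally have "r * (1 / b k) powr (\<theta> - 2) \<le> r * (d powr (\<theta> - 2) * (1 + real n) powr (\<theta> - 2))"
            using r by (intro mult_left_mono) auto
          also have "\<dots> = d powr (\<theta> - 2) * ((1 + real n) powr (- (\<theta> - 2)) * (1 + real n) powr (\<theta> - 2))"
            by (simp add: r_def rho_def)
          also have "(1 + real n) powr (- (\<theta> - 2)) * (1 + real n) powr (\<theta> - 2) = 1" by (simp flip: powr_add)
          finally have "r * (1 / b k) powr (\<theta> - 2) * b k powr \<theta> \<le> d powr (\<theta> - 2) * b k powr \<theta>"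
            by (intro mult_right_mono) auto
          moreover have "(b k)\<^sup>2 = (1 / b k) powr (\<theta> - 2) * b k powr \<theta>"
            using b0[of k] by (simp add: powr_divide powr_diff powr_realpow field_simps)
          ultimately have "b k ^ N + r * (b k)\<^sup>2 \<le> B0 * b k powr \<theta>" using 1 by (simp add: B0_def algebra_simps)
          then have "(b k ^ N + r * (b k)\<^sup>2) powr p \<le> (B0 * b k powr \<theta>) powr p"
            using b0[of k] r p by (intro powr_mono2) auto
          also have "\<dots> = B0 powr p * b k powr (\<theta> * p)" by (simp only: powr_mult powr_powr)
          also have "\<dots> \<le> B0 powr p * b k powr qB"
            using b0[of k] pq by (intro mult_left_mono powr_mono') auto
          finally show ?thesis unfolding G_def bpow .
        qed
        have "(\<integral>\<^sup>+k. ennreal (G k) \<partial>lborel) = ennreal (B0 powr p) * (\<integral>\<^sup>+k. ennreal ((1 + (norm (k :: real ^ 'd) / R L n)\<^sup>2) powr (- qB)) \<partial>lborel)"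
          unfolding G_def by (simp add: ennreal_mult nn_integral_cmult)
        also have "\<dots> \<le> ennreal (B0 powr p) * ennreal (V3 * R L n ^ CARD('d))"
          by (intro mult_left_mono V3(2) Rpos) auto
        also have "\<dots> = ennreal (B0 powr p * (V3 * (real n powr (- (d / 2)) * L powr (- d))))"
          unfolding Rd using V3(1) by (simp add: mult_ac flip: ennreal_mult)
        also have "\<dots> \<le> ennreal ((WB * T) powr p)"
        proof (rule ennreal_leI)
          have e1: "real n powr (- (d / 2)) \<le> real n powr (- \<mu> * p)"
          proof (rule powr_mono)
            have "\<mu> * p \<le> d / (2 * p) * p" using \<mu> p by (intro mult_right_mono) auto
            then show "- (d / 2) \<le> - \<mu> * p" using p by simp
          qed (use n1 in auto)
          have "V3 * (real n powr (- (d / 2)) * L powr (- d)) \<le> V3 * (real n powr (- \<mu> * p) * L powr (- d))"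
            using e1 V3(1) by (intro mult_left_mono mult_right_mono) auto
          also have "\<dots> = V3 * T powr p" by (simp add: Tp)
          also have "\<dots> \<le> (1 + V3) powr p * T powr p"
          proof (rule mult_right_mono)
            have "V3 \<le> (1 + V3) powr 1" using V3 by simp
            also have "\<dots> \<le> (1 + V3) powr p" using V3 p by (intro powr_mono) auto
            finally show "V3 \<le> (1 + V3) powr p" .
          qed simp
          finally have "B0 powr p * (V3 * (real n powr (- (d / 2)) * L powr (- d))) \<le> B0 powr p * ((1 + V3) powr p * T powr p)"
            by (intro mult_left_mono) auto
          then show "B0 powr p * (V3 * (real n powr (- (d / 2)) * L powr (- d))) \<le> (WB * T) powr p"
            by (simp add: WB_def powr_mult)
        qed
        finally show "(\<integral>\<^sup>+k. ennreal (G k) \<partial>lborel) \<le> ennreal ((WB * T) powr p)" .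
      qed
    qed

    define h where "h k = (Dhat P k)\<^sup>2 * complex_of_real (F k)" for k
    define \<alpha> where "\<alpha> = (C * (1 / c) ^ N) powr p"
    define \<gamma> where "\<gamma> = (C * C2 * nm) powr p"
    have [measurable]: "(kcube :: (real ^ 'd) set) \<in> sets borel" by (simp add: kcube_def)
    have pt: "norm (h k) powr p / (2 * pi) ^ CARD('d) * indicator kcube k \<le> \<alpha> * G k + \<gamma> * (indicator kcube k * (norm (Dhat P k))\<^sup>2)"
      if "k \<noteq> 0" for k
    proof (cases "k \<in> kcube")
      case False
      then show ?thesis using G0[of k] by (simp add: \<alpha>_def)
    next
      case True
      have D1: "(norm (Dhat P k))\<^sup>2 \<le> 1" using norm_Dhat_le_1[of P k] by (simp add: power_le_one)
      have pi1: "(2 * pi) ^ CARD('d) \<ge> 1" using pi_gt3 by (intro one_le_power) auto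
      have nh: "norm (h k) = (norm (Dhat P k))\<^sup>2 * \<bar>F k\<bar>" by (simp add: h_def norm_mult norm_power)
      have FP: "\<bar>F k\<bar> \<le> C * Phi (afun P k)" using F True by (simp add: Phi_def)
      have "norm (h k) powr p / (2 * pi) ^ CARD('d) \<le> norm (h k) powr p / 1"
        using pi1 by (intro divide_left_mono) auto
      also have "\<dots> = ((norm (Dhat P k))\<^sup>2) powr p * \<bar>F k\<bar> powr p" by (simp add: nh powr_mult)
      also have "\<dots> \<le> \<alpha> * G k + \<gamma> * (norm (Dhat P k))\<^sup>2"
      proof (cases "infnorm k \<le> 1 / L")
        case near: True
        have "((norm (Dhat P k))\<^sup>2) powr p * \<bar>F k\<bar> powr p \<le> 1 * (C * Phi (afun P k)) powr p"
          using D1 FP p by (intro mult_mono powr_le1 powr_mono2) auto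
        also have "\<dots> \<le> (C * ((1 / c) ^ N * (b k ^ N + r * (b k)\<^sup>2))) powr p"
        proof -
          have "0 \<le> C * Phi (afun P k)" using FP abs_ge_zero[of "F k"] by linarith
          then show ?thesis using Phi_near[OF True near] C p by (simp, intro powr_mono2 mult_left_mono) auto
        qed
        also have "\<dots> = \<alpha> * (b k ^ N + r * (b k)\<^sup>2) powr p" by (simp add: \<alpha>_def powr_mult mult.assoc)
        also have "\<dots> \<le> \<alpha> * G k" using Gb[OF True that near] by (intro mult_left_mono) (auto simp: \<alpha>_def)
        finally show ?thesis by (simp add: \<gamma>_def add_increasing2)
      next
        case far: False
        \<comment> \<open>Two powers of |\<open>Dhat\<close>| are kept for the square integral and
          the others are bounded by 1.\<close>
        have "((norm (Dhat P k))\<^sup>2) powr p \<le> ((norm (Dhat P k))\<^sup>2) powr 1"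
        proof (cases "Dhat P k = 0")
          case False
          then show ?thesis using D1 p by (intro powr_mono') simp_all
        qed (use p in simp)
        then have 1: "((norm (Dhat P k))\<^sup>2) powr p \<le> (norm (Dhat P k))\<^sup>2" by simp
        have "\<bar>F k\<bar> \<le> C * (C2 * nm)"
          using FP mult_left_mono[OF Phi_far[OF True] C] far by simp
        then have "\<bar>F k\<bar> powr p \<le> \<gamma>" unfolding \<gamma>_def using p by (intro powr_mono2) (auto simp: mult.assoc)
        then have "((norm (Dhat P k))\<^sup>2) powr p * \<bar>F k\<bar> powr p \<le> (norm (Dhat P k))\<^sup>2 * \<gamma>"
          using 1 by (intro mult_mono) auto
        then show ?thesis using G0[of k] by (simp add: \<alpha>_def mult.commute add_increasing)
      qed
      finally show ?thesis using True by simp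
    qed
    have "(\<integral>\<^sup>+ k \<in> kcube. ennreal (norm (h k) powr p / (2 * pi) ^ CARD('d)) \<partial>lebesgue)
        = (\<integral>\<^sup>+ k. ennreal (norm (h k) powr p / (2 * pi) ^ CARD('d)) * indicator kcube k \<partial>lborel)"
      by (rule nn_integral_completion)
    also have "\<dots> \<le> (\<integral>\<^sup>+ k. ennreal \<alpha> * ennreal (G k) + ennreal \<gamma> * ennreal (indicator kcube k * (norm (Dhat P k))\<^sup>2) \<partial>lborel)"
    proof (rule nn_integral_mono_AE)
      have "AE k in lborel. k \<noteq> (0 :: real ^ 'd)" by (rule AE_lborel_singleton)
      then show "AE k in lborel. ennreal (norm (h k) powr p / (2 * pi) ^ CARD('d)) * indicator kcube k
          \<le> ennreal \<alpha> * ennreal (G k) + ennreal \<gamma> * ennreal (indicator kcube k * (norm (Dhat P k))\<^sup>2)"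
      proof eventually_elim
        case (elim k)
        have "ennreal (norm (h k) powr p / (2 * pi) ^ CARD('d)) * indicator kcube k
            = ennreal (norm (h k) powr p / (2 * pi) ^ CARD('d) * indicator kcube k)"
          by (simp add: indicator_def)
        also have "\<dots> \<le> ennreal (\<alpha> * G k + \<gamma> * (indicator kcube k * (norm (Dhat P k))\<^sup>2))"
          by (intro ennreal_leI pt elim)
        also have "\<dots> = ennreal \<alpha> * ennreal (G k) + ennreal \<gamma> * ennreal (indicator kcube k * (norm (Dhat P k))\<^sup>2)"
          using G0[of k] by (simp add: ennreal_plus ennreal_mult \<alpha>_def \<gamma>_def)
        finally show ?case .
      qed
    qed
    also have "\<dots> = ennreal \<alpha> * (\<integral>\<^sup>+ k. ennreal (G k) \<partial>lborel) + ennreal \<gamma> * (\<integral>\<^sup>+ k. ennreal (indicator kcube k * (norm (Dhat P k))\<^sup>2) \<partial>lborel)"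
      by (subst nn_integral_add) (auto simp: nn_integral_cmult)
    also have "\<dots> \<le> ennreal \<alpha> * ennreal ((W * T) powr p) + ennreal \<gamma> * ennreal (X2 * L powr (- d))"
    proof (intro add_mono mult_left_mono W)
      have "4 * (2 * pi) ^ CARD('d) * (SUP x. pmf P x) \<le> 4 * (2 * pi) ^ CARD('d) * (CD * L powr (- real CARD('d)))"
        using sup by (intro mult_left_mono) auto
      also have "\<dots> = X2 * L powr (- d)" by (simp add: X2_def d_def)
      finally show "(\<integral>\<^sup>+ k. ennreal (indicator kcube k * (norm (Dhat P k))\<^sup>2) \<partial>lborel) \<le> ennreal (X2 * L powr (- d))"
        by (intro order_trans[OF Dhat_square_integral ennreal_leI])
    qed auto
    also have "\<dots> = ennreal (\<alpha> * (W * T) powr p + \<gamma> * (X2 * L powr (- d)))"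
      using nn by (simp add: ennreal_plus ennreal_mult \<alpha>_def \<gamma>_def)
    also have "\<dots> \<le> ennreal ((K * C * T) powr p)"
    proof (rule ennreal_leI)
      \<comment> \<open>Adding 1 before raising to the power p gives X2 \<le> (1 + X2)^p for every p
        \<ge> 1, which keeps K independent of p.\<close>
      have "X2 \<le> (1 + X2) powr 1" using nn by simp
      also have "\<dots> \<le> (1 + X2) powr p" using nn p by (intro powr_mono) auto
      finally have "X2 * L powr (- d) \<le> (1 + X2) powr p * Lp powr p" unfolding Lpp by (intro mult_right_mono) auto
      then have "\<gamma> * (X2 * L powr (- d)) \<le> \<gamma> * ((1 + X2) powr p * Lp powr p)"
        by (intro mult_left_mono) (auto simp: \<gamma>_def)
      also have "\<dots> = (C * (C2 * (1 + X2)) * T) powr p" by (simp add: \<gamma>_def T_def powr_mult mult_ac)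
      finally have 2: "\<gamma> * (X2 * L powr (- d)) \<le> (C * (C2 * (1 + X2)) * T) powr p" .
      have "\<alpha> * (W * T) powr p = (C * ((1 / c) ^ N * W) * T) powr p" by (simp add: \<alpha>_def powr_mult mult_ac)
      also have "\<dots> \<le> (C * ((1 / c) ^ N * (WA + WB)) * T) powr p"
        using W c C T p by (intro powr_mono2 mult_right_mono mult_left_mono) auto
      finally have "\<alpha> * (W * T) powr p + \<gamma> * (X2 * L powr (- d))
          \<le> (C * ((1 / c) ^ N * (WA + WB)) * T) powr p + (C * (C2 * (1 + X2)) * T) powr p" using 2 by linarith
      also have "\<dots> \<le> (C * ((1 / c) ^ N * (WA + WB)) * T + C * (C2 * (1 + X2)) * T) powr p"
        using C c nn T p by (intro add_powr_le) auto
      also have "C * ((1 / c) ^ N * (WA + WB)) * T + C * (C2 * (1 + X2)) * T = K * C * T"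
        by (simp add: K_def algebra_simps)
      finally show "\<alpha> * (W * T) powr p + \<gamma> * (X2 * L powr (- d)) \<le> (K * C * T) powr p" .
    qed
    finally have "lp_norm p h \<le> ennreal (K * C * T)"
      using K C T p by (intro lp_norm_le) auto
    also have "K * C * T = K * C / (L powr (d / p) * real n powr \<mu>)"
      by (simp add: T_def nm_def Lp_def powr_minus_divide)
    finally show "lp_norm p (\<lambda>k. (Dhat P k)\<^sup>2 * complex_of_real (F k))
        \<le> ennreal (K * C / (L powr (real CARD('d) / p) * real n powr min (real CARD('d) / (2 * p)) \<theta>))"
      by (simp add: h_def[abs_def] d_def \<mu>_def)
  qed
qed

section \<open>The Laplacian at the origin\<close>

definition twice_differentiable_0 :: "(real \<Rightarrow> real) \<Rightarrow> bool" where
  "twice_differentiable_0 s \<longleftrightarrow> (\<forall>\<^sub>F t in nhds 0. s differentiable (at t)) \<and> deriv s differentiable (at 0)"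

lemma twice_differentiable_0D:
  assumes "twice_differentiable_0 s"
  shows "\<forall>\<^sub>F t in nhds 0. (s has_real_derivative deriv s t) (at t)"
    and "(deriv s has_real_derivative deriv (deriv s) 0) (at 0)"
  using assms by (auto simp: twice_differentiable_0_def DERIV_deriv_iff_real_differentiable)

lemma twice_differentiable_0I:
  assumes s: "\<forall>\<^sub>F t in nhds 0. (s has_real_derivative s' t) (at t)"
    and s': "(s' has_real_derivative l) (at 0)"
  shows "twice_differentiable_0 s" "deriv s 0 = s' 0" "deriv (deriv s) 0 = l"
proof -
  have ev: "\<forall>\<^sub>F t in nhds 0. s' t = deriv s t"
    using s by eventually_elim (simp add: DERIV_imp_deriv)
  have d: "(deriv s has_real_derivative l) (at 0)"
    using s' DERIV_cong_ev[OF refl ev refl] by blast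
  show "deriv (deriv s) 0 = l" using d by (rule DERIV_imp_deriv)
  show "deriv s 0 = s' 0" using eventually_nhds_x_imp_x[OF ev] by simp
  have "\<forall>\<^sub>F t in nhds 0. s differentiable (at t)"
    using s by eventually_elim (auto simp: real_differentiable_def)
  then show "twice_differentiable_0 s" using d by (auto simp: twice_differentiable_0_def real_differentiable_def)
qed

lemma twice_differentiable_0_cong:
  assumes ev: "\<forall>\<^sub>F t in nhds 0. s t = u t" and s: "twice_differentiable_0 s"
  shows "twice_differentiable_0 u" "deriv (deriv u) 0 = deriv (deriv s) 0"
proof -
  have "\<forall>\<^sub>F x in nhds 0. \<forall>\<^sub>F t in nhds x. s t = u t" using ev by (subst eventually_eventually)
  with twice_differentiable_0D(1)[OF s] have "\<forall>\<^sub>F t in nhds 0. (u has_real_derivative deriv s t) (at t)"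
    by eventually_elim (use DERIV_cong_ev in blast)
  from twice_differentiable_0I[OF this twice_differentiable_0D(2)[OF s]]
  show "twice_differentiable_0 u" "deriv (deriv u) 0 = deriv (deriv s) 0" by auto
qed

lemma twice_differentiable_0_diff:
  assumes s: "twice_differentiable_0 s" and u: "twice_differentiable_0 u"
  shows "twice_differentiable_0 (\<lambda>t. s t - u t)" "deriv (deriv (\<lambda>t. s t - u t)) 0 = deriv (deriv s) 0 - deriv (deriv u) 0"
proof -
  have 1: "\<forall>\<^sub>F t in nhds 0. ((\<lambda>t. s t - u t) has_real_derivative deriv s t - deriv u t) (at t)"
    using twice_differentiable_0D(1)[OF s] twice_differentiable_0D(1)[OF u] by eventually_elim (rule DERIV_diff)
  have 2: "((\<lambda>t. deriv s t - deriv u t) has_real_derivative deriv (deriv s) 0 - deriv (deriv u) 0) (at 0)"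
    by (intro DERIV_diff twice_differentiable_0D(2) s u)
  show "twice_differentiable_0 (\<lambda>t. s t - u t)" "deriv (deriv (\<lambda>t. s t - u t)) 0 = deriv (deriv s) 0 - deriv (deriv u) 0"
    using twice_differentiable_0I[OF 1 2] by auto
qed

lemma twice_differentiable_0_add:
  assumes s: "twice_differentiable_0 s" and u: "twice_differentiable_0 u"
  shows "twice_differentiable_0 (\<lambda>t. s t + u t)" "deriv (deriv (\<lambda>t. s t + u t)) 0 = deriv (deriv s) 0 + deriv (deriv u) 0"
proof -
  have 1: "\<forall>\<^sub>F t in nhds 0. ((\<lambda>t. s t + u t) has_real_derivative deriv s t + deriv u t) (at t)"
    using twice_differentiable_0D(1)[OF s] twice_differentiable_0D(1)[OF u] by eventually_elim (rule DERIV_add)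
  have 2: "((\<lambda>t. deriv s t + deriv u t) has_real_derivative deriv (deriv s) 0 + deriv (deriv u) 0) (at 0)"
    by (intro DERIV_add twice_differentiable_0D(2) s u)
  show "twice_differentiable_0 (\<lambda>t. s t + u t)" "deriv (deriv (\<lambda>t. s t + u t)) 0 = deriv (deriv s) 0 + deriv (deriv u) 0"
    using twice_differentiable_0I[OF 1 2] by auto
qed

lemma twice_differentiable_0_const: "twice_differentiable_0 (\<lambda>_. c)" "deriv (deriv (\<lambda>_. c)) 0 = 0"
  using twice_differentiable_0I[of "\<lambda>_. c" "\<lambda>_. 0" 0] by auto

text \<open>Vanishing first derivatives remove the cross term of the Leibniz rule; in the model they
  vanish by reflection symmetry.\<close>

lemma twice_differentiable_0_mult:
  assumes s: "twice_differentiable_0 s" and u: "twice_differentiable_0 u"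
    and "deriv s 0 = 0" "deriv u 0 = 0"
  shows "twice_differentiable_0 (\<lambda>t. s t * u t)"
    "deriv (deriv (\<lambda>t. s t * u t)) 0 = deriv (deriv s) 0 * u 0 + s 0 * deriv (deriv u) 0"
proof -
  have 1: "\<forall>\<^sub>F t in nhds 0. ((\<lambda>t. s t * u t) has_real_derivative deriv s t * u t + deriv u t * s t) (at t)"
    using twice_differentiable_0D(1)[OF s] twice_differentiable_0D(1)[OF u] by eventually_elim (rule DERIV_mult)
  have d0: "(s has_real_derivative deriv s 0) (at 0)" "(u has_real_derivative deriv u 0) (at 0)"
    using twice_differentiable_0D(1)[OF s] twice_differentiable_0D(1)[OF u] eventually_nhds_x_imp_x by blast+
  have "((\<lambda>t. deriv s t * u t + deriv u t * s t) has_real_derivative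
      (deriv (deriv s) 0 * u 0 + deriv u 0 * deriv s 0) + (deriv (deriv u) 0 * s 0 + deriv s 0 * deriv u 0)) (at 0)"
    by (intro DERIV_add DERIV_mult twice_differentiable_0D(2) s u d0)
  then have 2: "((\<lambda>t. deriv s t * u t + deriv u t * s t) has_real_derivative
      deriv (deriv s) 0 * u 0 + s 0 * deriv (deriv u) 0) (at 0)" using assms(3,4) by (simp add: mult.commute)
  show "twice_differentiable_0 (\<lambda>t. s t * u t)"
    "deriv (deriv (\<lambda>t. s t * u t)) 0 = deriv (deriv s) 0 * u 0 + s 0 * deriv (deriv u) 0"
    using twice_differentiable_0I[OF 1 2] by auto
qed

lemma twice_differentiable_0_sum:
  assumes "finite S" "\<And>i. i \<in> S \<Longrightarrow> twice_differentiable_0 (s i)"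
  shows "twice_differentiable_0 (\<lambda>t. \<Sum>i\<in>S. s i t) \<and>
    deriv (deriv (\<lambda>t. \<Sum>i\<in>S. s i t)) 0 = (\<Sum>i\<in>S. deriv (deriv (s i)) 0)"
  using assms
proof (induction S rule: finite_induct)
  case empty
  show ?case using twice_differentiable_0_const[of 0] by simp
next
  case (insert i S)
  then show ?case using twice_differentiable_0_add[of "s i" "\<lambda>t. \<Sum>i\<in>S. s i t"] by simp
qed

lemma even_deriv_0:
  assumes s: "twice_differentiable_0 s" and even: "\<forall>\<^sub>F t in nhds 0. s (- t) = s t"
  shows "deriv s 0 = 0"
proof -
  have d: "(s has_real_derivative deriv s 0) (at 0)"
    using twice_differentiable_0D(1)[OF s] by (rule eventually_nhds_x_imp_x)
  have d2: "((\<lambda>t. s (- t)) has_real_derivative deriv s 0 * (- 1)) (at 0)"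
    by (rule DERIV_chain2[of s]) (use d in \<open>auto intro!: derivative_eq_intros\<close>)
  have "((\<lambda>t. s t) has_real_derivative deriv s 0 * (- 1)) (at 0)"
    using d2 DERIV_cong_ev[OF refl even refl] by blast
  from DERIV_unique[OF d this] show ?thesis by simp
qed

text \<open>L'Hospital's rule once, then the definition of the derivative of \<open>deriv s\<close>
  at 0: the second derivative is assumed to exist only at the origin.\<close>

lemma second_derivative_limit:
  assumes s: "twice_differentiable_0 s" and 0: "deriv s 0 = 0"
  shows "((\<lambda>t. (s t - s 0) / t\<^sup>2) \<longlongrightarrow> deriv (deriv s) 0 / 2) (at 0)"
proof (rule lhopital[where f' = "deriv s" and g' = "\<lambda>t. 2 * t"])
  have d: "(s has_real_derivative deriv s 0) (at 0)"
    using twice_differentiable_0D(1)[OF s] by (rule eventually_nhds_x_imp_x)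
  then have "(s \<longlongrightarrow> s 0) (at 0)" using DERIV_isCont isCont_def by blast
  then show "((\<lambda>t. s t - s 0) \<longlongrightarrow> 0) (at 0)" by (rule LIM_zero)
  have "((\<lambda>t. t\<^sup>2) \<longlongrightarrow> 0\<^sup>2) (at (0::real))" by (intro tendsto_intros)
  then show "((\<lambda>t. t\<^sup>2) \<longlongrightarrow> 0) (at (0::real))" by simp
  show "\<forall>\<^sub>F t in at 0. t\<^sup>2 \<noteq> (0::real)" by (auto simp: eventually_at intro!: exI[of _ 1])
  show "\<forall>\<^sub>F t in at 0. 2 * t \<noteq> (0::real)" by (auto simp: eventually_at intro!: exI[of _ 1])
  show "\<forall>\<^sub>F t in at 0. ((\<lambda>t. s t - s 0) has_real_derivative deriv s t) (at t)"
    using twice_differentiable_0D(1)[OF s] unfolding eventually_nhds_conv_at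
    by (auto elim!: eventually_mono intro!: derivative_eq_intros)
  show "\<forall>\<^sub>F t in at 0. ((\<lambda>t. t\<^sup>2) has_real_derivative 2 * t) (at t)"
    by (rule always_eventually) (auto intro!: derivative_eq_intros)
  have "((\<lambda>t. (deriv s t - deriv s 0) / (t - 0)) \<longlongrightarrow> deriv (deriv s) 0) (at 0)"
    using twice_differentiable_0D(2)[OF s] by (simp add: has_field_derivative_iff)
  from tendsto_divide[OF this tendsto_const[of 2]]
  show "((\<lambda>t. deriv s t / (2 * t)) \<longlongrightarrow> deriv (deriv s) 0 / 2) (at 0)" by (simp add: 0 mult.commute)
qed

lemma second_derivative_bound:
  assumes s: "twice_differentiable_0 s" and 0: "deriv s 0 = 0"
    and b: "\<forall>\<^sub>F t in nhds 0. \<bar>s t - s 0\<bar> \<le> c * t\<^sup>2"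
  shows "\<bar>deriv (deriv s) 0\<bar> \<le> 2 * c"
proof -
  have "((\<lambda>t. \<bar>(s t - s 0) / t\<^sup>2\<bar>) \<longlongrightarrow> \<bar>deriv (deriv s) 0 / 2\<bar>) (at 0)"
    by (intro tendsto_rabs second_derivative_limit assms)
  moreover have "\<forall>\<^sub>F t in at 0. \<bar>(s t - s 0) / t\<^sup>2\<bar> \<le> c"
  proof -
    have "\<forall>\<^sub>F t in at 0. \<bar>s t - s 0\<bar> \<le> c * t\<^sup>2" using b by (simp add: eventually_nhds_conv_at)
    moreover have "\<forall>\<^sub>F t in at 0. t \<noteq> (0::real)" by (auto simp: eventually_at intro!: exI[of _ 1])
    ultimately show ?thesis by eventually_elim (simp add: abs_divide divide_le_eq)
  qed
  ultimately have "\<bar>deriv (deriv s) 0 / 2\<bar> \<le> c" by (rule tendsto_upperbound) simp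
  then show ?thesis by simp
qed

lemma second_derivative_unique:
  assumes s: "twice_differentiable_0 s" and 0: "deriv s 0 = 0"
    and l: "((\<lambda>t. (s t - s 0) / t\<^sup>2) \<longlongrightarrow> l) (at 0)"
  shows "deriv (deriv s) 0 = 2 * l"
  using LIM_unique[OF second_derivative_limit[OF s 0] l] by simp

section \<open>Laplacians through coordinate slices\<close>

definition slice :: "(real ^ 'd::finite \<Rightarrow> real) \<Rightarrow> 'd \<Rightarrow> real \<Rightarrow> real" where
  "slice h j t = h (t *\<^sub>R axis j 1)"

lemma has_laplacian_iff: "has_laplacian h 0 \<longleftrightarrow> (\<forall>j. twice_differentiable_0 (slice h j))"
  unfolding has_laplacian_def twice_differentiable_0_def slice_def[abs_def] by simp

lemma laplacian_eq: "laplacian h 0 = (\<Sum>j\<in>UNIV. deriv (deriv (slice h j)) 0)"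
  unfolding laplacian_def slice_def[abs_def] by (simp add: numeral_2_eq_2)

lemma axis_in_kcube: "\<forall>\<^sub>F t in nhds 0. t *\<^sub>R axis j 1 \<in> (kcube :: (real ^ 'd::finite) set)"
proof -
  have "t *\<^sub>R axis j 1 \<in> (kcube :: (real ^ 'd) set)" if "dist t 0 < pi" for t
    using that by (auto simp: kcube_def mem_box_cart axis_def abs_le_iff)
  then show ?thesis unfolding eventually_nhds_metric by (intro exI[of _ pi]) auto
qed

lemma zero_in_kcube: "0 \<in> kcube"
  by (simp add: kcube_def mem_box_cart)

lemma slice_even:
  assumes "cube_symmetric h"
  shows "\<forall>\<^sub>F t in nhds 0. slice h j (- t) = slice h j t"
  using axis_in_kcube[of j]
proof eventually_elim
  case (elim t)
  then have "h (\<chi> i. if i = j then - ((t *\<^sub>R axis j 1) $ i) else (t *\<^sub>R axis j 1) $ i) = h (t *\<^sub>R axis j 1)"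
    using assms by (auto simp: cube_symmetric_def)
  moreover have "(\<chi> i. if i = j then - ((t *\<^sub>R axis j 1) $ i) else (t *\<^sub>R axis j 1) $ i) = (- t) *\<^sub>R (axis j 1 :: real ^ 'a)"
    by (auto simp: vec_eq_iff axis_def)
  ultimately show ?case by (simp add: slice_def)
qed

lemma slice_deriv_0: "cube_symmetric h \<Longrightarrow> has_laplacian h 0 \<Longrightarrow> deriv (slice h j) 0 = 0"
  by (rule even_deriv_0) (auto simp: has_laplacian_iff slice_even)

lemma has_laplacian_cong:
  assumes eq: "\<And>k. k \<in> kcube \<Longrightarrow> h k = h' k" and h: "has_laplacian h 0"
  shows "has_laplacian h' 0" "laplacian h' 0 = laplacian h 0"
proof -
  have ev: "\<forall>\<^sub>F t in nhds 0. slice h j t = slice h' j t" for j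
    using axis_in_kcube[of j] by eventually_elim (simp add: slice_def eq)
  have s: "twice_differentiable_0 (slice h j)" for j using h by (simp add: has_laplacian_iff)
  show "has_laplacian h' 0" unfolding has_laplacian_iff using twice_differentiable_0_cong(1)[OF ev s] by blast
  show "laplacian h' 0 = laplacian h 0" unfolding laplacian_eq
    by (intro sum.cong refl twice_differentiable_0_cong(2)[OF ev s])
qed

lemma laplacian_const:
  fixes h :: "real ^ 'd::finite \<Rightarrow> real"
  assumes "\<And>k. k \<in> kcube \<Longrightarrow> h k = c"
  shows "laplacian h 0 = 0"
proof -
  have c: "has_laplacian (\<lambda>_. c) (0 :: real ^ 'd)" "laplacian (\<lambda>_. c) (0 :: real ^ 'd) = 0"
    using twice_differentiable_0_const[of c] unfolding has_laplacian_iff laplacian_eq by (auto simp: slice_def[abs_def])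
  show ?thesis using has_laplacian_cong(2)[of "\<lambda>_. c" h] assms c by simp
qed

text \<open>That e has a Laplacian is a conclusion: the recursion expresses e through f and g, which
  have one. The products of gradients vanish by symmetry.\<close>

lemma laplacian_convolution:
  fixes f g :: "nat \<Rightarrow> real ^ 'd::finite \<Rightarrow> real" and e :: "real ^ 'd \<Rightarrow> real"
  assumes rec: "\<And>k. k \<in> kcube \<Longrightarrow> f n k = (\<Sum>m=1..n. g m k * f (n - m) k) + e k"
    and f: "\<And>m. m \<le> n \<Longrightarrow> has_laplacian (f m) 0 \<and> cube_symmetric (f m)"
    and g: "\<And>m. 1 \<le> m \<Longrightarrow> m \<le> n \<Longrightarrow> has_laplacian (g m) 0 \<and> cube_symmetric (g m)"
  shows "has_laplacian e 0"
    "laplacian (f n) 0 = (\<Sum>m=1..n. laplacian (g m) 0 * f (n - m) 0 + g m 0 * laplacian (f (n - m)) 0) + laplacian e 0"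
proof -
  define u where "u j m t = slice (g m) j t * slice (f (n - m)) j t" for j m t
  have D2: "twice_differentiable_0 (slice (f m) j)" "deriv (slice (f m) j) 0 = 0" if "m \<le> n" for m j
    using f[OF that] slice_deriv_0 by (auto simp: has_laplacian_iff)
  have D2g: "twice_differentiable_0 (slice (g m) j)" "deriv (slice (g m) j) 0 = 0" if "1 \<le> m" "m \<le> n" for m j
    using g[OF that] slice_deriv_0 by (auto simp: has_laplacian_iff)
  have s0: "slice h j 0 = h 0" for h :: "real ^ 'd \<Rightarrow> real" and j by (simp add: slice_def)
  have u: "twice_differentiable_0 (u j m)"
    "deriv (deriv (u j m)) 0 = deriv (deriv (slice (g m) j)) 0 * f (n - m) 0 + g m 0 * deriv (deriv (slice (f (n - m)) j)) 0"
    if "m \<in> {1..n}" for j m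
    unfolding u_def[abs_def] using twice_differentiable_0_mult[OF D2g(1) D2(1) D2g(2) D2(2)] that by (auto simp: s0)
  note us = twice_differentiable_0_sum[of "{1..n}" "u j" for j, OF _ u(1), simplified]
  have ev: "\<forall>\<^sub>F t in nhds 0. slice (f n) j t - (\<Sum>m=1..n. u j m t) = slice e j t" for j
    using axis_in_kcube[of j] by eventually_elim (simp add: slice_def u_def rec)
  have dd: "twice_differentiable_0 (\<lambda>t. slice (f n) j t - (\<Sum>m=1..n. u j m t))"
    "deriv (deriv (\<lambda>t. slice (f n) j t - (\<Sum>m=1..n. u j m t))) 0
      = deriv (deriv (slice (f n) j)) 0 - (\<Sum>m=1..n. deriv (deriv (u j m)) 0)" for j
    using twice_differentiable_0_diff[OF D2(1)[OF order_refl] conjunct1[OF us]] conjunct2[OF us] by simp_all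
  show "has_laplacian e 0"
    unfolding has_laplacian_iff using twice_differentiable_0_cong(1)[OF ev dd(1)] by blast
  have "deriv (deriv (slice e j)) 0 = deriv (deriv (slice (f n) j)) 0 - (\<Sum>m=1..n. deriv (deriv (u j m)) 0)" for j
    using twice_differentiable_0_cong(2)[OF ev dd(1)] dd(2) by simp
  then have "laplacian e 0 = laplacian (f n) 0 - (\<Sum>j\<in>UNIV. \<Sum>m=1..n. deriv (deriv (u j m)) 0)"
    by (simp add: laplacian_eq sum_subtractf)
  also have "(\<Sum>j\<in>UNIV. \<Sum>m=1..n. deriv (deriv (u j m)) 0) = (\<Sum>m=1..n. \<Sum>j\<in>UNIV. deriv (deriv (u j m)) 0)"
    by (rule sum.swap)
  also have "\<dots> = (\<Sum>m=1..n. laplacian (g m) 0 * f (n - m) 0 + g m 0 * laplacian (f (n - m)) 0)"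
    by (intro sum.cong refl) (simp add: u laplacian_eq sum.distrib sum_distrib_left sum_distrib_right)
  finally show "laplacian (f n) 0 = (\<Sum>m=1..n. laplacian (g m) 0 * f (n - m) 0 + g m 0 * laplacian (f (n - m)) 0) + laplacian e 0"
    by simp
qed

context step_distribution
begin

text \<open>Assumption E controls increments of e in units of a(k). As a(k) is at most half the
  second moment form, such a bound passes to the second derivatives at 0, and summing over the axes
  gives \<sigma>^2.\<close>

lemma laplacian_bound:
  assumes h: "has_laplacian h 0" "cube_symmetric h" and c: "c \<ge> 0"
    and b: "\<And>k. k \<in> kcube \<Longrightarrow> \<bar>h k - h 0\<bar> \<le> c * afun P k"
  shows "\<bar>laplacian h 0\<bar> \<le> c * sigma2 P"
proof -
  have "\<bar>deriv (deriv (slice h j)) 0\<bar> \<le> c * second_moment P (axis j 1)" for j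
  proof -
    have "\<bar>deriv (deriv (slice h j)) 0\<bar> \<le> 2 * (c * second_moment P (axis j 1) / 2)"
    proof (rule second_derivative_bound)
      show "twice_differentiable_0 (slice h j)" "deriv (slice h j) 0 = 0"
        using h slice_deriv_0 by (auto simp: has_laplacian_iff)
      show "\<forall>\<^sub>F t in nhds 0. \<bar>slice h j t - slice h j 0\<bar> \<le> c * second_moment P (axis j 1) / 2 * t\<^sup>2"
        using axis_in_kcube[of j]
      proof eventually_elim
        case (elim t)
        have "\<bar>slice h j t - slice h j 0\<bar> \<le> c * afun P (t *\<^sub>R axis j 1)"
          using b[OF elim] by (simp add: slice_def)
        also have "\<dots> \<le> c * (second_moment P (t *\<^sub>R axis j 1) / 2)"
          by (intro mult_left_mono afun_le_second_moment c)
        finally show ?case by (simp add: second_moment_scale mult_ac)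
      qed
    qed
    then show ?thesis by simp
  qed
  then have "\<bar>laplacian h 0\<bar> \<le> (\<Sum>j\<in>UNIV. c * second_moment P (axis j 1))"
    unfolding laplacian_eq by (intro order_trans[OF sum_abs sum_mono]) auto
  also have "\<dots> = (\<Sum>j\<in>(UNIV :: 'd set). c * second_moment P (axis undefined 1))"
    by (intro sum.cong refl arg_cong[where f = "\<lambda>x. c * x"] second_moment_axis)
  also have "\<dots> = c * sigma2 P" by (simp add: sigma2_eq[of undefined])
  finally show ?thesis .
qed

text \<open>The second derivatives are identified through the limit of a(t e_j) / t^2, which avoids
  differentiating the Fourier series term by term.\<close>

lemma laplacian_Dhat:
  assumes h: "has_laplacian h 0" "cube_symmetric h" and eq: "\<And>k. k \<in> kcube \<Longrightarrow> h k = z * (1 - afun P k)"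
  shows "laplacian h 0 = - z * sigma2 P"
proof -
  have a0: "afun P 0 = 0" using afun_le_second_moment[of 0] afun_nonneg[of P 0] second_moment_scale[of 0 0] by simp
  have "deriv (deriv (slice h j)) 0 = 2 * (- z * (second_moment P (axis j 1) / 2))" for j
  proof (rule second_derivative_unique)
    show "twice_differentiable_0 (slice h j)" "deriv (slice h j) 0 = 0"
      using h slice_deriv_0 by (auto simp: has_laplacian_iff)
    have "((\<lambda>t. - z * (afun P (t *\<^sub>R axis j 1) / t\<^sup>2)) \<longlongrightarrow> - z * (second_moment P (axis j 1) / 2)) (at 0)"
      by (intro tendsto_mult tendsto_const second_moment_limit)
    then show "((\<lambda>t. (slice h j t - slice h j 0) / t\<^sup>2) \<longlongrightarrow> - z * (second_moment P (axis j 1) / 2)) (at 0)"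
    proof (rule Lim_transform_eventually)
      have "\<forall>\<^sub>F t in at 0. t *\<^sub>R axis j 1 \<in> (kcube :: (real ^ 'd) set)"
        using axis_in_kcube[of j] by (simp add: eventually_nhds_conv_at)
      then show "\<forall>\<^sub>F t in at 0. - z * (afun P (t *\<^sub>R axis j 1) / t\<^sup>2) = (slice h j t - slice h j 0) / t\<^sup>2"
        by eventually_elim (simp add: slice_def eq zero_in_kcube a0 algebra_simps)
    qed
  qed
  then have "laplacian h 0 = (\<Sum>j\<in>UNIV. - z * second_moment P (axis j 1))"
    unfolding laplacian_eq by simp
  also have "\<dots> = (\<Sum>j\<in>(UNIV :: 'd set). - z * second_moment P (axis undefined 1))"
    by (intro sum.cong refl arg_cong[where f = "\<lambda>x. - z * x"] second_moment_axis)
  also have "\<dots> = - z * sigma2 P" by (simp add: sigma2_eq[of undefined])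
  finally show ?thesis .
qed

lemma afun_0: "afun P 0 = 0"
  using afun_le_second_moment[of 0] afun_nonneg[of P 0] second_moment_scale[of 0 0] by simp

end

section \<open>The spread-out model\<close>

text \<open>Since m \<ge> 1 and m \<ge> N / c, 1 + y \<le> m (1 + c y / N) \<le> m exp(c y / N);
  then take N-th powers.\<close>

lemma exp_decay_le_bump_power:
  fixes c :: real
  assumes c: "c > 0"
  shows "\<exists>M\<ge>1. \<forall>y\<ge>0. exp (- c * y) \<le> M * (1 / (1 + y)) ^ N"
proof -
  define m where "m = max 1 (real N / c)"
  have m: "m \<ge> 1" "real N / c \<le> m" by (auto simp: m_def)
  show ?thesis
  proof (rule exI[of _ "m ^ N"], intro conjI allI impI)
    show "1 \<le> m ^ N" using m by simp
    fix y :: real assume y: "y \<ge> 0"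
    have "(1 + y) ^ N \<le> m ^ N * exp (c * y)"
    proof (cases "N = 0")
      case True
      then show ?thesis using c y by simp
    next
      case False
      have "1 + y \<le> m * (1 + c * y / real N)"
      proof -
        have "(real N / c) * (c * y / real N) \<le> m * (c * y / real N)"
          using c y by (intro mult_right_mono m) auto
        then show ?thesis using False c m by (simp add: distrib_left)
      qed
      also have "\<dots> \<le> m * exp (c * y / real N)"
        using m by (intro mult_left_mono exp_ge_add_one_self) auto
      finally have "(1 + y) ^ N \<le> (m * exp (c * y / real N)) ^ N" using y by (intro power_mono) auto
      also have "\<dots> = m ^ N * exp (c * y)"
        using False by (simp add: power_mult_distrib exp_of_nat_mult[symmetric])
      finally show ?thesis .
    qed
    then have "(1 + y) ^ N * exp (- c * y) \<le> m ^ N * exp (c * y) * exp (- c * y)" by (intro mult_right_mono) auto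
    also have "\<dots> = m ^ N" by (simp add: exp_minus)
    finally show "exp (- c * y) \<le> m ^ N * (1 / (1 + y)) ^ N" using y by (simp add: power_divide field_simps)
  qed
qed

text \<open>Keeping a below 2 - \<eta> keeps 1 - a away from - 1, so |1 - a| \<le> 1 - c a \<le>
  exp(- c a) on the whole range, also for a > 1.\<close>

lemma geometric_le_bump_power:
  fixes \<eta> :: real
  assumes \<eta>: "\<eta> > 0"
  shows "\<exists>M\<ge>1. \<forall>a. 0 \<le> a \<longrightarrow> a \<le> 2 - \<eta> \<longrightarrow> (\<forall>i. \<bar>1 - a\<bar> ^ i \<le> M * bump a i ^ N)"
proof -
  define c where "c = min (\<eta> / 2) 1"
  have c: "c > 0" "c \<le> 1" "c \<le> \<eta> / 2" using \<eta> by (auto simp: c_def)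
  obtain M where M: "M \<ge> 1" "\<And>y. y \<ge> 0 \<Longrightarrow> exp (- c * y) \<le> M * (1 / (1 + y)) ^ N"
    using exp_decay_le_bump_power[OF c(1), of N] by blast
  have "\<bar>1 - a\<bar> ^ i \<le> M * bump a i ^ N" if a: "0 \<le> a" "a \<le> 2 - \<eta>" for a i
  proof -
    have "c * a \<le> a" using c a mult_right_mono[of c 1 a] by simp
    moreover have "c * a \<le> c * 2" using a \<eta> c by (intro mult_left_mono) auto
    then have "c * a \<le> \<eta>" using c by linarith
    ultimately have "\<bar>1 - a\<bar> \<le> 1 - c * a" using a by (simp add: abs_le_iff)
    also have "\<dots> \<le> exp (- c * a)" using exp_ge_add_one_self[of "- c * a"] by simp
    finally have "\<bar>1 - a\<bar> ^ i \<le> exp (- c * a) ^ i" by (intro power_mono) auto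
    also have "\<dots> = exp (- c * (a * real i))" by (simp add: exp_of_nat_mult[symmetric] mult_ac)
    also have "\<dots> \<le> M * (1 / (1 + a * real i)) ^ N" using a by (intro M) auto
    finally show ?thesis by (simp add: bump_def)
  qed
  then show ?thesis using M(1) by blast
qed

locale spread_out_model =
  fixes D :: "real \<Rightarrow> (int ^ 'd::finite) pmf"
    and f g e :: "'d family"
    and \<theta> \<epsilon> pstar :: real
    and B :: "real set"
  assumes theta: "\<theta> > 2"
    and pstar: "pstar \<ge> 1"
    and B: "B \<noteq> {}" "B \<subseteq> {1..pstar}"
    and wp: "well_posed f"
    and rec: "recursion f g e"
    and S: "assumption_S f g e"
    and D: "assumption_D \<theta> \<epsilon> D f g e"
    and E: "assumption_E B pstar \<theta> D f e"
    and G: "assumption_G B pstar \<theta> \<epsilon> D f g"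
begin

lemma eps: "0 < \<epsilon>" "\<epsilon> < \<theta> - 2"
  using D by (auto simp: assumption_D_def)

text \<open>Since f takes real values, Assumption D at z = 1 forces \<open>Dhat\<close> to be real
  on the cube; the other equations then hold over the reals.\<close>

lemma first_step:
  assumes "L \<ge> 1" "z > 0" "k \<in> kcube"
  shows "f L 1 k z = z * (1 - afun (D L) k)" "e L 1 k z = 0" "g L 1 k z = z * (1 - afun (D L) k)"
    "Dhat (D L) k = complex_of_real (1 - afun (D L) k)"
proof -
  have *: "complex_of_real (f L 1 k z') = complex_of_real z' * Dhat (D L) k" "e L 1 k z' = 0"
    "complex_of_real (g L 1 k z') = complex_of_real z' * Dhat (D L) k" if "z' > 0" for z'
    using D assms that unfolding assumption_D_def by blast+
  have "Dhat (D L) k = complex_of_real (f L 1 k 1)" using *(1)[of 1] by simp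
  then show 1: "Dhat (D L) k = complex_of_real (1 - afun (D L) k)"
    by (simp add: afun_def)
  have "complex_of_real (f L 1 k z) = complex_of_real (z * (1 - afun (D L) k))"
    "complex_of_real (g L 1 k z) = complex_of_real (z * (1 - afun (D L) k))"
    using *(1,3)[OF assms(2)] 1 by simp_all
  then show "f L 1 k z = z * (1 - afun (D L) k)" "g L 1 k z = z * (1 - afun (D L) k)"
    by (simp_all only: of_real_eq_iff)
  show "e L 1 k z = 0" by (rule *(2)[OF assms(2)])
qed

lemma symmetric_families:
  assumes "L \<ge> 1" "n \<ge> 1" "z > 0"
  shows "cube_symmetric (\<lambda>k. f L n k z)" "cube_symmetric (\<lambda>k. e L n k z)" "cube_symmetric (\<lambda>k. g L n k z)"
  using S assms unfolding assumption_S_def by blast+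

lemma kcube_flip: "k \<in> kcube \<Longrightarrow> (\<chi> j. if j = i then - (k $ j) else k $ j) \<in> (kcube :: (real ^ 'd) set)"
  by (auto simp: kcube_def mem_box_cart minus_le_iff le_minus_iff)

lemma kcube_permute: "k \<in> kcube \<Longrightarrow> (\<chi> j. k $ (\<pi> j)) \<in> (kcube :: (real ^ 'd) set)"
  by (auto simp: kcube_def mem_box_cart)

lemma step: "L \<ge> 1 \<Longrightarrow> step_distribution (D L) \<epsilon>"
proof
  assume L: "L \<ge> 1"
  show "0 < \<epsilon>" by (rule eps)
  show "(\<lambda>x. norm (lattice_vec x) powr (2 + 2 * \<epsilon>) * pmf (D L) x) summable_on UNIV"
    using D L by (auto simp: assumption_D_def)
  have "cube_symmetric (\<lambda>k. g L 1 k 1)" using symmetric_families[of L 1 1] L by simp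
  moreover have "afun (D L) k = 1 - g L 1 k 1" if "k \<in> kcube" for k using first_step(3)[of L 1 k] L that by simp
  ultimately show "cube_symmetric (afun (D L))"
    unfolding cube_symmetric_def by (auto simp: kcube_flip kcube_permute)
qed

lemma recursion_at:
  assumes "L \<ge> 1" "z > 0" "k \<in> kcube"
  shows "f L 0 k z = 1" "n \<ge> 1 \<Longrightarrow> f L n k z = (\<Sum>m=1..n. g L m k z * f L (n - m) k z) + e L n k z"
proof -
  show "f L 0 k z = 1" using rec assms by (auto simp: recursion_def)
  assume "n \<ge> 1"
  then obtain n' where n: "n = n' + 1" by (metis add.commute le_iff_add)
  show "f L n k z = (\<Sum>m=1..n. g L m k z * f L (n - m) k z) + e L n k z"
    unfolding n using rec assms unfolding recursion_def by blast
qed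

text \<open>Order 0 of g and e is set to 0 because the model leaves these values unspecified and the
  recursion starts at order 1.\<close>

definition "Gf L z k = Abs_fps (\<lambda>m. if m = 0 then 0 else g L m k z)"
definition "Ef L z k = Abs_fps (\<lambda>m. if m = 0 then 0 else e L m k z)"
definition "Ff L z k = Abs_fps (\<lambda>m. f L m k z)"
definition "Tf L z = Abs_fps (\<lambda>m. laplacian (\<lambda>k. f L m k z) 0)"
definition "Gamf L z = Abs_fps (\<lambda>m. if m = 0 then 0 else laplacian (\<lambda>k. g L m k z) 0)"
definition "E2f L z = Abs_fps (\<lambda>m. if m = 0 then 0 else laplacian (\<lambda>k. e L m k z) 0)"

lemma sum_drop_0:
  fixes u :: "nat \<Rightarrow> real"
  shows "u 0 = 0 \<Longrightarrow> (\<Sum>i=0..n. u i) = (\<Sum>i=1..n. u i)"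
  by (simp add: sum.atLeast_Suc_atMost)

lemma recursion_fps:
  assumes "L \<ge> 1" "z > 0" "k \<in> kcube"
  shows "Ff L z k * (1 - Gf L z k) = 1 + Ef L z k"
proof (rule fps_ext)
  fix n
  have "(Gf L z k * Ff L z k) $$ n = (\<Sum>m=1..n. Gf L z k $$ m * Ff L z k $$ (n - m))"
    unfolding fps_mult_nth by (rule sum_drop_0) (simp add: Gf_def)
  also have "\<dots> = (\<Sum>m=1..n. g L m k z * f L (n - m) k z)"
    by (intro sum.cong) (auto simp: Gf_def Ff_def)
  finally have "(Gf L z k * Ff L z k) $$ n = (\<Sum>m=1..n. g L m k z * f L (n - m) k z)" .
  moreover have "(Ff L z k * (1 - Gf L z k)) $$ n = Ff L z k $$ n - (Gf L z k * Ff L z k) $$ n"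
    by (simp add: right_diff_distrib mult.commute[of "Ff L z k"])
  ultimately have 1: "(Ff L z k * (1 - Gf L z k)) $$ n = f L n k z - (\<Sum>m=1..n. g L m k z * f L (n - m) k z)"
    by (simp add: Ff_def)
  show "(Ff L z k * (1 - Gf L z k)) $$ n = (1 + Ef L z k) $$ n"
  proof (cases "n = 0")
    case True
    then show ?thesis unfolding 1 using recursion_at(1)[OF assms] by (simp add: Ef_def)
  next
    case False
    then show ?thesis unfolding 1 using recursion_at(2)[OF assms, of n] by (simp add: Ef_def)
  qed
qed

lemma laplacian_f: "L \<ge> 1 \<Longrightarrow> z > 0 \<Longrightarrow> has_laplacian (\<lambda>k. f L n k z) 0"
  using wp by (auto simp: well_posed_def)

lemma laplacian_g_1:
  assumes L: "L \<ge> 1" "z > 0"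
  shows "has_laplacian (\<lambda>k. g L 1 k z) 0" "laplacian (\<lambda>k. g L 1 k z) 0 = - z * sigma2 (D L)"
proof -
  interpret st: step_distribution "D L" \<epsilon> by (rule step[OF L(1)])
  show 1: "has_laplacian (\<lambda>k. g L 1 k z) 0"
    by (rule has_laplacian_cong(1)[OF _ laplacian_f[OF L, of 1]]) (simp only: first_step[OF L])
  show "laplacian (\<lambda>k. g L 1 k z) 0 = - z * sigma2 (D L)"
    by (rule st.laplacian_Dhat[OF 1 symmetric_families(3)[OF L(1) _ L(2)]]) (simp_all only: first_step[OF L] order_refl)
qed

lemma f_symmetric:
  assumes "L \<ge> 1" "z > 0" shows "cube_symmetric (\<lambda>k. f L n k z)"
proof (cases "n = 0")
  case True
  have "f L 0 k z = 1" if "k \<in> kcube" for k using recursion_at(1)[OF assms that] .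
  then show ?thesis using True by (auto simp: cube_symmetric_def kcube_flip kcube_permute)
qed (use symmetric_families assms in auto)

lemma laplacian_recursion:
  assumes L: "L \<ge> 1" "z > 0" and n: "n \<ge> 1"
    and g: "\<And>m. 2 \<le> m \<Longrightarrow> m \<le> n \<Longrightarrow> has_laplacian (\<lambda>k. g L m k z) 0"
  shows "has_laplacian (\<lambda>k. e L n k z) 0"
    "laplacian (\<lambda>k. f L n k z) 0 = (\<Sum>m=1..n. laplacian (\<lambda>k. g L m k z) 0 * f L (n - m) 0 z
       + g L m 0 z * laplacian (\<lambda>k. f L (n - m) k z) 0) + laplacian (\<lambda>k. e L n k z) 0"
proof -
  have g': "has_laplacian (\<lambda>k. g L m k z) 0 \<and> cube_symmetric (\<lambda>k. g L m k z)" if "1 \<le> m" "m \<le> n" for m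
    using g[of m] laplacian_g_1[OF L] symmetric_families(3)[OF L(1) that(1) L(2)] that by (cases "m = 1") auto
  have f': "has_laplacian (\<lambda>k. f L m k z) 0 \<and> cube_symmetric (\<lambda>k. f L m k z)" for m
    using laplacian_f[OF L] f_symmetric[OF L] by blast
  note lc = laplacian_convolution[where f = "\<lambda>m k. f L m k z" and g = "\<lambda>m k. g L m k z" and e = "\<lambda>k. e L n k z",
      OF recursion_at(2)[OF L _ n] f' g']
  show "has_laplacian (\<lambda>k. e L n k z) 0" by (rule lc(1))
  show "laplacian (\<lambda>k. f L n k z) 0 = (\<Sum>m=1..n. laplacian (\<lambda>k. g L m k z) 0 * f L (n - m) 0 z
       + g L m 0 z * laplacian (\<lambda>k. f L (n - m) k z) 0) + laplacian (\<lambda>k. e L n k z) 0"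
    by (rule lc(2))
qed

lemma laplacian_f_0: "L \<ge> 1 \<Longrightarrow> z > 0 \<Longrightarrow> laplacian (\<lambda>k. f L 0 k z) 0 = 0"
  by (rule laplacian_const[of _ 1]) (rule recursion_at(1))

text \<open>Stated for one coefficient because inside the induction g is known to have Laplacians
  only up to order n.\<close>

lemma laplacian_fps_nth:
  assumes L: "L \<ge> 1" "z > 0"
    and g: "\<And>m. 2 \<le> m \<Longrightarrow> m \<le> n \<Longrightarrow> has_laplacian (\<lambda>k. g L m k z) 0"
  shows "(Tf L z * (1 - Gf L z 0)) $$ n = (Gamf L z * Ff L z 0 + E2f L z) $$ n"
proof -
  have "(Gf L z 0 * Tf L z) $$ n = (\<Sum>m=1..n. Gf L z 0 $$ m * Tf L z $$ (n - m))"
    unfolding fps_mult_nth by (rule sum_drop_0) (simp add: Gf_def)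
  also have "\<dots> = (\<Sum>m=1..n. g L m 0 z * laplacian (\<lambda>k. f L (n - m) k z) 0)"
    by (intro sum.cong) (auto simp: Gf_def Tf_def)
  finally have 1: "(Gf L z 0 * Tf L z) $$ n = (\<Sum>m=1..n. g L m 0 z * laplacian (\<lambda>k. f L (n - m) k z) 0)" .
  have "(Gamf L z * Ff L z 0) $$ n = (\<Sum>m=1..n. Gamf L z $$ m * Ff L z 0 $$ (n - m))"
    unfolding fps_mult_nth by (rule sum_drop_0) (simp add: Gamf_def)
  also have "\<dots> = (\<Sum>m=1..n. laplacian (\<lambda>k. g L m k z) 0 * f L (n - m) 0 z)"
    by (intro sum.cong) (auto simp: Gamf_def Ff_def)
  finally have 2: "(Gamf L z * Ff L z 0) $$ n = (\<Sum>m=1..n. laplacian (\<lambda>k. g L m k z) 0 * f L (n - m) 0 z)" .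
  have 3: "(Tf L z * (1 - Gf L z 0)) $$ n = Tf L z $$ n - (Gf L z 0 * Tf L z) $$ n"
    by (simp add: right_diff_distrib mult.commute[of "Tf L z"])
  show ?thesis
  proof (cases "n = 0")
    case True
    then show ?thesis using laplacian_f_0[OF L] by (simp add: Tf_def Gamf_def E2f_def Gf_def)
  next
    case False
    then have "laplacian (\<lambda>k. f L n k z) 0 = (\<Sum>m=1..n. laplacian (\<lambda>k. g L m k z) 0 * f L (n - m) 0 z
       + g L m 0 z * laplacian (\<lambda>k. f L (n - m) k z) 0) + laplacian (\<lambda>k. e L n k z) 0"
      using laplacian_recursion(2)[OF L _ g] by simp
    then show ?thesis unfolding 3 fps_add_nth 1 2 using False by (simp add: Tf_def E2f_def sum.distrib)
  qed
qed

text \<open>The condition on the partial sums of \<open>g\<close> is what the choice of \<open>z\<close> in nested intervals provides;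
  the others come from Assumptions E and G.\<close>

definition controlled :: "real \<Rightarrow> real \<Rightarrow> real \<Rightarrow> nat \<Rightarrow> bool" where
  "controlled s L z n \<longleftrightarrow> z > 0 \<and> \<bar>z - 1\<bar> \<le> s \<and>
    (\<forall>j. 1 \<le> j \<and> j \<le> n \<longrightarrow> \<bar>1 - (\<Sum>m=1..j. g L m 0 z)\<bar> \<le> s * rho (\<theta> - 1) j) \<and>
    (\<forall>k\<in>kcube. \<forall>m. 2 \<le> m \<and> m \<le> n \<longrightarrow>
      \<bar>e L m k z\<bar> \<le> s * rho \<theta> m \<and>
      \<bar>e L m k z - e L m 0 z\<bar> \<le> s * afun (D L) k * rho (\<theta> - 1) m \<and>
      \<bar>g L m k z\<bar> \<le> s * rho \<theta> m \<and>
      has_laplacian (\<lambda>k. g L m k z) 0 \<and>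
      \<bar>laplacian (\<lambda>k. g L m k z) 0\<bar> \<le> s * sigma2 (D L) * rho (\<theta> - 1) m \<and>
      (\<forall>e'\<in>{0..\<epsilon>}. \<bar>g L m k z - g L m 0 z - afun (D L) k / sigma2 (D L) * laplacian (\<lambda>k. g L m k z) 0\<bar>
         \<le> s * afun (D L) k powr (1 + e') * rho (\<theta> - 1 - e') m))"

text \<open>The last bound of \<open>controlled\<close> at e' = 0 and the bound on the Laplacian
  each contribute s a \<open>rho (\<theta> - 1)\<close>; hence the factor 2.\<close>

lemma controlled_g_difference:
  assumes c: "controlled s L z n" and L: "L \<ge> 1" and s: "s \<ge> 0" and k: "k \<in> kcube" and m: "2 \<le> m" "m \<le> n"
    and sigma: "sigma2 (D L) > 0"
  shows "\<bar>g L m k z - g L m 0 z\<bar> \<le> 2 * s * afun (D L) k * rho (\<theta> - 1) m"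
proof -
  define a where "a = afun (D L) k"
  define \<Lambda> where "\<Lambda> = laplacian (\<lambda>k. g L m k z) 0"
  have a: "a \<ge> 0" by (simp add: a_def afun_nonneg)
  have "\<forall>e'\<in>{0..\<epsilon>}. \<bar>g L m k z - g L m 0 z - a / sigma2 (D L) * \<Lambda>\<bar> \<le> s * a powr (1 + e') * rho (\<theta> - 1 - e') m"
    using c k m unfolding controlled_def a_def \<Lambda>_def by blast
  from bspec[OF this, of 0]
  have "\<bar>g L m k z - g L m 0 z - a / sigma2 (D L) * \<Lambda>\<bar> \<le> s * a powr (1 + 0) * rho (\<theta> - 1 - 0) m"
    using eps by simp
  then have 1: "\<bar>g L m k z - g L m 0 z - a / sigma2 (D L) * \<Lambda>\<bar> \<le> s * a * rho (\<theta> - 1) m" using a by simp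
  have "\<bar>\<Lambda>\<bar> \<le> s * sigma2 (D L) * rho (\<theta> - 1) m"
    using c k m unfolding controlled_def \<Lambda>_def by blast
  then have "a / sigma2 (D L) * \<bar>\<Lambda>\<bar> \<le> a / sigma2 (D L) * (s * sigma2 (D L) * rho (\<theta> - 1) m)"
    using a sigma by (intro mult_left_mono) auto
  also have "\<dots> = s * a * rho (\<theta> - 1) m" using sigma by simp
  finally have "\<bar>a / sigma2 (D L) * \<Lambda>\<bar> \<le> s * a * rho (\<theta> - 1) m"
    using a sigma by (simp add: abs_mult abs_divide)
  moreover define w where "w = a / sigma2 (D L) * \<Lambda>"
  ultimately have w: "\<bar>w\<bar> \<le> s * a * rho (\<theta> - 1) m" "\<bar>g L m k z - g L m 0 z - w\<bar> \<le> s * a * rho (\<theta> - 1) m"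
    using 1 by auto
  have "2 * s * a * rho (\<theta> - 1) m = s * a * rho (\<theta> - 1) m + s * a * rho (\<theta> - 1) m" by simp
  then show ?thesis unfolding a_def[symmetric] using w by linarith
qed

lemma controlled_mono: "controlled s L z n \<Longrightarrow> m \<le> n \<Longrightarrow> controlled s L z m"
  unfolding controlled_def by (meson order_trans)

text \<open>One point at distance 1 / L on an axis suffices: a(k) is positive there by its lower
  bound, and a(k) is at most half the second moment form, a multiple of \<sigma>^2.\<close>

lemma sigma2_pos:
  assumes "L \<ge> 1" shows "sigma2 (D L) > 0"
proof -
  interpret st: step_distribution "D L" \<epsilon> by (rule step[OF assms])
  obtain c1 where c1: "c1 > 0" and lo: "\<And>k. k \<in> kcube \<Longrightarrow> infnorm k \<le> 1 / L \<Longrightarrow> c1 * L\<^sup>2 * (norm k)\<^sup>2 \<le> afun (D L) k"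
    using D assms unfolding assumption_D_def by meson
  define k :: "real ^ 'd" where "k = (1 / L) *\<^sub>R axis undefined 1"
  have nk: "norm k = 1 / L" using assms by (simp add: k_def)
  have "infnorm k \<le> 1 / L" using infnorm_le_norm[of k] nk by simp
  moreover have "k \<in> kcube"
  proof -
    have "1 / L \<le> 1" using assms by simp
    then have "1 / L \<le> pi" "- pi \<le> 1 / L" using pi_gt3 assms by (linarith, smt (verit) divide_nonneg_nonneg)
    then show ?thesis by (auto simp: k_def kcube_def mem_box_cart axis_def)
  qed
  ultimately have "c1 * L\<^sup>2 * (norm k)\<^sup>2 \<le> afun (D L) k" by (rule lo[rotated])
  moreover have "c1 * L\<^sup>2 * (norm k)\<^sup>2 > 0" using c1 assms nk by simp
  ultimately have "0 < second_moment (D L) k" using st.afun_le_second_moment[of k] by linarith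
  then have "0 < (norm k)\<^sup>2 * sigma2 (D L) / real CARD('d)" by (simp add: st.second_moment_eq)
  then show ?thesis using nk assms by (simp add: zero_less_mult_iff zero_less_divide_iff)
qed

text \<open>At least d, so that all powers p \<ge> 1 are integrable in k; at least \<theta>, for the
  decay in n; at least 2, for the sums of \<open>bump\<close>.\<close>

definition "decay_power = CARD('d) + nat \<lceil>\<theta>\<rceil> + 2"

definition "profile a n = bump a n ^ decay_power + rho (\<theta> - 2) n * (bump a n)\<^sup>2"

lemma decay_power: "CARD('d) \<le> decay_power" "\<theta> \<le> real decay_power" "2 \<le> decay_power"
  unfolding decay_power_def by (auto simp: of_nat_ceiling add_increasing2 intro: order_trans[OF real_nat_ceiling_ge])

lemma profile_le_2:
  assumes "0 \<le> a" "a \<le> 2" shows "profile a n \<le> 2"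
proof -
  have b: "0 \<le> bump a n" "bump a n \<le> 1" using bump_nonneg[OF assms] bump_le_1[OF assms] by auto
  have "bump a n ^ decay_power \<le> 1" by (intro power_le_one b)
  moreover have "rho (\<theta> - 2) n * (bump a n)\<^sup>2 \<le> 1 * 1"
    by (intro mult_mono rho_le_1 power_le_one b) (use theta in auto)
  ultimately show ?thesis unfolding profile_def by linarith
qed

text \<open>An application of \<open>pointwise_bound\<close>, where X is G without its random walk
  part (1 - a) fps_X and X0 is the same at zero momentum. The required control of the partial sums
  of X0 is the condition in \<open>controlled\<close> on the partial sums of g.\<close>

lemma f_pointwise:
  "\<exists>s1>0. \<exists>C>0. \<forall>s L z n. 0 \<le> s \<longrightarrow> s \<le> s1 \<longrightarrow> L \<ge> 1 \<longrightarrow> controlled s L z n \<longrightarrow>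
     (\<forall>m\<le>n. \<forall>k\<in>kcube. \<bar>f L m k z\<bar> \<le> C * profile (afun (D L) k) m)"
proof -
  obtain \<eta> where \<eta>: "\<eta> > 0" "\<And>L k. L \<ge> 1 \<Longrightarrow> k \<in> kcube \<Longrightarrow> afun (D L) k < 2 - \<eta>"
    using D unfolding assumption_D_def by meson
  obtain CN where CN: "CN \<ge> 1" "\<forall>a. 0 \<le> a \<longrightarrow> a \<le> 2 - \<eta> \<longrightarrow> (\<forall>i. \<bar>1 - a\<bar> ^ i \<le> CN * bump a i ^ decay_power)"
    using geometric_le_bump_power[OF \<eta>(1)] by blast
  obtain s0 C where s0: "s0 > 0" and C: "C > 0" and
    PB: "\<And>a n s F X X0 E. 0 \<le> a \<Longrightarrow> a \<le> 2 \<Longrightarrow> 0 \<le> s \<Longrightarrow> s \<le> s0 \<Longrightarrow>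
    (\<forall>i. \<bar>1 - a\<bar> ^ i \<le> CN * bump a i ^ decay_power) \<Longrightarrow>
    F * (1 - fps_const (1 - a) * fps_X - X) = 1 + E \<Longrightarrow> X $$ 0 = 0 \<Longrightarrow>
    (\<forall>m\<le>n. \<bar>E $$ m\<bar> \<le> rho \<theta> m \<and> \<bar>X0 $$ m\<bar> \<le> s * rho \<theta> m \<and> \<bar>X $$ m\<bar> \<le> s * rho \<theta> m \<and>
        \<bar>X $$ m - X0 $$ m\<bar> \<le> s * a * rho (\<theta> - 1) m \<and>
        \<bar>\<Sum>i\<le>m. X0 $$ i\<bar> \<le> s * rho (\<theta> - 1) m) \<Longrightarrow>
    (\<forall>m\<le>n. \<bar>F $$ m\<bar> \<le> C * (bump a m ^ decay_power + rho (\<theta> - 2) m * (bump a m)\<^sup>2))"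
    using pointwise_bound[OF theta decay_power(3) CN(1)] by blast
  \<comment> \<open>Absorbs two losses: the factor 2 in \<open>controlled_g_difference\<close>, and
    2^\<theta> at order 1, where |z - 1| \<le> s has to be compared with s
    \<open>rho \<theta> 1\<close>, that is s 2^(-\<theta>).\<close>
  define c where "c = 2 * 2 powr \<theta>"
  have p1: "1 \<le> 2 powr \<theta>" using theta by (intro ge_one_powr_ge_zero) auto
  have c: "c \<ge> 2" using p1 by (simp add: c_def)
  show ?thesis
  proof (rule exI[of _ "min 1 (s0 / c)"], intro conjI exI[of _ C] allI impI ballI C)
    show "0 < min 1 (s0 / c)" using s0 c by simp
    fix s L z n m and k :: "real ^ 'd"
    assume s: "0 \<le> s" "s \<le> min 1 (s0 / c)" and L: "L \<ge> 1" and ct: "controlled s L z n" and m: "m \<le> n" and k: "k \<in> kcube"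
    define a where "a = afun (D L) k"
    have a: "0 \<le> a" "a \<le> 2" "a \<le> 2 - \<eta>"
      using afun_nonneg[of "D L" k] afun_le_2[of "D L" k] \<eta>(2)[OF L k] by (auto simp: a_def)
    have z: "z > 0" "\<bar>z - 1\<bar> \<le> s" using ct by (auto simp: controlled_def)
    have sig: "sigma2 (D L) > 0" by (rule sigma2_pos[OF L])
    define X where "X = Gf L z k - fps_const (1 - a) * fps_X"
    define X0 where "X0 = Gf L z 0 - fps_X"
    define s' where "s' = c * s"
    have s': "0 \<le> s'" "s' \<le> s0"
    proof -
      show "0 \<le> s'" using s c by (simp add: s'_def)
      have "s \<le> s0 / c" using s by simp
      then show "s' \<le> s0" using c by (simp add: s'_def field_simps)
    qed
    have ss: "s \<le> s'" "2 * s \<le> s'" "s * 2 powr \<theta> \<le> s'"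
      using mult_right_mono[OF c s(1)] s mult_nonneg_nonneg[OF s(1), of "2 powr \<theta>"] by (auto simp: s'_def c_def)
    interpret st: step_distribution "D L" \<epsilon> by (rule step[OF L])
    have X1: "X $$ 1 = (z - 1) * (1 - a)" "X0 $$ 1 = z - 1"
      using first_step(3)[OF L z(1) k] first_step(3)[OF L z(1) zero_in_kcube] st.afun_0
      by (auto simp: X_def X0_def Gf_def a_def algebra_simps)
    have Xm: "X $$ i = g L i k z" "X0 $$ i = g L i 0 z" "Ef L z k $$ i = e L i k z" if "i \<ge> 2" for i
      using that by (auto simp: X_def X0_def Gf_def Ef_def fps_X_nth)
    have X00: "X $$ 0 = 0" "X0 $$ 0 = 0" "Ef L z k $$ 0 = 0" by (auto simp: X_def X0_def Gf_def Ef_def)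
    have E1: "Ef L z k $$ 1 = 0" using first_step(2)[OF L z(1) k] by (simp add: Ef_def)
    have rho1: "1 = 2 powr q * rho q 1" for q by (simp add: rho_def powr_minus)
    have r1: "s \<le> s' * rho \<theta> 1" "s \<le> s' * rho (\<theta> - 1) 1"
    proof -
      have "s = s * (2 powr \<theta> * rho \<theta> 1)" by (simp only: rho1[symmetric] mult_1_right)
      also have "\<dots> = (s * 2 powr \<theta>) * rho \<theta> 1" by (simp only: mult.assoc)
      also have "\<dots> \<le> s' * rho \<theta> 1" by (intro mult_right_mono ss(3)) simp
      finally show 1: "s \<le> s' * rho \<theta> 1" .
      have "s' * rho \<theta> 1 \<le> s' * rho (\<theta> - 1) 1" using s' by (intro mult_left_mono rho_antimono) auto
      then show "s \<le> s' * rho (\<theta> - 1) 1" using 1 by linarith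
    qed
    have bounds: "\<bar>Ef L z k $$ i\<bar> \<le> rho \<theta> i \<and> \<bar>X0 $$ i\<bar> \<le> s' * rho \<theta> i \<and> \<bar>X $$ i\<bar> \<le> s' * rho \<theta> i \<and>
        \<bar>X $$ i - X0 $$ i\<bar> \<le> s' * a * rho (\<theta> - 1) i \<and>
        \<bar>\<Sum>j\<le>i. X0 $$ j\<bar> \<le> s' * rho (\<theta> - 1) i" if i: "i \<le> n" for i
    proof -
      have ps: "\<bar>\<Sum>j\<le>i. X0 $$ j\<bar> \<le> s' * rho (\<theta> - 1) i"
      proof (cases "i = 0")
        case True
        then show ?thesis using X00 s' by simp
      next
        case False
        have "(\<Sum>j\<le>i. X0 $$ j) = (\<Sum>j=0..i. X0 $$ j)" by (simp add: atLeast0AtMost)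
        also have "\<dots> = (\<Sum>j=1..i. X0 $$ j)" by (rule sum_drop_0) (rule X00)
        also have "\<dots> = (\<Sum>j=1..i. g L j 0 z - (if j = 1 then 1 else 0))"
          by (intro sum.cong) (auto simp: X0_def Gf_def fps_X_nth)
        also have "\<dots> = (\<Sum>j=1..i. g L j 0 z) - 1" using False by (simp add: sum_subtractf sum.delta)
        finally have "\<bar>\<Sum>j\<le>i. X0 $$ j\<bar> = \<bar>1 - (\<Sum>j=1..i. g L j 0 z)\<bar>" by (simp add: abs_minus_commute)
        also have "\<dots> \<le> s * rho (\<theta> - 1) i" using ct i False by (auto simp: controlled_def)
        also have "\<dots> \<le> s' * rho (\<theta> - 1) i" using ss by (intro mult_right_mono) auto
        finally show ?thesis .
      qed
      consider "i = 0" | "i = 1" | "i \<ge> 2" by linarith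
      then show ?thesis
      proof cases
        case 1
        then show ?thesis using X00 s' a ps by simp
      next
        case 2
        have "\<bar>1 - a\<bar> \<le> 1" using a by simp
        then have "\<bar>z - 1\<bar> * \<bar>1 - a\<bar> \<le> s * 1" using z s by (intro mult_mono) auto
        moreover have "\<bar>X $$ 1\<bar> = \<bar>z - 1\<bar> * \<bar>1 - a\<bar>" by (simp only: X1 abs_mult)
        ultimately have x: "\<bar>X $$ 1\<bar> \<le> s' * rho \<theta> 1" using r1 by linarith
        have "X $$ 1 - X0 $$ 1 = - ((z - 1) * a)" by (simp only: X1) (simp add: algebra_simps)
        then have "\<bar>X $$ 1 - X0 $$ 1\<bar> = \<bar>z - 1\<bar> * a" using a by (simp add: abs_mult)
        also have "\<dots> \<le> (s' * rho (\<theta> - 1) 1) * a" using z r1 a by (intro mult_right_mono) auto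
        finally have y: "\<bar>X $$ 1 - X0 $$ 1\<bar> \<le> s' * a * rho (\<theta> - 1) 1" by (simp add: mult_ac)
        have "\<bar>X0 $$ 1\<bar> \<le> s' * rho \<theta> 1" unfolding X1 using z r1 by linarith
        then show ?thesis using x y ps E1 2 by (simp only: abs_zero rho_nonneg simp_thms)
      next
        case 3
        have b: "\<bar>e L i k z\<bar> \<le> s * rho \<theta> i" "\<bar>g L i k z\<bar> \<le> s * rho \<theta> i" "\<bar>g L i 0 z\<bar> \<le> s * rho \<theta> i"
          using ct i k 3 zero_in_kcube unfolding controlled_def by blast+
        have s1: "s * rho \<theta> i \<le> 1 * rho \<theta> i" "s * rho \<theta> i \<le> s' * rho \<theta> i"
          by (intro mult_right_mono; use s ss in simp)+
        have b': "\<bar>e L i k z\<bar> \<le> rho \<theta> i" "\<bar>g L i k z\<bar> \<le> s' * rho \<theta> i" "\<bar>g L i 0 z\<bar> \<le> s' * rho \<theta> i"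
          using b s1 by linarith+
        have "\<bar>g L i k z - g L i 0 z\<bar> \<le> 2 * s * a * rho (\<theta> - 1) i"
          unfolding a_def by (rule controlled_g_difference[OF ct L s(1) k 3 i sig])
        also have "\<dots> \<le> s' * a * rho (\<theta> - 1) i" using ss a by (intro mult_right_mono) auto
        finally show ?thesis using b' ps by (simp only: Xm[OF 3] simp_thms)
      qed
    qed
    have "Ff L z k * (1 - fps_const (1 - a) * fps_X - X) = 1 + Ef L z k"
      using recursion_fps[OF L z(1) k] by (simp add: X_def)
    from PB[OF a(1,2) s' CN(2)[rule_format, OF a(1,3), THEN allI] this X00(1), of n X0] bounds m
    show "\<bar>f L m k z\<bar> \<le> C * profile (afun (D L) k) m"
      by (simp add: Ff_def profile_def a_def)
  qed
qed

text \<open>As K is chosen before p, the bound serves all p in B simultaneously in the induction,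
  and part (c) for every p \<ge> 1 at the end.\<close>

lemma f_lp_bound:
  "\<exists>K>0. \<exists>s1>0. \<forall>s L z n p. 0 \<le> s \<longrightarrow> s \<le> s1 \<longrightarrow> L \<ge> 1 \<longrightarrow> n \<ge> 1 \<longrightarrow> p \<ge> 1 \<longrightarrow> controlled s L z n \<longrightarrow>
     lp_norm p (\<lambda>k. (Dhat (D L) k)\<^sup>2 * complex_of_real (f L n k z))
       \<le> ennreal (K / (L powr (real CARD('d) / p) * real n powr min (real CARD('d) / (2 * p)) \<theta>))"
proof -
  obtain s1 Cf where s1: "s1 > 0" and Cf: "Cf > 0" and
    fb0: "\<forall>s L z n. 0 \<le> s \<longrightarrow> s \<le> s1 \<longrightarrow> L \<ge> 1 \<longrightarrow> controlled s L z n \<longrightarrow>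
     (\<forall>m\<le>n. \<forall>k\<in>kcube. \<bar>f L m k z\<bar> \<le> Cf * profile (afun (D L) k) m)"
    using f_pointwise by (elim exE conjE) (rule that; assumption)
  have fb: "\<bar>f L m k z\<bar> \<le> Cf * profile (afun (D L) k) m"
    if "0 \<le> s" "s \<le> s1" "L \<ge> 1" "controlled s L z n" "m \<le> n" "k \<in> kcube" for s L z n m k
    using fb0 that by blast
  obtain CD where CD: "\<And>L. L \<ge> 1 \<Longrightarrow> (SUP x. pmf (D L) x) \<le> CD * L powr (- real CARD('d))"
    using D unfolding assumption_D_def by meson
  obtain \<eta> c1 where \<eta>: "\<eta> > 0" "c1 > 0" and reg: "\<And>L k. L \<ge> 1 \<Longrightarrow> k \<in> kcube \<Longrightarrow>
      (infnorm k \<le> 1 / L \<longrightarrow> c1 * L\<^sup>2 * (norm k)\<^sup>2 \<le> afun (D L) k) \<and> (1 / L \<le> infnorm k \<longrightarrow> \<eta> < afun (D L) k)"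
    using D unfolding assumption_D_def by meson
  obtain Kp where Kp: "Kp > 0" and lp: "\<And>(P :: (int ^ 'd) pmf) L p n C F. L \<ge> 1 \<Longrightarrow> p \<ge> 1 \<Longrightarrow> n \<ge> 1 \<Longrightarrow> C \<ge> 0 \<Longrightarrow>
     (SUP x. pmf P x) \<le> max 1 CD * L powr (- real CARD('d)) \<Longrightarrow>
     (\<forall>k\<in>kcube. (infnorm k \<le> 1 / L \<longrightarrow> c1 * L\<^sup>2 * (norm k)\<^sup>2 \<le> afun P k) \<and> (1 / L \<le> infnorm k \<longrightarrow> \<eta> < afun P k)) \<Longrightarrow>
     (\<forall>k\<in>kcube. \<bar>F k\<bar> \<le> C * (bump (afun P k) n ^ decay_power + rho (\<theta> - 2) n * (bump (afun P k) n)\<^sup>2)) \<Longrightarrow>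
     lp_norm p (\<lambda>k. (Dhat P k)\<^sup>2 * complex_of_real (F k)) \<le> ennreal (Kp * C / (L powr (real CARD('d) / p) * real n powr min (real CARD('d) / (2 * p)) \<theta>))"
  proof -
    have "max 1 CD > 0" by simp
    from lp_norm_bound[OF theta decay_power(1,2) \<eta> this] show ?thesis
      by (elim exE conjE) (rule that, assumption, blast)
  qed
  show ?thesis
  proof (rule exI[of _ "Kp * Cf"], intro conjI exI[of _ s1] s1 mult_pos_pos Kp Cf allI impI)
    fix s L z p :: real and n :: nat
    assume s: "0 \<le> s" "s \<le> s1" and L: "L \<ge> 1" and n: "n \<ge> 1" and p1: "p \<ge> 1" and ct: "controlled s L z n"
    show "lp_norm p (\<lambda>k. (Dhat (D L) k)\<^sup>2 * complex_of_real (f L n k z))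
         \<le> ennreal (Kp * Cf / (L powr (real CARD('d) / p) * real n powr min (real CARD('d) / (2 * p)) \<theta>))"
      proof (rule lp[OF L p1 n])
        show "0 \<le> Cf" using Cf by simp
        have "CD * L powr (- real CARD('d)) \<le> max 1 CD * L powr (- real CARD('d))" by (intro mult_right_mono) auto
        then show "(SUP x. pmf (D L) x) \<le> max 1 CD * L powr (- real CARD('d))" using CD[OF L] by linarith
        show "\<forall>k\<in>kcube. (infnorm k \<le> 1 / L \<longrightarrow> c1 * L\<^sup>2 * (norm k)\<^sup>2 \<le> afun (D L) k) \<and> (1 / L \<le> infnorm k \<longrightarrow> \<eta> < afun (D L) k)"
          using reg[OF L] by blast
        show "\<forall>k\<in>kcube. \<bar>f L n k z\<bar> \<le> Cf * (bump (afun (D L) k) n ^ decay_power + rho (\<theta> - 2) n * (bump (afun (D L) k) n)\<^sup>2)"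
          using fb[OF s L ct order_refl] unfolding profile_def by blast
      qed
  qed
qed

text \<open>Closes the circle of the induction: K comes from \<theta> and Assumption D through the
  random walk estimates and is the same for all s \<le> s1. So the constants of Assumptions E and G
  can be evaluated at this K before L is taken large.\<close>

lemma star_from_controlled:
  "\<exists>K>1. \<exists>s1>0. \<forall>s L z n. 0 \<le> s \<longrightarrow> s \<le> s1 \<longrightarrow> L \<ge> 1 \<longrightarrow> n \<ge> 1 \<longrightarrow> controlled s L z n \<longrightarrow> star_bounds B \<theta> D f K L z n"
proof -
  obtain s1 Cf where s1: "s1 > 0" and Cf: "Cf > 0" and
    fb0: "\<forall>s L z n. 0 \<le> s \<longrightarrow> s \<le> s1 \<longrightarrow> L \<ge> 1 \<longrightarrow> controlled s L z n \<longrightarrow>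
     (\<forall>m\<le>n. \<forall>k\<in>kcube. \<bar>f L m k z\<bar> \<le> Cf * profile (afun (D L) k) m)"
    using f_pointwise by (elim exE conjE) (rule that; assumption)
  have fb: "\<bar>f L m k z\<bar> \<le> Cf * profile (afun (D L) k) m"
    if "0 \<le> s" "s \<le> s1" "L \<ge> 1" "controlled s L z n" "m \<le> n" "k \<in> kcube" for s L z n m k
    using fb0 that by blast
  obtain Kp s0 where Kp: "Kp > 0" and s0: "s0 > 0" and
    lp: "\<forall>s L z n p. 0 \<le> s \<longrightarrow> s \<le> s0 \<longrightarrow> L \<ge> 1 \<longrightarrow> n \<ge> 1 \<longrightarrow> p \<ge> 1 \<longrightarrow> controlled s L z n \<longrightarrow>
     lp_norm p (\<lambda>k. (Dhat (D L) k)\<^sup>2 * complex_of_real (f L n k z))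
       \<le> ennreal (Kp / (L powr (real CARD('d) / p) * real n powr min (real CARD('d) / (2 * p)) \<theta>))"
    using f_lp_bound by (elim exE conjE) (rule that; assumption)
  define Z where "Z = suminf (rho (\<theta> - 1))"
  have Z: "Z \<ge> 1" unfolding Z_def by (rule suminf_rho_ge_1) (use theta in simp)
  define P where "P = 2 * 2 powr \<theta>"
  have p1: "1 \<le> 2 powr \<theta>" using theta by (intro ge_one_powr_ge_zero) auto
  define Kl where "Kl = 4 * Z * (P * (2 * Cf) * Z + 1)"
  define K where "K = 2 + Kp + 2 * Cf + Kl"
  have Kl: "Kl \<ge> 0" unfolding Kl_def P_def using Z Cf p1 by (intro mult_nonneg_nonneg add_nonneg_nonneg) auto
  have K: "K > 1" unfolding K_def using Kp Cf Kl by simp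
  define s2 where "s2 = min (min 1 (min s0 s1)) (1 / (2 * rho_conv_const (\<theta> - 1)))"
  have rc: "rho_conv_const (\<theta> - 1) \<ge> 2" by (rule rho_conv_const_pos) (use theta in simp)
  have s2: "s2 > 0" using s1 s0 rc by (simp add: s2_def)
  show ?thesis
  proof (rule exI[of _ K], intro conjI K exI[of _ s2] s2 allI impI)
    fix s L z n
    assume s: "0 \<le> s" "s \<le> s2" and L: "L \<ge> 1" and n: "n \<ge> 1" and ct: "controlled s L z n"
    have s': "s \<le> s1" "s \<le> 1" "2 * s * rho_conv_const (\<theta> - 1) \<le> 1" "s \<le> s0"
    proof -
      show "s \<le> s1" "s \<le> 1" "s \<le> s0" using s by (auto simp: s2_def)
      have "s \<le> 1 / (2 * rho_conv_const (\<theta> - 1))" using s by (simp add: s2_def)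
      then show "2 * s * rho_conv_const (\<theta> - 1) \<le> 1" using rc by (simp add: field_simps)
    qed
    have z: "z > 0" "\<bar>z - 1\<bar> \<le> s" using ct by (auto simp: controlled_def)
    have sig: "sigma2 (D L) > 0" by (rule sigma2_pos[OF L])
    interpret st: step_distribution "D L" \<epsilon> by (rule step[OF L])
    have f0: "\<bar>f L m 0 z\<bar> \<le> 2 * Cf" if "m \<le> n" for m
    proof -
      have "\<bar>f L m 0 z\<bar> \<le> Cf * profile (afun (D L) 0) m"
        by (rule fb[OF s(1) s'(1) L ct that zero_in_kcube])
      also have "\<dots> \<le> Cf * 2" by (intro mult_left_mono profile_le_2 afun_nonneg afun_le_2) (use Cf in simp)
      finally show ?thesis by simp
    qed
    have part1: "lp_norm p (\<lambda>k. (Dhat (D L) k)\<^sup>2 * complex_of_real (f L n k z))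
       \<le> ennreal (K / (L powr (real CARD('d) / p) * real n powr min (real CARD('d) / (2 * p)) \<theta>))" if p: "p \<in> B" for p
    proof -
      have "p \<ge> 1" using p B by auto
      then have "lp_norm p (\<lambda>k. (Dhat (D L) k)\<^sup>2 * complex_of_real (f L n k z))
         \<le> ennreal (Kp / (L powr (real CARD('d) / p) * real n powr min (real CARD('d) / (2 * p)) \<theta>))"
        using lp s(1) s'(4) L n ct by blast
      also have "\<dots> \<le> ennreal (K / (L powr (real CARD('d) / p) * real n powr min (real CARD('d) / (2 * p)) \<theta>))"
        by (intro ennreal_leI divide_right_mono) (use Cf Kl in \<open>auto simp: K_def\<close>)
      finally show ?thesis .
    qed
    have part2: "\<bar>f L n 0 z\<bar> \<le> K"
      using f0[OF order_refl] Kl Kp by (simp add: K_def)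
    have lapg: "has_laplacian (\<lambda>k. g L m k z) 0" if "2 \<le> m" "m \<le> n" for m
      using ct that zero_in_kcube unfolding controlled_def by blast
    define \<sigma> where "\<sigma> = sigma2 (D L)"
    have sg: "\<sigma> > 0" using sig by (simp add: \<sigma>_def)
    have part3: "\<bar>laplacian (\<lambda>k. f L n k z) 0\<bar> \<le> K * \<sigma> * real n"
    proof -
      text \<open>Only orders up to \<open>n\<close> are controlled, so the series are cut off there; the bound
        only sees these orders.\<close>
      define V where "V = Tf L z * (1 - Gf L z 0) - Gamf L z * Ff L z 0"
      have Vn: "V $$ m = E2f L z $$ m" if "m \<le> n" for m
        using laplacian_fps_nth[OF L z(1), of m] lapg that by (simp add: V_def)
      have "\<bar>Tf L z $$ n\<bar> \<le> (real n + 1) * (2 * suminf (rho (\<theta> - 1)) * (P * \<sigma> * (2 * Cf) * suminf (rho (\<theta> - 1)) + \<sigma>))"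
      proof (rule laplacian_growth_bound[OF theta s(1) s'(3)])
        show "Gf L z 0 $$ 0 = 0" by (simp add: Gf_def)
        show "\<bar>1 - (\<Sum>i\<le>m. Gf L z 0 $$ i)\<bar> \<le> s * rho (\<theta> - 1) m \<or> m = 0" if "m \<le> n" for m
        proof (cases "m = 0")
          case False
          have "(\<Sum>i\<le>m. Gf L z 0 $$ i) = (\<Sum>i=0..m. Gf L z 0 $$ i)" by (simp add: atLeast0AtMost)
          also have "\<dots> = (\<Sum>i=1..m. Gf L z 0 $$ i)" by (rule sum_drop_0) (simp add: Gf_def)
          also have "\<dots> = (\<Sum>i=1..m. g L i 0 z)" by (intro sum.cong) (auto simp: Gf_def)
          finally show ?thesis using ct that False by (auto simp: controlled_def)
        qed simp
        show "Tf L z * (1 - Gf L z 0) = Gamf L z * Ff L z 0 + V" by (simp add: V_def)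
        show "\<bar>Gamf L z $$ m\<bar> \<le> P * \<sigma> * rho (\<theta> - 1) m" if m: "m \<le> n" for m
        proof -
          consider "m = 0" | "m = 1" | "m \<ge> 2" by linarith
          then show ?thesis
          proof cases
            case 1
            then show ?thesis using sg p1 by (simp add: Gamf_def P_def)
          next
            case 2
            have "\<bar>z\<bar> \<le> 2" using z s' by linarith
            then have "\<bar>z\<bar> * \<sigma> \<le> 2 * \<sigma>" using sg by (intro mult_right_mono) auto
            also have "2 * \<sigma> \<le> P * \<sigma> * rho (\<theta> - 1) 1"
            proof -
              have "1 = 2 powr (\<theta> - 1) * rho (\<theta> - 1) 1" by (simp add: rho_def powr_minus powr_diff)
              also have "\<dots> \<le> 2 powr \<theta> * rho (\<theta> - 1) 1" by (intro mult_right_mono) auto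
              finally have "2 * \<sigma> * 1 \<le> 2 * \<sigma> * (2 powr \<theta> * rho (\<theta> - 1) 1)" using sg by (intro mult_left_mono) auto
              then show ?thesis by (simp add: P_def mult_ac)
            qed
            finally show ?thesis using laplacian_g_1(2)[OF L z(1)] sg 2 by (simp add: Gamf_def abs_mult \<sigma>_def)
          next
            case 3
            have "\<bar>laplacian (\<lambda>k. g L m k z) 0\<bar> \<le> s * \<sigma> * rho (\<theta> - 1) m"
              using ct m 3 zero_in_kcube unfolding controlled_def \<sigma>_def by blast
            also have "\<dots> \<le> P * \<sigma> * rho (\<theta> - 1) m"
              using s' p1 sg by (intro mult_right_mono) (auto simp: P_def)
            finally show ?thesis using 3 by (simp add: Gamf_def)
          qed
        qed
        show "\<bar>Ff L z 0 $$ m\<bar> \<le> 2 * Cf" if "m \<le> n" for m using f0[OF that] by (simp add: Ff_def)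
        show "\<bar>V $$ m\<bar> \<le> \<sigma>" if m: "m \<le> n" for m
        proof -
          consider "m = 0" | "m = 1" | "m \<ge> 2" by linarith
          then show ?thesis
          proof cases
            case 1
            then show ?thesis using sg Vn[OF m] by (simp add: E2f_def)
          next
            case 2
            have "laplacian (\<lambda>k. e L 1 k z) 0 = 0"
              by (rule laplacian_const[of _ 0]) (rule first_step(2)[OF L z(1)])
            then show ?thesis using sg Vn[OF m] 2 by (simp add: E2f_def)
          next
            case 3
            have "has_laplacian (\<lambda>k. e L m k z) 0"
              using laplacian_recursion(1)[OF L z(1), of m] lapg m 3 by simp
            moreover have "cube_symmetric (\<lambda>k. e L m k z)" using symmetric_families(2)[OF L _ z(1)] 3 by simp
            ultimately have "\<bar>laplacian (\<lambda>k. e L m k z) 0\<bar> \<le> s * rho (\<theta> - 1) m * \<sigma>"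
              unfolding \<sigma>_def
            proof (rule st.laplacian_bound)
              show "\<bar>e L m k z - e L m 0 z\<bar> \<le> s * rho (\<theta> - 1) m * afun (D L) k" if "k \<in> kcube" for k
              proof -
                have "\<bar>e L m k z - e L m 0 z\<bar> \<le> s * afun (D L) k * rho (\<theta> - 1) m"
                  using ct m 3 that unfolding controlled_def by blast
                then show ?thesis by (simp add: mult_ac)
              qed
            qed (use s in simp)
            also have "\<dots> \<le> 1 * 1 * \<sigma>"
              using s' sg theta s by (intro mult_right_mono mult_mono rho_le_1) auto
            finally show ?thesis using Vn[OF m] 3 by (simp add: E2f_def)
          qed
        qed
      qed (use sg p1 Cf in \<open>auto simp: P_def\<close>)
      also have "\<dots> \<le> (2 * real n) * (2 * Z * (P * \<sigma> * (2 * Cf) * Z + \<sigma>))"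
        unfolding Z_def[symmetric] using n Z Cf sg p1
        by (intro mult_right_mono mult_nonneg_nonneg add_nonneg_nonneg) (auto simp: P_def)
      also have "\<dots> = Kl * \<sigma> * real n" by (simp add: Kl_def algebra_simps)
      also have "\<dots> \<le> K * \<sigma> * real n"
        using sg Kp Cf by (intro mult_right_mono) (auto simp: K_def)
      finally show ?thesis by (simp add: Tf_def)
    qed
    show "star_bounds B \<theta> D f K L z n"
      unfolding star_bounds_def using part1 part2 part3 by (simp add: \<sigma>_def)
  qed
qed

end

section \<open>The critical point\<close>

text \<open>Take the last point a' where S is at most lo, then the first point b' after it where S
  is at least hi. Intermediate values give equality at both, and extremality keeps S between lo and
  hi in between; S may oscillate.\<close>

lemma level_interval:
  fixes S :: "real \<Rightarrow> real"
  assumes cont: "continuous_on {a..b} S" and ab: "a \<le> b" and S: "S a \<le> lo" "hi \<le> S b" and lh: "lo \<le> hi"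
  shows "\<exists>a' b'. a \<le> a' \<and> a' \<le> b' \<and> b' \<le> b \<and> S a' = lo \<and> S b' = hi \<and> (\<forall>z\<in>{a'..b'}. lo \<le> S z \<and> S z \<le> hi)"
proof -
  have compact_le: "compact {z \<in> {c..d}. S z \<le> y}" "compact {z \<in> {c..d}. y \<le> S z}" if "a \<le> c" "d \<le> b" for c d y
  proof -
    have c: "continuous_on {c..d} S" by (rule continuous_on_subset[OF cont]) (use that in auto)
    have "closed ({c..d} \<inter> S -` {..y})" "closed ({c..d} \<inter> S -` {y..})"
      by (rule continuous_closed_preimage[OF c closed_atLeastAtMost closed_atMost],
          rule continuous_closed_preimage[OF c closed_atLeastAtMost closed_atLeast])
    moreover have "{c..d} \<inter> S -` {..y} = {z \<in> {c..d}. S z \<le> y}" "{c..d} \<inter> S -` {y..} = {z \<in> {c..d}. y \<le> S z}" by auto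
    ultimately have "closed {z \<in> {c..d}. S z \<le> y}" "closed {z \<in> {c..d}. y \<le> S z}" by simp_all
    moreover have "bounded {z \<in> {c..d}. S z \<le> y}" "bounded {z \<in> {c..d}. y \<le> S z}"
      by (rule bounded_subset[OF bounded_closed_interval[of c d]], auto)+
    ultimately show "compact {z \<in> {c..d}. S z \<le> y}" "compact {z \<in> {c..d}. y \<le> S z}"
      by (auto simp: compact_eq_bounded_closed)
  qed
  obtain a' where a': "a' \<in> {z \<in> {a..b}. S z \<le> lo}" "\<And>z. z \<in> {z \<in> {a..b}. S z \<le> lo} \<Longrightarrow> z \<le> a'"
    using compact_attains_sup[OF compact_le(1)[of a b lo]] ab S by auto
  have Sa': "S a' = lo"
  proof -
    have "\<exists>z\<ge>a'. z \<le> b \<and> S z = lo"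
      by (rule IVT') (use a'(1) S lh continuous_on_subset[OF cont] in auto)
    then obtain z where "z \<ge> a'" "z \<le> b" "S z = lo" by blast
    with a' have "z = a'" by (intro antisym) auto
    with \<open>S z = lo\<close> show ?thesis by simp
  qed
  have above: "lo \<le> S z" if "z \<in> {a'..b}" for z
  proof (rule ccontr)
    assume "\<not> lo \<le> S z"
    then have "z \<le> a'" using a'(1) that by (intro a'(2)) auto
    then have "z = a'" using that by auto
    then show False using Sa' \<open>\<not> lo \<le> S z\<close> by simp
  qed
  obtain b' where b': "b' \<in> {z \<in> {a'..b}. hi \<le> S z}" "\<And>z. z \<in> {z \<in> {a'..b}. hi \<le> S z} \<Longrightarrow> b' \<le> z"
    using compact_attains_inf[OF compact_le(2)[of a' b hi]] a'(1) S by auto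
  have Sb': "S b' = hi"
  proof -
    have "\<exists>z\<ge>a'. z \<le> b' \<and> S z = hi"
      by (rule IVT') (use a'(1) b'(1) Sa' lh continuous_on_subset[OF cont] in auto)
    then obtain z where "z \<ge> a'" "z \<le> b'" "S z = hi" by blast
    with b' have "z = b'" by (intro antisym) auto
    with \<open>S z = hi\<close> show ?thesis by simp
  qed
  have below: "S z \<le> hi" if "z \<in> {a'..b'}" for z
  proof (rule ccontr)
    assume "\<not> S z \<le> hi"
    then have "b' \<le> z" using b'(1) that by (intro b'(2)) auto
    then have "z = b'" using that by auto
    then show False using Sb' \<open>\<not> S z \<le> hi\<close> by simp
  qed
  show ?thesis
    using a'(1) b'(1) Sa' Sb' above below by (intro exI[of _ a'] exI[of _ b']) auto
qed

text \<open>The property speaks of both endpoints because the construction prescribes the exact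
  values of the partial sums there, and the next stage needs them.\<close>

lemma nested_intervals:
  fixes P :: "nat \<Rightarrow> real \<Rightarrow> real \<Rightarrow> bool"
  assumes base: "\<exists>a b. a \<le> b \<and> P 0 a b"
    and step: "\<And>n a b. a \<le> b \<Longrightarrow> P n a b \<Longrightarrow> \<exists>a' b'. a \<le> a' \<and> a' \<le> b' \<and> b' \<le> b \<and> P (Suc n) a' b'"
  shows "\<exists>z. \<forall>n. \<exists>a b. z \<in> {a..b} \<and> P n a b"
proof -
  have "\<exists>c. \<forall>n. (fst (c n) \<le> snd (c n) \<and> P n (fst (c n)) (snd (c n))) \<and>
      (fst (c n) \<le> fst (c (Suc n)) \<and> snd (c (Suc n)) \<le> snd (c n))"
  proof (rule dependent_nat_choice[where P = "\<lambda>n c. fst c \<le> snd c \<and> P n (fst c) (snd c)"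
        and Q = "\<lambda>n c c'. fst c \<le> fst c' \<and> snd c' \<le> snd c"])
    show "\<exists>c. fst c \<le> snd c \<and> P 0 (fst c) (snd c)" using base by simp
    fix c n assume "fst c \<le> snd c \<and> P n (fst c) (snd c)"
    then obtain a' b' where "fst c \<le> a'" "a' \<le> b'" "b' \<le> snd c" "P (Suc n) a' b'"
      using step by blast
    then show "\<exists>c'. (fst c' \<le> snd c' \<and> P (Suc n) (fst c') (snd c')) \<and> (fst c \<le> fst c' \<and> snd c' \<le> snd c)"
      by (intro exI[of _ "(a', b')"]) simp
  qed
  then obtain c where c: "\<And>n. fst (c n) \<le> snd (c n)" "\<And>n. P n (fst (c n)) (snd (c n))"
    "\<And>n. fst (c n) \<le> fst (c (Suc n))" "\<And>n. snd (c (Suc n)) \<le> snd (c n)" by blast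
  define F where "F n = {fst (c n)..snd (c n)}" for n
  have "\<Inter> (range F) \<noteq> {}"
  proof (rule compact_nest)
    show "compact (F n)" "F n \<noteq> {}" for n using c(1)[of n] by (auto simp: F_def)
    show "F n \<subseteq> F m" if "m \<le> n" for m n
      using that
    proof (induction n rule: dec_induct)
      case (step n)
      then show ?case using c(3,4)[of n] by (force simp: F_def)
    qed simp
  qed
  then obtain z where "\<And>n. z \<in> F n" by blast
  then show ?thesis using c(2) by (intro exI[of _ z]) (auto simp: F_def)
qed

section \<open>Consequences of Assumptions E and G for the choice of z\<close>

context spread_out_model
begin

definition "\<beta> L = beta TYPE('d) pstar L"

lemma beta_pos: "L \<ge> 1 \<Longrightarrow> \<beta> L > 0"
  by (simp add: \<beta>_def beta_def)

lemma beta_small: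
  assumes "x > 0" shows "\<exists>L0\<ge>1. \<forall>L\<ge>L0. \<beta> L \<le> x"
proof -
  define c where "c = real CARD('d) / pstar"
  have c: "c > 0" using pstar by (simp add: c_def zero_less_card_finite)
  define L0 where "L0 = max 1 (x powr (- (1 / c)))"
  have L0: "L0 \<ge> 1" "L0 > 0" by (auto simp: L0_def)
  have "\<beta> L \<le> x" if L: "L \<ge> L0" for L
  proof -
    have "\<beta> L = L powr (- c)" by (simp add: \<beta>_def beta_def c_def)
    also have "\<dots> \<le> (x powr (- (1 / c))) powr (- c)"
      using L c assms by (intro powr_mono2') (auto simp: L0_def)
    also have "\<dots> = x" using c assms by (simp add: powr_powr)
    finally show ?thesis .
  qed
  then show ?thesis using L0 by blast
qed

lemma ball_in_admissible:
  assumes "admissible_interval I"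
  shows "\<exists>r>0. r < 1 \<and> (\<forall>z. \<bar>z - 1\<bar> \<le> r \<longrightarrow> z \<in> I)"
proof -
  have "1 \<in> interior I" using assms by (simp add: admissible_interval_def)
  then obtain r where r: "r > 0" "cball 1 r \<subseteq> I" by (meson mem_interior_cball)
  then show ?thesis
    by (intro exI[of _ "min r (1/2)"]) (auto simp: dist_real_def abs_minus_commute subset_eq)
qed

text \<open>For fixed K the two assumptions are merged into one constant, one threshold for L and
  one neighbourhood of 1. The first conclusion needs only \<open>star_bounds\<close> up to n and
  reaches order n + 1 of g: it is available before the partial sum of that order has been adjusted
  by the choice of z. The second assumes this adjustment and yields \<open>controlled\<close>.
  Passing from powers of m to powers of 1 + m costs the factor 2^\<theta>.\<close>

lemma assumption_bounds:
  assumes K: "K > 1"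
  shows "\<exists>C\<ge>1. \<exists>L1\<ge>1. \<exists>r>0. r < 1 \<and> (\<forall>L\<ge>L1. \<forall>z n. \<bar>z - 1\<bar> \<le> r \<longrightarrow>
    (\<forall>m. 1 \<le> m \<and> m \<le> n \<longrightarrow> star_bounds B \<theta> D f K L z m) \<longrightarrow>
    (\<forall>m. 2 \<le> m \<and> m \<le> n + 1 \<longrightarrow> \<bar>g L m 0 z\<bar> \<le> C * \<beta> L * real m powr (- \<theta>) \<and> (\<lambda>w. g L m 0 w) differentiable (at z)) \<and>
    (\<bar>z - 1\<bar> \<le> C * \<beta> L \<longrightarrow> (\<forall>j. 1 \<le> j \<and> j \<le> n + 1 \<longrightarrow> \<bar>1 - (\<Sum>m=1..j. g L m 0 z)\<bar> \<le> C * \<beta> L * real j powr (1 - \<theta>)) \<longrightarrow>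
      controlled (2 powr \<theta> * C * \<beta> L) L z (n + 1)))"
proof -
  obtain LE IE Ce where LE: "LE \<ge> 1" and IE: "admissible_interval IE" and
    bE: "\<And>K L z n k m. K > 1 \<Longrightarrow> L \<ge> LE \<Longrightarrow> z \<in> IE \<Longrightarrow> (\<forall>m. 1 \<le> m \<and> m \<le> n \<longrightarrow> star_bounds B \<theta> D f K L z m) \<Longrightarrow>
       k \<in> kcube \<Longrightarrow> 2 \<le> m \<Longrightarrow> m \<le> n + 1 \<Longrightarrow>
           \<bar>e L m k z\<bar> \<le> Ce K * beta TYPE('d) pstar L * real m powr (- \<theta>) \<and>
           \<bar>e L m k z - e L m 0 z\<bar> \<le> Ce K * afun (D L) k * beta TYPE('d) pstar L * real m powr (- \<theta> + 1)"
    using E unfolding assumption_E_def by (elim exE conjE) (rule that, assumption, assumption, blast)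
  obtain LG IG Cg where LG: "LG \<ge> 1" and IG: "admissible_interval IG" and
    bG: "\<And>K L z n k m. K > 1 \<Longrightarrow> L \<ge> LG \<Longrightarrow> z \<in> IG \<Longrightarrow> (\<forall>m. 1 \<le> m \<and> m \<le> n \<longrightarrow> star_bounds B \<theta> D f K L z m) \<Longrightarrow>
       k \<in> kcube \<Longrightarrow> 2 \<le> m \<Longrightarrow> m \<le> n + 1 \<Longrightarrow>
           \<bar>g L m k z\<bar> \<le> Cg K * beta TYPE('d) pstar L * real m powr (- \<theta>) \<and>
           has_laplacian (\<lambda>k. g L m k z) 0 \<and>
           \<bar>laplacian (\<lambda>k. g L m k z) 0\<bar>
             \<le> Cg K * sigma2 (D L) * beta TYPE('d) pstar L * real m powr (- \<theta> + 1) \<and>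
           (\<lambda>w. g L m 0 w) differentiable (at z) \<and>
           \<bar>deriv (\<lambda>w. g L m 0 w) z\<bar>
             \<le> Cg K * beta TYPE('d) pstar L * real m powr (- \<theta> + 1) \<and>
           (\<forall>\<epsilon>'\<in>{0..\<epsilon>}.
             \<bar>g L m k z - g L m 0 z - afun (D L) k / sigma2 (D L) * laplacian (\<lambda>k. g L m k z) 0\<bar>
               \<le> Cg K * beta TYPE('d) pstar L * afun (D L) k powr (1 + \<epsilon>')
                  * real m powr (- \<theta> + 1 + \<epsilon>'))"
    using G unfolding assumption_G_def by (elim exE conjE) (rule that, assumption, assumption, blast)
  obtain rE where rE: "rE > 0" "rE < 1" "\<And>z. \<bar>z - 1\<bar> \<le> rE \<Longrightarrow> z \<in> IE" using ball_in_admissible[OF IE] by blast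
  obtain rG where rG: "rG > 0" "rG < 1" "\<And>z. \<bar>z - 1\<bar> \<le> rG \<Longrightarrow> z \<in> IG" using ball_in_admissible[OF IG] by blast
  define C where "C = max 1 (max (Ce K) (Cg K))"
  have C: "C \<ge> 1" "Ce K \<le> C" "Cg K \<le> C" by (auto simp: C_def)
  have p1: "1 \<le> 2 powr \<theta>" using theta by (intro ge_one_powr_ge_zero) auto
  show ?thesis
  proof (rule exI[of _ C], intro conjI C(1), rule exI[of _ "max LE LG"], intro conjI, use LE in simp,
      rule exI[of _ "min rE rG"], intro conjI allI impI)
    show "0 < min rE rG" "min rE rG < 1" using rE rG by auto
  next
    fix L z n m assume L: "max LE LG \<le> L" and z: "\<bar>z - 1\<bar> \<le> min rE rG"
      and st: "\<forall>m. 1 \<le> m \<and> m \<le> n \<longrightarrow> star_bounds B \<theta> D f K L z m" and m: "2 \<le> m \<and> m \<le> n + 1"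
    have L1: "L \<ge> 1" using L LE by simp
    have "\<bar>g L m 0 z\<bar> \<le> Cg K * \<beta> L * real m powr (- \<theta>)" "(\<lambda>w. g L m 0 w) differentiable (at z)"
    proof -
      have "L \<ge> LG" "z \<in> IG" "2 \<le> m" "m \<le> n + 1" using L z m rG(3) by auto
      from bG[OF K this(1,2) st zero_in_kcube this(3,4)]
      show "\<bar>g L m 0 z\<bar> \<le> Cg K * \<beta> L * real m powr (- \<theta>)" "(\<lambda>w. g L m 0 w) differentiable (at z)"
        unfolding \<beta>_def by blast+
    qed
    moreover have "Cg K * \<beta> L * real m powr (- \<theta>) \<le> C * \<beta> L * real m powr (- \<theta>)"
      using C beta_pos[OF L1] by (intro mult_right_mono) auto
    ultimately show "\<bar>g L m 0 z\<bar> \<le> C * \<beta> L * real m powr (- \<theta>)" "(\<lambda>w. g L m 0 w) differentiable (at z)" by auto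
  next
    fix L z n assume L: "max LE LG \<le> L" and z: "\<bar>z - 1\<bar> \<le> min rE rG"
      and st: "\<forall>m. 1 \<le> m \<and> m \<le> n \<longrightarrow> star_bounds B \<theta> D f K L z m"
      and z1: "\<bar>z - 1\<bar> \<le> C * \<beta> L"
      and S: "\<forall>j. 1 \<le> j \<and> j \<le> n + 1 \<longrightarrow> \<bar>1 - (\<Sum>m=1..j. g L m 0 z)\<bar> \<le> C * \<beta> L * real j powr (1 - \<theta>)"
    define s where "s = 2 powr \<theta> * C * \<beta> L"
    have L1: "L \<ge> 1" using L LE by simp
    have b: "\<beta> L > 0" by (rule beta_pos[OF L1])
    have Cb: "C * \<beta> L \<ge> 0" using C b by simp
    have pw: "C * \<beta> L * real m powr (- q) \<le> s * rho q m" if "0 \<le> q" "q \<le> \<theta>" "1 \<le> m" for q m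
    proof -
      have "C * \<beta> L * real m powr (- q) \<le> C * \<beta> L * (2 powr q * rho q m)"
        by (intro mult_left_mono powr_le_rho that Cb)
      also have "\<dots> \<le> C * \<beta> L * (2 powr \<theta> * rho q m)"
        using that by (intro mult_left_mono mult_right_mono powr_mono Cb) auto
      finally show ?thesis by (simp add: s_def mult_ac)
    qed
    have "z > 0" using z rE by (auto simp: abs_le_iff)
    moreover have "\<bar>z - 1\<bar> \<le> s"
    proof -
      have "1 * (C * \<beta> L) \<le> 2 powr \<theta> * (C * \<beta> L)" using p1 Cb by (intro mult_right_mono)
      then show ?thesis using z1 by (simp add: s_def mult.assoc)
    qed
    moreover have "\<bar>1 - (\<Sum>m=1..j. g L m 0 z)\<bar> \<le> s * rho (\<theta> - 1) j" if "1 \<le> j \<and> j \<le> n + 1" for j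
      using S[rule_format, OF that] pw[of "\<theta> - 1" j] that theta by simp
    moreover have "\<bar>e L m k z\<bar> \<le> s * rho \<theta> m \<and>
      \<bar>e L m k z - e L m 0 z\<bar> \<le> s * afun (D L) k * rho (\<theta> - 1) m \<and>
      \<bar>g L m k z\<bar> \<le> s * rho \<theta> m \<and>
      has_laplacian (\<lambda>k. g L m k z) 0 \<and>
      \<bar>laplacian (\<lambda>k. g L m k z) 0\<bar> \<le> s * sigma2 (D L) * rho (\<theta> - 1) m \<and>
      (\<forall>e'\<in>{0..\<epsilon>}. \<bar>g L m k z - g L m 0 z - afun (D L) k / sigma2 (D L) * laplacian (\<lambda>k. g L m k z) 0\<bar>
         \<le> s * afun (D L) k powr (1 + e') * rho (\<theta> - 1 - e') m)"
      if k: "k \<in> kcube" and m: "2 \<le> m \<and> m \<le> n + 1" for k m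
    proof -
      have m': "2 \<le> m" "m \<le> n + 1" "1 \<le> m" using m by auto
      define a where "a = afun (D L) k"
      define \<sigma> where "\<sigma> = sigma2 (D L)"
      define lap where "lap = laplacian (\<lambda>k. g L m k z) 0"
      have a: "a \<ge> 0" unfolding a_def by (rule afun_nonneg)
      have \<sigma>: "\<sigma> \<ge> 0" unfolding \<sigma>_def using sigma2_pos[OF L1] by simp
      have zE: "z \<in> IE" and zG: "z \<in> IG" using z rE(3) rG(3) by auto
      have LL: "L \<ge> LE" "L \<ge> LG" using L by auto
      note eb = bE[OF K LL(1) zE st k m'(1,2)]
      note gb = bG[OF K LL(2) zG st k m'(1,2)]
      have up: "c * \<beta> L * real m powr (- q) * x \<le> s * rho q m * x"
        if "c \<le> C" "0 \<le> q" "q \<le> \<theta>" "x \<ge> 0" for c q x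
      proof -
        have "c * \<beta> L * real m powr (- q) \<le> C * \<beta> L * real m powr (- q)"
          using that b by (intro mult_right_mono) auto
        then show ?thesis using pw[OF that(2,3) m'(3)] that by (intro mult_right_mono) linarith+
      qed
      have e1: "\<bar>e L m k z\<bar> \<le> s * rho \<theta> m"
        using conjunct1[OF eb] up[OF C(2), of \<theta> 1] theta unfolding \<beta>_def by simp
      have "\<bar>e L m k z - e L m 0 z\<bar> \<le> Ce K * \<beta> L * real m powr (- (\<theta> - 1)) * a"
        using conjunct2[OF eb] unfolding \<beta>_def a_def by (simp add: mult_ac)
      also have "\<dots> \<le> s * rho (\<theta> - 1) m * a" by (rule up[OF C(2)]) (use theta a in auto)
      finally have e2: "\<bar>e L m k z - e L m 0 z\<bar> \<le> s * a * rho (\<theta> - 1) m" by (simp add: mult_ac)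
      have g1: "\<bar>g L m k z\<bar> \<le> s * rho \<theta> m"
        using conjunct1[OF gb] up[OF C(3), of \<theta> 1] theta unfolding \<beta>_def by simp
      have "\<bar>lap\<bar> \<le> Cg K * \<beta> L * real m powr (- (\<theta> - 1)) * \<sigma>"
        using gb unfolding \<beta>_def lap_def \<sigma>_def by (simp add: mult_ac)
      also have "\<dots> \<le> s * rho (\<theta> - 1) m * \<sigma>" by (rule up[OF C(3)]) (use theta \<sigma> in auto)
      finally have g2: "\<bar>lap\<bar> \<le> s * \<sigma> * rho (\<theta> - 1) m" by (simp add: mult_ac)
      have g3: "\<bar>g L m k z - g L m 0 z - a / \<sigma> * lap\<bar> \<le> s * a powr (1 + e') * rho (\<theta> - 1 - e') m"
        if e': "e' \<in> {0..\<epsilon>}" for e'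
      proof -
        have "\<bar>g L m k z - g L m 0 z - a / \<sigma> * lap\<bar> \<le> Cg K * \<beta> L * a powr (1 + e') * real m powr (- \<theta> + 1 + e')"
          using gb e' unfolding \<beta>_def a_def \<sigma>_def lap_def by blast
        also have "\<dots> = Cg K * \<beta> L * real m powr (- (\<theta> - 1 - e')) * a powr (1 + e')"
        proof -
          have "- \<theta> + 1 + e' = - (\<theta> - 1 - e')" by simp
          then show ?thesis by (simp only: mult_ac)
        qed
        also have "\<dots> \<le> s * rho (\<theta> - 1 - e') m * a powr (1 + e')"
          by (rule up[OF C(3)]) (use theta e' eps in auto)
        finally show ?thesis by (simp add: mult_ac)
      qed
      show ?thesis
        using e1 e2 g1 g2 g3 gb unfolding a_def \<sigma>_def lap_def by blast
    qed
    ultimately show "controlled (2 powr \<theta> * C * \<beta> L) L z (n + 1)"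
      unfolding controlled_def s_def[symmetric] by blast
  qed
qed

text \<open>The order of choices is K, then C from the assumptions at K, then L so large that C'
  \<beta> is below every threshold. At each stage the partial sum attains its tolerance exactly at
  the two ends of the interval. Adding order n + 2 moves it by at most \<kappa> (n + 2)^(-\<theta>),
  and the tolerance shrinks by at least as much because \<theta> - 1 > 1. So the smaller target
  range is still crossed, and \<open>level_interval\<close> applies.\<close>

lemma critical_point:
  "\<exists>C\<ge>1. \<forall>x>0. \<exists>L0\<ge>1. \<forall>L\<ge>L0. C * \<beta> L \<le> x \<and> (\<exists>zc. \<forall>n. controlled (C * \<beta> L) L zc n)"
proof -
  obtain K s1 where K: "K > 1" and s1: "s1 > 0" and
    star: "\<forall>s L z n. 0 \<le> s \<longrightarrow> s \<le> s1 \<longrightarrow> L \<ge> 1 \<longrightarrow> n \<ge> 1 \<longrightarrow> controlled s L z n \<longrightarrow> star_bounds B \<theta> D f K L z n"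
    using star_from_controlled by (elim exE conjE) (rule that; assumption)
  obtain C L1 r where C: "C \<ge> 1" and L1: "L1 \<ge> 1" and r: "r > 0" "r < 1" and
    bnd: "\<forall>L\<ge>L1. \<forall>z n. \<bar>z - 1\<bar> \<le> r \<longrightarrow>
    (\<forall>m. 1 \<le> m \<and> m \<le> n \<longrightarrow> star_bounds B \<theta> D f K L z m) \<longrightarrow>
    (\<forall>m. 2 \<le> m \<and> m \<le> n + 1 \<longrightarrow> \<bar>g L m 0 z\<bar> \<le> C * \<beta> L * real m powr (- \<theta>) \<and> (\<lambda>w. g L m 0 w) differentiable (at z)) \<and>
    (\<bar>z - 1\<bar> \<le> C * \<beta> L \<longrightarrow> (\<forall>j. 1 \<le> j \<and> j \<le> n + 1 \<longrightarrow> \<bar>1 - (\<Sum>m=1..j. g L m 0 z)\<bar> \<le> C * \<beta> L * real j powr (1 - \<theta>)) \<longrightarrow>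
      controlled (2 powr \<theta> * C * \<beta> L) L z (n + 1))"
    using assumption_bounds[OF K] by (elim exE conjE) (rule that; assumption)
  define C' where "C' = 2 powr \<theta> * C"
  have p1: "1 \<le> 2 powr \<theta>" using theta by (intro ge_one_powr_ge_zero) auto
  have C': "C' \<ge> 1" "C \<le> C'"
    unfolding C'_def using mult_mono[OF p1 C] mult_right_mono[OF p1, of C] C by auto
  show ?thesis
  proof (rule exI[of _ C'], intro conjI C'(1) allI impI)
    fix x :: real assume x: "x > 0"
    define y where "y = min x (min s1 r) / C'"
    have y: "y > 0" using x s1 r C' by (simp add: y_def)
    obtain L2 where L2: "L2 \<ge> 1" "\<And>L. L \<ge> L2 \<Longrightarrow> \<beta> L \<le> y" using beta_small[OF y] by blast
    show "\<exists>L0\<ge>1. \<forall>L\<ge>L0. C' * \<beta> L \<le> x \<and> (\<exists>zc. \<forall>n. controlled (C' * \<beta> L) L zc n)"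
    proof (rule exI[of _ "max L1 L2"], intro conjI allI impI)
      show "1 \<le> max L1 L2" using L1 by simp
      fix L assume L: "max L1 L2 \<le> L"
      have L1': "L \<ge> L1" "L \<ge> 1" using L L1 by auto
      have b: "\<beta> L > 0" by (rule beta_pos[OF L1'(2)])
      have "C' * \<beta> L \<le> C' * y" using L2(2)[of L] L C' by (intro mult_left_mono) auto
      also have "C' * y = min x (min s1 r)" using C' by (simp add: y_def)
      finally have small: "C' * \<beta> L \<le> x" "C' * \<beta> L \<le> s1" "C' * \<beta> L \<le> r" by auto
      show "C' * \<beta> L \<le> x" by (rule small)
      define \<kappa> where "\<kappa> = C * \<beta> L"
      have \<kappa>: "\<kappa> > 0" "\<kappa> \<le> r"
      proof -
        show "\<kappa> > 0" using C b by (simp add: \<kappa>_def)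
        have "\<kappa> \<le> C' * \<beta> L" unfolding \<kappa>_def using C' b by (intro mult_right_mono) auto
        then show "\<kappa> \<le> r" using small by linarith
      qed
      define Sm where "Sm j z = (\<Sum>m=1..j. g L m 0 z)" for j z
      define good where "good n z \<longleftrightarrow> (\<forall>j. 1 \<le> j \<and> j \<le> n \<longrightarrow> \<bar>1 - Sm j z\<bar> \<le> \<kappa> * real j powr (1 - \<theta>))" for n z
      \<comment> \<open>Induction on the order: \<open>star_bounds\<close> up to n and a good
        partial sum at n + 1 give \<open>controlled\<close> at n + 1, which returns
        \<open>star_bounds\<close> at n + 1 with the same K.\<close>
      have good_star: "\<forall>m. 1 \<le> m \<and> m \<le> n \<longrightarrow> star_bounds B \<theta> D f K L z m" if "\<bar>z - 1\<bar> \<le> \<kappa>" "good n z" for n z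
        using that(2)
      proof (induction n)
        case (Suc n)
        have gn: "good n z" using Suc.prems by (auto simp: good_def)
        have z: "\<bar>z - 1\<bar> \<le> r" using that(1) \<kappa> by linarith
        have "controlled (2 powr \<theta> * C * \<beta> L) L z (n + 1)"
          using bnd[rule_format, OF L1'(1) z Suc.IH[OF gn, rule_format], THEN conjunct2] that(1) Suc.prems
          unfolding good_def Sm_def \<kappa>_def by simp
        then have "controlled (C' * \<beta> L) L z (Suc n)" by (simp add: C'_def)
        then have "star_bounds B \<theta> D f K L z (Suc n)"
          using star[rule_format, of "C' * \<beta> L" L "Suc n" z] small L1' b C' by simp
        then show ?case using Suc.IH[OF gn] by (auto simp: le_Suc_eq)
      qed simp
      have zpos: "z > 0" "\<bar>z - 1\<bar> \<le> r" if "\<bar>z - 1\<bar> \<le> \<kappa>" for z using that \<kappa> r by (auto simp: abs_le_iff)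
      have good_controlled: "controlled (C' * \<beta> L) L z n" if z: "\<bar>z - 1\<bar> \<le> \<kappa>" and g: "good (n + 1) z" for n z
      proof -
        have gn: "good n z" using g by (auto simp: good_def)
        have "controlled (2 powr \<theta> * C * \<beta> L) L z (n + 1)"
          using bnd[rule_format, OF L1'(1) zpos(2)[OF z] good_star[OF z gn, rule_format], THEN conjunct2] z g
          unfolding good_def Sm_def \<kappa>_def by simp
        then show ?thesis unfolding C'_def by (rule controlled_mono) simp
      qed
      have S1: "Sm 1 z = z" if "\<bar>z - 1\<bar> \<le> \<kappa>" for z
      proof -
        interpret st: step_distribution "D L" \<epsilon> by (rule step[OF L1'(2)])
        show ?thesis using first_step(3)[OF L1'(2) zpos(1)[OF that] zero_in_kcube] by (simp add: Sm_def st.afun_0)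
      qed
      \<comment> \<open>Stage n deals with order n + 1. Stage 0 is thus the interval of radius
        \<kappa> around 1, on which the partial sum of order 1 is z itself.\<close>
      define P where "P n a b \<longleftrightarrow> {a..b} \<subseteq> {1 - \<kappa>..1 + \<kappa>} \<and> (\<forall>z\<in>{a..b}. good (n + 1) z) \<and>
         Sm (n + 1) a = 1 - \<kappa> * real (n + 1) powr (1 - \<theta>) \<and> Sm (n + 1) b = 1 + \<kappa> * real (n + 1) powr (1 - \<theta>)" for n a b
      have "\<exists>z. \<forall>n. \<exists>a b. z \<in> {a..b} \<and> P n a b"
      proof (rule nested_intervals)
        have "good 1 z" if "z \<in> {1 - \<kappa>..1 + \<kappa>}" for z
          unfolding good_def
        proof (intro allI impI)
          fix j :: nat assume "1 \<le> j \<and> j \<le> 1"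
          then have j: "j = 1" by simp
          have "\<bar>z - 1\<bar> \<le> \<kappa>" using that by (simp add: abs_le_iff)
          then show "\<bar>1 - Sm j z\<bar> \<le> \<kappa> * real j powr (1 - \<theta>)" unfolding j using S1[of z] by simp
        qed
        then show "\<exists>a b. a \<le> b \<and> P 0 a b"
          using \<kappa> S1[of "1 - \<kappa>"] S1[of "1 + \<kappa>"] by (intro exI[of _ "1 - \<kappa>"] exI[of _ "1 + \<kappa>"]) (simp add: P_def)
      next
        fix n a b assume ab: "a \<le> b" and P: "P n a b"
        have zz: "\<bar>z - 1\<bar> \<le> \<kappa>" if "z \<in> {a..b}" for z
        proof -
          have "z \<in> {1 - \<kappa>..1 + \<kappa>}" using P that unfolding P_def by blast
          then show ?thesis by (simp add: abs_le_iff)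
        qed
        have gd: "good (n + 1) z" if "z \<in> {a..b}" for z using P that by (auto simp: P_def)
        have gb: "\<bar>g L m 0 z\<bar> \<le> \<kappa> * real m powr (- \<theta>)" "(\<lambda>w. g L m 0 w) differentiable (at z)"
          if "z \<in> {a..b}" "2 \<le> m" "m \<le> n + 2" for z m
          using bnd[rule_format, OF L1'(1) zpos(2)[OF zz[OF that(1)]] good_star[OF zz[OF that(1)] gd[OF that(1)], rule_format], THEN conjunct1] that
          by (auto simp: \<kappa>_def)
        have step: "Sm (n + 2) z = Sm (n + 1) z + g L (n + 2) 0 z" for z by (simp add: Sm_def)
        have split: "Sm (n + 2) z = z + (\<Sum>m=2..n+2. g L m 0 z)" if "z \<in> {a..b}" for z
        proof -
          have "Sm (n + 2) z = g L 1 0 z + (\<Sum>m=Suc 1..n+2. g L m 0 z)"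
            unfolding Sm_def by (rule sum.atLeast_Suc_atMost) simp
          then show ?thesis using S1[OF zz[OF that]] by (simp add: Sm_def numeral_2_eq_2)
        qed
        have cont: "continuous_on {a..b} (Sm (n + 2))"
        proof -
          have "continuous_on {a..b} (\<lambda>z. z + (\<Sum>m=2..n+2. g L m 0 z))"
          proof (intro continuous_on_add continuous_on_id continuous_on_sum)
            fix m assume "m \<in> {2..n+2}"
            then have "isCont (\<lambda>w. g L m 0 w) z" if "z \<in> {a..b}" for z
              using gb(2)[OF that, of m] by (intro differentiable_imp_continuous_within) auto
            then show "continuous_on {a..b} (\<lambda>w. g L m 0 w)" by (intro continuous_at_imp_continuous_on) auto
          qed
          then show ?thesis by (rule continuous_on_eq) (rule split[symmetric])
        qed
        have diff: "\<kappa> * real (n + 2) powr (- \<theta>) \<le> \<kappa> * real (n + 1) powr (1 - \<theta>) - \<kappa> * real (n + 2) powr (1 - \<theta>)"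
        proof -
          have "(\<theta> - 1) * rho \<theta> (Suc n) \<le> rho (\<theta> - 1) n - rho (\<theta> - 1) (Suc n)"
            by (rule rho_telescope) (use theta in simp)
          moreover have "1 * rho \<theta> (Suc n) \<le> (\<theta> - 1) * rho \<theta> (Suc n)" by (intro mult_right_mono) (use theta in auto)
          ultimately have "rho \<theta> (Suc n) \<le> rho (\<theta> - 1) n - rho (\<theta> - 1) (Suc n)" by linarith
          then have "\<kappa> * rho \<theta> (Suc n) \<le> \<kappa> * (rho (\<theta> - 1) n - rho (\<theta> - 1) (Suc n))" using \<kappa> by (intro mult_left_mono) auto
          then show ?thesis by (simp add: rho_def algebra_simps)
        qed
        have lo: "Sm (n + 2) a \<le> 1 - \<kappa> * real (n + 2) powr (1 - \<theta>)"
          using gb(1)[of a "n + 2"] ab P diff unfolding step P_def abs_le_iff by simp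
        have hi: "1 + \<kappa> * real (n + 2) powr (1 - \<theta>) \<le> Sm (n + 2) b"
          using gb(1)[of b "n + 2"] ab P diff unfolding step P_def abs_le_iff by simp
        have "1 - \<kappa> * real (n + 2) powr (1 - \<theta>) \<le> 1 + \<kappa> * real (n + 2) powr (1 - \<theta>)" using \<kappa> by simp
        from level_interval[OF cont ab lo hi this] obtain a' b' where ab': "a \<le> a'" "a' \<le> b'" "b' \<le> b"
          "Sm (n + 2) a' = 1 - \<kappa> * real (n + 2) powr (1 - \<theta>)" "Sm (n + 2) b' = 1 + \<kappa> * real (n + 2) powr (1 - \<theta>)"
          and mid: "\<And>z. z \<in> {a'..b'} \<Longrightarrow> 1 - \<kappa> * real (n + 2) powr (1 - \<theta>) \<le> Sm (n + 2) z \<and> Sm (n + 2) z \<le> 1 + \<kappa> * real (n + 2) powr (1 - \<theta>)"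
          by blast
        have "good (n + 2) z" if z: "z \<in> {a'..b'}" for z
          unfolding good_def
        proof (intro allI impI)
          fix j assume j: "1 \<le> j \<and> j \<le> n + 2"
          show "\<bar>1 - Sm j z\<bar> \<le> \<kappa> * real j powr (1 - \<theta>)"
          proof (cases "j = n + 2")
            case True
            then show ?thesis using mid[OF z] by (simp only: abs_le_iff) linarith
          next
            case False
            have "z \<in> {a..b}" using z ab' by auto
            then show ?thesis using gd[of z] j False unfolding good_def by simp
          qed
        qed
        moreover have "{a'..b'} \<subseteq> {1 - \<kappa>..1 + \<kappa>}" using P ab' unfolding P_def by auto
        ultimately have "P (Suc n) a' b'" using ab' by (simp add: P_def)
        then show "\<exists>a' b'. a \<le> a' \<and> a' \<le> b' \<and> b' \<le> b \<and> P (Suc n) a' b'" using ab' by blast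
      qed
      then obtain zc where zc: "\<And>n. \<exists>a b. zc \<in> {a..b} \<and> P n a b" by blast
      have "controlled (C' * \<beta> L) L zc n" for n
      proof -
        obtain a b where ab: "zc \<in> {a..b}" "P n a b" using zc by blast
        then have "zc \<in> {1 - \<kappa>..1 + \<kappa>}" "good (n + 1) zc" unfolding P_def by blast+
        then show ?thesis by (intro good_controlled) (auto simp: abs_le_iff)
      qed
      then show "\<exists>zc. \<forall>n. controlled (C' * \<beta> L) L zc n" by blast
    qed
  qed
qed

section \<open>Critical asymptotics\<close>

lemma sum_fps_drop_0:
  assumes "x $$ 0 = 0" "\<And>m. m \<ge> 1 \<Longrightarrow> x $$ m = u m"
  shows "(\<Sum>i\<le>n. x $$ i) = (\<Sum>m=1..n. u m :: real)"
proof -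
  have "(\<Sum>i\<le>n. x $$ i) = (\<Sum>i=0..n. x $$ i)" by (simp add: atLeast0AtMost)
  also have "\<dots> = (\<Sum>i=1..n. x $$ i)" by (rule sum_drop_0) (rule assms)
  also have "\<dots> = (\<Sum>m=1..n. u m)" using assms(2) by (intro sum.cong) auto
  finally show ?thesis .
qed

text \<open>At the critical point all orders are controlled, so the coefficientwise identity for the
  Laplacians becomes an identity of power series, without truncation.\<close>

lemma zero_mode_instance:
  assumes L: "L \<ge> 1" and s: "0 \<le> s" "2 * s * rho_conv_const (\<theta> - 1) \<le> 1"
    and ct: "\<And>n. controlled s L z n"
  shows "zero_mode \<theta> s (sigma2 (D L)) (Gf L z 0) (Ef L z 0) (Ff L z 0) (Tf L z) (Gamf L z) (E2f L z)"
proof -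
  have z: "z > 0" "\<bar>z - 1\<bar> \<le> s" using ct[of 0] by (auto simp: controlled_def)
  interpret st: step_distribution "D L" \<epsilon> by (rule step[OF L])
  have sig: "sigma2 (D L) > 0" by (rule sigma2_pos[OF L])
  have cm: "\<bar>e L m k z\<bar> \<le> s * rho \<theta> m \<and>
      \<bar>e L m k z - e L m 0 z\<bar> \<le> s * afun (D L) k * rho (\<theta> - 1) m \<and>
      \<bar>g L m k z\<bar> \<le> s * rho \<theta> m \<and>
      has_laplacian (\<lambda>k. g L m k z) 0 \<and>
      \<bar>laplacian (\<lambda>k. g L m k z) 0\<bar> \<le> s * sigma2 (D L) * rho (\<theta> - 1) m" if "k \<in> kcube" "m \<ge> 2" for k m
    using ct[of m] that unfolding controlled_def by blast
  show ?thesis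
  proof
    show "\<theta> > 2" "0 \<le> s" "2 * s * rho_conv_const (\<theta> - 1) \<le> 1" "sigma2 (D L) > 0"
      using theta s sig by auto
    show "Gf L z 0 $$ 0 = 0" "Ef L z 0 $$ 0 = 0" "Gamf L z $$ 0 = 0" "E2f L z $$ 0 = 0"
      by (auto simp: Gf_def Ef_def Gamf_def E2f_def)
    show "\<bar>1 - (\<Sum>i\<le>m. Gf L z 0 $$ i)\<bar> \<le> s * rho (\<theta> - 1) m" if "m \<ge> 1" for m
    proof -
      have "(\<Sum>i\<le>m. Gf L z 0 $$ i) = (\<Sum>i=1..m. g L i 0 z)" by (rule sum_fps_drop_0) (auto simp: Gf_def)
      then show ?thesis using ct[of m] that by (auto simp: controlled_def)
    qed
    show "\<bar>Ef L z 0 $$ m\<bar> \<le> s * rho (\<theta> - 1) m" for m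
    proof -
      consider "m = 0" | "m = 1" | "m \<ge> 2" by linarith
      then show ?thesis
      proof cases
        case 2
        then show ?thesis using first_step(2)[OF L z(1) zero_in_kcube] s by (simp add: Ef_def)
      next
        case 3
        have "s * rho \<theta> m \<le> s * rho (\<theta> - 1) m" by (intro mult_left_mono rho_antimono s) simp
        then show ?thesis using cm[OF zero_in_kcube 3] 3 by (simp add: Ef_def)
      qed (use s in \<open>simp add: Ef_def\<close>)
    qed
    show "Ff L z 0 * (1 - Gf L z 0) = 1 + Ef L z 0" by (rule recursion_fps[OF L z(1) zero_in_kcube])
    have "Gamf L z $$ 1 + sigma2 (D L) = (1 - z) * sigma2 (D L)"
      using laplacian_g_1(2)[OF L z(1)] by (simp add: Gamf_def algebra_simps)
    then show "\<bar>Gamf L z $$ 1 + sigma2 (D L)\<bar> \<le> s * sigma2 (D L)"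
      using z sig by (simp add: abs_mult abs_minus_commute)
    show "\<bar>Gamf L z $$ m\<bar> \<le> s * sigma2 (D L) * rho (\<theta> - 1) m" if "m \<ge> 2" for m
      using cm[OF zero_in_kcube that] that by (simp add: Gamf_def)
    show "\<bar>E2f L z $$ m\<bar> \<le> s * sigma2 (D L) * rho (\<theta> - 1) m" for m
    proof -
      consider "m = 0" | "m = 1" | "m \<ge> 2" by linarith
      then show ?thesis
      proof cases
        case 2
        have "laplacian (\<lambda>k. e L 1 k z) 0 = 0"
          by (rule laplacian_const[of _ 0]) (rule first_step(2)[OF L z(1)])
        then show ?thesis using 2 s sig by (simp add: E2f_def)
      next
        case 3
        have "has_laplacian (\<lambda>k. e L m k z) 0"
          using laplacian_recursion(1)[OF L z(1), of m] cm[OF zero_in_kcube] 3 by simp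
        moreover have "cube_symmetric (\<lambda>k. e L m k z)" using symmetric_families(2)[OF L _ z(1)] 3 by simp
        ultimately have "\<bar>laplacian (\<lambda>k. e L m k z) 0\<bar> \<le> s * rho (\<theta> - 1) m * sigma2 (D L)"
        proof (rule st.laplacian_bound)
          show "\<bar>e L m k z - e L m 0 z\<bar> \<le> s * rho (\<theta> - 1) m * afun (D L) k" if "k \<in> kcube" for k
            using cm[OF that 3] by (simp add: mult_ac)
        qed (use s in simp)
        then show ?thesis using 3 by (simp add: E2f_def mult_ac)
      qed (use s sig in \<open>simp add: E2f_def\<close>)
    qed
    show "Tf L z * (1 - Gf L z 0) = Gamf L z * Ff L z 0 + E2f L z"
      by (rule fps_ext) (rule laplacian_fps_nth[OF L z(1)], use cm[OF zero_in_kcube] in blast)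
  qed
qed

text \<open>\<open>gaussian_modulation\<close> compares f with exp(- v a n) times its value at zero
  momentum. It remains to replace v a n by |k|^2 / (2 d), using isotropy and the moments of order 2
  + 2 p. Large n ensures that a is below \<eta> at the rescaled momentum, hence bounded below by a
  multiple of its square, and that the correction in the exponent stays bounded.\<close>

lemma gaussian_asymptotics_large_n:
  fixes \<gamma> \<delta> s L z :: real
  assumes L: "L \<ge> 1" and s: "0 \<le> s" "2 * s * rho_conv_const (\<theta> - 1) \<le> 1"
    and ct: "\<And>n. controlled s L z n"
    and \<gamma>: "0 < \<gamma>" and \<delta>: "0 < \<delta>" "\<delta> < min 1 \<epsilon>"
  defines "v \<equiv> zero_mode.v (sigma2 (D L)) (Gf L z 0) (Gamf L z)"
    and "A \<equiv> zero_mode.A (Gf L z 0) (Ef L z 0)"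
  assumes vg: "v * \<gamma> + \<delta> < \<theta> - 2"
  shows "\<exists>C n0. \<forall>n\<ge>n0. \<forall>k \<kappa> :: real ^ 'd. \<kappa> = (1 / sqrt (v * sigma2 (D L) * real n)) *\<^sub>R k \<longrightarrow>
    \<kappa> \<in> kcube \<longrightarrow> afun (D L) \<kappa> \<le> \<gamma> * ln (real n) / real n \<longrightarrow>
    (\<exists>r u. \<bar>r\<bar> \<le> C * (norm k)\<^sup>2 * real n powr (- \<delta>) \<and> \<bar>u\<bar> \<le> C * real n powr (- \<theta> + 2) \<and>
       f L n \<kappa> z = A * exp (- (norm k)\<^sup>2 / (2 * real CARD('d))) * (1 + r + u))"
proof -
  define \<sigma> where "\<sigma> = sigma2 (D L)"
  interpret zm: zero_mode \<theta> s \<sigma> "Gf L z 0" "Ef L z 0" "Ff L z 0" "Tf L z" "Gamf L z" "E2f L z"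
    unfolding \<sigma>_def by (rule zero_mode_instance[OF L s ct])
  interpret st: step_distribution "D L" \<epsilon> by (rule step[OF L])
  have z: "z > 0" "\<bar>z - 1\<bar> \<le> s" using ct[of 0] by (auto simp: controlled_def)
  have \<sigma>: "\<sigma> > 0" by (rule zm.t)
  have v: "v \<ge> 2 / 3" "v > 0" using zm.v_bounds(1) by (auto simp: v_def \<sigma>_def)
  have A: "7 / 9 \<le> A" using zm.A_bounds(1) by (simp add: A_def)
  have s1: "s \<le> 1" using zm.s1 by linarith
  define p where "p = min 1 \<epsilon>"
  have p: "0 < p" "p \<le> 1" "p \<le> \<epsilon>" "\<delta> < p" using eps \<delta> by (auto simp: p_def)
  define d where "d = real CARD('d)"
  have d: "d > 0" by (simp add: d_def zero_less_card_finite)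
  \<comment> \<open>Chosen to cover order 1 as well, where g and its Laplacian divided by \<sigma>^2
    have absolute value z \<le> 2 and are not small; 2^\<theta> offsets the value of
    \<open>rho\<close> at 1.\<close>
  define M where "M = 4 * 2 powr \<theta>"
  have p1: "1 \<le> 2 powr \<theta>" using theta by (intro ge_one_powr_ge_zero) auto
  have M: "M \<ge> 4" "M \<ge> 0" using p1 by (auto simp: M_def)
  define Gam where "Gam = fps_const (1 / \<sigma>) * Gamf L z"
  have Gamn: "Gam $$ m = Gamf L z $$ m / \<sigma>" for m by (simp add: Gam_def)
  have rho1: "2 \<le> M * rho q 1" if "q \<le> \<theta>" for q
  proof -
    have "2 powr q * rho q 1 = 1" by (simp add: rho_def powr_minus)
    moreover have "2 powr q * rho q 1 \<le> 2 powr \<theta> * rho q 1" using that by (intro mult_right_mono) auto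
    moreover have "M * rho q 1 = 4 * (2 powr \<theta> * rho q 1)" by (simp only: M_def mult.assoc)
    ultimately show ?thesis by linarith
  qed
  have cm: "\<bar>e L m k z\<bar> \<le> s * rho \<theta> m \<and>
      \<bar>e L m k z - e L m 0 z\<bar> \<le> s * afun (D L) k * rho (\<theta> - 1) m \<and>
      \<bar>g L m k z\<bar> \<le> s * rho \<theta> m \<and>
      has_laplacian (\<lambda>k. g L m k z) 0 \<and>
      \<bar>laplacian (\<lambda>k. g L m k z) 0\<bar> \<le> s * sigma2 (D L) * rho (\<theta> - 1) m \<and>
      (\<forall>e'\<in>{0..\<epsilon>}. \<bar>g L m k z - g L m 0 z - afun (D L) k / sigma2 (D L) * laplacian (\<lambda>k. g L m k z) 0\<bar>
         \<le> s * afun (D L) k powr (1 + e') * rho (\<theta> - 1 - e') m)" if "k \<in> kcube" "m \<ge> 2" for k m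
    using ct[of m] that unfolding controlled_def by blast
  have sM: "s * x \<le> M * x" if "x \<ge> 0" for x using s1 M that by (intro mult_right_mono) auto
  have g10: "g L 1 0 z = z" using first_step(3)[OF L z(1) zero_in_kcube] by (simp add: st.afun_0)
  have G0b: "\<bar>Gf L z 0 $$ m\<bar> \<le> M * rho \<theta> m" for m
  proof -
    consider "m = 0" | "m = 1" | "m \<ge> 2" by linarith
    then show ?thesis
    proof cases
      case 2
      have "\<bar>z\<bar> \<le> 2" using z s1 by linarith
      then show ?thesis using g10 rho1[of \<theta>] 2 by (simp add: Gf_def)
    next
      case 3
      have "\<bar>g L m 0 z\<bar> \<le> s * rho \<theta> m" using cm[OF zero_in_kcube 3] by blast
      also have "\<dots> \<le> M * rho \<theta> m" by (rule sM) simp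
      finally show ?thesis using 3 by (simp add: Gf_def)
    qed (use M in \<open>simp add: Gf_def\<close>)
  qed
  have E0b: "\<bar>Ef L z 0 $$ m\<bar> \<le> M * rho \<theta> m" for m
  proof -
    consider "m = 0" | "m = 1" | "m \<ge> 2" by linarith
    then show ?thesis
    proof cases
      case 2
      then show ?thesis using first_step(2)[OF L z(1) zero_in_kcube] M by (simp add: Ef_def)
    next
      case 3
      have "\<bar>e L m 0 z\<bar> \<le> s * rho \<theta> m" using cm[OF zero_in_kcube 3] by blast
      also have "\<dots> \<le> M * rho \<theta> m" by (rule sM) simp
      finally show ?thesis using 3 by (simp add: Ef_def)
    qed (use M in \<open>simp add: Ef_def\<close>)
  qed
  have Gam1: "Gam $$ 1 = - z" using laplacian_g_1(2)[OF L z(1)] \<sigma> by (simp add: Gamn Gamf_def \<sigma>_def)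
  have Gamb: "\<bar>Gam $$ m\<bar> \<le> M * rho (\<theta> - 1) m" for m
  proof -
    consider "m = 0" | "m = 1" | "m \<ge> 2" by linarith
    then show ?thesis
    proof cases
      case 1
      then show ?thesis using M by (simp add: Gamn Gamf_def)
    next
      case 2
      have "\<bar>z\<bar> \<le> 2" using z s1 by linarith
      then show ?thesis using Gam1 rho1[of "\<theta> - 1"] 2 by simp
    next
      case 3
      have "\<bar>laplacian (\<lambda>k. g L m k z) 0\<bar> / \<sigma> \<le> s * \<sigma> * rho (\<theta> - 1) m / \<sigma>"
        using cm[OF zero_in_kcube 3] \<sigma> unfolding \<sigma>_def by (intro divide_right_mono) auto
      also have "\<dots> \<le> M * rho (\<theta> - 1) m" using \<sigma> sM[of "rho (\<theta> - 1) m"] by simp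
      finally show ?thesis using 3 \<sigma> by (simp add: Gamn Gamf_def abs_divide)
    qed
  qed
  have sum0: "(\<lambda>m. Gam $$ m + v * (real m * Gf L z 0 $$ m)) sums 0"
  proof -
    have "(\<lambda>m. Gam $$ m) sums (suminf (fps_nth (Gamf L z)) / \<sigma>)"
      unfolding Gamn by (intro sums_divide summable_sums zm.Gam_sums(1))
    then have "(\<lambda>m. Gam $$ m + v * (real m * Gf L z 0 $$ m)) sums (suminf (fps_nth (Gamf L z)) / \<sigma> + v * zm.mean)"
      by (intro sums_add sums_mult zm.mean_sums)
    moreover have "suminf (fps_nth (Gamf L z)) / \<sigma> + v * zm.mean = 0"
      using zm.mean \<sigma> unfolding v_def \<sigma>_def[symmetric] zm.v_def by simp
    ultimately show ?thesis by simp
  qed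
  have F0: "Ff L z 0 * (1 - Gf L z 0) = 1 + Ef L z 0" by (rule zm.F)
  have "\<exists>C\<ge>0. \<exists>n0\<ge>1. \<forall>n\<ge>n0. \<forall>a G E F. 0 \<le> a \<longrightarrow> a \<le> \<gamma> * ln (real n) / real n \<longrightarrow>
    G $$ 0 = 0 \<longrightarrow> F * (1 - G) = 1 + E \<longrightarrow>
    (\<forall>m\<le>n. (\<forall>e\<in>{0..p}. \<bar>G $$ m - Gf L z 0 $$ m - a * Gam $$ m\<bar> \<le> M * a powr (1 + e) * rho (\<theta> - 1 - e) m) \<and>
       \<bar>E $$ m - Ef L z 0 $$ m\<bar> \<le> M * a * rho (\<theta> - 1) m) \<longrightarrow>
    \<bar>F $$ n * exp (v * a * real n) - Ff L z 0 $$ n\<bar> \<le> C * (a * real n powr (1 - \<delta>))"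
    by (rule gaussian_modulation[OF theta s \<gamma> \<delta>(1) p(4) p(2) v(2) vg M(2) zm.G0 zm.G_tail E0b G0b Gamb sum0 F0])
  then obtain C n0 where C: "C \<ge> 0" and n0: "n0 \<ge> 1" and
    mod: "\<forall>n\<ge>n0. \<forall>a G E F. 0 \<le> a \<longrightarrow> a \<le> \<gamma> * ln (real n) / real n \<longrightarrow>
    G $$ 0 = 0 \<longrightarrow> F * (1 - G) = 1 + E \<longrightarrow>
    (\<forall>m\<le>n. (\<forall>e\<in>{0..p}. \<bar>G $$ m - Gf L z 0 $$ m - a * Gam $$ m\<bar> \<le> M * a powr (1 + e) * rho (\<theta> - 1 - e) m) \<and>
       \<bar>E $$ m - Ef L z 0 $$ m\<bar> \<le> M * a * rho (\<theta> - 1) m) \<longrightarrow>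
    \<bar>F $$ n * exp (v * a * real n) - Ff L z 0 $$ n\<bar> \<le> C * (a * real n powr (1 - \<delta>))"
    by (elim exE conjE) (rule that; assumption)
  have fmod: "\<bar>f L n k z * exp (v * afun (D L) k * real n) - f L n 0 z\<bar> \<le> C * (afun (D L) k * real n powr (1 - \<delta>))"
    if n: "n \<ge> n0" and k: "k \<in> kcube" and ak: "afun (D L) k \<le> \<gamma> * ln (real n) / real n" for n k
  proof -
    define a where "a = afun (D L) k"
    have a: "a \<ge> 0" by (simp add: a_def afun_nonneg)
    have "(\<forall>e\<in>{0..p}. \<bar>Gf L z k $$ m - Gf L z 0 $$ m - a * Gam $$ m\<bar> \<le> M * a powr (1 + e) * rho (\<theta> - 1 - e) m) \<and>
       \<bar>Ef L z k $$ m - Ef L z 0 $$ m\<bar> \<le> M * a * rho (\<theta> - 1) m" for m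
    proof -
      consider "m = 0" | "m = 1" | "m \<ge> 2" by linarith
      then show ?thesis
      proof cases
        case 1
        then show ?thesis using M a by (simp add: Gf_def Ef_def Gamn Gamf_def)
      next
        case 2
        have "Gf L z k $$ 1 - Gf L z 0 $$ 1 - a * Gam $$ 1 = 0"
          using first_step(3)[OF L z(1) k] g10 by (simp add: Gf_def Gam1[simplified] a_def algebra_simps)
        moreover have "Ef L z k $$ 1 - Ef L z 0 $$ 1 = 0"
          using first_step(2)[OF L z(1) k] first_step(2)[OF L z(1) zero_in_kcube] by (simp add: Ef_def)
        ultimately show ?thesis using M a 2 by simp
      next
        case 3
        have "\<bar>Ef L z k $$ m - Ef L z 0 $$ m\<bar> \<le> s * (a * rho (\<theta> - 1) m)"
          using cm[OF k 3] 3 by (simp add: Ef_def a_def mult.assoc)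
        also have "\<dots> \<le> M * (a * rho (\<theta> - 1) m)" by (rule sM) (use a in simp)
        finally have 1: "\<bar>Ef L z k $$ m - Ef L z 0 $$ m\<bar> \<le> M * a * rho (\<theta> - 1) m" by (simp add: mult.assoc)
        have "\<bar>Gf L z k $$ m - Gf L z 0 $$ m - a * Gam $$ m\<bar> \<le> M * a powr (1 + e) * rho (\<theta> - 1 - e) m" if e: "e \<in> {0..p}" for e
        proof -
          have "e \<in> {0..\<epsilon>}" using e p by auto
          then have "\<bar>g L m k z - g L m 0 z - afun (D L) k / sigma2 (D L) * laplacian (\<lambda>k. g L m k z) 0\<bar>
             \<le> s * afun (D L) k powr (1 + e) * rho (\<theta> - 1 - e) m" using cm[OF k 3] by blast
          then have "\<bar>Gf L z k $$ m - Gf L z 0 $$ m - a * Gam $$ m\<bar> \<le> s * (a powr (1 + e) * rho (\<theta> - 1 - e) m)"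
            using 3 by (simp add: Gf_def Gamn Gamf_def a_def \<sigma>_def mult.assoc)
          also have "\<dots> \<le> M * (a powr (1 + e) * rho (\<theta> - 1 - e) m)" by (rule sM) simp
          finally show ?thesis by (simp add: mult.assoc)
        qed
        with 1 show ?thesis by blast
      qed
    qed
    moreover have "Gf L z k $$ 0 = 0" by (simp add: Gf_def)
    ultimately have "\<bar>Ff L z k $$ n * exp (v * a * real n) - Ff L z 0 $$ n\<bar> \<le> C * (a * real n powr (1 - \<delta>))"
      using mod n a ak recursion_fps[OF L z(1) k] unfolding a_def by blast
    then show ?thesis by (simp add: Ff_def a_def)
  qed
  define Y where "Y = 4 / (\<theta> - 2) * s"
  have Y: "Y \<ge> 0" using theta s by (simp add: Y_def)
  have f0A: "\<bar>f L n 0 z - A\<bar> \<le> Y * real n powr (- \<theta> + 2)" if "n \<ge> 1" for n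
  proof -
    have "\<bar>f L n 0 z - A\<bar> \<le> Y * rho (\<theta> - 2) n" using zm.F_limit[of n] by (simp add: Ff_def A_def Y_def)
    also have "\<dots> \<le> Y * real n powr (- (\<theta> - 2))" using Y theta that by (intro mult_left_mono rho_le_powr) auto
    finally show ?thesis by simp
  qed
  obtain \<eta> c1 where \<eta>: "\<eta> > 0" "c1 > 0" and reg: "\<And>k. k \<in> kcube \<Longrightarrow>
      (infnorm k \<le> 1 / L \<longrightarrow> c1 * L\<^sup>2 * (norm k)\<^sup>2 \<le> afun (D L) k) \<and> (1 / L \<le> infnorm k \<longrightarrow> \<eta> < afun (D L) k)"
    using D L unfolding assumption_D_def by meson
  define b where "b = c1 * L\<^sup>2"
  have b: "b > 0" using \<eta> L by (simp add: b_def)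
  have rate0: "(\<lambda>n. \<gamma> * ln (real n) / real n) \<longlonglongrightarrow> 0" by real_asymp
  then have "\<forall>\<^sub>F n in sequentially. \<gamma> * ln (real n) / real n < \<eta>" using \<eta> by (intro order_tendstoD)
  then obtain n2 where n2: "\<And>n. n \<ge> n2 \<Longrightarrow> \<gamma> * ln (real n) / real n < \<eta>" by (auto simp: eventually_sequentially)
  have lnn0: "(\<lambda>n. ln (real n) * real n powr (- \<delta>)) \<longlonglongrightarrow> 0"
    using \<delta> by real_asymp
  then have "\<forall>\<^sub>F n in sequentially. ln (real n) * real n powr (- \<delta>) < 1" by (intro order_tendstoD) auto
  then obtain n3 where n3: "\<And>n. n \<ge> n3 \<Longrightarrow> ln (real n) * real n powr (- \<delta>) < 1" by (auto simp: eventually_sequentially)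
  define Mp where "Mp = pmf_sum (D L) (\<lambda>x. norm (lattice_vec x) powr (2 + 2 * p))"
  have Mp: "Mp \<ge> 0" unfolding Mp_def by (rule pmf_sum_nonneg) simp
  define C3 where "C3 = (\<gamma> / (1 - \<delta> / p)) powr p"
  have C3: "C3 \<ge> 0" by (simp add: C3_def)
  define C4 where "C4 = Mp / \<sigma> * (1 / b) powr p * C3"
  have C4: "C4 \<ge> 0" unfolding C4_def using Mp \<sigma> C3 by simp
  define C5 where "C5 = C4 * (v * \<sigma> / b * \<gamma>)"
  have C5: "C5 \<ge> 0" unfolding C5_def using C4 v \<sigma> b \<gamma> by simp
  define C6 where "C6 = C4 * exp C5"
  have C6: "C6 \<ge> 0" unfolding C6_def using C4 by simp
  define Cx where "Cx = C / (2 * d * v)"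
  have Cx: "Cx \<ge> 0" unfolding Cx_def using C d v by simp
  define Cr where "Cr = C6 + exp C5 * Cx / A + (C6 * Y) / A"
  define CC where "CC = Cr + Y / A"
  have Cr: "Cr \<ge> 0" unfolding Cr_def using C6 Cx A Y by simp
  show ?thesis
  proof (rule exI[of _ CC], rule exI[of _ "max n0 (max n2 n3)"], intro allI impI)
    fix n :: nat and k \<kappa> :: "real ^ 'd"
    assume n: "max n0 (max n2 n3) \<le> n" and \<kappa>: "\<kappa> = (1 / sqrt (v * sigma2 (D L) * real n)) *\<^sub>R k"
      and kc: "\<kappa> \<in> kcube" and ak: "afun (D L) \<kappa> \<le> \<gamma> * ln (real n) / real n"
    define a where "a = afun (D L) \<kappa>"
    have a: "0 \<le> a" "a \<le> \<gamma> * ln (real n) / real n" using ak by (auto simp: a_def afun_nonneg)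
    have n1: "n \<ge> 1" "real n \<ge> 1" "real n > 0" using n n0 by auto
    define nd where "nd = real n powr (- \<delta>)"
    have nd: "nd > 0" using n1 by (simp add: nd_def)
    have k2: "(norm k)\<^sup>2 = v * \<sigma> * real n * (norm \<kappa>)\<^sup>2"
    proof -
      have "(norm \<kappa>)\<^sup>2 = (norm k)\<^sup>2 / (v * \<sigma> * real n)"
        using v \<sigma> n1 by (simp add: \<kappa> \<sigma>_def power_mult_distrib power_divide)
      then show ?thesis using v \<sigma> n1 by (simp add: field_simps)
    qed
    have bk: "b * (norm \<kappa>)\<^sup>2 \<le> a"
    proof -
      have "a < \<eta>" using a n2[of n] n by auto
      then have "infnorm \<kappa> \<le> 1 / L" using reg[OF kc] unfolding a_def by (meson linear not_less_iff_gr_or_eq order_less_trans)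
      then show ?thesis using reg[OF kc] by (simp add: a_def b_def)
    qed
    define \<phi> where "\<phi> = (norm k)\<^sup>2 / (2 * d)"
    have sm: "second_moment (D L) \<kappa> / 2 = \<phi> / (v * real n)"
      using v \<sigma> n1 d unfolding st.second_moment_eq by (simp add: \<phi>_def k2 d_def \<sigma>_def field_simps)
    have an: "a * real n \<le> (norm k)\<^sup>2 / (2 * d * v)"
    proof -
      have "a \<le> \<phi> / (v * real n)" using st.afun_le_second_moment[of \<kappa>] by (simp add: sm a_def)
      then have "a * real n \<le> \<phi> / (v * real n) * real n" using n1 by (intro mult_right_mono) auto
      also have "\<dots> = (norm k)\<^sup>2 / (2 * d * v)" using n1 v d by (simp add: \<phi>_def field_simps)
      finally show ?thesis .
    qed
    \<comment> \<open>The error in the exponent. It is v n times the error of the quadratic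
      approximation of a at \<kappa>, of order |\<kappa>|^(2 + 2 p). Here n |\<kappa>|^2 gives
      |k|^2, while |\<kappa>|^(2 p) is traded for a^p and then for n^(-\<delta>).\<close>
    define w where "w = v * a * real n - \<phi>"
    have w: "\<bar>w\<bar> \<le> C4 * ((norm k)\<^sup>2 * nd)"
    proof -
      have "w = v * real n * (a - second_moment (D L) \<kappa> / 2)" using v n1 by (simp add: w_def sm right_diff_distrib)
      then have "\<bar>w\<bar> = v * real n * \<bar>a - second_moment (D L) \<kappa> / 2\<bar>" using v n1 by (simp add: abs_mult)
      also have "\<dots> \<le> v * real n * (Mp * norm \<kappa> powr (2 + 2 * p))"
        unfolding a_def Mp_def using v n1 p by (intro mult_left_mono st.afun_expansion) auto
      also have "norm \<kappa> powr (2 + 2 * p) = (norm \<kappa>)\<^sup>2 * ((norm \<kappa>)\<^sup>2) powr p"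
      proof (cases "norm \<kappa> = 0")
        case False
        then have "norm \<kappa> > 0" by simp
        then have "((norm \<kappa>)\<^sup>2) powr p = norm \<kappa> powr (2 * p)" "norm \<kappa> powr 2 = (norm \<kappa>)\<^sup>2"
          by (simp_all add: powr_powr powr_numeral[symmetric] del: powr_numeral)
        then show ?thesis by (simp add: powr_add)
      qed (use p in simp)
      also have "v * real n * (Mp * ((norm \<kappa>)\<^sup>2 * ((norm \<kappa>)\<^sup>2) powr p)) = Mp / \<sigma> * (norm k)\<^sup>2 * ((norm \<kappa>)\<^sup>2) powr p"
        using \<sigma> by (simp add: k2)
      also have "\<dots> \<le> Mp / \<sigma> * (norm k)\<^sup>2 * ((1 / b) powr p * (C3 * nd))"
      proof (rule mult_left_mono)
        have "((norm \<kappa>)\<^sup>2) powr p \<le> (1 / b * a) powr p"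
          using bk b p by (intro powr_mono2) (auto simp: field_simps)
        also have "\<dots> = (1 / b) powr p * a powr p" by (rule powr_mult)
        also have "\<dots> \<le> (1 / b) powr p * (C3 * nd)"
          unfolding C3_def nd_def by (intro mult_left_mono log_rate_powr[OF n1(1) a \<gamma> \<delta>(1) p(4)]) simp
        finally show "((norm \<kappa>)\<^sup>2) powr p \<le> (1 / b) powr p * (C3 * nd)" .
      qed (use Mp \<sigma> in simp)
      finally show ?thesis by (simp add: C4_def mult_ac)
    qed
    have kn: "(norm k)\<^sup>2 * nd \<le> v * \<sigma> / b * \<gamma>"
    proof -
      have "(norm \<kappa>)\<^sup>2 \<le> a / b" using bk b by (simp add: field_simps)
      also have "\<dots> \<le> (\<gamma> * ln (real n) / real n) / b" using a b by (intro divide_right_mono) auto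
      finally have "(norm k)\<^sup>2 \<le> v * \<sigma> * real n * ((\<gamma> * ln (real n) / real n) / b)"
        unfolding k2 using v \<sigma> n1 by (intro mult_left_mono) auto
      also have "\<dots> = v * \<sigma> / b * \<gamma> * ln (real n)" using n1 by simp
      finally have "(norm k)\<^sup>2 * nd \<le> v * \<sigma> / b * \<gamma> * ln (real n) * nd" using nd by (intro mult_right_mono) auto
      also have "\<dots> = v * \<sigma> / b * \<gamma> * (ln (real n) * nd)" by simp
      also have "\<dots> \<le> v * \<sigma> / b * \<gamma> * 1"
      proof (rule mult_left_mono)
        show "ln (real n) * nd \<le> 1" using n3[of n] n unfolding nd_def by simp
      qed (use v \<sigma> b \<gamma> in simp)
      finally show ?thesis by simp
    qed
    have wb: "\<bar>w\<bar> \<le> C5"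
      using w mult_left_mono[OF kn C4] unfolding C5_def by linarith
    define w' where "w' = exp (- w) - 1"
    have w': "\<bar>w'\<bar> \<le> C6 * ((norm k)\<^sup>2 * nd)"
    proof -
      have "\<bar>w'\<bar> \<le> exp \<bar>w\<bar> - 1"
      proof -
        have "exp (- w) \<le> exp \<bar>w\<bar>" by simp
        moreover have "1 - exp (- w) \<le> exp \<bar>w\<bar> - 1"
          using exp_ge_add_one_self[of "- w"] exp_ge_add_one_self[of "\<bar>w\<bar>"] by linarith
        ultimately show ?thesis unfolding w'_def by linarith
      qed
      also have "\<dots> \<le> \<bar>w\<bar> * exp \<bar>w\<bar>" using exp_minus_1_le[of "\<bar>w\<bar>" 1] by simp
      also have "\<dots> \<le> (C4 * ((norm k)\<^sup>2 * nd)) * exp C5" using w wb by (intro mult_mono) auto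
      finally show ?thesis by (simp add: C6_def mult_ac)
    qed
    define x where "x = f L n \<kappa> z * exp (v * a * real n) - f L n 0 z"
    have x: "\<bar>x\<bar> \<le> Cx * ((norm k)\<^sup>2 * nd)"
    proof -
      have "\<bar>x\<bar> \<le> C * (a * real n powr (1 - \<delta>))" unfolding x_def a_def by (rule fmod[OF _ kc ak]) (use n in simp)
      also have "real n powr (1 - \<delta>) = real n * nd" using n1 by (simp add: nd_def powr_diff powr_minus_divide)
      also have "C * (a * (real n * nd)) = C * ((a * real n) * nd)" by simp
      also have "\<dots> \<le> C * ((norm k)\<^sup>2 / (2 * d * v) * nd)" using an nd C by (intro mult_left_mono mult_right_mono) auto
      finally show ?thesis by (simp add: Cx_def)
    qed
    define y where "y = f L n 0 z - A"
    have y: "\<bar>y\<bar> \<le> Y * real n powr (- \<theta> + 2)" unfolding y_def by (rule f0A[OF n1(1)])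
    have y1: "\<bar>y\<bar> \<le> Y"
    proof -
      have "real n powr (- \<theta> + 2) \<le> real n powr 0" using n1 theta by (intro powr_mono) auto
      then have "Y * real n powr (- \<theta> + 2) \<le> Y * 1" using n1 Y by (intro mult_left_mono) auto
      then show ?thesis using y by linarith
    qed
    \<comment> \<open>u carries only the error at zero momentum, which does not vanish as k tends to
      0. All other terms, including the product w' y, have a factor |k|^2 n^(-\<delta>) and go into
      r.\<close>
    define r where "r = w' + (1 + w') * x / A + w' * y / A"
    define u where "u = y / A"
    have "f L n \<kappa> z = (x + f L n 0 z) * exp (- (v * a * real n))"
      by (simp add: x_def exp_minus)
    also have "\<dots> = (A + y + x) * (exp (- \<phi>) * (1 + w'))"
    proof -
      have "- (v * a * real n) = - \<phi> + - w" by (simp add: w_def)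
      then have "exp (- (v * a * real n)) = exp (- \<phi>) * (1 + w')" unfolding w'_def by (simp only: exp_add) simp
      then show ?thesis by (simp add: y_def)
    qed
    also have "\<dots> = A * exp (- \<phi>) * (1 + r + u)"
      using A by (simp add: r_def u_def field_simps)
    finally have fe: "f L n \<kappa> z = A * exp (- \<phi>) * (1 + r + u)" .
    have "\<bar>u\<bar> \<le> CC * real n powr (- \<theta> + 2)"
    proof -
      have "\<bar>u\<bar> = \<bar>y\<bar> / A" using A by (simp add: u_def abs_divide)
      also have "\<dots> \<le> (Y * real n powr (- \<theta> + 2)) / A" using y A by (intro divide_right_mono) auto
      also have "\<dots> = (Y / A) * real n powr (- \<theta> + 2)" by simp
      also have "\<dots> \<le> CC * real n powr (- \<theta> + 2)" unfolding CC_def using Cr by (intro mult_right_mono) auto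
      finally show ?thesis .
    qed
    moreover have "\<bar>r\<bar> \<le> CC * (norm k)\<^sup>2 * real n powr (- \<delta>)"
    proof -
      define K where "K = (norm k)\<^sup>2 * nd"
      have K: "K \<ge> 0" using nd by (simp add: K_def)
      have ew: "\<bar>1 + w'\<bar> \<le> exp C5" using wb unfolding w'_def by (simp add: abs_le_iff)
      have "\<bar>r\<bar> \<le> \<bar>w'\<bar> + \<bar>(1 + w') * x / A\<bar> + \<bar>w' * y / A\<bar>" unfolding r_def by linarith
      also have "\<dots> = \<bar>w'\<bar> + \<bar>1 + w'\<bar> * \<bar>x\<bar> / A + \<bar>w'\<bar> * \<bar>y\<bar> / A" using A by (simp add: abs_mult abs_divide)
      also have "\<dots> \<le> C6 * K + exp C5 * (Cx * K) / A + (C6 * K) * Y / A"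
        using w' x y1 ew A C6 K unfolding K_def[symmetric]
        by (intro add_mono divide_right_mono mult_mono) auto
      also have "\<dots> = Cr * K" by (simp add: Cr_def algebra_simps)
      also have "\<dots> \<le> CC * K" unfolding CC_def using Y A K by (intro mult_right_mono) auto
      finally show ?thesis by (simp add: K_def nd_def mult_ac)
    qed
    ultimately show "\<exists>r u. \<bar>r\<bar> \<le> CC * (norm k)\<^sup>2 * real n powr (- \<delta>) \<and> \<bar>u\<bar> \<le> CC * real n powr (- \<theta> + 2) \<and>
       f L n \<kappa> z = A * exp (- (norm k)\<^sup>2 / (2 * real CARD('d))) * (1 + r + u)"
      using fe unfolding \<phi>_def d_def by (intro exI[of _ r] exI[of _ u]) simp
  qed
qed

text \<open>For the finitely many n below n0 the whole error is put into u: \<kappa> ranges over a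
  bounded set, so exp(|k|^2 / (2 d)) is bounded, and (n0 / n)^(\<theta> - 2) \<ge> 1 supplies the
  required power of n.\<close>

lemma gaussian_asymptotics:
  fixes \<gamma> \<delta> s L z Fmax :: real
  assumes L: "L \<ge> 1" and s: "0 \<le> s" "2 * s * rho_conv_const (\<theta> - 1) \<le> 1"
    and ct: "\<And>n. controlled s L z n"
    and \<gamma>: "0 < \<gamma>" and \<delta>: "0 < \<delta>" "\<delta> < min 1 \<epsilon>"
    and Fmax: "\<And>n k. k \<in> kcube \<Longrightarrow> \<bar>f L n k z\<bar> \<le> Fmax"
  defines "v \<equiv> zero_mode.v (sigma2 (D L)) (Gf L z 0) (Gamf L z)"
    and "A \<equiv> zero_mode.A (Gf L z 0) (Ef L z 0)"
  assumes vg: "v * \<gamma> + \<delta> < \<theta> - 2"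
  shows "\<exists>C. \<forall>n\<ge>1. \<forall>k \<kappa> :: real ^ 'd. \<kappa> = (1 / sqrt (v * sigma2 (D L) * real n)) *\<^sub>R k \<longrightarrow>
    \<kappa> \<in> kcube \<longrightarrow> afun (D L) \<kappa> \<le> \<gamma> * ln (real n) / real n \<longrightarrow>
    (\<exists>r u. \<bar>r\<bar> \<le> C * (norm k)\<^sup>2 * real n powr (- \<delta>) \<and> \<bar>u\<bar> \<le> C * real n powr (- \<theta> + 2) \<and>
       f L n \<kappa> z = A * exp (- (norm k)\<^sup>2 / (2 * real CARD('d))) * (1 + r + u))"
proof -
  define \<sigma> where "\<sigma> = sigma2 (D L)"
  interpret zm: zero_mode \<theta> s \<sigma> "Gf L z 0" "Ef L z 0" "Ff L z 0" "Tf L z" "Gamf L z" "E2f L z"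
    unfolding \<sigma>_def by (rule zero_mode_instance[OF L s ct])
  have \<sigma>: "\<sigma> > 0" by (rule zm.t)
  have v: "v > 0" using zm.v_bounds(1) by (auto simp: v_def \<sigma>_def)
  have A: "A > 0" using zm.A_bounds(1) by (simp add: A_def)
  define d where "d = real CARD('d)"
  have d: "d > 0" by (simp add: d_def zero_less_card_finite)
  obtain C n0 where large: "\<forall>n\<ge>n0. \<forall>k \<kappa> :: real ^ 'd. \<kappa> = (1 / sqrt (v * sigma2 (D L) * real n)) *\<^sub>R k \<longrightarrow>
    \<kappa> \<in> kcube \<longrightarrow> afun (D L) \<kappa> \<le> \<gamma> * ln (real n) / real n \<longrightarrow>
    (\<exists>r u. \<bar>r\<bar> \<le> C * (norm k)\<^sup>2 * real n powr (- \<delta>) \<and> \<bar>u\<bar> \<le> C * real n powr (- \<theta> + 2) \<and>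
       f L n \<kappa> z = A * exp (- (norm k)\<^sup>2 / (2 * real CARD('d))) * (1 + r + u))"
    using gaussian_asymptotics_large_n[OF L s ct \<gamma> \<delta> vg[unfolded v_def], folded v_def A_def]
    by (elim exE) (rule that)
  have "bounded (kcube :: (real ^ 'd) set)" unfolding kcube_def by (rule bounded_cbox)
  then obtain R where R: "\<And>\<kappa> :: real ^ 'd. \<kappa> \<in> kcube \<Longrightarrow> norm \<kappa> \<le> R" unfolding bounded_iff by blast
  define Q where "Q = v * \<sigma> * real n0 * R\<^sup>2 / (2 * d)"
  define U where "U = Fmax / A * exp Q + 1"
  have Fm: "Fmax \<ge> 0" using Fmax[OF zero_in_kcube, of 0] by linarith
  have U: "U \<ge> 0" using A Fm by (simp add: U_def)
  define C' where "C' = \<bar>C\<bar> + U * real n0 powr (\<theta> - 2)"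
  have "U * real n0 powr (\<theta> - 2) \<ge> 0" using U by simp
  then have C': "C \<le> C'" "U * real n0 powr (\<theta> - 2) \<le> C'" "C' \<ge> 0" unfolding C'_def by linarith+
  show ?thesis
  proof (rule exI[of _ C'], intro allI impI)
    fix n :: nat and k \<kappa> :: "real ^ 'd"
    assume n: "n \<ge> 1" and \<kappa>: "\<kappa> = (1 / sqrt (v * sigma2 (D L) * real n)) *\<^sub>R k"
      and kc: "\<kappa> \<in> kcube" and ak: "afun (D L) \<kappa> \<le> \<gamma> * ln (real n) / real n"
    show "\<exists>r u. \<bar>r\<bar> \<le> C' * (norm k)\<^sup>2 * real n powr (- \<delta>) \<and> \<bar>u\<bar> \<le> C' * real n powr (- \<theta> + 2) \<and>
       f L n \<kappa> z = A * exp (- (norm k)\<^sup>2 / (2 * real CARD('d))) * (1 + r + u)"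
    proof (cases "n \<ge> n0")
      case True
      obtain r u where ru: "\<bar>r\<bar> \<le> C * (norm k)\<^sup>2 * real n powr (- \<delta>)" "\<bar>u\<bar> \<le> C * real n powr (- \<theta> + 2)"
         "f L n \<kappa> z = A * exp (- (norm k)\<^sup>2 / (2 * real CARD('d))) * (1 + r + u)"
        using large True \<kappa> kc ak by meson
      have "C * (norm k)\<^sup>2 * real n powr (- \<delta>) \<le> C' * (norm k)\<^sup>2 * real n powr (- \<delta>)"
        by (intro mult_right_mono C') auto
      moreover have "C * real n powr (- \<theta> + 2) \<le> C' * real n powr (- \<theta> + 2)"
        by (intro mult_right_mono C') auto
      ultimately have "\<bar>r\<bar> \<le> C' * (norm k)\<^sup>2 * real n powr (- \<delta>)" "\<bar>u\<bar> \<le> C' * real n powr (- \<theta> + 2)"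
        using ru(1,2) by linarith+
      then show ?thesis using ru(3) by blast
    next
      case False
      define \<phi> where "\<phi> = (norm k)\<^sup>2 / (2 * d)"
      define S where "S = v * \<sigma> * real n"
      have S: "S > 0" using v \<sigma> n by (simp add: S_def)
      have "(norm k)\<^sup>2 = S * (norm \<kappa>)\<^sup>2"
        using S unfolding \<kappa> \<sigma>_def[symmetric] S_def[symmetric] by (simp add: power_mult_distrib power_divide)
      also have "\<dots> \<le> (v * \<sigma> * real n0) * R\<^sup>2"
        unfolding S_def using v \<sigma> False R[OF kc] by (intro mult_mono power_mono) auto
      finally have \<phi>: "\<phi> \<le> Q" unfolding \<phi>_def Q_def using d by (intro divide_right_mono) auto
      define u where "u = f L n \<kappa> z / (A * exp (- \<phi>)) - 1"
      have "\<bar>f L n \<kappa> z / (A * exp (- \<phi>))\<bar> = \<bar>f L n \<kappa> z\<bar> / A * exp \<phi>"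
        using A by (simp add: abs_divide abs_mult exp_minus field_simps)
      also have "\<dots> \<le> Fmax / A * exp Q"
        using A \<phi> Fmax[OF kc] Fm by (intro mult_mono divide_right_mono) auto
      finally have u: "\<bar>u\<bar> \<le> U" unfolding u_def U_def by linarith
      have "1 \<le> (real n0 / real n) powr (\<theta> - 2)"
        using False n theta by (intro ge_one_powr_ge_zero) auto
      then have "U * 1 \<le> U * (real n0 / real n) powr (\<theta> - 2)" using U by (intro mult_left_mono) auto
      also have "\<dots> = U * real n0 powr (\<theta> - 2) * real n powr (- \<theta> + 2)"
        using powr_minus_divide[of "real n" "\<theta> - 2"] by (simp add: powr_divide)
      also have "\<dots> \<le> C' * real n powr (- \<theta> + 2)" by (intro mult_right_mono C') auto
      finally have "\<bar>u\<bar> \<le> C' * real n powr (- \<theta> + 2)" using u by linarith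
      moreover have "f L n \<kappa> z = A * exp (- (norm k)\<^sup>2 / (2 * real CARD('d))) * (1 + 0 + u)"
      proof -
        have "A * exp (- \<phi>) * (1 + 0 + u) = f L n \<kappa> z" using A by (simp add: u_def)
        then show ?thesis by (simp add: \<phi>_def d_def)
      qed
      moreover have "\<bar>0\<bar> \<le> C' * (norm k)\<^sup>2 * real n powr (- \<delta>)" using C' by simp
      ultimately show ?thesis by blast
    qed
  qed
qed

section \<open>The formulas for A and v, and the ratio of Laplacian and value\<close>

lemma sums_drop_0:
  fixes x :: "nat \<Rightarrow> real"
  assumes "x sums l" "x 0 = 0"
  shows "(\<lambda>m. x (Suc m)) sums l"
  using assms sums_Suc_iff[of x l] by simp

lemma critical_identities:
  fixes s L z :: real
  assumes L: "L \<ge> 1" and s: "0 \<le> s" "2 * s * rho_conv_const (\<theta> - 1) \<le> 1"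
    and ct: "\<And>n. controlled s L z n"
  defines "v \<equiv> zero_mode.v (sigma2 (D L)) (Gf L z 0) (Gamf L z)"
    and "A \<equiv> zero_mode.A (Gf L z 0) (Ef L z 0)"
  shows "(\<lambda>m. g L (Suc m) 0 z) sums 1"
    and "summable (\<lambda>m. e L (Suc m) 0 z)"
    and "summable (\<lambda>m. real (Suc m) * g L (Suc m) 0 z)"
    and "summable (\<lambda>m. laplacian (\<lambda>k. g L (Suc m) k z) 0)"
    and "A = (1 + (\<Sum>m. e L (Suc m) 0 z)) / (\<Sum>m. real (Suc m) * g L (Suc m) 0 z)"
    and "v = - (\<Sum>m. laplacian (\<lambda>k. g L (Suc m) k z) 0) / (sigma2 (D L) * (\<Sum>m. real (Suc m) * g L (Suc m) 0 z))"
proof -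
  interpret zm: zero_mode \<theta> s "sigma2 (D L)" "Gf L z 0" "Ef L z 0" "Ff L z 0" "Tf L z" "Gamf L z" "E2f L z"
    by (rule zero_mode_instance[OF L s ct])
  show "(\<lambda>m. g L (Suc m) 0 z) sums 1"
    using sums_drop_0[OF zm.G_sums] by (simp add: Gf_def)
  have e: "(\<lambda>m. e L (Suc m) 0 z) sums suminf (fps_nth (Ef L z 0))"
    using sums_drop_0[OF summable_sums[OF zm.E_sums(1)]] by (simp add: Ef_def)
  have mu: "(\<lambda>m. real (Suc m) * g L (Suc m) 0 z) sums zm.mean"
    using sums_drop_0[OF zm.mean_sums] by (simp add: Gf_def)
  have lap: "(\<lambda>m. laplacian (\<lambda>k. g L (Suc m) k z) 0) sums suminf (fps_nth (Gamf L z))"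
    using sums_drop_0[OF summable_sums[OF zm.Gam_sums(1)]] by (simp add: Gamf_def)
  show "summable (\<lambda>m. e L (Suc m) 0 z)" by (rule sums_summable[OF e])
  show "summable (\<lambda>m. real (Suc m) * g L (Suc m) 0 z)" by (rule sums_summable[OF mu])
  show "summable (\<lambda>m. laplacian (\<lambda>k. g L (Suc m) k z) 0)" by (rule sums_summable[OF lap])
  show "A = (1 + (\<Sum>m. e L (Suc m) 0 z)) / (\<Sum>m. real (Suc m) * g L (Suc m) 0 z)"
    unfolding sums_unique[OF e, symmetric] sums_unique[OF mu, symmetric] A_def zm.A_def by (rule refl)
  show "v = - (\<Sum>m. laplacian (\<lambda>k. g L (Suc m) k z) 0) / (sigma2 (D L) * (\<Sum>m. real (Suc m) * g L (Suc m) 0 z))"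
    unfolding sums_unique[OF lap, symmetric] sums_unique[OF mu, symmetric] v_def zm.v_def by (rule refl)
qed

lemma laplacian_ratio:
  fixes s L z \<delta> :: real
  assumes L: "L \<ge> 1" and s: "0 \<le> s" "2 * s * rho_conv_const (\<theta> - 1) \<le> 1"
    and ct: "\<And>n. controlled s L z n" and \<delta>: "0 < \<delta>" "\<delta> < min 1 \<epsilon>" and n: "n \<ge> 1"
  defines "v \<equiv> zero_mode.v (sigma2 (D L)) (Gf L z 0) (Gamf L z)"
  shows "f L n 0 z \<noteq> 0"
    and "\<exists>r. \<bar>r\<bar> \<le> (8 / (\<theta> - 2) + 6 * zero_mode.Kv \<theta> / (1 - \<delta>)) * s * real n powr (- \<delta>) \<and>
      - laplacian (\<lambda>k. f L n k z) 0 / f L n 0 z = v * sigma2 (D L) * real n * (1 + r)"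
proof -
  interpret zm: zero_mode \<theta> s "sigma2 (D L)" "Gf L z 0" "Ef L z 0" "Ff L z 0" "Tf L z" "Gamf L z" "E2f L z"
    by (rule zero_mode_instance[OF L s ct])
  have F: "Ff L z 0 $$ n = f L n 0 z" by (simp add: Ff_def)
  have T: "Tf L z $$ n = laplacian (\<lambda>k. f L n k z) 0" by (simp add: Tf_def)
  show "f L n 0 z \<noteq> 0" using zm.F_near_1[of n] unfolding F by auto
  have v: "v > 0" using zm.v_bounds(1) by (simp add: v_def)
  have w: "v * sigma2 (D L) * real n \<noteq> 0" using v zm.t n by simp
  define x where "x = - laplacian (\<lambda>k. f L n k z) 0 / f L n 0 z"
  have "\<bar>x / (v * sigma2 (D L) * real n) - 1\<bar> \<le> (8 / (\<theta> - 2) + 6 * zero_mode.Kv \<theta> / (1 - \<delta>)) * s * real n powr (- \<delta>)"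
    unfolding x_def v_def F[symmetric] T[symmetric] using \<delta> eps n by (intro zm.T_over_F) auto
  moreover have "x = v * sigma2 (D L) * real n * (1 + (x / (v * sigma2 (D L) * real n) - 1))"
    using w by simp
  ultimately show "\<exists>r. \<bar>r\<bar> \<le> (8 / (\<theta> - 2) + 6 * zero_mode.Kv \<theta> / (1 - \<delta>)) * s * real n powr (- \<delta>) \<and>
      - laplacian (\<lambda>k. f L n k z) 0 / f L n 0 z = v * sigma2 (D L) * real n * (1 + r)"
    unfolding x_def by blast
qed

end

theorem theorem3p1:
  fixes D :: "real \<Rightarrow> (int ^ 'd::finite) pmf"
    and f g e :: "'d family"
    and d\<^sub>c \<theta> \<epsilon> pstar :: real
    and B :: "real set"
  assumes dim: "real CARD('d) > d\<^sub>c"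
    and theta: "\<theta> > 2"
    and pstar: "pstar \<ge> 1"
    and B: "B \<noteq> {}" "B \<subseteq> {1..pstar}"
    and wp: "well_posed f"
    and rec: "recursion f g e"
    and S: "assumption_S f g e"
    and D: "assumption_D \<theta> \<epsilon> D f g e"
    and E: "assumption_E B pstar \<theta> D f e"
    and G: "assumption_G B pstar \<theta> \<epsilon> D f g"
  shows "\<exists>L0\<ge>1. \<exists>zc A v :: real \<Rightarrow> real.
    (\<forall>L\<ge>L0. zc L > 0 \<and> A L > 0 \<and> v L > 0) \<and>
    (\<forall>\<gamma> \<delta>. 0 < \<gamma> \<and> \<gamma> < min 1 \<epsilon> \<and> 0 < \<delta> \<and> \<delta> < min 1 \<epsilon> - \<gamma> \<longrightarrow>
       \<comment> \<open>(a)\<close>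
       (\<forall>L\<ge>L0. \<exists>C. \<forall>n\<ge>1. \<forall>k :: real ^ 'd.
          let \<kappa> = (1 / sqrt (v L * sigma2 (D L) * real n)) *\<^sub>R k in
          \<kappa> \<in> kcube \<and> afun (D L) \<kappa> \<le> \<gamma> * ln (real n) / real n \<longrightarrow>
          (\<exists>r s. \<bar>r\<bar> \<le> C * (norm k)\<^sup>2 * real n powr (- \<delta>) \<and>
                 \<bar>s\<bar> \<le> C * real n powr (- \<theta> + 2) \<and>
                 f L n \<kappa> (zc L) = A L * exp (- (norm k)\<^sup>2 / (2 * real CARD('d))) * (1 + r + s))) \<and>
       \<comment> \<open>(b)\<close>
       (\<exists>C. \<forall>L\<ge>L0. \<forall>n\<ge>1.
          f L n 0 (zc L) \<noteq> 0 \<and>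
          (\<exists>r. \<bar>r\<bar> \<le> C * beta TYPE('d) pstar L * real n powr (- \<delta>) \<and>
               - laplacian (\<lambda>k. f L n k (zc L)) 0 / f L n 0 (zc L)
                 = v L * sigma2 (D L) * real n * (1 + r)))) \<and>
    \<comment> \<open>(c)\<close>
    (\<forall>p\<ge>1. \<exists>C>0. \<forall>L\<ge>L0. \<forall>n\<ge>1.
       lp_norm p (\<lambda>k. (Dhat (D L) k)\<^sup>2 * complex_of_real (f L n k (zc L)))
         \<le> ennreal (C / (L powr (real CARD('d) / p) * real n powr min (real CARD('d) / (2 * p)) \<theta>))) \<and>
    \<comment> \<open>(d)\<close>
    (\<forall>L\<ge>L0.
       (\<lambda>m. g L (Suc m) 0 (zc L)) sums 1 \<and>
       summable (\<lambda>m. e L (Suc m) 0 (zc L)) \<and>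
       summable (\<lambda>m. real (Suc m) * g L (Suc m) 0 (zc L)) \<and>
       summable (\<lambda>m. laplacian (\<lambda>k. g L (Suc m) k (zc L)) 0) \<and>
       A L = (1 + (\<Sum>m. e L (Suc m) 0 (zc L))) / (\<Sum>m. real (Suc m) * g L (Suc m) 0 (zc L)) \<and>
       v L = - (\<Sum>m. laplacian (\<lambda>k. g L (Suc m) k (zc L)) 0)
               / (sigma2 (D L) * (\<Sum>m. real (Suc m) * g L (Suc m) 0 (zc L))))"
proof -
  interpret spread_out_model D f g e \<theta> \<epsilon> pstar B
    by unfold_locales (fact theta pstar B wp rec S D E G)+
  obtain s1 Cf where s1: "s1 > 0" and Cf: "Cf > 0" and
    fb: "\<forall>s L z n. 0 \<le> s \<longrightarrow> s \<le> s1 \<longrightarrow> L \<ge> 1 \<longrightarrow> controlled s L z n \<longrightarrow>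
     (\<forall>m\<le>n. \<forall>k\<in>kcube. \<bar>f L m k z\<bar> \<le> Cf * profile (afun (D L) k) m)"
    using f_pointwise by (elim exE conjE) (rule that; assumption)
  obtain K s2 where K: "K > 0" and s2: "s2 > 0" and
    lp: "\<forall>s L z n p. 0 \<le> s \<longrightarrow> s \<le> s2 \<longrightarrow> L \<ge> 1 \<longrightarrow> n \<ge> 1 \<longrightarrow> p \<ge> 1 \<longrightarrow> controlled s L z n \<longrightarrow>
     lp_norm p (\<lambda>k. (Dhat (D L) k)\<^sup>2 * complex_of_real (f L n k z))
       \<le> ennreal (K / (L powr (real CARD('d) / p) * real n powr min (real CARD('d) / (2 * p)) \<theta>))"
    using f_lp_bound by (elim exE conjE) (rule that; assumption)
  obtain C where C: "C \<ge> 1" and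
    crit: "\<forall>x>0. \<exists>L0\<ge>1. \<forall>L\<ge>L0. C * \<beta> L \<le> x \<and> (\<exists>zc. \<forall>n. controlled (C * \<beta> L) L zc n)"
    using critical_point by (elim exE conjE) (rule that; assumption)
  define R where "R = \<bar>rho_conv_const (\<theta> - 1)\<bar> + 1"
  have R: "R > 0" "rho_conv_const (\<theta> - 1) \<le> R" by (auto simp: R_def)
  \<comment> \<open>s1 and s2 are the thresholds for the pointwise and integrated bounds, 1 / (2 R)
    makes the zero momentum analysis applicable, and the last entry forces v - 1 \<le> \<theta> - 2
    - \<epsilon>. None of these involves \<gamma>, \<delta> or p, so a single L0 serves all
    statements.\<close>
  define x where "x = min (min s1 s2) (min (1 / (2 * R)) ((\<theta> - 2 - \<epsilon>) / (2 * R)))"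
  have x: "x > 0" using s1 s2 R eps by (auto simp: x_def)
  obtain L0 where L0: "L0 \<ge> 1" and
    c0: "\<forall>L\<ge>L0. C * \<beta> L \<le> x \<and> (\<exists>zc. \<forall>n. controlled (C * \<beta> L) L zc n)"
    using crit x by blast
  obtain zc where zc: "\<forall>L\<ge>L0. \<forall>n. controlled (C * \<beta> L) L (zc L) n"
    using c0 by metis
  define s where "s L = C * \<beta> L" for L
  have ct: "controlled (s L) L (zc L) n" if "L \<ge> L0" for L n using zc that by (simp add: s_def)
  have L1: "L \<ge> 1" if "L \<ge> L0" for L using that L0 by linarith
  have s0: "0 \<le> s L" if "L \<ge> L0" for L using beta_pos[OF L1[OF that]] C by (simp add: s_def)
  have sx: "s L \<le> s1" "s L \<le> s2" "s L \<le> 1 / (2 * R)" "s L \<le> (\<theta> - 2 - \<epsilon>) / (2 * R)" if "L \<ge> L0" for L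
    using c0 that by (auto simp: s_def x_def)
  have srho: "2 * s L * rho_conv_const (\<theta> - 1) \<le> 2 * s L * R" if "L \<ge> L0" for L
    by (intro mult_left_mono R) (use s0[OF that] in simp)
  have sr: "2 * s L * rho_conv_const (\<theta> - 1) \<le> 1" if "L \<ge> L0" for L
  proof -
    have "2 * s L * R \<le> 1" using sx(3)[OF that] R by (simp add: field_simps)
    then show ?thesis using srho[OF that] by linarith
  qed
  have se: "2 * s L * rho_conv_const (\<theta> - 1) \<le> \<theta> - 2 - \<epsilon>" if "L \<ge> L0" for L
  proof -
    have "2 * s L * R \<le> \<theta> - 2 - \<epsilon>" using sx(4)[OF that] R by (simp add: field_simps)
    then show ?thesis using srho[OF that] by linarith
  qed
  define A where "A L = zero_mode.A (Gf L (zc L) 0) (Ef L (zc L) 0)" for L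
  define v where "v L = zero_mode.v (sigma2 (D L)) (Gf L (zc L) 0) (Gamf L (zc L))" for L
  have zcpos: "zc L > 0" if "L \<ge> L0" for L using ct[OF that, of 0] by (simp add: controlled_def)
  have bounds: "A L > 0" "v L > 0" "v L - 1 \<le> \<theta> - 2 - \<epsilon>" if L: "L \<ge> L0" for L
  proof -
    interpret zm: zero_mode \<theta> "s L" "sigma2 (D L)" "Gf L (zc L) 0" "Ef L (zc L) 0" "Ff L (zc L) 0"
      "Tf L (zc L)" "Gamf L (zc L)" "E2f L (zc L)"
      by (rule zero_mode_instance[OF L1[OF L] s0[OF L] sr[OF L] ct[OF L]])
    show "A L > 0" using zm.A_bounds(1) by (simp add: A_def)
    show "v L > 0" using zm.v_bounds(1) by (simp add: v_def)
    have "rho_conv_const (\<theta> - 1) = 2 * (zm.P * zm.Z)"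
      by (simp add: rho_conv_const_def zm.q_def zm.P_def zm.Z_def)
    then have "4 * (zm.P * zm.Z) * s L = 2 * s L * rho_conv_const (\<theta> - 1)" by simp
    then show "v L - 1 \<le> \<theta> - 2 - \<epsilon>" using zm.v_bounds(2) se[OF L] unfolding v_def by linarith
  qed
  have Fmax: "\<bar>f L n k (zc L)\<bar> \<le> Cf * 2" if L: "L \<ge> L0" and k: "k \<in> kcube" for L n k
  proof -
    have "\<bar>f L n k (zc L)\<bar> \<le> Cf * profile (afun (D L) k) n"
      using fb s0[OF L] sx(1)[OF L] L1[OF L] ct[OF L, of n] k by blast
    also have "\<dots> \<le> Cf * 2" by (intro mult_left_mono profile_le_2 afun_nonneg afun_le_2) (use Cf in simp)
    finally show ?thesis .
  qed
  have a: "\<exists>C. \<forall>n\<ge>1. \<forall>k :: real ^ 'd.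
          let \<kappa> = (1 / sqrt (v L * sigma2 (D L) * real n)) *\<^sub>R k in
          \<kappa> \<in> kcube \<and> afun (D L) \<kappa> \<le> \<gamma> * ln (real n) / real n \<longrightarrow>
          (\<exists>r s. \<bar>r\<bar> \<le> C * (norm k)\<^sup>2 * real n powr (- \<delta>) \<and>
                 \<bar>s\<bar> \<le> C * real n powr (- \<theta> + 2) \<and>
                 f L n \<kappa> (zc L) = A L * exp (- (norm k)\<^sup>2 / (2 * real CARD('d))) * (1 + r + s))"
    if \<gamma>: "0 < \<gamma>" "\<gamma> < min 1 \<epsilon>" and \<delta>: "0 < \<delta>" "\<delta> < min 1 \<epsilon> - \<gamma>" and L: "L \<ge> L0" for L \<gamma> \<delta>
  proof -
    \<comment> \<open>Because \<gamma> < 1 and \<gamma> + \<delta> < \<epsilon>, the bound on v - 1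
      leaves v \<gamma> + \<delta> strictly below \<theta> - 2.\<close>
    have "(v L - 1) * \<gamma> \<le> (\<theta> - 2 - \<epsilon>) * \<gamma>" using bounds(3)[OF L] \<gamma> by (intro mult_right_mono) auto
    also have "\<dots> \<le> (\<theta> - 2 - \<epsilon>) * 1" using \<gamma> eps by (intro mult_left_mono) auto
    finally have vg: "v L * \<gamma> + \<delta> < \<theta> - 2" using \<delta> by (simp add: algebra_simps)
    have \<delta>': "\<delta> < min 1 \<epsilon>" using \<delta> \<gamma> by linarith
    show ?thesis
      using gaussian_asymptotics[OF L1[OF L] s0[OF L] sr[OF L] ct[OF L] \<gamma>(1) \<delta>(1) \<delta>' Fmax[OF L] vg[unfolded v_def]]
      unfolding Let_def v_def[symmetric] A_def[symmetric] by meson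
  qed
  have b: "\<exists>C. \<forall>L\<ge>L0. \<forall>n\<ge>1.
          f L n 0 (zc L) \<noteq> 0 \<and>
          (\<exists>r. \<bar>r\<bar> \<le> C * beta TYPE('d) pstar L * real n powr (- \<delta>) \<and>
               - laplacian (\<lambda>k. f L n k (zc L)) 0 / f L n 0 (zc L)
                 = v L * sigma2 (D L) * real n * (1 + r))" if \<gamma>\<delta>: "0 < \<gamma>" "0 < \<delta>" "\<delta> < min 1 \<epsilon> - \<gamma>" for \<gamma> \<delta>
  proof (rule exI[of _ "(8 / (\<theta> - 2) + 6 * zero_mode.Kv \<theta> / (1 - \<delta>)) * C"], intro allI impI conjI)
    fix L :: real and n :: nat assume L: "L \<ge> L0" and n: "n \<ge> 1"
    have \<delta>: "0 < \<delta>" "\<delta> < min 1 \<epsilon>" using \<gamma>\<delta> by linarith+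
    note lr = laplacian_ratio[OF L1[OF L] s0[OF L] sr[OF L] ct[OF L] \<delta> n]
    show "f L n 0 (zc L) \<noteq> 0" by (rule lr(1))
    show "\<exists>r. \<bar>r\<bar> \<le> (8 / (\<theta> - 2) + 6 * zero_mode.Kv \<theta> / (1 - \<delta>)) * C * beta TYPE('d) pstar L * real n powr (- \<delta>) \<and>
               - laplacian (\<lambda>k. f L n k (zc L)) 0 / f L n 0 (zc L) = v L * sigma2 (D L) * real n * (1 + r)"
      using lr(2) unfolding v_def s_def \<beta>_def by (simp only: mult.assoc)
  qed
  have c: "\<exists>C>0. \<forall>L\<ge>L0. \<forall>n\<ge>1.
       lp_norm p (\<lambda>k. (Dhat (D L) k)\<^sup>2 * complex_of_real (f L n k (zc L)))
         \<le> ennreal (C / (L powr (real CARD('d) / p) * real n powr min (real CARD('d) / (2 * p)) \<theta>))" if "p \<ge> 1" for p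
    using lp s0 sx(2) L1 ct K that by blast
  note d = critical_identities[OF L1 s0 sr ct, folded A_def v_def]
  show ?thesis
    by (rule exI[of _ L0], rule conjI[OF L0], rule exI[of _ zc], rule exI[of _ A], rule exI[of _ v],
        intro conjI allI impI; (elim conjE)?; rule zcpos bounds(1,2) a b c d; assumption)
qed

end
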